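(* Let $\mathbf A$ be a finite simple algebra. The following are equivalent: (1) $\mathbf A\in\mathcal K_{\mathrm{surj}}^{\mathrm{eff}}$ (equivalently, $\mathbf A^*\in\mathcal K_{\mathrm{poly}}^{\mathrm{eff}}$); (2) $\mathbf A\in\mathcal K_{\mathrm{surj}}$ (equivalently, $\mathbf A^*\in\mathcal K_{\mathrm{poly}}$); (3) $\mathrm{typ}(\mathbf A)\neq 1$.
   Context: $\mathbf A$ is simple if $|A|>1$ and its only congruences are equality and $A\times A$. $\mathbf A^*$ is the expansion of $\mathbf A$ by all constant operations. A polynomial operation of $\mathbf A$ is a term operation with some arguments fixed to elements of $A$. For $N\subseteq A$, $\mathbf A|_N$ is the algebra on $N$ whose operations are the polynomial operations of $\mathbf A$ preserving $N$. For simple $\mathbf A$, let $U$ be minimal under inclusion among sets $p(A)$, $p$ a unary polynomial of $\mathbf A$, with $|p(A)|\ge2$; then $\mathbf A|_U$ is a minimal algebra (every unary polynomial is constant or a permutation) and is polynomially equivalent to one of: (1) an algebra all of whose operations are unary permutations; (2) a vector space over a finite field; (3) a two-element Boolean algebra; (4) a two-element lattice; (5) a two-element semilattice. The index, independent of $U$, is $\mathrm{typ}(\mathbf A)$. $\mathcal K_{\mathrm{poly}}$ (resp. $\mathcal K_{\mathrm{surj}}$): finite algebras $\mathbf C$ with a polynomial $p$ such that for all finite $\mathbf X$ of the same signature the number of homomorphisms (resp. surjective homomorphisms) $\mathbf X\to\mathbf C$ is at most $p(|X|)$; the $\mathrm{eff}$ versions additionally require these homomorphisms to be enumerable in time polynomial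 in $|X|$.
   Formalization: The equivalences involving the "eff" classes are stated for algebras with finitely many operation symbols; for an infinite signature X is not a finite input, and an enumeration reading only finitely many operations cannot be correct. The rest is for arbitrary signatures. *)

theory Defs
  imports "HOL-Algebra.Module" "HOL-Computational_Algebra.Polynomial"
begin

section \<open>Algebras, congruences, homomorphisms\<close>

record ('s, 'a) ualg =
  symbs :: "'s set"
  ar :: "'s \<Rightarrow> nat"
  univ :: "'a set"
  opn :: "'s \<Rightarrow> 'a list \<Rightarrow> 'a"

definition tuples :: "'a set \<Rightarrow> nat \<Rightarrow> 'a list set" where
  "tuples N n = {xs. length xs = n \<and> set xs \<subseteq> N}"

definition is_ualg :: "('s, 'a) ualg \<Rightarrow> bool" where
  "is_ualg A \<longleftrightarrow> univ A \<noteq> {} \<and>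
     (\<forall>f\<in>symbs A. \<forall>xs\<in>tuples (univ A) (ar A f). opn A f xs \<in> univ A)"

definition same_sig :: "('s, 'a) ualg \<Rightarrow> ('s, 'b) ualg \<Rightarrow> bool" where
  "same_sig A B \<longleftrightarrow> symbs A = symbs B \<and> (\<forall>f\<in>symbs A. ar A f = ar B f)"

definition congruence :: "('s, 'a) ualg \<Rightarrow> ('a \<times> 'a) set \<Rightarrow> bool" where
  "congruence A \<theta> \<longleftrightarrow> equiv (univ A) \<theta> \<and>
     (\<forall>f\<in>symbs A. \<forall>xs\<in>tuples (univ A) (ar A f). \<forall>ys\<in>tuples (univ A) (ar A f).
        (\<forall>i<ar A f. (xs ! i, ys ! i) \<in> \<theta>) \<longrightarrow> (opn A f xs, opn A f ys) \<in> \<theta>)"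

text \<open>Used for finite algebras only, where \<open>card\<close> is the genuine cardinality.\<close>

definition simple :: "('s, 'a) ualg \<Rightarrow> bool" where
  "simple A \<longleftrightarrow> card (univ A) > 1 \<and>
     (\<forall>\<theta>. congruence A \<theta> \<longrightarrow> \<theta> = Id_on (univ A) \<or> \<theta> = univ A \<times> univ A)"

definition homs :: "('s, 'a) ualg \<Rightarrow> ('s, 'b) ualg \<Rightarrow> ('a \<Rightarrow> 'b) set" where
  "homs X C = {h \<in> univ X \<rightarrow>\<^sub>E univ C.
     \<forall>f\<in>symbs X. \<forall>xs\<in>tuples (univ X) (ar X f). h (opn X f xs) = opn C f (map h xs)}"

definition surj_homs :: "('s, 'a) ualg \<Rightarrow> ('s, 'b) ualg \<Rightarrow> ('a \<Rightarrow> 'b) set" where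
  "surj_homs X C = {h \<in> homs X C. h ` univ X = univ C}"

definition const_expansion :: "('s, 'a) ualg \<Rightarrow> ('s + 'a, 'a) ualg" where
  "const_expansion A = \<lparr>symbs = symbs A <+> univ A, ar = case_sum (ar A) (\<lambda>_. 0),
     univ = univ A, opn = case_sum (opn A) (\<lambda>a _. a)\<rparr>"


section \<open>Polynomial operations and the type of a simple algebra\<close>

datatype 's trm = Var nat | App 's "'s trm list"

fun wf_trm :: "('s, 'a) ualg \<Rightarrow> nat \<Rightarrow> 's trm \<Rightarrow> bool" where
  "wf_trm A n (Var i) \<longleftrightarrow> i < n"
| "wf_trm A n (App f ts) \<longleftrightarrow> f \<in> symbs A \<and> length ts = ar A f \<and> (\<forall>t\<in>set ts. wf_trm A n t)"

fun eval_trm :: "('s, 'a) ualg \<Rightarrow> 'a list \<Rightarrow> 's trm \<Rightarrow> 'a" where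
  "eval_trm A xs (Var i) = xs ! i"
| "eval_trm A xs (App f ts) = opn A f (map (eval_trm A xs) ts)"

text \<open>Operations are taken extensionally, i.e. \<open>undefined\<close> outside the tuples of the right length
  over the universe, so that equality of operations is equality in HOL.\<close>

definition term_ops :: "('s, 'a) ualg \<Rightarrow> nat \<Rightarrow> ('a list \<Rightarrow> 'a) set" where
  "term_ops A n = {restrict (\<lambda>xs. eval_trm A xs t) (tuples (univ A) n) | t. wf_trm A n t}"

text \<open>As variables of terms can be renamed, the fixed arguments may be taken to be the last ones.\<close>

definition poly_ops :: "('s, 'a) ualg \<Rightarrow> nat \<Rightarrow> ('a list \<Rightarrow> 'a) set" where
  "poly_ops A n = {restrict (\<lambda>xs. g (xs @ as)) (tuples (univ A) n) | g as m.
     g \<in> term_ops A (n + m) \<and> as \<in> tuples (univ A) m}"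

definition poly_equiv :: "('s, 'a) ualg \<Rightarrow> ('t, 'a) ualg \<Rightarrow> bool" where
  "poly_equiv A B \<longleftrightarrow> univ A = univ B \<and> (\<forall>n. poly_ops A n = poly_ops B n)"

text \<open>The algebra induced on \<open>N\<close>; its operation symbols are the operations themselves, paired with
  their arities.\<close>

definition induced :: "('s, 'a) ualg \<Rightarrow> 'a set \<Rightarrow> (nat \<times> ('a list \<Rightarrow> 'a), 'a) ualg" where
  "induced A N = \<lparr>symbs = {(n, p). p \<in> poly_ops A n \<and> (\<forall>xs\<in>tuples N n. p xs \<in> N)},
     ar = fst, univ = N, opn = snd\<rparr>"

definition poly_images :: "('s, 'a) ualg \<Rightarrow> 'a set set" where
  "poly_images A = {(\<lambda>x. p [x]) ` univ A | p. p \<in> poly_ops A 1}"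

definition minimal_set :: "('s, 'a) ualg \<Rightarrow> 'a set \<Rightarrow> bool" where
  "minimal_set A U \<longleftrightarrow> U \<in> poly_images A \<and> card U \<ge> 2 \<and>
     (\<forall>V\<in>poly_images A. card V \<ge> 2 \<longrightarrow> V \<subseteq> U \<longrightarrow> V = U)"

definition unary_permutational :: "('s, 'a) ualg \<Rightarrow> bool" where
  "unary_permutational B \<longleftrightarrow>
     (\<forall>f\<in>symbs B. ar B f = 1 \<and> bij_betw (\<lambda>x. opn B f [x]) (univ B) (univ B))"

datatype 'k vs_sym = VZero | VNeg | VAdd | VScale 'k

definition vs_alg :: "'k ring \<Rightarrow> ('k, 'a) module \<Rightarrow> ('k vs_sym, 'a) ualg" where
  "vs_alg F V = \<lparr>symbs = {VZero, VNeg, VAdd} \<union> VScale ` carrier F,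
     ar = (\<lambda>f. case f of VZero \<Rightarrow> 0 | VNeg \<Rightarrow> 1 | VAdd \<Rightarrow> 2 | VScale _ \<Rightarrow> 1),
     univ = carrier V,
     opn = (\<lambda>f xs. case f of VZero \<Rightarrow> \<zero>\<^bsub>V\<^esub> | VNeg \<Rightarrow> \<ominus>\<^bsub>V\<^esub> (xs ! 0)
       | VAdd \<Rightarrow> xs ! 0 \<oplus>\<^bsub>V\<^esub> xs ! 1 | VScale k \<Rightarrow> k \<odot>\<^bsub>V\<^esub> (xs ! 0))\<rparr>"

datatype bool_sym = Bot | Top | Compl | Meet | Join

text \<open>The operations of the Boolean algebra on \<open>{b, t}\<close> with \<open>b < t\<close>; the lattice and the
  semilattice are its reducts.\<close>

fun two_ar :: "bool_sym \<Rightarrow> nat" where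
  "two_ar Bot = 0" | "two_ar Top = 0" | "two_ar Compl = 1" | "two_ar Meet = 2" | "two_ar Join = 2"

fun two_opn :: "'a \<Rightarrow> 'a \<Rightarrow> bool_sym \<Rightarrow> 'a list \<Rightarrow> 'a" where
  "two_opn b t Bot xs = b"
| "two_opn b t Top xs = t"
| "two_opn b t Compl xs = (if xs ! 0 = b then t else b)"
| "two_opn b t Meet xs = (if xs ! 0 = t \<and> xs ! 1 = t then t else b)"
| "two_opn b t Join xs = (if xs ! 0 = b \<and> xs ! 1 = b then b else t)"

definition two_alg :: "bool_sym set \<Rightarrow> 'a \<Rightarrow> 'a \<Rightarrow> (bool_sym, 'a) ualg" where
  "two_alg S b t = \<lparr>symbs = S, ar = two_ar, univ = {b, t}, opn = two_opn b t\<rparr>"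

text \<open>Up to polynomial equivalence the operations of a unary algebra may serve as their own symbols,
  and up to isomorphism the elements of a finite field are natural numbers.\<close>

definition has_kind :: "('s, 'a) ualg \<Rightarrow> nat \<Rightarrow> bool" where
  "has_kind M i \<longleftrightarrow>
     i = 1 \<and> (\<exists>B :: ('a \<Rightarrow> 'a, 'a) ualg. is_ualg B \<and> unary_permutational B \<and> poly_equiv M B) \<or>
     i = 2 \<and> (\<exists>(F :: nat ring) (V :: (nat, 'a) module).
        field F \<and> finite (carrier F) \<and> Module.module F V \<and> poly_equiv M (vs_alg F V)) \<or>
     i = 3 \<and> (\<exists>b t. b \<noteq> t \<and> poly_equiv M (two_alg {Bot, Top, Compl, Meet, Join} b t)) \<or>
     i = 4 \<and> (\<exists>b t. b \<noteq> t \<and> poly_equiv M (two_alg {Meet, Join} b t)) \<or>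
     i = 5 \<and> (\<exists>b t. b \<noteq> t \<and> poly_equiv M (two_alg {Meet} b t))"

definition typ_of :: "('s, 'a) ualg \<Rightarrow> nat" where
  "typ_of A = (THE i. \<exists>U. minimal_set A U \<and> has_kind (induced A U) i)"


section \<open>Random access machine programs\<close>

text \<open>Structured programs of a unit-cost random access machine: registers and finitely many
  unbounded arrays holding natural numbers, with addition and truncated subtraction as the only
  arithmetic (hence polynomially related to Turing machines). The input is a finite
  algebra \<open>X\<close> on \<open>{0..<n}\<close> whose operation tables are read with \<open>Apply\<close>; results are
  written to an output tape with \<open>Emit\<close>. Conditionals and loops test a register for being nonzero.\<close>

datatype 's com =
    Const nat nat
  | Add nat nat nat
  | Sub nat nat nat
  | Load nat nat nat
  | Store nat nat nat
  | Apply nat 's "nat list"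
  | Emit nat
  | Seq "'s com" "'s com"
  | Cond nat "'s com" "'s com"
  | While nat "'s com"

record config =
  reg :: "nat \<Rightarrow> nat"
  arr :: "nat \<Rightarrow> nat \<Rightarrow> nat"
  out :: "nat list"

definition lookup :: "('s, nat) ualg \<Rightarrow> 's \<Rightarrow> nat list \<Rightarrow> nat" where
  "lookup X f xs = (if f \<in> symbs X \<and> xs \<in> tuples (univ X) (ar X f) then opn X f xs else 0)"

definition set_reg :: "nat \<Rightarrow> nat \<Rightarrow> config \<Rightarrow> config" where
  "set_reg i v s = s\<lparr>reg := (reg s)(i := v)\<rparr>"

inductive exec :: "('s, nat) ualg \<Rightarrow> 's com \<Rightarrow> config \<Rightarrow> nat \<Rightarrow> config \<Rightarrow> bool"
  for X :: "('s, nat) ualg" where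
  Const: "exec X (Const i c) s 1 (set_reg i c s)"
| Add: "exec X (Add i j k) s 1 (set_reg i (reg s j + reg s k) s)"
| Sub: "exec X (Sub i j k) s 1 (set_reg i (reg s j - reg s k) s)"
| Load: "exec X (Load i a j) s 1 (set_reg i (arr s a (reg s j)) s)"
| Store: "exec X (Store a i j) s 1
    (s\<lparr>arr := (arr s)(a := (arr s a)(reg s i := reg s j))\<rparr>)"
| Apply: "exec X (Apply i f js) s 1 (set_reg i (lookup X f (map (reg s) js)) s)"
| Emit: "exec X (Emit i) s 1 (s\<lparr>out := out s @ [reg s i]\<rparr>)"
| Seq: "exec X c s m s' \<Longrightarrow> exec X d s' n s'' \<Longrightarrow> exec X (Seq c d) s (m + n) s''"
| CondT: "reg s i \<noteq> 0 \<Longrightarrow> exec X c s m s' \<Longrightarrow> exec X (Cond i c d) s (m + 1) s'"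
| CondF: "reg s i = 0 \<Longrightarrow> exec X d s m s' \<Longrightarrow> exec X (Cond i c d) s (m + 1) s'"
| WhileF: "reg s i = 0 \<Longrightarrow> exec X (While i c) s 1 s"
| WhileT: "reg s i \<noteq> 0 \<Longrightarrow> exec X c s m s' \<Longrightarrow> exec X (While i c) s' n s'' \<Longrightarrow>
    exec X (While i c) s (m + n + 1) s''"

text \<open>Register 0 initially holds the size of the input algebra.\<close>

definition init :: "nat \<Rightarrow> config" where
  "init n = \<lparr>reg = (\<lambda>_. 0)(0 := n), arr = (\<lambda>_ _. 0), out = []\<rparr>"

text \<open>\<open>H X\<close> is a set of maps from \<open>X\<close> to \<open>C\<close>. One program, depending on \<open>C\<close> only, writes the value
  tables of all maps in \<open>H X\<close> one after the other and without repetition; \<open>enc\<close> fixes numerical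
  names for the elements of \<open>C\<close>.\<close>

definition poly_time_enumerable ::
    "(('s, nat) ualg \<Rightarrow> (nat \<Rightarrow> 'a) set) \<Rightarrow> ('s, 'a) ualg \<Rightarrow> bool" where
  "poly_time_enumerable H C \<longleftrightarrow>
     (\<exists>(prog :: 's com) (enc :: 'a \<Rightarrow> nat) (q :: real poly). inj_on enc (univ C) \<and>
        (\<forall>X n. is_ualg X \<and> same_sig X C \<and> univ X = {0..<n} \<longrightarrow>
           (\<exists>time s hs. exec X prog (init n) time s \<and> real time \<le> poly q (real n) \<and>
              distinct hs \<and> set hs = H X \<and>
              out s = concat (map (\<lambda>h. map (\<lambda>x. enc (h x)) [0..<n]) hs))))"


section \<open>The classes\<close>

text \<open>Finite algebras are represented, up to isomorphism, with universes consisting of natural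
  numbers.\<close>

definition K_poly :: "('s, 'a) ualg set" where
  "K_poly = {C. is_ualg C \<and> finite (univ C) \<and>
     (\<exists>p :: real poly. \<forall>X :: ('s, nat) ualg. is_ualg X \<and> finite (univ X) \<and> same_sig X C \<longrightarrow>
        real (card (homs X C)) \<le> poly p (real (card (univ X))))}"

definition K_surj :: "('s, 'a) ualg set" where
  "K_surj = {C. is_ualg C \<and> finite (univ C) \<and>
     (\<exists>p :: real poly. \<forall>X :: ('s, nat) ualg. is_ualg X \<and> finite (univ X) \<and> same_sig X C \<longrightarrow>
        real (card (surj_homs X C)) \<le> poly p (real (card (univ X))))}"

definition K_poly_eff :: "('s, 'a) ualg set" where
  "K_poly_eff = {C \<in> K_poly. poly_time_enumerable (\<lambda>X. homs X C) C}"

definition K_surj_eff :: "('s, 'a) ualg set" where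
  "K_surj_eff = {C \<in> K_surj. poly_time_enumerable (\<lambda>X. surj_homs X C) C}"

end

(*
  Separation of points by polynomials into a minimal set U bounds the homomorphisms from X to the
  expansion A' of A by constants in terms of data on U. Outside type 1, A has a binary polynomial
  acting on U as a meet or as a latin square; since the constants let this polynomial act on X, a
  homomorphism is determined on U by a single element of X (the meet of the elements sent to 1) or
  by its values on logarithmically many elements. In type 1 every polynomial of A into U depends
  on one variable when restricted to U^n, so the algebra of these restrictions has size polynomial
  in n, but the evaluations at the points of U^n give |U|^n homomorphisms. Surjections onto A and
  homomorphisms to A' are compared by choosing preimages of the elements of A as values of the
  constants.

  That the type exists and does not depend on U uses Palfy's theorem: a minimal algebra with an
  operation depending on two variables has at most two elements or the twin property, and in the
  latter case a Maltsev operation makes it affine over its ring of unary polynomials fixing a point,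
  a finite division ring and hence a field by Wedderburn's theorem.

  Homomorphisms are enumerated by extending partial homomorphisms element by element.  A partial map
  is kept only if it extends to the subalgebra it generates together with the preimages of the
  constants; the polynomial bound applied to these subalgebras keeps every level small.
*)
theory Submission
  imports Defs "HOL-Algebra.Group_Action" "HOL-Algebra.Weak_Morphisms"
begin

section \<open>Polynomial clones\<close>

lemma tuplesI: "length xs = n \<Longrightarrow> set xs \<subseteq> N \<Longrightarrow> xs \<in> tuples N n"
  by (simp add: tuples_def)

lemma tuples_length: "xs \<in> tuples N n \<Longrightarrow> length xs = n"
  by (simp add: tuples_def)

lemma tuples_nth: "xs \<in> tuples N n \<Longrightarrow> i < n \<Longrightarrow> xs ! i \<in> N"
  by (auto simp: tuples_def)

lemma tuples_map: "xs \<in> tuples N n \<Longrightarrow> (\<And>x. x \<in> N \<Longrightarrow> f x \<in> M) \<Longrightarrow> map f xs \<in> tuples M n"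
  by (auto simp: tuples_def)

lemma tuples_mono: "N \<subseteq> M \<Longrightarrow> xs \<in> tuples N n \<Longrightarrow> xs \<in> tuples M n"
  by (auto simp: tuples_def)

lemma tuples_update: "xs \<in> tuples N n \<Longrightarrow> a \<in> N \<Longrightarrow> xs[i := a] \<in> tuples N n"
  using set_update_subset_insert[of xs i a] by (auto simp: tuples_def)

lemma tuples_append: "xs \<in> tuples N n \<Longrightarrow> ys \<in> tuples N m \<Longrightarrow> xs @ ys \<in> tuples N (n + m)"
  by (auto simp: tuples_def)

lemma finite_tuples: "finite N \<Longrightarrow> finite (tuples N n)"
  using finite_lists_length_eq[of N n] by (simp add: tuples_def conj_commute)

lemma card_tuples: "finite N \<Longrightarrow> card (tuples N n) = card N ^ n"
  using card_lists_length_eq[of N n] by (simp add: tuples_def conj_commute)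

lemma tuples_1: "tuples N 1 = (\<lambda>x. [x]) ` N"
  by (auto simp: tuples_def length_Suc_conv)

lemma map_tuple: "xs \<in> tuples N n \<Longrightarrow> map ((!) xs) [0..<n] = xs"
  by (auto simp: tuples_def map_nth)

lemma tuples_0: "tuples N 0 = {[]}"
  by (auto simp: tuples_def)

definition is_pol :: "('s, 'a) ualg \<Rightarrow> nat \<Rightarrow> ('a list \<Rightarrow> 'a) \<Rightarrow> bool" where
  "is_pol A n p \<longleftrightarrow> restrict p (tuples (univ A) n) \<in> poly_ops A n"

lemma poly_opsD: "p \<in> poly_ops A n \<Longrightarrow> restrict p (tuples (univ A) n) = p"
  by (auto simp: poly_ops_def)

lemma poly_ops_subset:
  assumes "univ A = univ B" "\<And>n p. is_pol A n p \<Longrightarrow> is_pol B n p"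
  shows "poly_ops A n \<subseteq> poly_ops B n"
proof
  fix p assume p: "p \<in> poly_ops A n"
  then have "is_pol A n p" by (simp add: is_pol_def poly_opsD)
  then have "restrict p (tuples (univ B) n) \<in> poly_ops B n" using assms by (simp add: is_pol_def)
  then show "p \<in> poly_ops B n" using poly_opsD[OF p] assms by simp
qed

lemma poly_equiv_iff:
  "poly_equiv A B \<longleftrightarrow> univ A = univ B \<and> (\<forall>n p. is_pol A n p \<longleftrightarrow> is_pol B n p)"
proof
  assume "poly_equiv A B"
  then show "univ A = univ B \<and> (\<forall>n p. is_pol A n p \<longleftrightarrow> is_pol B n p)"
    by (simp add: poly_equiv_def is_pol_def)
next
  assume *: "univ A = univ B \<and> (\<forall>n p. is_pol A n p \<longleftrightarrow> is_pol B n p)"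
  then have "poly_ops A n = poly_ops B n" for n
    using poly_ops_subset[of A B n] poly_ops_subset[of B A n] by auto
  with * show "poly_equiv A B" by (simp add: poly_equiv_def)
qed

lemma is_pol_alt:
  "is_pol A n p \<longleftrightarrow> (\<exists>t as m. wf_trm A (n + m) t \<and> as \<in> tuples (univ A) m \<and>
     (\<forall>xs\<in>tuples (univ A) n. p xs = eval_trm A (xs @ as) t))" (is "_ \<longleftrightarrow> ?R")
proof
  assume "is_pol A n p"
  then obtain t as m where *: "wf_trm A (n + m) t" "as \<in> tuples (univ A) m"
    "restrict p (tuples (univ A) n) = (\<lambda>xs\<in>tuples (univ A) n.
       (\<lambda>xs\<in>tuples (univ A) (n + m). eval_trm A xs t) (xs @ as))"
    unfolding is_pol_def poly_ops_def term_ops_def by blast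
  have "p xs = eval_trm A (xs @ as) t" if "xs \<in> tuples (univ A) n" for xs
    using fun_cong[OF *(3), of xs] that *(2) by (simp add: tuples_append)
  with * show ?R by blast
next
  assume ?R
  then obtain t as m where *: "wf_trm A (n + m) t" "as \<in> tuples (univ A) m"
    "\<forall>xs\<in>tuples (univ A) n. p xs = eval_trm A (xs @ as) t" by blast
  have "restrict p (tuples (univ A) n) = (\<lambda>xs\<in>tuples (univ A) n.
       (\<lambda>xs\<in>tuples (univ A) (n + m). eval_trm A xs t) (xs @ as))"
    using * by (auto simp: restrict_def fun_eq_iff tuples_append)
  then show "is_pol A n p"
    unfolding is_pol_def poly_ops_def term_ops_def using *(1,2) by blast
qed

lemma is_pol_cong:
  "is_pol A n p \<Longrightarrow> (\<And>xs. xs \<in> tuples (univ A) n \<Longrightarrow> p xs = q xs) \<Longrightarrow> is_pol A n q"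
  unfolding is_pol_alt by fastforce

primrec ren :: "(nat \<Rightarrow> nat) \<Rightarrow> 's trm \<Rightarrow> 's trm" where
  "ren r (Var i) = Var (r i)"
| "ren r (App f ts) = App f (map (ren r) ts)"

lemma wf_ren: "wf_trm A n t \<Longrightarrow> (\<And>i. i < n \<Longrightarrow> r i < m) \<Longrightarrow> wf_trm A m (ren r t)"
  by (induction t) auto

lemma eval_ren:
  "wf_trm A n t \<Longrightarrow> (\<And>i. i < n \<Longrightarrow> ys ! r i = xs ! i) \<Longrightarrow> eval_trm A ys (ren r t) = eval_trm A xs t"
  by (induction t) (auto intro!: arg_cong[of _ _ "opn A _"])

text \<open>Fixing one enumeration of the universe as the tuple of parameters makes it possible to
  combine several polynomials.\<close>

lemma is_pol_params:
  assumes L: "set L = univ A"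
  shows "is_pol A n p \<longleftrightarrow> (\<exists>t. wf_trm A (n + length L) t \<and>
     (\<forall>xs\<in>tuples (univ A) n. p xs = eval_trm A (xs @ L) t))" (is "_ \<longleftrightarrow> ?R")
proof
  assume "is_pol A n p"
  then obtain t as m where *: "wf_trm A (n + m) t" "as \<in> tuples (univ A) m"
    "\<forall>xs\<in>tuples (univ A) n. p xs = eval_trm A (xs @ as) t" unfolding is_pol_alt by blast
  have "\<exists>j<length L. L ! j = as ! i" if "i < m" for i
    using *(2) that L by (metis in_set_conv_nth tuples_nth)
  then obtain j where j: "\<And>i. i < m \<Longrightarrow> j i < length L \<and> L ! j i = as ! i" by metis
  define r where "r i = (if i < n then i else n + j (i - n))" for i
  have "wf_trm A (n + length L) (ren r t)"
    using *(1) by (rule wf_ren) (auto simp: r_def j)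
  moreover have "p xs = eval_trm A (xs @ L) (ren r t)" if "xs \<in> tuples (univ A) n" for xs
  proof -
    have "eval_trm A (xs @ L) (ren r t) = eval_trm A (xs @ as) t"
      using *(1) by (rule eval_ren) (use that j in \<open>auto simp: r_def nth_append tuples_length\<close>)
    then show ?thesis using *(3) that by simp
  qed
  ultimately show ?R by blast
next
  assume ?R then show "is_pol A n p"
    unfolding is_pol_alt using L by (force intro!: tuplesI)
qed

lemma is_pol_proj: "i < n \<Longrightarrow> is_pol A n (\<lambda>xs. xs ! i)"
  unfolding is_pol_alt
  by (rule exI[of _ "Var i"], rule exI[of _ "[]"], rule exI[of _ 0]) (simp add: tuples_0)

lemma is_pol_const: "a \<in> univ A \<Longrightarrow> is_pol A n (\<lambda>xs. a)"
  unfolding is_pol_alt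
  by (rule exI[of _ "Var n"], rule exI[of _ "[a]"], rule exI[of _ 1])
    (auto simp: tuples_def nth_append)

lemma is_pol_app:
  assumes "finite (univ A)" "f \<in> symbs A" "length gs = ar A f" "\<And>g. g \<in> set gs \<Longrightarrow> is_pol A n g"
  shows "is_pol A n (\<lambda>xs. opn A f (map (\<lambda>g. g xs) gs))"
proof -
  obtain L where L: "set L = univ A" using assms(1) finite_list by blast
  have "\<forall>g\<in>set gs. \<exists>t. wf_trm A (n + length L) t \<and>
     (\<forall>xs\<in>tuples (univ A) n. g xs = eval_trm A (xs @ L) t)"
    using assms(4) is_pol_params[OF L] by blast
  then obtain t where t: "\<forall>g\<in>set gs. wf_trm A (n + length L) (t g) \<and>
     (\<forall>xs\<in>tuples (univ A) n. g xs = eval_trm A (xs @ L) (t g))" by metis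
  have "opn A f (map (\<lambda>g. g xs) gs) = eval_trm A (xs @ L) (App f (map t gs))"
    if "xs \<in> tuples (univ A) n" for xs
    using t that by (auto intro!: arg_cong[of _ _ "opn A f"])
  moreover have "wf_trm A (n + length L) (App f (map t gs))" using t assms by auto
  ultimately show ?thesis unfolding is_pol_params[OF L] by blast
qed

lemma is_pol_induct [consumes 1, case_names cong proj const app]:
  assumes "is_pol A n p"
    and cong: "\<And>p q. Q p \<Longrightarrow> (\<And>xs. xs \<in> tuples (univ A) n \<Longrightarrow> p xs = q xs) \<Longrightarrow> Q q"
    and proj: "\<And>i. i < n \<Longrightarrow> Q (\<lambda>xs. xs ! i)"
    and const: "\<And>a. a \<in> univ A \<Longrightarrow> Q (\<lambda>xs. a)"
    and app: "\<And>f gs. f \<in> symbs A \<Longrightarrow> length gs = ar A f \<Longrightarrow> (\<And>g. g \<in> set gs \<Longrightarrow> Q g)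
      \<Longrightarrow> Q (\<lambda>xs. opn A f (map (\<lambda>g. g xs) gs))"
  shows "Q p"
proof -
  obtain t as m where *: "wf_trm A (n + m) t" "as \<in> tuples (univ A) m"
    "\<forall>xs\<in>tuples (univ A) n. p xs = eval_trm A (xs @ as) t" using assms(1) unfolding is_pol_alt by blast
  have "Q (\<lambda>xs. eval_trm A (xs @ as) t)" using *(1)
  proof (induction t)
    case (Var i)
    show ?case
    proof (cases "i < n")
      case True
      show ?thesis by (rule cong[OF proj[OF True]]) (use True in \<open>auto simp: nth_append tuples_length\<close>)
    next
      case False
      show ?thesis by (rule cong[OF const[of "as ! (i - n)"]])
        (use False *(2) Var in \<open>auto simp: nth_append tuples_length tuples_nth\<close>)
    qed
  next
    case (App f ts)
    have "Q (\<lambda>xs. opn A f (map (\<lambda>g. g xs) (map (\<lambda>t xs. eval_trm A (xs @ as) t) ts)))"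
      by (rule app) (use App in auto)
    then show ?case by (rule cong) (simp add: comp_def)
  qed
  then show ?thesis by (rule cong) (use * in auto)
qed

text \<open>A clone of operations on \<open>U\<close> containing the constants; operations are considered up to their values
  on \<open>U\<^sup>n\<close>.\<close>

locale clone =
  fixes U :: "'a set" and P :: "nat \<Rightarrow> ('a list \<Rightarrow> 'a) \<Rightarrow> bool"
  assumes P_closed: "P n p \<Longrightarrow> xs \<in> tuples U n \<Longrightarrow> p xs \<in> U"
    and P_cong: "P n p \<Longrightarrow> (\<And>xs. xs \<in> tuples U n \<Longrightarrow> p xs = q xs) \<Longrightarrow> P n q"
    and P_proj: "i < n \<Longrightarrow> P n (\<lambda>xs. xs ! i)"
    and P_const: "a \<in> U \<Longrightarrow> P n (\<lambda>xs. a)"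
    and P_comp: "P m p \<Longrightarrow> length qs = m \<Longrightarrow> (\<And>q. q \<in> set qs \<Longrightarrow> P n q)
      \<Longrightarrow> P n (\<lambda>xs. p (map (\<lambda>q. q xs) qs))"
begin

definition un :: "('a \<Rightarrow> 'a) \<Rightarrow> bool" where "un f \<longleftrightarrow> P 1 (\<lambda>xs. f (xs ! 0))"
definition bin :: "('a \<Rightarrow> 'a \<Rightarrow> 'a) \<Rightarrow> bool" where "bin f \<longleftrightarrow> P 2 (\<lambda>xs. f (xs ! 0) (xs ! 1))"

lemma un_app: "un f \<Longrightarrow> P n p \<Longrightarrow> P n (\<lambda>xs. f (p xs))"
  using P_comp[of 1 "\<lambda>xs. f (xs ! 0)" "[p]" n] by (simp add: un_def)

lemma bin_app: "bin f \<Longrightarrow> P n p \<Longrightarrow> P n q \<Longrightarrow> P n (\<lambda>xs. f (p xs) (q xs))"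
  using P_comp[of 2 "\<lambda>xs. f (xs ! 0) (xs ! 1)" "[p, q]" n] by (auto simp: bin_def)

lemma unI: "P n p \<Longrightarrow> (\<And>i. i < n \<Longrightarrow> P 1 (\<lambda>xs. g i (xs ! 0))) \<Longrightarrow> un (\<lambda>x. p (map (\<lambda>i. g i x) [0..<n]))"
proof -
  assume *: "P n p" "\<And>i. i < n \<Longrightarrow> P 1 (\<lambda>xs. g i (xs ! 0))"
  have "P 1 (\<lambda>xs. p (map (\<lambda>q. q xs) (map (\<lambda>i xs. g i (xs ! 0)) [0..<n])))"
    by (rule P_comp[OF *(1)]) (use *(2) in auto)
  then show ?thesis by (simp add: un_def comp_def)
qed

lemma un_closed: "un f \<Longrightarrow> x \<in> U \<Longrightarrow> f x \<in> U"
  using P_closed[of 1 "\<lambda>xs. f (xs ! 0)" "[x]"] by (simp add: un_def tuples_def)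

lemma bin_closed: "bin f \<Longrightarrow> x \<in> U \<Longrightarrow> y \<in> U \<Longrightarrow> f x y \<in> U"
  using P_closed[of 2 "\<lambda>xs. f (xs ! 0) (xs ! 1)" "[x, y]"] by (simp add: bin_def tuples_def)

lemma un_cong: "un f \<Longrightarrow> (\<And>x. x \<in> U \<Longrightarrow> f x = g x) \<Longrightarrow> un g"
  unfolding un_def by (erule P_cong) (auto simp: tuples_nth)

lemma bin_cong: "bin f \<Longrightarrow> (\<And>x y. x \<in> U \<Longrightarrow> y \<in> U \<Longrightarrow> f x y = g x y) \<Longrightarrow> bin g"
  unfolding bin_def by (erule P_cong) (auto simp: tuples_nth)

lemma un_id: "un (\<lambda>x. x)"
  unfolding un_def by (rule P_proj) simp

lemma un_const: "a \<in> U \<Longrightarrow> un (\<lambda>x. a)"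
  unfolding un_def by (rule P_const)

lemma un_comp: "un f \<Longrightarrow> un g \<Longrightarrow> un (\<lambda>x. f (g x))"
  unfolding un_def[of "\<lambda>x. f (g x)"] by (rule un_app) (auto simp: un_def)

lemma un_funpow: "un f \<Longrightarrow> un (f ^^ k)"
  by (induction k) (auto simp: id_def comp_def intro: un_id un_comp)

lemma un_bin: "bin f \<Longrightarrow> un g \<Longrightarrow> un h \<Longrightarrow> un (\<lambda>x. f (g x) (h x))"
  unfolding un_def[of "\<lambda>x. f (g x) (h x)"] by (rule bin_app) (auto simp: un_def)

lemma bin_fst: "un g \<Longrightarrow> bin (\<lambda>x y. g x)"
  unfolding bin_def by (rule un_app) (auto intro: P_proj)

lemma bin_snd: "un g \<Longrightarrow> bin (\<lambda>x y. g y)"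
  unfolding bin_def by (rule un_app) (auto intro: P_proj)

lemma bin_comp: "bin f \<Longrightarrow> bin g \<Longrightarrow> bin h \<Longrightarrow> bin (\<lambda>x y. f (g x y) (h x y))"
  unfolding bin_def[of "\<lambda>x y. f (g x y) (h x y)"] by (rule bin_app) (auto simp: bin_def)

lemma bin_un: "un f \<Longrightarrow> bin g \<Longrightarrow> bin (\<lambda>x y. f (g x y))"
  unfolding bin_def[of "\<lambda>x y. f (g x y)"] by (rule un_app) (auto simp: bin_def)

lemma bin_swap: "bin f \<Longrightarrow> bin (\<lambda>x y. f y x)"
  by (rule bin_comp) (auto intro: bin_fst bin_snd un_id)

lemma bin_funpow: "bin f \<Longrightarrow> bin (\<lambda>x y. ((\<lambda>z. f z y) ^^ k) x)"
proof (induction k)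
  case 0 then show ?case by (simp add: bin_fst un_id)
next
  case (Suc k)
  then have "bin (\<lambda>x y. f (((\<lambda>z. f z y) ^^ k) x) y)"
    by (intro bin_comp[OF Suc.prems Suc.IH bin_snd[OF un_id]])
  then show ?case by simp
qed

lemma P_if: "(c \<Longrightarrow> P n p) \<Longrightarrow> (\<not> c \<Longrightarrow> P n q) \<Longrightarrow> P n (\<lambda>xs. if c then p xs else q xs)"
  by (cases c) auto

lemma P_update: "P n p \<Longrightarrow> xs \<in> tuples U n \<Longrightarrow> i < n \<Longrightarrow> un (\<lambda>x. p (xs[i := x]))"
proof -
  assume *: "P n p" "xs \<in> tuples U n" "i < n"
  have "un (\<lambda>x. p (map (\<lambda>j. (\<lambda>y. if j = i then y else xs ! j) x) [0..<n]))"
    by (rule unI[OF *(1)]) (use * in \<open>auto intro!: P_if P_proj P_const tuples_nth\<close>)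
  moreover have "map (\<lambda>j. if j = i then x else xs ! j) [0..<n] = xs[i := x]" for x
    using * by (intro nth_equalityI) (auto simp: nth_list_update tuples_length)
  ultimately show ?thesis by simp
qed

lemma P_update2:
  assumes *: "P n p" "xs \<in> tuples U n" "i < n" "j < n" "i \<noteq> j"
  shows "bin (\<lambda>x y. p (xs[i := x, j := y]))"
proof -
  let ?q = "\<lambda>k zs. if k = i then zs ! 0 else if k = j then zs ! 1 else xs ! k"
  have "P 2 (\<lambda>zs. p (map (\<lambda>q. q zs) (map ?q [0..<n])))"
    by (rule P_comp[OF *(1)]) (use * in \<open>auto intro!: P_if P_proj P_const tuples_nth\<close>)
  moreover have "map (\<lambda>q. q zs) (map ?q [0..<n]) = xs[i := zs ! 0, j := zs ! 1]" for zs
    using * by (intro nth_equalityI) (auto simp: nth_list_update tuples_length)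
  ultimately show ?thesis by (simp add: bin_def)
qed

lemma is_pol_imp_P:
  assumes "univ B = U" "is_pol B n p"
    and "\<And>f. f \<in> symbs B \<Longrightarrow> P (ar B f) (opn B f)"
  shows "P n p"
  using assms(2)
proof (induction rule: is_pol_induct)
  case (cong p q)
  show ?case by (rule P_cong[OF cong(1)]) (use cong(2) assms(1) in auto)
next
  case (app f gs)
  show ?case by (rule P_comp[OF assms(3)]) (use app in auto)
qed (use assms in \<open>auto intro: P_proj P_const\<close>)

end

lemma is_pol_closed:
  assumes "is_ualg A" "is_pol A n p" "xs \<in> tuples (univ A) n"
  shows "p xs \<in> univ A"
proof -
  have "\<forall>xs\<in>tuples (univ A) n. p xs \<in> univ A"
    using assms(2)
  proof (induction rule: is_pol_induct)
    case (app f gs)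
    show ?case
    proof
      fix xs assume "xs \<in> tuples (univ A) n"
      then have "map (\<lambda>g. g xs) gs \<in> tuples (univ A) (ar A f)"
        using app by (auto intro!: tuplesI)
      then show "opn A f (map (\<lambda>g. g xs) gs) \<in> univ A"
        using assms(1) app by (auto simp: is_ualg_def)
    qed
  qed (auto simp: tuples_nth)
  then show ?thesis using assms(3) by blast
qed

lemma is_pol_comp:
  assumes A: "is_ualg A" "finite (univ A)"
    and "is_pol A m p" "length qs = m" "\<And>q. q \<in> set qs \<Longrightarrow> is_pol A n q"
  shows "is_pol A n (\<lambda>xs. p (map (\<lambda>q. q xs) qs))"
  using assms(3)
proof (induction rule: is_pol_induct)
  case (cong p q)
  show ?case
  proof (rule is_pol_cong[OF cong(1)], rule cong(2))
    fix xs assume "xs \<in> tuples (univ A) n"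
    then show "map (\<lambda>q. q xs) qs \<in> tuples (univ A) m"
      using assms(4) is_pol_closed[OF A(1) assms(5)] by (auto intro!: tuplesI)
  qed
next
  case (proj i)
  then have "is_pol A n (qs ! i)" using assms by simp
  then show ?case by (rule is_pol_cong) (use proj assms in simp)
next
  case (const a)
  then show ?case by (rule is_pol_const)
next
  case (app f gs)
  have "is_pol A n (\<lambda>xs. opn A f (map (\<lambda>g. g xs) (map (\<lambda>g xs. g (map (\<lambda>q. q xs) qs)) gs)))"
    by (rule is_pol_app) (use app A in auto)
  then show ?case by (rule is_pol_cong) (simp add: comp_def)
qed

lemma clone_is_pol: "is_ualg A \<Longrightarrow> finite (univ A) \<Longrightarrow> clone (univ A) (is_pol A)"
  by unfold_locales
    (auto intro: is_pol_closed is_pol_cong is_pol_proj is_pol_const is_pol_comp)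

lemma is_pol_basic:
  assumes "is_ualg A" "finite (univ A)" "f \<in> symbs A"
  shows "is_pol A (ar A f) (opn A f)"
proof -
  have "is_pol A (ar A f) (\<lambda>xs. opn A f (map (\<lambda>g. g xs) (map (\<lambda>i xs. xs ! i) [0..<ar A f])))"
    by (rule is_pol_app) (use assms in \<open>auto intro: is_pol_proj\<close>)
  then show ?thesis
    by (rule is_pol_cong) (simp add: comp_def map_tuple)
qed

definition pol_on :: "('s, 'a) ualg \<Rightarrow> 'a set \<Rightarrow> nat \<Rightarrow> ('a list \<Rightarrow> 'a) \<Rightarrow> bool" where
  "pol_on A U n p \<longleftrightarrow> (\<forall>xs\<in>tuples U n. p xs \<in> U) \<and>
     (\<exists>q. is_pol A n q \<and> (\<forall>xs\<in>tuples U n. p xs = q xs))"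

lemma clone_pol_on:
  fixes A :: "('s, 'a) ualg"
  assumes A: "is_ualg A" "finite (univ A)" and U: "U \<subseteq> univ A"
  shows "clone U (pol_on A U)"
proof
  fix n p xs assume "pol_on A U n p" "xs \<in> tuples U n"
  then show "p xs \<in> U" by (simp add: pol_on_def)
next
  fix n p q assume *: "pol_on A U n p" "\<And>xs. xs \<in> tuples U n \<Longrightarrow> p xs = q xs"
  then show "pol_on A U n q" by (auto simp: pol_on_def)
next
  fix i n :: nat assume "i < n"
  then show "pol_on A U n (\<lambda>xs. xs ! i)" by (auto simp: pol_on_def tuples_nth intro!: is_pol_proj)
next
  fix a n assume "a \<in> U"
  then show "pol_on A U n (\<lambda>xs. a)" using U is_pol_const[of a A n] by (auto simp: pol_on_def)
next
  fix m n p and qs :: "('a list \<Rightarrow> 'a) list"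
  assume p: "pol_on A U m p" "length qs = m" and q: "\<And>q. q \<in> set qs \<Longrightarrow> pol_on A U n q"
  obtain p' where p': "is_pol A m p'" "\<forall>xs\<in>tuples U m. p xs = p' xs"
    using p by (auto simp: pol_on_def)
  obtain q' where q': "\<And>q. q \<in> set qs \<Longrightarrow> is_pol A n (q' q) \<and> (\<forall>xs\<in>tuples U n. q xs = q' q xs)"
    using q unfolding pol_on_def by metis
  have in_U: "map (\<lambda>q. q xs) qs \<in> tuples U m" if "xs \<in> tuples U n" for xs
    using that p q by (auto simp: tuples_def pol_on_def)
  have "is_pol A n (\<lambda>xs. p' (map (\<lambda>q. q xs) (map q' qs)))"
    by (rule is_pol_comp) (use A p' p q' in auto)
  moreover have "p (map (\<lambda>q. q xs) qs) = p' (map (\<lambda>q. q xs) (map q' qs))" if "xs \<in> tuples U n" for xs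
  proof -
    have eq: "map (\<lambda>q. q xs) (map q' qs) = map (\<lambda>q. q xs) qs" using q' that by auto
    show ?thesis unfolding eq using p'(2) in_U[OF that] by blast
  qed
  moreover have "p (map (\<lambda>q. q xs) qs) \<in> U" if "xs \<in> tuples U n" for xs
    using in_U[OF that] p by (auto simp: pol_on_def)
  ultimately show "pol_on A U n (\<lambda>xs. p (map (\<lambda>q. q xs) qs))" unfolding pol_on_def by blast
qed

lemma is_pol_induced:
  assumes A: "is_ualg A" "finite (univ A)" and U: "U \<subseteq> univ A"
  shows "is_pol (induced A U) n p \<longleftrightarrow> pol_on A U n p"
proof
  interpret clone U "pol_on A U" by (rule clone_pol_on[OF assms])
  assume "is_pol (induced A U) n p"
  then show "pol_on A U n p"
  proof (rule is_pol_imp_P[rotated])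
    fix f assume "f \<in> symbs (induced A U)"
    then obtain k g where g: "f = (k, g)" "g \<in> poly_ops A k" "\<forall>xs\<in>tuples U k. g xs \<in> U"
      by (auto simp: induced_def)
    have "is_pol A k g" using g(2) poly_opsD[OF g(2)] by (simp add: is_pol_def)
    then show "pol_on A U (ar (induced A U) f) (opn (induced A U) f)"
      using g by (auto simp: induced_def pol_on_def)
  qed (auto simp: induced_def)
next
  assume p: "pol_on A U n p"
  then obtain q where q: "is_pol A n q" "\<forall>xs\<in>tuples U n. p xs = q xs" by (auto simp: pol_on_def)
  let ?q = "restrict q (tuples (univ A) n)"
  let ?I = "induced A U"
  have eq: "?q xs = p xs" if "xs \<in> tuples U n" for xs using q that tuples_mono[OF U that] by simp
  have s: "(n, ?q) \<in> symbs ?I"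
    using q p by (auto simp: induced_def is_pol_def[symmetric] pol_on_def tuples_mono[OF U])
  have fin: "finite (univ ?I)" using A U finite_subset by (auto simp: induced_def)
  have "is_pol ?I n (\<lambda>xs. opn ?I (n, ?q) (map (\<lambda>g. g xs) (map (\<lambda>i xs. xs ! i) [0..<n])))"
    by (rule is_pol_app[OF fin s]) (auto simp: induced_def intro: is_pol_proj)
  then show "is_pol ?I n p"
    by (rule is_pol_cong) (use eq in \<open>simp add: induced_def comp_def map_tuple\<close>)
qed

section \<open>Minimal clones\<close>

lemma idempotent_power:
  assumes "finite U"
  shows "\<exists>k>0. \<forall>f\<in>U \<rightarrow> U. \<forall>x\<in>U. (f ^^ k) ((f ^^ k) x) = (f ^^ k) x"
proof -
  let ?F = "U \<rightarrow>\<^sub>E U"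
  let ?\<Phi> = "\<lambda>k. \<lambda>f\<in>?F. restrict (f ^^ k) U"
  have closed: "(f ^^ k) x \<in> U" if "f \<in> U \<rightarrow> U" "x \<in> U" for f :: "'a \<Rightarrow> 'a" and k x
    using that by (induction k) auto
  have "?\<Phi> k \<in> ?F \<rightarrow>\<^sub>E ?F" for k
    by (intro restrict_PiE_iff[THEN iffD2] ballI closed) (auto simp: PiE_def)
  then have "range ?\<Phi> \<subseteq> ?F \<rightarrow>\<^sub>E ?F" by blast
  moreover have "finite (?F \<rightarrow>\<^sub>E ?F)" using assms by (intro finite_PiE) auto
  ultimately have "finite (range ?\<Phi>)" by (rule finite_subset)
  then have "\<not> inj ?\<Phi>" using finite_imageD[of ?\<Phi> UNIV] by auto
  then obtain i j where ij: "i < j" "?\<Phi> i = ?\<Phi> j" unfolding inj_def by (metis linorder_neqE_nat)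
  define m where "m = j - i"
  define k where "k = Suc i * m"
  have m: "m > 0" using ij by (simp add: m_def)
  have "(f ^^ k) ((f ^^ k) x) = (f ^^ k) x" if f: "f \<in> U \<rightarrow> U" and x: "x \<in> U" for f x
  proof -
    define g where "g = restrict f U"
    have g: "g \<in> ?F" using f by (auto simp: g_def)
    have gf: "(g ^^ l) y = (f ^^ l) y" if "y \<in> U" for l y
      using closed[OF f that] by (induction l) (auto simp: g_def)
    have "(f ^^ i) y = (f ^^ j) y" if "y \<in> U" for y
    proof -
      have "?\<Phi> i g y = ?\<Phi> j g y" using ij by simp
      then show ?thesis using g that gf by simp
    qed
    then have step: "(f ^^ (i + m)) y = (f ^^ i) y" if "y \<in> U" for y
      using ij that by (simp add: m_def)
    have step': "(f ^^ (l + m)) y = (f ^^ l) y" if "y \<in> U" "l \<ge> i" for l y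
    proof -
      have "(f ^^ (l + m)) y = (f ^^ (l - i)) ((f ^^ (i + m)) y)"
        using that by (simp flip: funpow_add[unfolded comp_def, THEN fun_cong] add: comp_def)
      also have "\<dots> = (f ^^ (l - i + i)) y" using step[OF that(1)] by (simp add: funpow_add)
      finally show ?thesis using that by simp
    qed
    have "(f ^^ (k + r * m)) x = (f ^^ k) x" for r
    proof (induction r)
      case (Suc r)
      have "i * 1 \<le> i * m" using m by (intro mult_le_mono2) simp
      then have "k + r * m \<ge> i" unfolding k_def mult_Suc by linarith
      then show ?case using step'[OF x, of "k + r * m"] Suc by (simp add: add_ac)
    qed simp
    from this[of "Suc i"] have "(f ^^ (k + k)) x = (f ^^ k) x" by (simp only: k_def)
    then show ?thesis by (simp add: funpow_add)
  qed
  moreover have "k > 0" using m by (simp add: k_def)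
  ultimately show ?thesis by blast
qed

lemma card_ge_2E:
  assumes "card S \<ge> 2" obtains a b where "a \<in> S" "b \<in> S" "a \<noteq> b"
proof -
  have "finite S" using assms card_ge_0_finite[of S] by simp
  then show ?thesis using assms that card_le_Suc0_iff_eq[of S] by force
qed

lemma take_drop_step:
  "k < length xs \<Longrightarrow> length ys = length xs \<Longrightarrow>
     take (Suc k) ys @ drop (Suc k) xs = (take k ys @ drop k xs)[k := ys ! k]"
  by (intro nth_equalityI) (auto simp: nth_append nth_list_update min_def)

lemma take_drop_tuples:
  "xs \<in> tuples U n \<Longrightarrow> ys \<in> tuples U n \<Longrightarrow> take k ys @ drop k xs \<in> tuples U n"
  by (auto simp: tuples_def dest: in_set_takeD in_set_dropD)

context clone begin

definition two_dep :: bool where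
  "two_dep \<longleftrightarrow> (\<exists>f. bin f \<and> (\<exists>a\<in>U. \<exists>b\<in>U. \<exists>c\<in>U. f a c \<noteq> f b c) \<and>
     (\<exists>a\<in>U. \<exists>b\<in>U. \<exists>c\<in>U. f c a \<noteq> f c b))"

definition twin :: bool where
  "twin \<longleftrightarrow> (\<forall>f. bin f \<longrightarrow> (\<forall>c\<in>U. \<forall>d\<in>U. inj_on (\<lambda>x. f x c) U \<longrightarrow> inj_on (\<lambda>x. f x d) U))"

definition moving :: bool where
  "moving \<longleftrightarrow> (\<exists>f. un f \<and> inj_on f U \<and> (\<exists>x\<in>U. f x \<noteq> x))"

abbreviation meet :: "'a \<Rightarrow> 'a \<Rightarrow> 'a \<Rightarrow> 'a \<Rightarrow> 'a" where
  "meet b t x y \<equiv> (if x = t \<and> y = t then t else b)"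

abbreviation join :: "'a \<Rightarrow> 'a \<Rightarrow> 'a \<Rightarrow> 'a \<Rightarrow> 'a" where
  "join b t x y \<equiv> (if x = b \<and> y = b then b else t)"

definition latticed :: bool where
  "latticed \<longleftrightarrow> (\<exists>b\<in>U. \<exists>t\<in>U. b \<noteq> t \<and> bin (meet b t) \<and> bin (join b t))"

definition kind :: nat where
  "kind = (if \<not> two_dep then 1 else if twin then 2 else if moving then 3 else if latticed then 4 else 5)"

lemma un_of_bin: "bin f \<Longrightarrow> c \<in> U \<Longrightarrow> un (\<lambda>x. f x c)"
  by (rule un_bin[OF _ un_id un_const])

lemma un_of_bin': "bin f \<Longrightarrow> c \<in> U \<Longrightarrow> un (\<lambda>x. f c x)"
  by (rule un_bin[OF _ un_const un_id])

lemma indep_agree: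
  assumes p: "\<And>i xs a. i < n \<Longrightarrow> i \<notin> S \<Longrightarrow> xs \<in> tuples U n \<Longrightarrow> a \<in> U \<Longrightarrow> p (xs[i := a]) = p xs"
    and xs: "xs \<in> tuples U n" and ys: "ys \<in> tuples U n" and eq: "\<And>i. i < n \<Longrightarrow> i \<in> S \<Longrightarrow> xs ! i = ys ! i"
  shows "p xs = p ys"
proof -
  have len: "length xs = n" "length ys = n" using xs ys by (auto simp: tuples_length)
  have "k \<le> n \<Longrightarrow> p (take k ys @ drop k xs) = p xs" for k
  proof (induction k)
    case (Suc k)
    let ?zs = "take k ys @ drop k xs"
    have zs: "?zs \<in> tuples U n" by (rule take_drop_tuples[OF xs ys])
    have step: "take (Suc k) ys @ drop (Suc k) xs = ?zs[k := ys ! k]"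
      using take_drop_step[of k xs ys] Suc.prems len by simp
    show ?case
    proof (cases "k \<in> S")
      case True
      then have "?zs[k := ys ! k] = ?zs"
        using eq[of k] Suc.prems len by (intro list_update_same_conv[THEN iffD2]) (auto simp: nth_append)
      then show ?thesis using Suc step by simp
    next
      case False
      then show ?thesis unfolding step using p[OF _ False zs, of "ys ! k"] ys Suc by (simp add: tuples_nth)
    qed
  qed simp
  from this[of n] show ?thesis using len by simp
qed

end

locale minimal_clone = clone +
  assumes fin: "finite U" and card2: "card U \<ge> 2"
    and minimal: "un f \<Longrightarrow> inj_on f U \<or> (\<exists>c. \<forall>x\<in>U. f x = c)"
begin

lemma two_elements: obtains a b where "a \<in> U" "b \<in> U" "a \<noteq> b"
  using card2 card_ge_2E by blast

lemma un_inj: "un f \<Longrightarrow> x \<in> U \<Longrightarrow> y \<in> U \<Longrightarrow> f x \<noteq> f y \<Longrightarrow> inj_on f U"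
  using minimal by metis

lemma un_const_on: "un f \<Longrightarrow> \<not> inj_on f U \<Longrightarrow> x \<in> U \<Longrightarrow> y \<in> U \<Longrightarrow> f x = f y"
  using un_inj by blast

lemma inj_not_const: "inj_on f U \<Longrightarrow> \<not> (\<forall>x\<in>U. f x = c)"
  using two_elements by (metis inj_onD)

lemma non_twin_retraction:
  assumes f: "bin f" and cd: "c \<in> U" "d \<in> U" and inj: "inj_on (\<lambda>x. f x c) U" and ninj: "\<not> inj_on (\<lambda>x. f x d) U"
  obtains g r where "bin g" "r \<in> U" "\<And>x. x \<in> U \<Longrightarrow> g x c = x" "\<And>x. x \<in> U \<Longrightarrow> g x d = r"
    "\<And>x y. x \<in> U \<Longrightarrow> y \<in> U \<Longrightarrow> g (g x y) y = g x y"
proof -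
  obtain k where k: "k > 0" "\<And>f x. f \<in> U \<rightarrow> U \<Longrightarrow> x \<in> U \<Longrightarrow> (f ^^ k) ((f ^^ k) x) = (f ^^ k) x"
    using idempotent_power[OF fin] by blast
  define g where "g = (\<lambda>x y. ((\<lambda>z. f z y) ^^ k) x)"
  have g: "bin g" unfolding g_def by (rule bin_funpow[OF f])
  have fU: "(\<lambda>z. f z y) \<in> U \<rightarrow> U" if "y \<in> U" for y using bin_closed[OF f] that by auto
  have idem: "g (g x y) y = g x y" if "x \<in> U" "y \<in> U" for x y
    using k(2)[OF fU[OF that(2)] that(1)] by (simp add: g_def)
  have powU: "((\<lambda>z. f z y) ^^ j) x \<in> U" if "x \<in> U" "y \<in> U" for x y j
    using that by (induction j) (auto intro: bin_closed[OF f])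
  have injpow: "inj_on ((\<lambda>z. f z c) ^^ j) U" for j
  proof (induction j)
    case (Suc j)
    show ?case
    proof (rule inj_onI)
      fix x y assume xy: "x \<in> U" "y \<in> U" "((\<lambda>z. f z c) ^^ Suc j) x = ((\<lambda>z. f z c) ^^ Suc j) y"
      then have "((\<lambda>z. f z c) ^^ j) x = ((\<lambda>z. f z c) ^^ j) y"
        using inj_onD[OF inj] powU cd by simp
      then show "x = y" using inj_onD[OF Suc.IH] xy by blast
    qed
  qed simp
  have "g x c = x" if "x \<in> U" for x
    using inj_onD[OF injpow[of k], of "g x c" x] idem[OF that cd(1)] that cd powU by (simp add: g_def)
  moreover have "g x d = f d d" if "x \<in> U" for x
  proof -
    obtain j where j: "k = Suc j" using k by (cases k) auto
    have "g x d = f (((\<lambda>z. f z d) ^^ j) x) d" by (simp add: g_def j)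
    also have "\<dots> = f d d" using un_const_on[OF un_of_bin[OF f cd(2)] ninj powU[OF that cd(2)] cd(2)] .
    finally show ?thesis .
  qed
  moreover have "f d d \<in> U" using bin_closed f cd by blast
  ultimately show ?thesis using that g idem by blast
qed

lemma twin_of_card: assumes "card U \<ge> 3" shows twin
  unfolding twin_def
proof (intro allI impI ballI, rule ccontr)
  fix f c d assume f: "bin f" "c \<in> U" "d \<in> U" "inj_on (\<lambda>x. f x c) U" "\<not> inj_on (\<lambda>x. f x d) U"
  obtain g r where g: "bin g" and gc: "\<And>x. x \<in> U \<Longrightarrow> g x c = x" and gd: "\<And>x. x \<in> U \<Longrightarrow> g x d = r"
    and idem: "\<And>x y. x \<in> U \<Longrightarrow> y \<in> U \<Longrightarrow> g (g x y) y = g x y"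
    using non_twin_retraction[OF f] by metis
  note cd = f(2,3)
  have "card (U - {r}) \<ge> 2" using assms fin by (cases "r \<in> U") auto
  then obtain x1 x2 where x: "x1 \<in> U" "x2 \<in> U" "x1 \<noteq> r" "x2 \<noteq> r" "x1 \<noteq> x2"
    using card_ge_2E[of "U - {r}"] by blast
  have inj: "inj_on (\<lambda>y. g x y) U" if "x \<in> U" "x \<noteq> r" for x
    using un_inj[OF un_of_bin'[OF g that(1)] cd] gc gd that by auto
  have same: "g x1 y = g x2 y" if "y \<in> U" "y \<noteq> c" for y
  proof (cases "inj_on (\<lambda>x. g x y) U")
    case True
    then have "g x1 y = x1" using idem[OF x(1) that(1)] x that bin_closed[OF g] by (auto dest: inj_onD)
    then show ?thesis using inj_onD[OF inj[OF x(1,3)], of y c] gc[OF x(1)] that cd by auto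
  next
    case False
    then show ?thesis using un_const_on[OF un_of_bin[OF g that(1)]] x by blast
  qed
  have "(\<lambda>y. g x1 y) ` U = U"
    using inj[OF x(1,3)] bin_closed[OF g x(1)] fin by (intro endo_inj_surj) auto
  then obtain y where y: "y \<in> U" "g x1 y = x2" using x by (metis imageE)
  then have "y \<noteq> c" using gc x by auto
  then have "g x2 y = g x2 c" using same y gc x by simp
  then show False using inj_onD[OF inj[OF x(2,4)]] y cd \<open>y \<noteq> c\<close> by blast
qed

lemma twin_nary:
  assumes tw: twin and p: "P n p" and i: "i < n" and xs: "xs \<in> tuples U n" and ys: "ys \<in> tuples U n"
    and inj: "inj_on (\<lambda>a. p (xs[i := a])) U"
  shows "inj_on (\<lambda>a. p (ys[i := a])) U"
proof -
  have len: "length xs = n" "length ys = n" using xs ys by (auto simp: tuples_length)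
  have "k \<le> n \<Longrightarrow> inj_on (\<lambda>a. p ((take k ys @ drop k xs)[i := a])) U" for k
  proof (induction k)
    case 0 then show ?case using inj by simp
  next
    case (Suc k)
    let ?zs = "take k ys @ drop k xs"
    have zs: "?zs \<in> tuples U n" by (rule take_drop_tuples[OF xs ys])
    have step: "take (Suc k) ys @ drop (Suc k) xs = ?zs[k := ys ! k]"
      using take_drop_step[of k xs ys] Suc.prems len by simp
    have IH: "inj_on (\<lambda>a. p (?zs[i := a])) U" using Suc by simp
    show ?case
    proof (cases "k = i")
      case True then show ?thesis using IH step by simp
    next
      case False
      have k: "k < n" using Suc by simp
      have "bin (\<lambda>x y. p (?zs[i := x, k := y]))" using P_update2[OF p zs i k] False by blast
      moreover have "?zs[i := x, k := ?zs ! k] = ?zs[i := x]" for x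
        using False by (metis list_update_id list_update_swap)
      then have "inj_on (\<lambda>x. p (?zs[i := x, k := ?zs ! k])) U" using IH by simp
      ultimately have "inj_on (\<lambda>x. p (?zs[i := x, k := ys ! k])) U"
        using tw tuples_nth[OF zs k] tuples_nth[OF ys k] unfolding twin_def by blast
      then show ?thesis unfolding step using False by (simp add: list_update_swap)
    qed
  qed
  from this[of n] show ?thesis using len by simp
qed

lemma twin_cases:
  assumes tw: twin and p: "P n p" and i: "i < n"
  shows "(\<forall>xs\<in>tuples U n. inj_on (\<lambda>a. p (xs[i := a])) U) \<or>
    (\<forall>xs\<in>tuples U n. \<forall>a\<in>U. p (xs[i := a]) = p xs)"
proof (rule disjCI)
  assume "\<not> (\<forall>xs\<in>tuples U n. \<forall>a\<in>U. p (xs[i := a]) = p xs)"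
  then obtain xs a where *: "xs \<in> tuples U n" "a \<in> U" "p (xs[i := a]) \<noteq> p (xs[i := xs ! i])" by auto
  then have "inj_on (\<lambda>a. p (xs[i := a])) U"
    using un_inj[OF P_update[OF p *(1) i], of a "xs ! i"] i by (auto simp: tuples_nth)
  then show "\<forall>xs\<in>tuples U n. inj_on (\<lambda>a. p (xs[i := a])) U"
    using twin_nary[OF tw p i *(1)] by blast
qed

lemma not_twin_two_dep: assumes "\<not> twin" shows two_dep
proof -
  obtain f c d where f: "bin f" "c \<in> U" "d \<in> U" "inj_on (\<lambda>x. f x c) U" "\<not> inj_on (\<lambda>x. f x d) U"
    using assms unfolding twin_def by blast
  obtain g r where g: "bin g" "r \<in> U" "\<And>x. x \<in> U \<Longrightarrow> g x c = x" "\<And>x. x \<in> U \<Longrightarrow> g x d = r"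
    using non_twin_retraction[OF f] by metis
  obtain x where x: "x \<in> U" "x \<noteq> r" using two_elements by metis
  have "g x c \<noteq> g r c" "g x c \<noteq> g x d" using g x by auto
  then show ?thesis unfolding two_dep_def using g(1,2) x f(2,3) by blast
qed

lemma essentially_unary:
  assumes nd: "\<not> two_dep" and p: "P n p"
  shows "(\<exists>c\<in>U. \<forall>xs\<in>tuples U n. p xs = c) \<or>
    (\<exists>i<n. \<exists>u. un u \<and> inj_on u U \<and> (\<forall>xs\<in>tuples U n. p xs = u (xs ! i)))"
proof -
  have tw: twin using nd not_twin_two_dep by blast
  obtain o' where o: "o' \<in> U" using two_elements by blast
  let ?z = "replicate n o'"
  have z: "?z \<in> tuples U n" using o by (auto simp: tuples_def)
  show ?thesis
  proof (cases "\<exists>i<n. \<not> (\<forall>xs\<in>tuples U n. \<forall>a\<in>U. p (xs[i := a]) = p xs)")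
    case False
    then have ind: "p (xs[i := a]) = p xs" if "i < n" "xs \<in> tuples U n" "a \<in> U" for i xs a
      using that by blast
    have "p xs = p ?z" if "xs \<in> tuples U n" for xs
      by (rule indep_agree[of n "{}" p]) (use that z ind in auto)
    then show ?thesis using P_closed[OF p z] by metis
  next
    case True
    then obtain i where i: "i < n" "\<forall>xs\<in>tuples U n. inj_on (\<lambda>a. p (xs[i := a])) U"
      using twin_cases[OF tw p] by blast
    have ind: "p (xs[j := a]) = p xs" if "j < n" "j \<noteq> i" "xs \<in> tuples U n" "a \<in> U" for j xs a
    proof (rule ccontr)
      assume "p (xs[j := a]) \<noteq> p xs"
      then have inj: "\<forall>xs\<in>tuples U n. inj_on (\<lambda>a. p (xs[j := a])) U"
        using twin_cases[OF tw p that(1)] that by blast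
      obtain a b where ab: "a \<in> U" "b \<in> U" "a \<noteq> b" using two_elements by blast
      let ?f = "\<lambda>x y. p (?z[i := x, j := y])"
      have "bin ?f" using P_update2[OF p z i(1) that(1)] that by blast
      moreover have "?f a a \<noteq> ?f b a"
        using inj_onD[OF i(2)[rule_format, OF tuples_update[OF z ab(1)], of j], of a b] ab that
        by (auto simp: list_update_swap)
      moreover have "?f a a \<noteq> ?f a b"
        using inj_onD[OF inj[rule_format, OF tuples_update[OF z ab(1)], of i], of a b] ab by auto
      ultimately show False using nd ab unfolding two_dep_def by blast
    qed
    have "p xs = p (?z[i := xs ! i])" if "xs \<in> tuples U n" for xs
      by (rule indep_agree[of n "{i}" p]) (use ind i that z in \<open>auto intro: tuples_update tuples_nth\<close>)
    moreover have "un (\<lambda>x. p (?z[i := x]))" by (rule P_update[OF p z i(1)])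
    ultimately show ?thesis using i z by blast
  qed
qed

lemma kind_1_exists:
  assumes nd: "\<not> two_dep"
  shows "\<exists>B :: ('a \<Rightarrow> 'a, 'a) ualg. is_ualg B \<and> unary_permutational B \<and> univ B = U \<and>
    (\<forall>n p. is_pol B n p \<longleftrightarrow> P n p)"
proof -
  define B :: "('a \<Rightarrow> 'a, 'a) ualg" where
    "B = \<lparr>symbs = {u. un u \<and> inj_on u U}, ar = \<lambda>_. 1, univ = U, opn = \<lambda>u xs. u (xs ! 0)\<rparr>"
  have B: "is_ualg B" "univ B = U"
    using two_elements by (auto simp: is_ualg_def B_def tuples_nth un_closed)
  have perm: "unary_permutational B"
    unfolding unary_permutational_def
  proof
    fix u assume u: "u \<in> symbs B"
    then have "bij_betw u U U"
      using endo_inj_surj[OF fin, of u] un_closed by (auto simp: B_def bij_betw_def)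
    then show "ar B u = 1 \<and> bij_betw (\<lambda>x. opn B u [x]) (univ B) (univ B)" by (simp add: B_def)
  qed
  have fB: "finite (univ B)" using B fin by simp
  interpret B: clone U "is_pol B" using clone_is_pol[OF B(1) fB] B by simp
  have "P n p" if "is_pol B n p" for n p
    using B(2) that by (rule is_pol_imp_P) (auto simp: B_def un_def)
  moreover have "is_pol B n p" if "P n p" for n p
    using essentially_unary[OF nd that]
  proof (elim disjE bexE exE conjE)
    fix c assume "c \<in> U" "\<forall>xs\<in>tuples U n. p xs = c"
    then show "is_pol B n p" by (intro B.P_cong[OF B.P_const[of c]]) auto
  next
    fix i u assume *: "i < n" "un u" "inj_on u U" "\<forall>xs\<in>tuples U n. p xs = u (xs ! i)"
    have "u \<in> symbs B" using * by (simp add: B_def)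
    from is_pol_app[OF fB this, of "[\<lambda>xs. xs ! i]" n] have "is_pol B n (\<lambda>xs. u (xs ! i))"
      using *(1) is_pol_proj by (auto simp: B_def)
    then show "is_pol B n p" by (rule B.P_cong) (use * in auto)
  qed
  ultimately show ?thesis using B perm by blast
qed

end

section \<open>Wedderburn's little theorem\<close>

definition primitive_roots :: "nat \<Rightarrow> complex set" where
  "primitive_roots n = {z. z ^ n = 1 \<and> (\<forall>d. 0 < d \<and> d < n \<longrightarrow> z ^ d \<noteq> 1)}"

definition cyclotomic :: "nat \<Rightarrow> complex poly" where
  "cyclotomic n = (\<Prod>z\<in>primitive_roots n. [:-z, 1:])"

lemma finite_primitive_roots: "n > 0 \<Longrightarrow> finite (primitive_roots n)"
  unfolding primitive_roots_def by (rule finite_subset[OF _ finite_roots_unity[of n]]) auto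

lemma lead_coeff_prod_linear: "lead_coeff (\<Prod>z\<in>S. [:-z, 1:]) = (1::complex)"
  unfolding lead_coeff_prod by simp

lemma degree_prod_linear: "finite S \<Longrightarrow> degree (\<Prod>z\<in>S. [:-z, 1::complex:]) = card S"
  by (subst degree_prod_eq_sum_degree) auto

lemma prod_roots_unity:
  assumes "n > 0" shows "(\<Prod>z | z ^ n = 1. [:-z, 1:]) = monom 1 n - (1 :: complex poly)"
proof (rule poly_eqI_degree_lead_coeff[where n = n and A = "{z. z ^ n = 1}"])
  have fin: "finite {z::complex. z ^ n = 1}" using assms by (intro finite_roots_unity) simp
  note deg = degree_prod_linear[OF fin]
  have card: "card {z::complex. z ^ n = 1} = n" using assms by (rule card_roots_unity_eq)
  show "coeff (\<Prod>z | z ^ n = 1. [:-z, 1:]) n = coeff (monom 1 n - (1 :: complex poly)) n"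
    using lead_coeff_prod_linear[of "{z. z ^ n = 1}"] deg card assms by (simp add: coeff_1)
  show "degree (\<Prod>z | z ^ n = 1. [:-z, 1::complex:]) \<le> n" using deg card by simp
  show "degree (monom 1 n - (1 :: complex poly)) \<le> n"
    by (rule degree_diff_le) (auto simp: degree_monom_eq)
  show "n \<le> card {z::complex. z ^ n = 1}" using card by simp
  fix z :: complex assume "z \<in> {z. z ^ n = 1}"
  then show "poly (\<Prod>z | z ^ n = 1. [:-z, 1:]) z = poly (monom 1 n - 1) z"
    using fin by (simp add: poly_prod poly_monom prod_zero_iff)
qed

lemma roots_unity_partition:
  assumes "n > 0" shows "{z::complex. z ^ n = 1} = (\<Union>d\<in>{d. d dvd n}. primitive_roots d)"
proof (rule Set.set_eqI, rule iffI)
  fix z :: complex assume "z \<in> {z. z ^ n = 1}"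
  then have z: "z ^ n = 1" by simp
  define d where "d = (LEAST d. 0 < d \<and> z ^ d = 1)"
  have d: "0 < d" "z ^ d = 1"
    using LeastI[of "\<lambda>d. 0 < d \<and> z ^ d = 1" n] z assms by (auto simp: d_def)
  have least: "z ^ e \<noteq> 1" if "0 < e" "e < d" for e
    using not_less_Least[of e "\<lambda>d. 0 < d \<and> z ^ d = 1"] that by (auto simp: d_def)
  have "z ^ n = (z ^ d) ^ (n div d) * z ^ (n mod d)"
    by (simp flip: power_mult power_add)
  then have "z ^ (n mod d) = 1" using z d by simp
  then have "n mod d = 0" using least[of "n mod d"] d by (cases "n mod d = 0") auto
  then have "d dvd n" by auto
  moreover have "z \<in> primitive_roots d" using d least by (auto simp: primitive_roots_def)
  ultimately show "z \<in> (\<Union>d\<in>{d. d dvd n}. primitive_roots d)" by auto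
qed (auto simp: primitive_roots_def power_mult)

lemma primitive_roots_disjoint:
  assumes "d > 0" "e > 0" "d \<noteq> e" shows "primitive_roots d \<inter> primitive_roots e = {}"
  using assms by (auto simp: primitive_roots_def) (metis nat_neq_iff)

lemma prod_cyclotomic:
  assumes "n > 0" shows "(\<Prod>d | d dvd n. cyclotomic d) = monom 1 n - 1"
proof -
  have "(\<Prod>z | z ^ n = 1. [:-z, 1::complex:]) = (\<Prod>d | d dvd n. cyclotomic d)"
    unfolding roots_unity_partition[OF assms] cyclotomic_def
  proof (rule prod.UNION_disjoint)
    show "\<forall>i\<in>{d. d dvd n}. finite (primitive_roots i)"
      using assms dvd_pos_nat finite_primitive_roots by blast
    show "\<forall>i\<in>{d. d dvd n}. \<forall>j\<in>{d. d dvd n}. i \<noteq> j \<longrightarrow> primitive_roots i \<inter> primitive_roots j = {}"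
    proof (intro ballI impI)
      fix i j assume "i \<in> {d. d dvd n}" "j \<in> {d. d dvd n}" "i \<noteq> j"
      then show "primitive_roots i \<inter> primitive_roots j = {}"
        using assms by (intro primitive_roots_disjoint) (auto intro: dvd_pos_nat)
    qed
  qed (use assms in auto)
  then show ?thesis using prod_roots_unity[OF assms] by simp
qed

lemma Ints_coeff_mult:
  fixes f g :: "complex poly"
  assumes "\<And>i. coeff f i \<in> \<int>" "\<And>i. coeff g i \<in> \<int>" shows "coeff (f * g) i \<in> \<int>"
  unfolding coeff_mult by (intro Ints_sum Ints_mult assms)

lemma Ints_coeff_prod:
  fixes f :: "'b \<Rightarrow> complex poly"
  assumes "\<And>j. j \<in> S \<Longrightarrow> \<forall>i. coeff (f j) i \<in> \<int>" shows "\<forall>i. coeff (\<Prod>j\<in>S. f j) i \<in> \<int>"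
  using assms
  by (induction S rule: infinite_finite_induct) (auto simp: coeff_1 intro!: Ints_coeff_mult)

lemma Ints_coeff_monic_quotient:
  fixes g h :: "complex poly"
  assumes g: "lead_coeff g = 1" "\<And>i. coeff g i \<in> \<int>" and f: "\<And>i. coeff (g * h) i \<in> \<int>"
  shows "coeff h i \<in> \<int>"
proof (induction "Suc (degree h) - i" arbitrary: i rule: less_induct)
  case less
  show ?case
  proof (cases "i > degree h")
    case True then show ?thesis by (simp add: coeff_eq_0)
  next
    case False
    let ?m = "degree g"
    have "coeff (g * h) (?m + i) = (\<Sum>j\<le>?m + i. coeff g j * coeff h (?m + i - j))"
      by (simp add: coeff_mult)
    also have "\<dots> = (\<Sum>j\<le>?m. coeff g j * coeff h (?m + i - j))"
      by (rule sum.mono_neutral_right) (auto simp: coeff_eq_0)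
    also have "\<dots> = (\<Sum>j<?m. coeff g j * coeff h (?m + i - j)) + coeff h i"
      using g by (simp add: lessThan_Suc_atMost[symmetric])
    finally have "coeff h i = coeff (g * h) (?m + i) - (\<Sum>j<?m. coeff g j * coeff h (?m + i - j))"
      by simp
    also have "\<dots> \<in> \<int>"
      by (intro Ints_diff f Ints_sum Ints_mult g less) (use False in auto)
    finally show ?thesis .
  qed
qed

lemma cyclotomic_Ints: "n > 0 \<Longrightarrow> coeff (cyclotomic n) i \<in> \<int>"
proof (induction n arbitrary: i rule: less_induct)
  case (less n)
  let ?g = "\<Prod>d | d dvd n \<and> d < n. cyclotomic d"
  have "{d. d dvd n} = insert n {d. d dvd n \<and> d < n}"
    using less.prems by (auto dest: dvd_imp_le)
  then have "?g * cyclotomic n = monom 1 n - 1"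
    using prod_cyclotomic[OF less.prems] less.prems by (simp add: mult.commute)
  then have "coeff (?g * cyclotomic n) j \<in> \<int>" for j by (simp add: coeff_1)
  moreover have "coeff ?g j \<in> \<int>" for j
  proof -
    have "\<forall>j. coeff ?g j \<in> \<int>"
      using less by (intro Ints_coeff_prod) (auto intro: dvd_pos_nat)
    then show ?thesis by blast
  qed
  moreover have "lead_coeff ?g = 1"
    unfolding lead_coeff_prod
  proof (rule prod.neutral, safe)
    fix d assume "d dvd n" then have "d > 0" using less.prems by (rule dvd_pos_nat[rotated])
    then show "lead_coeff (cyclotomic d) = 1"
      unfolding cyclotomic_def by (intro lead_coeff_prod_linear)
  qed
  ultimately show ?case using Ints_coeff_monic_quotient[of ?g "cyclotomic n" i] by blast
qed

lemma poly_Ints: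
  fixes p :: "complex poly" assumes "\<And>i. coeff p i \<in> \<int>" "x \<in> \<int>" shows "poly p x \<in> \<int>"
  unfolding poly_altdef by (intro Ints_sum Ints_mult Ints_power assms)

lemma primitive_roots_nonempty: assumes "n > 0" shows "primitive_roots n \<noteq> {}"
proof (cases "n = 1")
  case True then show ?thesis by (auto simp: primitive_roots_def)
next
  case False
  let ?z = "cis (2 * pi * real 1 / real n)"
  have inj: "inj_on (\<lambda>k. cis (2 * pi * real k / real n)) {..<n}"
    using bij_betw_roots_unity[OF assms] by (rule bij_betw_imp_inj_on)
  have pow: "?z ^ d = cis (2 * pi * real d / real n)" for d
    by (simp add: DeMoivre mult_ac)
  have "?z ^ d \<noteq> 1" if "0 < d" "d < n" for d
    using inj_onD[OF inj, of d 0] that pow[of d] by auto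
  moreover have "?z ^ n = 1" using assms pow[of n] by simp
  ultimately show ?thesis unfolding primitive_roots_def by blast
qed

lemma cyclotomic_large:
  assumes "n \<ge> 2" "q \<ge> 2" shows "cmod (poly (cyclotomic n) (of_nat q)) > real q - 1"
proof -
  have n: "n > 0" using assms by simp
  have z: "cmod (of_nat q - z) > real q - 1" if "z \<in> primitive_roots n" for z
  proof -
    have "z ^ n = 1" "z \<noteq> 1" using that assms by (auto simp: primitive_roots_def dest: spec[of _ 1])
    then have nz: "cmod z = 1" using n by (metis norm_one norm_power power_eq_1_iff norm_ge_zero less_numeral_extra(3))
    then have "Re z < 1"
      using \<open>z \<noteq> 1\<close> complex_Re_le_cmod[of z] by (metis cmod_eq_Re complex.expand complex_Re_le_cmod order_less_le one_complex.sel cmod_power2 norm_one abs_Re_le_cmod add_cancel_left_right power_one power2_eq_square zero_eq_power2)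
    then have "Re (of_nat q - z) > real q - 1" by simp
    then show ?thesis using complex_Re_le_cmod[of "of_nat q - z"] by linarith
  qed
  obtain z0 where z0: "z0 \<in> primitive_roots n" using primitive_roots_nonempty[OF n] by blast
  have fin: "finite (primitive_roots n)" using n by (rule finite_primitive_roots)
  have "cmod (poly (cyclotomic n) (of_nat q)) = (\<Prod>z\<in>primitive_roots n. cmod (of_nat q - z))"
    by (simp add: cyclotomic_def poly_prod prod_norm[symmetric])
  also have "\<dots> = cmod (of_nat q - z0) * (\<Prod>z\<in>primitive_roots n - {z0}. cmod (of_nat q - z))"
    using fin z0 by (rule prod.remove)
  finally have eq: "cmod (poly (cyclotomic n) (of_nat q)) =
    cmod (of_nat q - z0) * (\<Prod>z\<in>primitive_roots n - {z0}. cmod (of_nat q - z))" .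
  have "1 \<le> (\<Prod>z\<in>primitive_roots n - {z0}. cmod (of_nat q - z))"
  proof (rule prod_ge_1)
    fix z assume "z \<in> primitive_roots n - {z0}"
    then show "1 \<le> cmod (of_nat q - z)" using z[of z] assms by auto
  qed
  then have "cmod (of_nat q - z0) * 1 \<le>
    cmod (of_nat q - z0) * (\<Prod>z\<in>primitive_roots n - {z0}. cmod (of_nat q - z))"
    by (intro mult_left_mono) auto
  then show ?thesis using z[OF z0] eq by simp
qed

lemma cyclotomic_divisor:
  assumes "n \<ge> 2" "q \<ge> 2"
  obtains c :: int where "\<bar>c\<bar> > int q - 1"
    "\<And>d. d dvd n \<Longrightarrow> d < n \<Longrightarrow> (int q ^ d - 1) * c dvd int q ^ n - 1"
proof -
  have n: "n > 0" using assms by simp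
  have int: "poly (cyclotomic e) (of_nat q) \<in> \<int>" if "e > 0" for e
    by (rule poly_Ints) (use cyclotomic_Ints that in auto)
  obtain c where c: "poly (cyclotomic n) (of_nat q) = of_int c"
    using int[OF n] by (auto elim: Ints_cases)
  have "real_of_int \<bar>c\<bar> > real q - 1"
    using cyclotomic_large[OF assms] by (simp add: c)
  then have "\<bar>c\<bar> > int q - 1" by linarith
  moreover have "(int q ^ d - 1) * c dvd int q ^ n - 1" if d: "d dvd n" "d < n" for d
  proof -
    have "d > 0" using d n by (auto intro: dvd_pos_nat)
    have fin: "finite {e. e dvd n}" using n by simp
    let ?r = "\<Prod>e | e dvd n \<and> \<not> e dvd d \<and> e \<noteq> n. poly (cyclotomic e) (of_nat q)"
    have "?r \<in> \<int>" by (intro Ints_prod int) (use n in \<open>auto intro: dvd_pos_nat\<close>)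
    then obtain k where k: "?r = of_int k" by (auto elim: Ints_cases)
    have val: "(\<Prod>e | e dvd m. poly (cyclotomic e) (of_nat q)) = of_nat q ^ m - 1" if "m > 0" for m
    proof -
      have "(\<Prod>e | e dvd m. poly (cyclotomic e) (of_nat q)) = poly (\<Prod>e | e dvd m. cyclotomic e) (of_nat q)"
        by (simp add: poly_prod)
      then show ?thesis using prod_cyclotomic[OF that] by (simp add: poly_monom)
    qed
    have split: "{e. e dvd n} = {e. e dvd d} \<union> insert n {e. e dvd n \<and> \<not> e dvd d \<and> e \<noteq> n}"
      using d by auto
    have nd: "\<not> n dvd d" using d \<open>d > 0\<close> by (auto dest: dvd_imp_le)
    have "of_nat q ^ n - 1 = (\<Prod>e | e dvd n. poly (cyclotomic e) (of_nat q))"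
      using val[OF n] by simp
    also have "\<dots> = (\<Prod>e | e dvd d. poly (cyclotomic e) (of_nat q)) *
       (\<Prod>e\<in>insert n {e. e dvd n \<and> \<not> e dvd d \<and> e \<noteq> n}. poly (cyclotomic e) (of_nat q))"
      unfolding split by (rule prod.union_disjoint) (use fin \<open>d > 0\<close> nd in auto)
    also have "\<dots> = (of_nat q ^ d - 1) * (of_int c * of_int k)"
      using val[OF \<open>d > 0\<close>] fin by (simp add: c k)
    finally have "of_int (int q ^ n - 1) = (of_int ((int q ^ d - 1) * c * k) :: complex)"
      by simp
    then have "int q ^ n - 1 = (int q ^ d - 1) * c * k" by (simp only: of_int_eq_iff)
    then show ?thesis by simp
  qed
  ultimately show ?thesis using that by blast
qed

locale finite_division_ring = ring +
  assumes fin: "finite (carrier R)" and units: "Units R = carrier R - {\<zero>}"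
begin

lemma one_neq_zero: "\<one> \<noteq> \<zero>"
  using Units_one_closed units by auto

lemma inv_closed [simp]: "a \<in> carrier R \<Longrightarrow> a \<noteq> \<zero> \<Longrightarrow> inv a \<in> carrier R"
  using units by (simp add: Units_inv_closed)

lemma inv_left [simp]: "a \<in> carrier R \<Longrightarrow> a \<noteq> \<zero> \<Longrightarrow> inv a \<otimes> a = \<one>"
  using units by (simp add: Units_l_inv)

lemma inv_right [simp]: "a \<in> carrier R \<Longrightarrow> a \<noteq> \<zero> \<Longrightarrow> a \<otimes> inv a = \<one>"
  using units by (simp add: Units_r_inv)

definition subdivision :: "'a set \<Rightarrow> bool" where
  "subdivision K \<longleftrightarrow> K \<subseteq> carrier R \<and> \<one> \<in> K \<and> (\<forall>a\<in>K. \<forall>b\<in>K. a \<ominus> b \<in> K \<and> a \<otimes> b \<in> K) \<and>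
     (\<forall>a\<in>K. a \<noteq> \<zero> \<longrightarrow> inv a \<in> K)"

definition subspace :: "'a set \<Rightarrow> 'a set \<Rightarrow> bool" where
  "subspace K V \<longleftrightarrow> V \<subseteq> carrier R \<and> \<zero> \<in> V \<and> (\<forall>v\<in>V. \<forall>w\<in>V. v \<ominus> w \<in> V) \<and>
     (\<forall>a\<in>K. \<forall>v\<in>V. a \<otimes> v \<in> V)"

lemma subspace_add: "subspace K V \<Longrightarrow> v \<in> V \<Longrightarrow> w \<in> V \<Longrightarrow> v \<oplus> w \<in> V"
proof -
  assume *: "subspace K V" "v \<in> V" "w \<in> V"
  then have "\<zero> \<ominus> w \<in> V" "v \<in> carrier R" "w \<in> carrier R" by (auto simp: subspace_def)
  with * have "v \<ominus> (\<zero> \<ominus> w) \<in> V" by (auto simp: subspace_def)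
  moreover have "v \<ominus> (\<zero> \<ominus> w) = v \<oplus> w"
    using \<open>v \<in> carrier R\<close> \<open>w \<in> carrier R\<close> by (simp add: minus_eq)
  ultimately show ?thesis by simp
qed

lemma subspace_extend:
  assumes K: "subdivision K" and W: "subspace K W" and v: "v \<in> carrier R" "v \<notin> W"
  defines "W' \<equiv> (\<lambda>(w, a). w \<oplus> a \<otimes> v) ` (W \<times> K)"
  shows "subspace K W'" "card W' = card W * card K" "W \<subset> W'"
proof -
  have Wc: "\<And>w. w \<in> W \<Longrightarrow> w \<in> carrier R" and Kc: "\<And>a. a \<in> K \<Longrightarrow> a \<in> carrier R"
    using K W by (auto simp: subdivision_def subspace_def)
  have K0: "\<zero> \<in> K"
  proof -
    have "\<one> \<ominus> \<one> \<in> K" using K by (auto simp: subdivision_def)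
    then show ?thesis by (simp add: minus_eq r_neg)
  qed
  show "subspace K W'" unfolding subspace_def
  proof (intro conjI ballI)
    show "W' \<subseteq> carrier R" using Wc Kc v by (auto simp: W'_def)
    show "\<zero> \<in> W'"
      using W K0 v unfolding W'_def by (intro image_eqI[of _ _ "(\<zero>, \<zero>)"]) (auto simp: subspace_def)
  next
    fix x y assume "x \<in> W'" "y \<in> W'"
    then obtain w a w' a' where *: "w \<in> W" "a \<in> K" "w' \<in> W" "a' \<in> K"
      and x: "x = w \<oplus> a \<otimes> v" and y: "y = w' \<oplus> a' \<otimes> v" by (auto simp: W'_def)
    note c = Wc[OF *(1)] Kc[OF *(2)] Wc[OF *(3)] Kc[OF *(4)] v(1)
    have "x \<ominus> y = (w \<ominus> w') \<oplus> (a \<ominus> a') \<otimes> v"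
      unfolding x y minus_eq using c by (simp add: l_distr l_minus minus_add a_ac)
    then show "x \<ominus> y \<in> W'"
      using * K W unfolding W'_def subdivision_def subspace_def
      by (intro image_eqI[of _ _ "(w \<ominus> w', a \<ominus> a')"]) auto
  next
    fix b x assume b: "b \<in> K" and "x \<in> W'"
    then obtain w a where *: "w \<in> W" "a \<in> K" and x: "x = w \<oplus> a \<otimes> v" by (auto simp: W'_def)
    have "b \<otimes> x = b \<otimes> w \<oplus> (b \<otimes> a) \<otimes> v"
      unfolding x using Wc[OF *(1)] Kc[OF *(2)] Kc[OF b] v(1) by (simp add: r_distr m_assoc)
    then show "b \<otimes> x \<in> W'"
      using * b K W unfolding W'_def subdivision_def subspace_def
      by (intro image_eqI[of _ _ "(b \<otimes> w, b \<otimes> a)"]) auto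
  qed
  have "inj_on (\<lambda>(w, a). w \<oplus> a \<otimes> v) (W \<times> K)"
  proof (rule inj_onI, clarify)
    fix w a w' a' assume *: "w \<in> W" "a \<in> K" "w' \<in> W" "a' \<in> K"
      and eq: "w \<oplus> a \<otimes> v = w' \<oplus> a' \<otimes> v"
    note c = Wc[OF *(1)] Kc[OF *(2)] Wc[OF *(3)] Kc[OF *(4)] v(1)
    have "(a \<ominus> a') \<otimes> v = (w \<oplus> a \<otimes> v) \<ominus> w \<ominus> a' \<otimes> v"
      unfolding minus_eq using c by (simp add: l_distr l_minus a_ac r_neg1 r_neg2)
    also have "\<dots> = w' \<ominus> w"
      unfolding eq minus_eq using c by (simp add: a_ac r_neg r_neg1 r_neg2)
    finally have d: "(a \<ominus> a') \<otimes> v = w' \<ominus> w" .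
    have "a = a'"
    proof (rule ccontr)
      assume "a \<noteq> a'"
      then have nz: "a \<ominus> a' \<noteq> \<zero>" using c by (metis a_minus_def add.inv_closed minus_equality r_neg)
      have ac: "a \<ominus> a' \<in> K" "a \<ominus> a' \<in> carrier R" using * K c by (auto simp: subdivision_def)
      have "v = inv (a \<ominus> a') \<otimes> ((a \<ominus> a') \<otimes> v)"
        using nz ac c by (simp add: m_assoc[symmetric])
      also have "\<dots> = inv (a \<ominus> a') \<otimes> (w' \<ominus> w)" using d by simp
      also have "\<dots> \<in> W" using * K W nz ac unfolding subdivision_def subspace_def by blast
      finally show False using v by simp
    qed
    then show "w = w' \<and> a = a'" using eq c by simp
  qed
  then show "card W' = card W * card K" unfolding W'_def by (simp add: card_image card_cartesian_product)
  have "W \<subseteq> W'"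
  proof
    fix w assume "w \<in> W"
    then show "w \<in> W'" using K0 Wc v unfolding W'_def by (intro image_eqI[of _ _ "(w, \<zero>)"]) auto
  qed
  moreover have "v \<in> W'"
    using K W v unfolding W'_def subdivision_def subspace_def
    by (intro image_eqI[of _ _ "(\<zero>, \<one>)"]) auto
  ultimately show "W \<subset> W'" using v by blast
qed

lemma card_subspace:
  assumes K: "subdivision K" and V: "subspace K V" shows "\<exists>k. card V = card K ^ k"
proof -
  have finV: "finite V" using V fin finite_subset by (auto simp: subspace_def)
  have "\<exists>k. card V = card K ^ k" if "subspace K W" "W \<subseteq> V" "card W = card K ^ j" for W j
    using that
  proof (induction "card V - card W" arbitrary: W j rule: less_induct)
    case less
    show ?case
    proof (cases "W = V")
      case True then show ?thesis using less by auto
    next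
      case False
      then obtain v where v: "v \<in> V" "v \<notin> W" using less by auto
      have vc: "v \<in> carrier R" using v V by (auto simp: subspace_def)
      let ?W = "(\<lambda>(w, a). w \<oplus> a \<otimes> v) ` (W \<times> K)"
      note ext = subspace_extend[OF K less.prems(1) vc v(2)]
      have "?W \<subseteq> V"
      proof
        fix x assume "x \<in> ?W"
        then obtain w a where *: "w \<in> W" "a \<in> K" and x: "x = w \<oplus> a \<otimes> v" by auto
        have "w \<in> V" "a \<otimes> v \<in> V" using * less.prems v V by (auto simp: subspace_def)
        then show "x \<in> V" unfolding x by (rule subspace_add[OF V])
      qed
      moreover have "card W < card ?W" using ext(3) finV \<open>?W \<subseteq> V\<close> by (meson finite_subset psubset_card_mono)
      moreover have "card ?W \<le> card V" using finV \<open>?W \<subseteq> V\<close> by (rule card_mono)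
      moreover have "card ?W = card K ^ Suc j" using ext(2) less.prems by simp
      ultimately show ?thesis using less.hyps[OF _ ext(1)] by (meson diff_less_mono2 less_le_trans)
    qed
  qed
  moreover have "subspace K {\<zero>}" using K by (auto simp: subspace_def subdivision_def minus_eq)
  moreover have "{\<zero>} \<subseteq> V" using V by (simp add: subspace_def)
  moreover have "card {\<zero>} = card K ^ 0" by simp
  ultimately show ?thesis by blast
qed

definition centralizer :: "'a \<Rightarrow> 'a set" where
  "centralizer a = {x \<in> carrier R. x \<otimes> a = a \<otimes> x}"

definition center :: "'a set" where
  "center = {x \<in> carrier R. \<forall>y\<in>carrier R. x \<otimes> y = y \<otimes> x}"

lemma inv_commute:
  assumes "x \<in> carrier R" "a \<in> carrier R" "x \<noteq> \<zero>" "x \<otimes> a = a \<otimes> x"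
  shows "inv x \<otimes> a = a \<otimes> inv x"
proof -
  have "inv x \<otimes> a = inv x \<otimes> (a \<otimes> x) \<otimes> inv x" using assms by (simp add: m_assoc)
  also have "\<dots> = inv x \<otimes> (x \<otimes> a) \<otimes> inv x" using assms by simp
  also have "\<dots> = (inv x \<otimes> x) \<otimes> a \<otimes> inv x"
    using assms(1-3) by (simp add: m_assoc del: inv_left inv_right)
  also have "\<dots> = a \<otimes> inv x" using assms(1-3) by simp
  finally show ?thesis .
qed

lemma subdivision_centralizer: "a \<in> carrier R \<Longrightarrow> subdivision (centralizer a)"
  unfolding subdivision_def centralizer_def
  by (auto simp: minus_eq l_distr r_distr l_minus r_minus inv_commute)
    (metis m_assoc)

lemma center_eq: "center = carrier R \<inter> (\<Inter>a\<in>carrier R. centralizer a)"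
  by (auto simp: center_def centralizer_def)

lemma subdivision_center: "subdivision center"
  unfolding center_eq using subdivision_centralizer by (fastforce simp: subdivision_def)

lemma card_commutative_center: "center \<noteq> carrier R \<Longrightarrow> False"
proof -
  assume nc: "center \<noteq> carrier R"
  define q where "q = card center"
  have cen_sub: "center \<subseteq> carrier R" by (auto simp: center_def)
  have fcen: "finite center" using cen_sub fin finite_subset by blast
  have zo: "\<zero> \<in> center" "\<one> \<in> center" by (auto simp: center_def)
  have "{\<zero>, \<one>} \<subseteq> center" using zo by simp
  then have q2: "q \<ge> 2" using card_mono[OF fcen, of "{\<zero>, \<one>}"] one_neq_zero by (simp add: q_def)
  have "subspace center (carrier R)" using cen_sub by (auto simp: subspace_def)
  then obtain n where n: "card (carrier R) = q ^ n"
    using card_subspace[OF subdivision_center] by (auto simp: q_def)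
  have cent: "\<exists>d. card (centralizer a) = q ^ d \<and> d dvd n \<and> 0 < d \<and> d < n"
    if a: "a \<in> carrier R" "a \<notin> center" for a
  proof -
    have sub: "subdivision (centralizer a)" using a by (intro subdivision_centralizer)
    have csub: "centralizer a \<subseteq> carrier R" by (auto simp: centralizer_def)
    have zo: "\<zero> \<in> centralizer a" "\<one> \<in> centralizer a" using a by (auto simp: centralizer_def)
    have "subspace center (centralizer a)"
      using sub zo a unfolding subspace_def subdivision_def center_eq by blast
    then obtain d where d: "card (centralizer a) = q ^ d"
      using card_subspace[OF subdivision_center] by (auto simp: q_def)
    have "subspace (centralizer a) (carrier R)" using csub by (auto simp: subspace_def)
    then obtain k where "card (carrier R) = card (centralizer a) ^ k"
      using card_subspace[OF sub] by auto
    then have "q ^ n = q ^ (d * k)" using n d by (simp add: power_mult)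
    then have "n = d * k" using q2 by (simp add: power_inject_exp)
    moreover have "card (centralizer a) \<ge> 2"
      using card_mono[OF finite_subset[OF csub fin], of "{\<zero>, \<one>}"] zo one_neq_zero by auto
    then have "d > 0" using d by (cases d) auto
    moreover obtain y where "y \<in> carrier R" "a \<otimes> y \<noteq> y \<otimes> a" using a by (auto simp: center_def)
    then have "y \<in> carrier R" "y \<notin> centralizer a" by (auto simp: centralizer_def)
    then have "centralizer a \<noteq> carrier R" by blast
    then have "card (centralizer a) < card (carrier R)" using csub fin by (intro psubset_card_mono) auto
    then have "d < n" using d n q2 by (simp add: power_strict_increasing_iff)
    ultimately show ?thesis using d by auto
  qed
  obtain a0 where a0: "a0 \<in> carrier R" "a0 \<notin> center" using nc cen_sub by auto
  have n2: "n \<ge> 2" using cent[OF a0] by auto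
  obtain c :: int where c: "\<bar>c\<bar> > int q - 1"
    "\<And>d. d dvd n \<Longrightarrow> d < n \<Longrightarrow> (int q ^ d - 1) * c dvd int q ^ n - 1"
    using cyclotomic_divisor[OF n2 q2] by blast
  define m where "m = nat \<bar>c\<bar>"
  define \<phi> where "\<phi> = (\<lambda>g. \<lambda>h\<in>carrier (units_of R). g \<otimes>\<^bsub>units_of R\<^esub> h \<otimes>\<^bsub>units_of R\<^esub> inv\<^bsub>units_of R\<^esub> g)"
  interpret act: group_action "units_of R" "Units R" \<phi>
    using group.action_by_conjugation[OF units_group] by (simp add: \<phi>_def units_of_carrier)
  have \<phi>: "\<phi> g h = g \<otimes> h \<otimes> inv g" if "g \<in> Units R" "h \<in> Units R" for g h
    using that by (simp add: \<phi>_def units_of_carrier units_of_mult units_of_inv)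
  have conj_fix: "\<phi> g h = h \<longleftrightarrow> g \<otimes> h = h \<otimes> g" if "g \<in> Units R" "h \<in> Units R" for g h
  proof -
    have gh: "g \<in> carrier R" "h \<in> carrier R" "g \<noteq> \<zero>" using that units by auto
    have "g \<otimes> h \<otimes> inv g = h" if "g \<otimes> h = h \<otimes> g" using that gh by (simp add: m_assoc)
    moreover have "g \<otimes> h = h \<otimes> g" if "g \<otimes> h \<otimes> inv g = h"
    proof -
      have "g \<otimes> h = (g \<otimes> h \<otimes> inv g) \<otimes> g" using gh by (simp add: m_assoc)
      then show ?thesis using that by simp
    qed
    ultimately show ?thesis using \<phi> that by auto
  qed
  have card_units: "card (Units R) = q ^ n - 1" using units fin n by simp
  have orb: "m dvd card (orbit (units_of R) \<phi> a)" if a: "a \<in> Units R" "a \<notin> center" for a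
  proof -
    have ac: "a \<in> carrier R" using a units by auto
    obtain d where d: "card (centralizer a) = q ^ d" "d dvd n" "0 < d" "d < n"
      using cent[OF ac a(2)] by auto
    have "stabilizer (units_of R) \<phi> a = centralizer a - {\<zero>}"
      unfolding stabilizer_def units_of_carrier using conj_fix a units by (auto simp: centralizer_def)
    moreover have "\<zero> \<in> centralizer a" "finite (centralizer a)"
      using ac fin by (auto simp: centralizer_def)
    ultimately have "card (stabilizer (units_of R) \<phi> a) = q ^ d - 1" using d by simp
    then have "card (orbit (units_of R) \<phi> a) * (q ^ d - 1) = q ^ n - 1"
      using act.orbit_stabilizer_theorem[OF a(1)] card_units by (simp add: order_def units_of_carrier)
    then have "int (card (orbit (units_of R) \<phi> a) * (q ^ d - 1)) = int (q ^ n - 1)" by simp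
    then have "int (card (orbit (units_of R) \<phi> a)) * (int q ^ d - 1) = int q ^ n - 1"
      using q2 by (simp add: of_nat_diff)
    then have "(int q ^ d - 1) * c dvd (int q ^ d - 1) * int (card (orbit (units_of R) \<phi> a))"
      using c(2)[OF d(2,4)] by (simp add: mult.commute)
    moreover have "int q ^ d - 1 \<noteq> 0"
    proof -
      have "q ^ d > 1" using one_less_power[of q d] q2 d by simp
      then have "int (q ^ d) > 1" by linarith
      then show ?thesis by simp
    qed
    ultimately have "c dvd int (card (orbit (units_of R) \<phi> a))" by simp
    then show ?thesis by (simp add: m_def nat_abs_dvd_iff)
  qed
  let ?C = "{orbit (units_of R) \<phi> a | a. a \<in> Units R \<and> a \<notin> center}"
  have inv_center: "b \<notin> center" if "a \<in> Units R" "a \<notin> center" "b \<in> orbit (units_of R) \<phi> a" for a b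
  proof
    assume b: "b \<in> center"
    have bU: "b \<in> Units R" using act.element_image[OF _ that(1)] that(3) by (auto simp: orbit_def)
    have "a \<in> orbit (units_of R) \<phi> b" using act.orbit_sym[OF that(1) bU that(3)] .
    then obtain g where g: "g \<in> Units R" "a = \<phi> g b" by (auto simp: orbit_def units_of_carrier)
    have "\<phi> g b = b" using conj_fix[OF g(1) bU] b bU g units by (auto simp: center_def)
    then show False using g b that by simp
  qed
  have Un: "\<Union>?C = Units R - center"
  proof
    show "\<Union>?C \<subseteq> Units R - center"
      using inv_center act.element_image by (force simp: orbit_def)
    show "Units R - center \<subseteq> \<Union>?C" using act.orbit_refl by blast
  qed
  have finU: "finite (Units R)" using fin units by simp
  have "m dvd card (\<Union>?C)"
  proof (rule dvd_partition)
    show "finite (\<Union>?C)" using Un finU by simp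
    show "\<forall>c\<in>?C. m dvd card c" using orb by blast
    show "\<forall>c1\<in>?C. \<forall>c2\<in>?C. c1 \<noteq> c2 \<longrightarrow> c1 \<inter> c2 = {}"
    proof (intro ballI impI)
      fix c1 c2 assume *: "c1 \<in> ?C" "c2 \<in> ?C" "c1 \<noteq> c2"
      have "?C \<subseteq> orbits (units_of R) (Units R) \<phi>" by (auto simp: orbits_def)
      then show "c1 \<inter> c2 = {}" using act.disjoint_union[of c1 c2] * by blast
    qed
  qed
  moreover have "Units R - center = carrier R - center" using units zo by auto
  then have "card (\<Union>?C) = q ^ n - q"
    using Un card_Diff_subset[OF fcen cen_sub] n by (simp add: q_def)
  ultimately have "m dvd q ^ n - q" by simp
  moreover have "m dvd q ^ n - 1"
  proof -
    have "(int q ^ 1 - 1) * c dvd int q ^ n - 1" using c(2)[of 1] n2 by simp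
    then have "c dvd int q ^ n - 1" by (rule dvd_mult_right)
    moreover have "int (q ^ n - 1) = int q ^ n - 1" using q2 by (simp add: of_nat_diff)
    ultimately have "c dvd int (q ^ n - 1)" by simp
    then show ?thesis by (simp add: m_def nat_abs_dvd_iff)
  qed
  moreover have "q ^ n - 1 - (q ^ n - q) = q - 1"
    using q2 n2 self_le_power[of q n] by auto
  ultimately have "m dvd q - 1" using dvd_diff_nat[of m "q ^ n - 1" "q ^ n - q"] by simp
  moreover have "q - 1 > 0" "m > q - 1" using c(1) q2 by (auto simp: m_def)
  ultimately show False by (auto dest: dvd_imp_le)
qed

theorem wedderburn: "field R"
proof -
  have "center = carrier R" using card_commutative_center by blast
  then have "cring R"
    by (intro cringI) (auto simp: center_def intro!: comm_monoidI abelian_group_axioms m_assoc l_distr)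
  then show ?thesis using units by (rule cring.cring_fieldI)
qed

end

section \<open>Clones on two elements\<close>

locale two_clone = clone U P for U :: "'a set" and P +
  fixes b t :: 'a
  assumes U2: "U = {b, t}" and bt: "b \<noteq> t"
begin

lemma un_compl_iff: "un f \<Longrightarrow> f b = t \<Longrightarrow> f t = b \<Longrightarrow> un (\<lambda>x. if x = b then t else b)"
  by (erule un_cong) (use U2 bt in auto)

definition mono_fun :: "nat \<Rightarrow> ('a list \<Rightarrow> 'a) \<Rightarrow> bool" where
  "mono_fun n p \<longleftrightarrow> (\<forall>xs\<in>tuples U n. \<forall>ys\<in>tuples U n.
     (\<forall>i<n. xs ! i = t \<longrightarrow> ys ! i = t) \<longrightarrow> p xs = t \<longrightarrow> p ys = t)"

lemma mono_funD:
  "mono_fun n p \<Longrightarrow> xs \<in> tuples U n \<Longrightarrow> ys \<in> tuples U n \<Longrightarrow>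
     (\<And>i. i < n \<Longrightarrow> xs ! i = t \<Longrightarrow> ys ! i = t) \<Longrightarrow> p xs = t \<Longrightarrow> p ys = t"
  unfolding mono_fun_def by blast

lemma mono_of_no_compl:
  assumes nc: "\<not> un (\<lambda>x. if x = b then t else b)" and p: "P n p" shows "mono_fun n p"
  unfolding mono_fun_def
proof (intro ballI impI)
  fix xs ys assume xs: "xs \<in> tuples U n" and ys: "ys \<in> tuples U n"
    and le: "\<forall>i<n. xs ! i = t \<longrightarrow> ys ! i = t" and pt: "p xs = t"
  have len: "length xs = n" "length ys = n" using xs ys by (auto simp: tuples_length)
  have "k \<le> n \<Longrightarrow> p (take k ys @ drop k xs) = t" for k
  proof (induction k)
    case 0 then show ?case using pt by simp
  next
    case (Suc k)
    let ?zs = "take k ys @ drop k xs"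
    have k: "k < n" using Suc by simp
    have zs: "?zs \<in> tuples U n" by (rule take_drop_tuples[OF xs ys])
    have step: "take (Suc k) ys @ drop (Suc k) xs = ?zs[k := ys ! k]"
      using take_drop_step[of k xs ys] Suc.prems len by simp
    have nth: "?zs ! k = xs ! k" using k len by (simp add: nth_append)
    have id: "?zs[k := xs ! k] = ?zs" using nth by (metis list_update_id)
    show ?case
    proof (cases "xs ! k = ys ! k")
      case True then show ?thesis using Suc step id by simp
    next
      case False
      then have "xs ! k = b" "ys ! k = t" using le k tuples_nth[OF xs k] tuples_nth[OF ys k] U2 by auto
      moreover have "un (\<lambda>x. p (?zs[k := x]))" by (rule P_update[OF p zs k])
      moreover have "p (?zs[k := t]) \<in> U" by (rule P_closed[OF p tuples_update[OF zs]]) (use U2 in auto)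
      ultimately have "p (?zs[k := t]) = t"
        using nc un_compl_iff[of "\<lambda>x. p (?zs[k := x])"] Suc k id U2 by auto
      then show ?thesis using step \<open>ys ! k = t\<close> by simp
    qed
  qed
  from this[of n] show "p ys = t" using len by simp
qed

lemma all_in_clone:
  assumes mt: "bin (meet b t)" and cp: "un (\<lambda>x. if x = b then t else b)"
    and p: "\<And>xs. xs \<in> tuples U n \<Longrightarrow> p xs \<in> U"
  shows "P n p"
proof -
  have jn: "bin (join b t)"
  proof -
    have "bin (\<lambda>x y. (\<lambda>z. if z = b then t else b) (meet b t (if x = b then t else b) (if y = b then t else b)))"
      by (rule bin_un[OF cp], rule bin_comp[OF mt bin_fst[OF cp] bin_snd[OF cp]])
    then show ?thesis by (rule bin_cong) (use U2 bt in auto)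
  qed
  have "k \<le> n \<Longrightarrow> (\<And>xs. xs \<in> tuples U n \<Longrightarrow> p xs \<in> U) \<Longrightarrow>
     (\<And>xs ys. xs \<in> tuples U n \<Longrightarrow> ys \<in> tuples U n \<Longrightarrow> (\<And>i. i < k \<Longrightarrow> xs ! i = ys ! i) \<Longrightarrow> p xs = p ys) \<Longrightarrow> P n p" for k p
  proof (induction k arbitrary: p)
    case 0
    have z: "replicate n b \<in> tuples U n" using U2 by (auto simp: tuples_def)
    show ?case
    proof (rule P_cong[OF P_const])
      show "p (replicate n b) \<in> U" using 0(2) z by blast
      show "p (replicate n b) = p xs" if "xs \<in> tuples U n" for xs by (rule 0(3)[OF z that]) simp
    qed
  next
    case (Suc k)
    have k: "k < n" using Suc.prems(1) by simp
    have q: "P n (\<lambda>xs. p (xs[k := a]))" if a: "a \<in> U" for a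
    proof (rule Suc.IH)
      fix xs assume "xs \<in> tuples U n"
      then have "xs[k := a] \<in> tuples U n" using a by (rule tuples_update)
      then show "p (xs[k := a]) \<in> U" by (rule Suc.prems(2))
    next
      fix xs ys assume *: "xs \<in> tuples U n" "ys \<in> tuples U n" "\<And>i. i < k \<Longrightarrow> xs ! i = ys ! i"
      show "p (xs[k := a]) = p (ys[k := a])"
        by (rule Suc.prems(3)[of "xs[k := a]" "ys[k := a]"]) (use * a k in \<open>auto simp: nth_list_update tuples_length less_Suc_eq intro: tuples_update\<close>)
    qed (use k in simp)
    have "P n (\<lambda>xs. join b t (meet b t (xs ! k) (p (xs[k := t])))
        (meet b t (if xs ! k = b then t else b) (p (xs[k := b]))))"
      by (intro bin_app[OF jn] bin_app[OF mt] un_app[OF cp] P_proj k q) (use U2 in auto)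
    then show ?case
    proof (rule P_cong)
      fix xs assume xs: "xs \<in> tuples U n"
      have "xs ! k = b \<or> xs ! k = t" using tuples_nth[OF xs k] U2 by auto
      moreover have "p (xs[k := xs ! k]) = p xs" by simp
      moreover have "p xs \<in> U" using Suc.prems(2) xs by blast
      ultimately show "join b t (meet b t (xs ! k) (p (xs[k := t])))
        (meet b t (if xs ! k = b then t else b) (p (xs[k := b]))) = p xs" using bt U2 by (auto simp del: list_update_id)
    qed
  qed
  from this[of n p] show ?thesis using p by (metis nth_equalityI order_refl tuples_length)
qed

lemma mono_in_clone:
  assumes mt: "bin (meet b t)" and jn: "bin (join b t)"
    and p: "\<And>xs. xs \<in> tuples U n \<Longrightarrow> p xs \<in> U" "mono_fun n p"
  shows "P n p"
proof -
  have "k \<le> n \<Longrightarrow> (\<And>xs. xs \<in> tuples U n \<Longrightarrow> p xs \<in> U) \<Longrightarrow> mono_fun n p \<Longrightarrow>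
     (\<And>xs ys. xs \<in> tuples U n \<Longrightarrow> ys \<in> tuples U n \<Longrightarrow> (\<And>i. i < k \<Longrightarrow> xs ! i = ys ! i) \<Longrightarrow> p xs = p ys) \<Longrightarrow> P n p" for k p
  proof (induction k arbitrary: p)
    case 0
    have z: "replicate n b \<in> tuples U n" using U2 by (auto simp: tuples_def)
    show ?case
    proof (rule P_cong[OF P_const])
      show "p (replicate n b) \<in> U" using 0(2) z by blast
      show "p (replicate n b) = p xs" if "xs \<in> tuples U n" for xs by (rule 0(4)[OF z that]) simp
    qed
  next
    case (Suc k)
    have k: "k < n" using Suc.prems(1) by simp
    have q: "P n (\<lambda>xs. p (xs[k := a]))" if a: "a \<in> U" for a
    proof (rule Suc.IH)
      fix xs assume "xs \<in> tuples U n"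
      then have "xs[k := a] \<in> tuples U n" using a by (rule tuples_update)
      then show "p (xs[k := a]) \<in> U" by (rule Suc.prems(2))
    next
      show "mono_fun n (\<lambda>xs. p (xs[k := a]))"
        unfolding mono_fun_def
      proof (intro ballI impI)
        fix xs ys assume *: "xs \<in> tuples U n" "ys \<in> tuples U n" "\<forall>i<n. xs ! i = t \<longrightarrow> ys ! i = t"
          "p (xs[k := a]) = t"
        show "p (ys[k := a]) = t"
          by (rule mono_funD[OF Suc.prems(3) _ _ _ *(4)])
            (use * a k in \<open>auto simp: nth_list_update tuples_length intro: tuples_update\<close>)
      qed
    next
      fix xs ys assume *: "xs \<in> tuples U n" "ys \<in> tuples U n" "\<And>i. i < k \<Longrightarrow> xs ! i = ys ! i"
      show "p (xs[k := a]) = p (ys[k := a])"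
        by (rule Suc.prems(4)[of "xs[k := a]" "ys[k := a]"]) (use * a k in \<open>auto simp: nth_list_update tuples_length less_Suc_eq intro: tuples_update\<close>)
    qed (use k in simp)
    have "P n (\<lambda>xs. join b t (meet b t (xs ! k) (p (xs[k := t]))) (p (xs[k := b])))"
      by (intro bin_app[OF jn] bin_app[OF mt] P_proj k q) (use U2 in auto)
    then show ?case
    proof (rule P_cong)
      fix xs assume xs: "xs \<in> tuples U n"
      have "xs ! k = b \<or> xs ! k = t" using tuples_nth[OF xs k] U2 by auto
      moreover have "p (xs[k := xs ! k]) = p xs" by simp
      moreover have "p xs \<in> U" "p (xs[k := b]) \<in> U" using Suc.prems(2) xs U2 tuples_update[OF xs] by auto
      moreover have "p (xs[k := t]) = t" if "p (xs[k := b]) = t"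
        by (rule mono_funD[OF Suc.prems(3) _ _ _ that])
          (use xs U2 bt k in \<open>auto simp: nth_list_update tuples_length intro: tuples_update\<close>)
      ultimately show "join b t (meet b t (xs ! k) (p (xs[k := t]))) (p (xs[k := b])) = p xs"
        using bt U2 by (auto simp del: list_update_id)
    qed
  qed
  from this[of n p] show ?thesis using p by (metis nth_equalityI order_refl tuples_length)
qed

lemma meet_closed_of_no_join:
  assumes nj: "\<not> bin (join b t)" and p: "P n p" "mono_fun n p"
    and xs: "xs \<in> tuples U n" "p xs = t" and ys: "ys \<in> tuples U n" "p ys = t"
  shows "p (map2 (meet b t) xs ys) = t"
proof (rule ccontr)
  assume ne: "p (map2 (meet b t) xs ys) \<noteq> t"
  let ?q = "\<lambda>i x y. if xs ! i = t then (if ys ! i = t then t else x) else (if ys ! i = t then y else b)"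
  let ?h = "\<lambda>x y. p (map (\<lambda>i. ?q i x y) [0..<n])"
  have "P 2 (\<lambda>zs. p (map (\<lambda>q. q zs) (map (\<lambda>i zs. ?q i (zs ! 0) (zs ! 1)) [0..<n])))"
    by (rule P_comp[OF p(1)]) (use U2 in \<open>auto intro!: P_if P_proj P_const\<close>)
  then have h: "bin ?h" by (simp only: bin_def map_map comp_def)
  have len: "length xs = n" "length ys = n" using xs ys by (auto simp: tuples_length)
  have U: "xs ! i \<in> {b, t}" "ys ! i \<in> {b, t}" if "i < n" for i
    using tuples_nth[OF xs(1) that] tuples_nth[OF ys(1) that] U2 by auto
  have "?h t b = p xs"
    by (rule arg_cong[of _ _ p], rule nth_equalityI) (use U len in fastforce)+
  moreover have "?h b t = p ys"
    by (rule arg_cong[of _ _ p], rule nth_equalityI) (use U len in fastforce)+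
  moreover have "?h b b = p (map2 (meet b t) xs ys)"
    by (rule arg_cong[of _ _ p], rule nth_equalityI) (use U len in fastforce)+
  moreover have tup: "map (\<lambda>i. ?q i x y) [0..<n] \<in> tuples U n" if "x \<in> U" "y \<in> U" for x y
    using that U2 by (auto simp: tuples_def)
  moreover have "?h t t = t"
    by (rule mono_funD[OF p(2) xs(1) tup _ xs(2)]) (use U2 in auto)
  moreover have "?h b b \<in> U" using bin_closed[OF h, of b b] U2 by blast
  ultimately have "bin (join b t)"
    by (intro bin_cong[OF h]) (use U2 bt xs ys ne in auto)
  then show False using nj by blast
qed

lemma meet_of_variables:
  assumes nj: "\<not> bin (join b t)" and p: "P n p" "mono_fun n p"
  shows "(\<forall>xs\<in>tuples U n. p xs = b) \<or>
    (\<exists>S. \<forall>xs\<in>tuples U n. p xs = (if \<forall>i<n. i \<in> S \<longrightarrow> xs ! i = t then t else b))"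
proof (cases "\<forall>xs\<in>tuples U n. p xs = b")
  case False
  let ?T = "replicate n t"
  have T: "?T \<in> tuples U n" using U2 by (auto simp: tuples_def)
  obtain xs0 where xs0: "xs0 \<in> tuples U n" "p xs0 \<noteq> b" using False by blast
  then have "p xs0 = t" using P_closed[OF p(1) xs0(1)] U2 by auto
  then have pT: "p ?T = t" by (rule mono_funD[OF p(2) xs0(1) T, rotated]) simp
  define S where "S = {i. p (?T[i := b]) = b}"
  have "p xs = (if \<forall>i<n. i \<in> S \<longrightarrow> xs ! i = t then t else b)" if xs: "xs \<in> tuples U n" for xs
  proof (cases "\<forall>i<n. i \<in> S \<longrightarrow> xs ! i = t")
    case True
    have len: "length xs = n" using xs by (simp add: tuples_length)
    have "k \<le> n \<Longrightarrow> p (take k xs @ drop k ?T) = t" for k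
    proof (induction k)
      case 0 then show ?case using pT by simp
    next
      case (Suc k)
      have k: "k < n" using Suc by simp
      have Ub: "b \<in> U" using U2 by simp
      have "xs ! k = t \<or> xs ! k = b" using tuples_nth[OF xs k] U2 by auto
      then have pk: "p (?T[k := xs ! k]) = t"
      proof
        assume "xs ! k = t"
        then have "?T[k := xs ! k] = ?T" using k by (metis list_update_id nth_replicate)
        then show ?thesis using pT by simp
      next
        assume xb: "xs ! k = b"
        then have "k \<notin> S" using True k bt by auto
        then show ?thesis using P_closed[OF p(1) tuples_update[OF T Ub, of k]] U2 xb by (auto simp: S_def)
      qed
      have tu: "?T[k := xs ! k] \<in> tuples U n" using tuples_update[OF T tuples_nth[OF xs k]] .
      have "take (Suc k) xs @ drop (Suc k) ?T = map2 (meet b t) (take k xs @ drop k ?T) (?T[k := xs ! k])"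
      proof (rule nth_equalityI)
        fix i assume "i < length (take (Suc k) xs @ drop (Suc k) ?T)"
        then have i: "i < n" using len by (simp add: min_def split: if_splits)
        have "xs ! i = t \<or> xs ! i = b" using tuples_nth[OF xs i] U2 by auto
        then show "(take (Suc k) xs @ drop (Suc k) ?T) ! i =
          map2 (meet b t) (take k xs @ drop k ?T) (?T[k := xs ! k]) ! i"
          using i len k bt by (cases i k rule: linorder_cases) (auto simp: nth_append nth_list_update min_def less_Suc_eq)
      qed (use len in simp)
      then show ?case
        using meet_closed_of_no_join[OF nj p take_drop_tuples[OF T xs] _ tu pk, of k] Suc by simp
    qed
    from this[of n] show ?thesis using len True by simp
  next
    case False
    then obtain i where i: "i < n" "i \<in> S" "xs ! i \<noteq> t" by blast
    have Ub: "b \<in> U" using U2 by simp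
    have "p xs \<noteq> t"
    proof
      assume "p xs = t"
      then have "p (?T[i := b]) = t"
        by (rule mono_funD[OF p(2) xs tuples_update[OF T Ub], rotated]) (use i in \<open>auto simp: nth_list_update\<close>)
      then show False using i bt by (simp add: S_def)
    qed
    then have "p xs = b" using P_closed[OF p(1) xs] U2 by auto
    then show ?thesis unfolding if_not_P[OF False] .
  qed
  then show ?thesis by blast
qed simp

lemma meets_in_clone:
  assumes mt: "bin (meet b t)"
  shows "P n (\<lambda>xs. if \<forall>i<n. i \<in> S \<longrightarrow> xs ! i = t then t else b)"
proof -
  have "k \<le> n \<Longrightarrow> P n (\<lambda>xs. if \<forall>i<k. i \<in> S \<longrightarrow> xs ! i = t then t else b)" for k
  proof (induction k)
    case 0 then show ?case using P_const[of t n] U2 by simp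
  next
    case (Suc k)
    then have IH: "P n (\<lambda>xs. if \<forall>i<k. i \<in> S \<longrightarrow> xs ! i = t then t else b)" and k: "k < n" by auto
    show ?case
    proof (cases "k \<in> S")
      case True
      have "P n (\<lambda>xs. meet b t (if \<forall>i<k. i \<in> S \<longrightarrow> xs ! i = t then t else b) (xs ! k))"
        by (rule bin_app[OF mt IH P_proj[OF k]])
      then show ?thesis by (rule P_cong) (use True bt in \<open>auto simp: less_Suc_eq\<close>)
    next
      case False
      show ?thesis by (rule P_cong[OF IH]) (use False in \<open>auto simp: less_Suc_eq\<close>)
    qed
  qed
  then show ?thesis by simp
qed

end

lemma two_opn_fun:
  "two_opn b t Meet = (\<lambda>xs. if xs ! 0 = t \<and> xs ! 1 = t then t else b)"
  "two_opn b t Join = (\<lambda>xs. if xs ! 0 = b \<and> xs ! 1 = b then b else t)"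
  "two_opn b t Compl = (\<lambda>xs. if xs ! 0 = b then t else b)"
  by (auto simp del: One_nat_def)

lemma is_ualg_two_alg: "is_ualg (two_alg S b t)"
proof -
  have "two_opn b t f xs \<in> {b, t}" for f xs by (cases f) auto
  then show ?thesis by (auto simp: is_ualg_def two_alg_def)
qed

lemma two_clone_two_alg: "b \<noteq> t \<Longrightarrow> two_clone {b, t} (is_pol (two_alg S b t)) b t"
  unfolding two_clone_def two_clone_axioms_def
  using clone_is_pol[OF is_ualg_two_alg[of S b t]] by (simp add: two_alg_def)

lemma two_alg_basic: "f \<in> S \<Longrightarrow> is_pol (two_alg S b t) (two_ar f) (two_opn b t f)"
  using is_pol_basic[OF is_ualg_two_alg[of S b t], of f] by (simp add: two_alg_def)

lemma two_alg_args:
  assumes "S \<subseteq> {Meet, Join}" "f \<in> symbs (two_alg S b t)" "length gs = ar (two_alg S b t) f"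
  obtains g h where "gs = [g, h]" "f = Meet \<or> f = Join"
proof -
  have f: "f = Meet \<or> f = Join" using assms by (auto simp: two_alg_def)
  then have "length gs = Suc (Suc 0)" using assms by (auto simp: two_alg_def)
  then show ?thesis using that f by (auto simp: length_Suc_conv)
qed

lemma two_alg_mono:
  assumes bt: "b \<noteq> t" and S: "S \<subseteq> {Meet, Join}" and p: "is_pol (two_alg S b t) n p"
  shows "(\<forall>xs\<in>tuples {b, t} n. p xs \<in> {b, t}) \<and> (\<forall>xs\<in>tuples {b, t} n. \<forall>ys\<in>tuples {b, t} n.
     (\<forall>i<n. xs ! i = t \<longrightarrow> ys ! i = t) \<longrightarrow> p xs = t \<longrightarrow> p ys = t)"
  using p
proof (induction rule: is_pol_induct)
  case (cong p q)
  then show ?case by (simp add: two_alg_def)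
next
  case (proj i)
  then show ?case using tuples_nth by fastforce
next
  case (const a)
  then show ?case by (simp add: two_alg_def)
next
  case (app f gs)
  obtain g h where gs: "gs = [g, h]" "f = Meet \<or> f = Join" using two_alg_args[OF S app(1,2)] .
  have g: "\<forall>xs\<in>tuples {b, t} n. g xs \<in> {b, t}" "\<forall>xs\<in>tuples {b, t} n. \<forall>ys\<in>tuples {b, t} n.
     (\<forall>i<n. xs ! i = t \<longrightarrow> ys ! i = t) \<longrightarrow> g xs = t \<longrightarrow> g ys = t" using app(3)[of g] gs by auto
  have h: "\<forall>xs\<in>tuples {b, t} n. h xs \<in> {b, t}" "\<forall>xs\<in>tuples {b, t} n. \<forall>ys\<in>tuples {b, t} n.
     (\<forall>i<n. xs ! i = t \<longrightarrow> ys ! i = t) \<longrightarrow> h xs = t \<longrightarrow> h ys = t" using app(3)[of h] gs by auto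
  show ?case
  proof (intro conjI ballI impI)
    fix xs ys assume *: "xs \<in> tuples {b, t} n" "ys \<in> tuples {b, t} n" "\<forall>i<n. xs ! i = t \<longrightarrow> ys ! i = t"
      "opn (two_alg S b t) f (map (\<lambda>g. g xs) gs) = t"
    have "g xs = t \<Longrightarrow> g ys = t" "h xs = t \<Longrightarrow> h ys = t" "g xs \<in> {b, t}" "h xs \<in> {b, t}" "g ys \<in> {b, t}" "h ys \<in> {b, t}"
      using g h * by blast+
    then show "opn (two_alg S b t) f (map (\<lambda>g. g ys) gs) = t"
      using *(4) gs bt by (auto simp: two_alg_def split: if_splits)
  qed (use gs in \<open>auto simp: two_alg_def\<close>)
qed

lemma semilattice_meet:
  assumes bt: "b \<noteq> t" and p: "is_pol (two_alg {Meet} b t) n p"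
  shows "\<forall>xs\<in>tuples {b, t} n. \<forall>ys\<in>tuples {b, t} n.
     (p (map2 (\<lambda>x y. if x = t \<and> y = t then t else b) xs ys) = t) = (p xs = t \<and> p ys = t)"
  using p
proof (induction rule: is_pol_induct)
  case (cong p q)
  have "map2 (\<lambda>x y. if x = t \<and> y = t then t else b) xs ys \<in> tuples {b, t} n"
    if "xs \<in> tuples {b, t} n" "ys \<in> tuples {b, t} n" for xs ys
    using that by (auto simp: tuples_def)
  then show ?case using cong by (simp add: two_alg_def)
next
  case (proj i)
  then show ?case using bt by (auto simp: tuples_length)
next
  case (const a)
  then show ?case by (simp add: two_alg_def)
next
  case (app f gs)
  obtain g h where gs: "gs = [g, h]" "f = Meet \<or> f = Join" using two_alg_args[OF _ app(1,2)] by auto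
  then have f: "f = Meet" using app(1) by (auto simp: two_alg_def)
  show ?case using app(3)[of g] app(3)[of h] gs bt f by (auto simp: two_alg_def)
qed

context minimal_clone begin

lemma not_twin_meet:
  assumes "\<not> twin" obtains b t where "U = {b, t}" "b \<noteq> t" "bin (meet b t)"
proof -
  obtain f c d where f: "bin f" "c \<in> U" "d \<in> U" "inj_on (\<lambda>x. f x c) U" "\<not> inj_on (\<lambda>x. f x d) U"
    using assms unfolding twin_def by blast
  obtain g r where g: "bin g" "r \<in> U" "\<And>x. x \<in> U \<Longrightarrow> g x c = x" "\<And>x. x \<in> U \<Longrightarrow> g x d = r"
    using non_twin_retraction[OF f] by metis
  have "card U = 2" using card2 twin_of_card assms by force
  moreover have cd: "c \<noteq> d" using f by auto
  ultimately have U: "U = {c, d}" using f fin by (intro card_subset_eq[symmetric]) auto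
  show ?thesis
  proof (cases "r = d")
    case True
    have "bin (meet d c)" by (rule bin_cong[OF g(1)]) (use g(3,4) U cd True in auto)
    then show ?thesis using that[of d c] U cd by blast
  next
    case False
    then have r: "r = c" using U g by auto
    have cp: "un (\<lambda>y. g d y)" by (rule un_of_bin'[OF g(1) f(3)])
    have "bin (\<lambda>x y. g x (g d y))" by (rule bin_comp[OF g(1) bin_fst[OF un_id] bin_snd[OF cp]])
    moreover have "g c c = c" "g d c = d" "g c d = c" "g d d = c" using g(3,4) f(2,3) r by auto
    ultimately have "bin (meet c d)" by (elim bin_cong) (use U cd in auto)
    then show ?thesis using that[of c d] U cd by blast
  qed
qed

lemma moving_iff_compl:
  assumes "U = {b, t}" "b \<noteq> t" shows "moving \<longleftrightarrow> un (\<lambda>x. if x = b then t else b)"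
proof
  assume moving
  then obtain f where f: "un f" "inj_on f U" "\<exists>x\<in>U. f x \<noteq> x" unfolding moving_def by blast
  have "f b \<in> U" "f t \<in> U" "f b \<noteq> f t" using f un_closed[OF f(1)] assms by (auto simp: inj_on_def)
  then have "f b = t \<and> f t = b" using f(3) assms by auto
  then show "un (\<lambda>x. if x = b then t else b)" by (intro un_cong[OF f(1)]) (use assms in auto)
next
  assume "un (\<lambda>x. if x = b then t else b)"
  then show moving unfolding moving_def using assms
    by (intro exI[of _ "\<lambda>x. if x = b then t else b"]) (auto simp: inj_on_def)
qed

lemma latticed_iff_join:
  assumes U: "U = {b, t}" "b \<noteq> t" and mt: "bin (meet b t)" shows "latticed \<longleftrightarrow> bin (join b t)"
proof
  assume latticed
  then obtain b' t' where *: "b' \<in> U" "t' \<in> U" "b' \<noteq> t'" "bin (meet b' t')" "bin (join b' t')"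
    unfolding latticed_def by blast
  then consider "b' = b" "t' = t" | "b' = t" "t' = b" using U by auto
  then show "bin (join b t)" using * by cases auto
next
  assume "bin (join b t)"
  then show latticed unfolding latticed_def using U mt by blast
qed

lemma kind_345_exists:
  assumes "\<not> twin"
  shows "\<exists>b t. b \<noteq> t \<and> {b, t} = U \<and> (\<forall>n p. is_pol (two_alg (if moving then {Bot, Top, Compl, Meet, Join}
    else if latticed then {Meet, Join} else {Meet}) b t) n p \<longleftrightarrow> P n p)"
proof -
  obtain b t where U: "U = {b, t}" "b \<noteq> t" and mt: "bin (meet b t)" using not_twin_meet[OF assms] .
  define S where "S = (if moving then {Bot, Top, Compl, Meet, Join}
    else if latticed then {Meet, Join} else {Meet})"
  interpret two_clone U P b t by unfold_locales (use U in auto)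
  interpret B: two_clone U "is_pol (two_alg S b t)" b t using two_clone_two_alg[OF U(2)] U(1) by simp
  have "Meet \<in> S" by (auto simp: S_def)
  then have Bmt: "B.bin (meet b t)" using two_alg_basic[of Meet S b t] unfolding B.bin_def two_opn_fun two_ar.simps by blast
  have Bjn: "B.bin (join b t)" if "Join \<in> S" using two_alg_basic[OF that, of b t] unfolding B.bin_def two_opn_fun two_ar.simps .
  have Bcp: "B.un (\<lambda>x. if x = b then t else b)" if "Compl \<in> S"
    using two_alg_basic[OF that, of b t] unfolding B.un_def two_opn_fun two_ar.simps .
  have "is_pol (two_alg S b t) n p \<longleftrightarrow> P n p" for n p
  proof (cases moving)
    case True
    then have "un (\<lambda>x. if x = b then t else b)" using moving_iff_compl U by simp
    moreover have "Compl \<in> S" using True by (simp add: S_def)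
    ultimately show ?thesis using all_in_clone[OF mt] B.all_in_clone[OF Bmt Bcp] P_closed B.P_closed by blast
  next
    case False
    then have nc: "\<not> un (\<lambda>x. if x = b then t else b)" using moving_iff_compl U by simp
    have "P n p" if p: "is_pol (two_alg S b t) n p"
    proof (rule is_pol_imp_P[OF _ p])
      show "univ (two_alg S b t) = U" by (simp add: two_alg_def U)
      fix f assume "f \<in> symbs (two_alg S b t)"
      then have "f = Meet \<or> (f = Join \<and> latticed)" using False by (auto simp: two_alg_def S_def split: if_splits)
      then show "P (ar (two_alg S b t) f) (opn (two_alg S b t) f)"
        using mt latticed_iff_join[OF U mt] by (auto simp: two_alg_def bin_def two_opn_fun simp del: One_nat_def two_opn.simps)
    qed
    moreover have "is_pol (two_alg S b t) n p" if p: "P n p"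
    proof -
      have mono: "mono_fun n p" by (rule mono_of_no_compl[OF nc p])
      show ?thesis
      proof (cases latticed)
        case True
        then have "Join \<in> S" using False by (simp add: S_def)
        moreover have "B.mono_fun n p" using mono unfolding mono_fun_def B.mono_fun_def .
        ultimately show ?thesis using B.mono_in_clone[OF Bmt Bjn, of n p] P_closed[OF p] by blast
      next
        case False
        then have "\<not> bin (join b t)" using latticed_iff_join[OF U mt] by blast
        from meet_of_variables[OF this p mono] show ?thesis
        proof (elim disjE exE)
          assume "\<forall>xs\<in>tuples U n. p xs = b"
          then show ?thesis by (intro B.P_cong[OF B.P_const[of b]]) (use U in auto)
        next
          fix V assume "\<forall>xs\<in>tuples U n. p xs = (if \<forall>i<n. i \<in> V \<longrightarrow> xs ! i = t then t else b)"
          then show ?thesis by (intro B.P_cong[OF B.meets_in_clone[OF Bmt, of n V]]) simp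
        qed
      qed
    qed
    ultimately show ?thesis by blast
  qed
  then show ?thesis using U unfolding S_def by blast
qed

lemma kind_of_two_alg:
  assumes bt: "b \<noteq> t" and U: "U = {b, t}" and eq: "\<And>n p. is_pol (two_alg S b t) n p \<longleftrightarrow> P n p"
  shows "Meet \<in> S \<Longrightarrow> \<not> twin" "Compl \<in> S \<Longrightarrow> moving" "S \<subseteq> {Meet, Join} \<Longrightarrow> \<not> moving"
    "S = {Meet, Join} \<Longrightarrow> latticed" "S = {Meet} \<Longrightarrow> \<not> latticed"
proof -
  have basic: "P (two_ar f) (two_opn b t f)" if "f \<in> S" for f
    using two_alg_basic[OF that, of b t] eq by blast
  have mt: "bin (meet b t)" if "Meet \<in> S" using basic[OF that] unfolding bin_def two_opn_fun two_ar.simps .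
  show "\<not> twin" if "Meet \<in> S"
  proof
    assume twin
    moreover have "inj_on (\<lambda>x. meet b t x t) U" using U bt by (auto simp: inj_on_def)
    ultimately have "inj_on (\<lambda>x. meet b t x b) U" using mt[OF that] U unfolding twin_def by blast
    then show False using U bt by (auto simp: inj_on_def)
  qed
  show moving if "Compl \<in> S"
    unfolding moving_iff_compl[OF U bt] using basic[OF that] unfolding un_def two_opn_fun two_ar.simps .
  show "\<not> moving" if S: "S \<subseteq> {Meet, Join}"
  proof
    assume moving
    then have "is_pol (two_alg S b t) 1 (\<lambda>xs. if xs ! 0 = b then t else b)"
      unfolding moving_iff_compl[OF U bt] using eq by (simp add: un_def)
    from two_alg_mono[OF bt S this] have "\<forall>xs\<in>tuples {b, t} 1. \<forall>ys\<in>tuples {b, t} 1.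
      (\<forall>i<1. xs ! i = t \<longrightarrow> ys ! i = t) \<longrightarrow> (if xs ! 0 = b then t else b) = t \<longrightarrow> (if ys ! 0 = b then t else b) = t"
      by blast
    from bspec[OF bspec[OF this, of "[b]"], of "[t]"] show False using bt by (auto simp: tuples_def)
  qed
  show latticed if "S = {Meet, Join}"
  proof -
    have "bin (join b t)" using basic[of Join] that unfolding bin_def two_opn_fun two_ar.simps by blast
    then show ?thesis using latticed_iff_join[OF U bt mt] that by blast
  qed
  show "\<not> latticed" if S: "S = {Meet}"
  proof
    assume latticed
    then have "bin (join b t)" using latticed_iff_join[OF U bt mt] S by simp
    then have "is_pol (two_alg {Meet} b t) 2 (\<lambda>xs. join b t (xs ! 0) (xs ! 1))"
      using eq S unfolding bin_def by blast
    from semilattice_meet[OF bt this, THEN bspec[of _ _ "[b, t]"], THEN bspec[of _ _ "[t, b]"]]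
    show False using bt by (simp add: tuples_def)
  qed
qed

end

section \<open>Minimal clones with the twin property\<close>

lemma vs_alg_simps:
  "symbs (vs_alg F V) = {VZero, VNeg, VAdd} \<union> VScale ` carrier F" "univ (vs_alg F V) = carrier V"
  "ar (vs_alg F V) VZero = 0" "ar (vs_alg F V) VNeg = 1" "ar (vs_alg F V) VAdd = 2" "ar (vs_alg F V) (VScale k) = 1"
  "opn (vs_alg F V) VZero = (\<lambda>xs. \<zero>\<^bsub>V\<^esub>)" "opn (vs_alg F V) VNeg = (\<lambda>xs. \<ominus>\<^bsub>V\<^esub> (xs ! 0))"
  "opn (vs_alg F V) VAdd = (\<lambda>xs. xs ! 0 \<oplus>\<^bsub>V\<^esub> xs ! 1)"
  "opn (vs_alg F V) (VScale k) = (\<lambda>xs. k \<odot>\<^bsub>V\<^esub> (xs ! 0))"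
  by (simp_all add: vs_alg_def)

context minimal_clone begin

lemma twin_latin_square:
  assumes twin two_dep
  obtains f where "bin f" "\<And>c. c \<in> U \<Longrightarrow> inj_on (\<lambda>x. f x c) U" "\<And>c. c \<in> U \<Longrightarrow> inj_on (\<lambda>y. f c y) U"
proof -
  obtain f a b c a' b' c' where f: "bin f" "a \<in> U" "b \<in> U" "c \<in> U" "f a c \<noteq> f b c"
    "a' \<in> U" "b' \<in> U" "c' \<in> U" "f c' a' \<noteq> f c' b'"
    using assms(2) unfolding two_dep_def by blast
  have 1: "inj_on (\<lambda>x. f x c) U" using un_inj[OF un_of_bin[OF f(1,4)] f(2,3,5)] .
  have 2: "inj_on (\<lambda>y. f c' y) U" using un_inj[OF un_of_bin'[OF f(1,8)] f(6,7,9)] .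
  have "inj_on (\<lambda>x. f x d) U" if "d \<in> U" for d
    using assms(1) f(1,4) 1 that unfolding twin_def by blast
  moreover have "inj_on (\<lambda>y. f d y) U" if "d \<in> U" for d
    using assms(1)[unfolded twin_def, rule_format, OF bin_swap[OF f(1)] f(8) that] 2 by blast
  ultimately show ?thesis using that f(1) by blast
qed

lemma loop_operations:
  assumes "twin" "two_dep" "e \<in> U"
  obtains pl df where "bin pl" "bin df"
    "\<And>x. x \<in> U \<Longrightarrow> pl e x = x" "\<And>x. x \<in> U \<Longrightarrow> pl x e = x"
    "\<And>x. x \<in> U \<Longrightarrow> df x x = e" "\<And>x. x \<in> U \<Longrightarrow> df x e = x"
proof -
  obtain f where f: "bin f" and inj1: "\<And>c. c \<in> U \<Longrightarrow> inj_on (\<lambda>x. f x c) U"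
    and inj2: "\<And>c. c \<in> U \<Longrightarrow> inj_on (\<lambda>y. f c y) U" using twin_latin_square[OF assms(1,2)] by blast
  obtain k where k: "k > 0" "\<And>f x. f \<in> U \<rightarrow> U \<Longrightarrow> x \<in> U \<Longrightarrow> (f ^^ k) ((f ^^ k) x) = (f ^^ k) x"
    using idempotent_power[OF fin] by blast
  then obtain j where j: "k = Suc j" by (cases k) auto
  have pow_id: "(g ^^ k) x = x" if g: "g \<in> U \<rightarrow> U" "inj_on g U" and x: "x \<in> U" for g x
  proof -
    have cl: "(g ^^ i) y \<in> U" if "y \<in> U" for i y using that g(1) by (induction i) auto
    have inj: "inj_on (g ^^ i) U" for i
    proof (induction i)
      case (Suc i)
      show ?case
      proof (rule inj_onI)
        fix y z assume yz: "y \<in> U" "z \<in> U" "(g ^^ Suc i) y = (g ^^ Suc i) z"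
        then have "(g ^^ i) y = (g ^^ i) z" using inj_onD[OF g(2)] cl by simp
        then show "y = z" using inj_onD[OF Suc.IH] yz by blast
      qed
    qed simp
    show ?thesis using inj_onD[OF inj k(2)[OF g(1) x] cl[OF x] x] .
  qed
  define rd where "rd = (\<lambda>x y. ((\<lambda>z. f z y) ^^ j) x)"
  define ld where "ld = (\<lambda>x y. ((\<lambda>z. f y z) ^^ j) x)"
  have rd: "bin rd" unfolding rd_def by (rule bin_funpow[OF f])
  have ld: "bin ld" unfolding ld_def by (rule bin_funpow[OF bin_swap[OF f]])
  have frd: "f (rd x y) y = x" if "x \<in> U" "y \<in> U" for x y
    using pow_id[of "\<lambda>z. f z y" x] inj1 bin_closed[OF f] that by (simp add: rd_def j)
  have fld: "f y (ld x y) = x" if "x \<in> U" "y \<in> U" for x y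
    using pow_id[of "\<lambda>z. f y z" x] inj2 bin_closed[OF f] that by (simp add: ld_def j)
  have rdf: "rd x (ld x x) = x" if "x \<in> U" for x
    using inj_onD[OF inj1[of "ld x x"], of "rd x (ld x x)" x] frd[of x "ld x x"] fld[of x x] that
      bin_closed[OF ld] bin_closed[OF rd] by simp
  define pl where "pl = (\<lambda>x y. f (rd x (ld e e)) (ld y e))"
  define df where "df = (\<lambda>x y. f (rd x (ld y y)) (ld e y))"
  have we: "ld e e \<in> U" using assms bin_closed[OF ld] by blast
  have "bin pl" unfolding pl_def
    by (intro bin_comp[OF f bin_comp[OF rd bin_fst[OF un_id] bin_fst[OF un_const[OF we]]]
        bin_comp[OF ld bin_snd[OF un_id] bin_fst[OF un_const[OF assms(3)]]]])
  moreover have "bin df" unfolding df_def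
    by (intro bin_comp[OF f bin_comp[OF rd bin_fst[OF un_id] bin_comp[OF ld bin_snd[OF un_id] bin_snd[OF un_id]]]
        bin_comp[OF ld bin_fst[OF un_const[OF assms(3)]] bin_snd[OF un_id]]])
  moreover have "pl e x = x" "pl x e = x" "df x x = e" "df x e = x" if "x \<in> U" for x
    using that assms(3) rdf fld frd we by (simp_all add: pl_def df_def)
  ultimately show ?thesis using that by blast
qed

end

locale affine_clone = minimal_clone +
  fixes e :: 'a and pl df :: "'a \<Rightarrow> 'a \<Rightarrow> 'a"
  assumes tw: twin and e: "e \<in> U" and pl: "bin pl" and df: "bin df"
    and pl_left: "x \<in> U \<Longrightarrow> pl e x = x" and pl_right: "x \<in> U \<Longrightarrow> pl x e = x"
    and df_self: "x \<in> U \<Longrightarrow> df x x = e" and df_right: "x \<in> U \<Longrightarrow> df x e = x"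
begin

lemma plU: "x \<in> U \<Longrightarrow> y \<in> U \<Longrightarrow> pl x y \<in> U" by (rule bin_closed[OF pl])
lemma dfU: "x \<in> U \<Longrightarrow> y \<in> U \<Longrightarrow> df x y \<in> U" by (rule bin_closed[OF df])

lemma df_inj: "y \<in> U \<Longrightarrow> inj_on (\<lambda>x. df x y) U"
proof -
  assume y: "y \<in> U"
  have "inj_on (\<lambda>x. df x e) U" by (rule inj_onI) (simp add: df_right)
  then show ?thesis using tw df e y unfolding twin_def by blast
qed

lemma zeros: "replicate n e \<in> tuples U n"
  using e by (auto simp: tuples_def)

text \<open>The difference \<open>p xs - p (xs[i := e])\<close> vanishes whenever \<open>xs ! i = e\<close>; hence it is
  injective in no variable other than the \<open>i\<close>-th, so by the twin property it depends on
  \<open>xs ! i\<close> only.\<close>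

lemma difference_unary:
  assumes p: "P n p" and i: "i < n" and xs: "xs \<in> tuples U n"
  shows "df (p xs) (p (xs[i := e])) = df (p ((replicate n e)[i := xs ! i])) (p (replicate n e))"
proof -
  let ?G = "\<lambda>xs. df (p xs) (p (xs[i := e]))"
  have pe: "P n (\<lambda>xs. p (xs[i := e]))"
  proof -
    let ?q = "\<lambda>j xs. if j = i then e else xs ! j"
    have "P n (\<lambda>xs. p (map (\<lambda>q. q xs) (map ?q [0..<n])))"
      by (rule P_comp[OF p]) (use e in \<open>auto intro!: P_if P_proj P_const\<close>)
    moreover have "map (\<lambda>q. q xs) (map ?q [0..<n]) = xs[i := e]" if "xs \<in> tuples U n" for xs
      using that by (intro nth_equalityI) (auto simp: tuples_length nth_list_update)
    ultimately show ?thesis by (elim P_cong) simp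
  qed
  have G: "P n ?G" by (rule bin_app[OF df p pe])
  have ind: "?G (ys[j := a]) = ?G ys" if "j < n" "j \<noteq> i" "ys \<in> tuples U n" "a \<in> U" for j ys a
  proof (rule ccontr)
    assume "?G (ys[j := a]) \<noteq> ?G ys"
    then have "\<forall>ys\<in>tuples U n. inj_on (\<lambda>a. ?G (ys[j := a])) U"
      using twin_cases[OF tw G that(1)] that by blast
    then have inj: "inj_on (\<lambda>a. ?G ((replicate n e)[j := a])) U" using zeros by blast
    have "?G ((replicate n e)[j := a]) = e" if "a \<in> U" for a
    proof -
      have "(replicate n e)[j := a, i := e] = (replicate n e)[j := a]"
        using \<open>j \<noteq> i\<close> i by (metis list_update_id nth_list_update_neq nth_replicate)
      then show ?thesis using df_self P_closed[OF p tuples_update[OF zeros that]] by simp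
    qed
    then show False using inj_not_const[OF inj] by blast
  qed
  have "?G xs = ?G ((replicate n e)[i := xs ! i])"
    by (rule indep_agree[of n "{i}" ?G])
      (use ind i xs zeros in \<open>auto intro: tuples_update tuples_nth\<close>)
  moreover have "(replicate n e)[i := xs ! i, i := e] = replicate n e"
    using i by (metis list_update_id list_update_overwrite nth_replicate)
  ultimately show ?thesis by simp
qed

lemma bin_split:
  assumes t: "bin t" and x: "x \<in> U" and y: "y \<in> U"
  shows "df (t x y) (t e y) = df (t x e) (t e e)"
  using difference_unary[OF t[unfolded bin_def], of 0 "[x, y]"] x y
  by (simp add: tuples_def numeral_2_eq_2)

lemma df_pl: "x \<in> U \<Longrightarrow> y \<in> U \<Longrightarrow> df (pl x y) y = x"
  using bin_split[OF pl, of x y] pl_left pl_right df_right e by simp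

lemma pl_df: "w \<in> U \<Longrightarrow> y \<in> U \<Longrightarrow> pl (df w y) y = w"
  using inj_onD[OF df_inj[of y], of "pl (df w y) y" w] df_pl[of "df w y" y] plU dfU by simp

lemma bin_affine:
  assumes t: "bin t" and x: "x \<in> U" and y: "y \<in> U"
  shows "t x y = pl (df (t x e) (t e e)) (t e y)"
  using bin_split[OF assms] pl_df[of "t x y" "t e y"] bin_closed[OF t] x y e by simp

lemma pl_comm: "x \<in> U \<Longrightarrow> y \<in> U \<Longrightarrow> pl y x = pl x y"
  using bin_affine[OF bin_swap[OF pl], of x y] pl_left pl_right df_right e by simp

lemma pl_assoc:
  assumes "x \<in> U" "y \<in> U" "z \<in> U" shows "pl (pl x y) z = pl x (pl y z)"
proof -
  have "bin (\<lambda>x y. pl (pl x y) z)" by (rule bin_un[OF un_of_bin[OF pl assms(3)] pl])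
  from bin_affine[OF this assms(1,2)] show ?thesis
    using assms pl_left pl_right e df_pl by simp
qed

definition endos :: "('a \<Rightarrow> 'a) set" where
  "endos = {r \<in> U \<rightarrow>\<^sub>E U. un r \<and> r e = e}"

lemma endosD: "r \<in> endos \<Longrightarrow> un r" "r \<in> endos \<Longrightarrow> r e = e" "r \<in> endos \<Longrightarrow> x \<in> U \<Longrightarrow> r x \<in> U"
  by (auto simp: endos_def)

lemma endos_add: assumes "r \<in> endos" "x \<in> U" "y \<in> U" shows "r (pl x y) = pl (r x) (r y)"
  using bin_affine[OF bin_un[OF endosD(1)[OF assms(1)] pl] assms(2,3)] assms endosD(2,3)[OF assms(1)]
    pl_left pl_right df_right e by simp

lemma finite_endos: "finite endos"
  unfolding endos_def using fin by (auto intro: finite_subset[OF _ finite_PiE[OF fin, of "\<lambda>_. U"]])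

lemma endos_eqI: "r \<in> endos \<Longrightarrow> s \<in> endos \<Longrightarrow> (\<And>x. x \<in> U \<Longrightarrow> r x = s x) \<Longrightarrow> r = s"
  unfolding endos_def by (auto intro: PiE_ext)

lemma restrict_endos: "un r \<Longrightarrow> r e = e \<Longrightarrow> restrict r U \<in> endos"
  unfolding endos_def using e un_closed[of r] by (auto intro: un_cong[of r])

definition End :: "('a \<Rightarrow> 'a) ring" where
  "End = \<lparr>carrier = endos, monoid.mult = (\<lambda>r s. restrict (\<lambda>x. r (s x)) U), one = restrict (\<lambda>x. x) U,
     zero = restrict (\<lambda>x. e) U, add = (\<lambda>r s. restrict (\<lambda>x. pl (r x) (s x)) U)\<rparr>"

lemma endos_mult: "r \<in> endos \<Longrightarrow> s \<in> endos \<Longrightarrow> restrict (\<lambda>x. r (s x)) U \<in> endos"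
  by (rule restrict_endos) (auto simp: endosD intro: un_comp)

lemma endos_plus: "r \<in> endos \<Longrightarrow> s \<in> endos \<Longrightarrow> restrict (\<lambda>x. pl (r x) (s x)) U \<in> endos"
  by (rule restrict_endos) (auto simp: endosD pl_left e intro: un_bin[OF pl])

lemma endos_zero: "restrict (\<lambda>x. e) U \<in> endos"
  by (rule restrict_endos) (auto intro: un_const e)

lemma endos_one: "restrict (\<lambda>x. x) U \<in> endos"
  by (rule restrict_endos) (auto intro: un_id)

lemma endos_neg: "r \<in> endos \<Longrightarrow> restrict (\<lambda>x. df e (r x)) U \<in> endos"
  by (rule restrict_endos) (auto simp: endosD df_self e intro: un_bin[OF df un_const])

lemma ring_End: "ring End"
proof (rule ringI)
  show "abelian_group End"
  proof (rule abelian_groupI)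
    fix r assume r: "r \<in> carrier End"
    let ?n = "restrict (\<lambda>x. df e (r x)) U"
    have "?n \<in> carrier End" using r endos_neg by (simp add: End_def)
    moreover have "?n \<oplus>\<^bsub>End\<^esub> r = \<zero>\<^bsub>End\<^esub>"
      unfolding End_def using r by (auto simp: End_def restrict_def fun_eq_iff pl_df endosD e)
    ultimately show "\<exists>y\<in>carrier End. y \<oplus>\<^bsub>End\<^esub> r = \<zero>\<^bsub>End\<^esub>" by blast
  next
    fix r s t assume *: "r \<in> carrier End" "s \<in> carrier End" "t \<in> carrier End"
    show "r \<oplus>\<^bsub>End\<^esub> s \<oplus>\<^bsub>End\<^esub> t = r \<oplus>\<^bsub>End\<^esub> (s \<oplus>\<^bsub>End\<^esub> t)"
      using * by (auto simp: End_def restrict_def fun_eq_iff pl_assoc endosD)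
  next
    fix r s assume *: "r \<in> carrier End" "s \<in> carrier End"
    show "r \<oplus>\<^bsub>End\<^esub> s = s \<oplus>\<^bsub>End\<^esub> r"
      using * by (auto simp: End_def restrict_def fun_eq_iff endosD intro: pl_comm)
  next
    fix r assume "r \<in> carrier End"
    then have "r \<in> endos" by (simp add: End_def)
    from endos_plus[OF endos_zero this] this show "\<zero>\<^bsub>End\<^esub> \<oplus>\<^bsub>End\<^esub> r = r"
      unfolding End_def ring.simps by (rule endos_eqI) (use \<open>r \<in> endos\<close> in \<open>auto simp: endosD pl_left\<close>)
  qed (auto simp: End_def endos_plus endos_zero)
next
  show "monoid End"
  proof (rule monoidI)
    fix r s t assume *: "r \<in> carrier End" "s \<in> carrier End" "t \<in> carrier End"
    show "r \<otimes>\<^bsub>End\<^esub> s \<otimes>\<^bsub>End\<^esub> t = r \<otimes>\<^bsub>End\<^esub> (s \<otimes>\<^bsub>End\<^esub> t)"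
      using * by (auto simp: End_def restrict_def fun_eq_iff endosD)
  next
    fix r assume "r \<in> carrier End"
    then have r: "r \<in> endos" by (simp add: End_def)
    show "\<one>\<^bsub>End\<^esub> \<otimes>\<^bsub>End\<^esub> r = r"
      unfolding End_def monoid.simps by (rule endos_eqI[OF endos_mult[OF endos_one r] r]) (simp add: endosD r)
    show "r \<otimes>\<^bsub>End\<^esub> \<one>\<^bsub>End\<^esub> = r"
      unfolding End_def monoid.simps by (rule endos_eqI[OF endos_mult[OF r endos_one] r]) (simp add: endosD r)
  qed (auto simp: End_def endos_mult endos_one)
next
  fix r s t assume *: "r \<in> carrier End" "s \<in> carrier End" "t \<in> carrier End"
  show "(r \<oplus>\<^bsub>End\<^esub> s) \<otimes>\<^bsub>End\<^esub> t = r \<otimes>\<^bsub>End\<^esub> t \<oplus>\<^bsub>End\<^esub> s \<otimes>\<^bsub>End\<^esub> t"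
    using * by (auto simp: End_def restrict_def fun_eq_iff endosD)
  show "t \<otimes>\<^bsub>End\<^esub> (r \<oplus>\<^bsub>End\<^esub> s) = t \<otimes>\<^bsub>End\<^esub> r \<oplus>\<^bsub>End\<^esub> t \<otimes>\<^bsub>End\<^esub> s"
    using * by (auto simp: End_def restrict_def fun_eq_iff endosD endos_add)
qed

lemma field_End: "field End"
proof -
  have Units: "Units End = carrier End - {\<zero>\<^bsub>End\<^esub>}"
  proof
    obtain a b where ab: "a \<in> U" "b \<in> U" "a \<noteq> b" using two_elements by blast
    have "\<zero>\<^bsub>End\<^esub> \<notin> Units End"
    proof
      assume "\<zero>\<^bsub>End\<^esub> \<in> Units End"
      then obtain s where "s \<in> endos" "s \<otimes>\<^bsub>End\<^esub> \<zero>\<^bsub>End\<^esub> = \<one>\<^bsub>End\<^esub>" by (auto simp: Units_def End_def)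
      then have s: "(\<lambda>x\<in>U. s ((\<lambda>x\<in>U. e) x)) = (\<lambda>x\<in>U. x)" by (simp add: End_def)
      have "a = s e" "b = s e" using fun_cong[OF s, of a] fun_cong[OF s, of b] ab by auto
      then show False using ab by simp
    qed
    then show "Units End \<subseteq> carrier End - {\<zero>\<^bsub>End\<^esub>}" by (auto simp: Units_def)
    show "carrier End - {\<zero>\<^bsub>End\<^esub>} \<subseteq> Units End"
    proof
      fix r assume "r \<in> carrier End - {\<zero>\<^bsub>End\<^esub>}"
      then have r: "r \<in> endos" "r \<noteq> restrict (\<lambda>x. e) U" by (auto simp: End_def)
      then obtain x where x: "x \<in> U" "r x \<noteq> e" using endos_eqI[OF r(1) endos_zero] by auto
      have inj: "inj_on r U" using un_inj[OF endosD(1)[OF r(1)] x(1) e] x endosD(2)[OF r(1)] by simp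
      have rU: "r \<in> U \<rightarrow> U" using endosD(3)[OF r(1)] by blast
      obtain k where k: "k > 0" "\<And>f x. f \<in> U \<rightarrow> U \<Longrightarrow> x \<in> U \<Longrightarrow> (f ^^ k) ((f ^^ k) x) = (f ^^ k) x"
        using idempotent_power[OF fin] by blast
      then obtain j where j: "k = Suc j" by (cases k) auto
      have cl: "(r ^^ i) y \<in> U" if "y \<in> U" for i y using that rU by (induction i) auto
      have injp: "inj_on (r ^^ i) U" for i
      proof (induction i)
        case (Suc i)
        show ?case
        proof (rule inj_onI)
          fix y z assume yz: "y \<in> U" "z \<in> U" "(r ^^ Suc i) y = (r ^^ Suc i) z"
          then have "(r ^^ i) y = (r ^^ i) z" using inj_onD[OF inj] cl by simp
          then show "y = z" using inj_onD[OF Suc.IH] yz by blast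
        qed
      qed simp
      have pow_id: "(r ^^ k) y = y" if "y \<in> U" for y
        using inj_onD[OF injp k(2)[OF rU that] cl[OF that] that] .
      have re: "(r ^^ i) e = e" for i using endosD(2)[OF r(1)] by (induction i) auto
      let ?s = "restrict (r ^^ j) U"
      have s: "?s \<in> endos" by (rule restrict_endos[OF un_funpow[OF endosD(1)[OF r(1)]] re])
      have "?s \<otimes>\<^bsub>End\<^esub> r = \<one>\<^bsub>End\<^esub>" "r \<otimes>\<^bsub>End\<^esub> ?s = \<one>\<^bsub>End\<^esub>"
        using pow_id endosD(3)[OF r(1)]
        by (auto simp: End_def restrict_def fun_eq_iff j funpow_swap1)
      moreover have "r \<in> carrier End" "?s \<in> carrier End" using r s by (auto simp: End_def)
      ultimately show "r \<in> Units End" unfolding Units_def by blast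
    qed
  qed
  have "finite_division_ring End"
    unfolding finite_division_ring_def finite_division_ring_axioms_def
    using ring_End Units finite_endos by (simp add: End_def)
  then show ?thesis by (rule finite_division_ring.wedderburn)
qed

lemma vector_space_exists:
  "\<exists>(F :: nat ring) (V :: (nat, 'a) module). field F \<and> finite (carrier F) \<and> Module.module F V \<and>
     univ (vs_alg F V) = U \<and> (\<forall>n p. is_pol (vs_alg F V) n p \<longleftrightarrow> P n p)"
proof -
  obtain code :: "('a \<Rightarrow> 'a) \<Rightarrow> nat" where code: "inj_on code endos"
    using finite_imp_inj_to_nat_seg[OF finite_endos] by blast
  have code': "inj_on code (carrier End)" using code by (simp add: End_def)
  define F where "F = image_ring code End"
  interpret End: field End by (rule field_End)
  have F: "field F" unfolding F_def by (rule End.inj_imp_image_ring_is_field[OF code'])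
  interpret F: field F by (rule F)
  have iso: "code \<in> ring_hom End F"
    using inj_imp_image_ring_iso[OF code'] by (simp add: F_def ring_iso_def)
  have carF: "carrier F = code ` endos" by (simp add: F_def image_ring_carrier End_def)
  define dec where "dec = inv_into endos code"
  have dec: "dec (code r) = r" if "r \<in> endos" for r using code that by (simp add: dec_def)
  have dec_add: "dec (code r \<oplus>\<^bsub>F\<^esub> code s) = r \<oplus>\<^bsub>End\<^esub> s" if "r \<in> endos" "s \<in> endos" for r s
    using ring_hom_add[OF iso, of r s] that dec[OF endos_plus[OF that]] by (simp add: End_def)
  have dec_mult: "dec (code r \<otimes>\<^bsub>F\<^esub> code s) = r \<otimes>\<^bsub>End\<^esub> s" if "r \<in> endos" "s \<in> endos" for r s
    using ring_hom_mult[OF iso, of r s] that dec[OF endos_mult[OF that]] by (simp add: End_def)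
  have dec_one: "dec \<one>\<^bsub>F\<^esub> = \<one>\<^bsub>End\<^esub>"
    using ring_hom_one[OF iso] dec[OF endos_one] by (simp add: End_def)
  define V :: "(nat, 'a) module" where
    "V = \<lparr>carrier = U, monoid.mult = (\<lambda>x y. e), one = e, zero = e, add = pl, module.smult = (\<lambda>k x. dec k x)\<rparr>"
  have V: "abelian_group V"
  proof (rule abelian_groupI)
    fix x assume "x \<in> carrier V"
    then have "df e x \<in> carrier V" "df e x \<oplus>\<^bsub>V\<^esub> x = \<zero>\<^bsub>V\<^esub>" by (auto simp: V_def dfU e pl_df)
    then show "\<exists>y\<in>carrier V. y \<oplus>\<^bsub>V\<^esub> x = \<zero>\<^bsub>V\<^esub>" by blast
  qed (auto simp: V_def plU e pl_assoc pl_left intro: pl_comm)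
  interpret V: abelian_group V by (rule V)
  have M: "Module.module F V"
  proof (rule moduleI)
    show "cring F" by (rule F.is_cring)
    show "abelian_group V" by (rule V)
    fix k x assume "k \<in> carrier F" "x \<in> carrier V"
    then show "k \<odot>\<^bsub>V\<^esub> x \<in> carrier V" using dec endosD(3) by (auto simp: V_def carF)
  next
    fix k l x assume "k \<in> carrier F" "l \<in> carrier F" "x \<in> carrier V"
    then show "(k \<oplus>\<^bsub>F\<^esub> l) \<odot>\<^bsub>V\<^esub> x = k \<odot>\<^bsub>V\<^esub> x \<oplus>\<^bsub>V\<^esub> l \<odot>\<^bsub>V\<^esub> x"
      using dec dec_add by (auto simp: V_def carF End_def)
  next
    fix k x y assume "k \<in> carrier F" "x \<in> carrier V" "y \<in> carrier V"
    then show "k \<odot>\<^bsub>V\<^esub> (x \<oplus>\<^bsub>V\<^esub> y) = k \<odot>\<^bsub>V\<^esub> x \<oplus>\<^bsub>V\<^esub> k \<odot>\<^bsub>V\<^esub> y"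
      using dec endos_add by (auto simp: V_def carF)
  next
    fix k l x assume "k \<in> carrier F" "l \<in> carrier F" "x \<in> carrier V"
    then show "(k \<otimes>\<^bsub>F\<^esub> l) \<odot>\<^bsub>V\<^esub> x = k \<odot>\<^bsub>V\<^esub> (l \<odot>\<^bsub>V\<^esub> x)"
      using dec dec_mult by (auto simp: V_def carF End_def)
  next
    fix x assume "x \<in> carrier V"
    then show "\<one>\<^bsub>F\<^esub> \<odot>\<^bsub>V\<^esub> x = x" by (simp add: V_def dec_one End_def)
  qed
  let ?B = "vs_alg F V"
  have uB: "univ ?B = U" by (simp add: vs_alg_def V_def)
  have neg: "\<ominus>\<^bsub>V\<^esub> x = df e x" if "x \<in> U" for x
    by (rule V.minus_equality) (use that in \<open>auto simp: V_def dfU e pl_df\<close>)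
  have basic: "P (ar ?B f) (opn ?B f)" if fB: "f \<in> symbs ?B" for f
  proof (cases f)
    case VZero then show ?thesis using P_const[OF e] by (simp add: vs_alg_def V_def)
  next
    case VNeg
    have "P 1 (\<lambda>xs. df e (xs ! 0))" by (rule bin_app[OF df P_const[OF e] P_proj]) simp
    then have "P 1 (\<lambda>xs. \<ominus>\<^bsub>V\<^esub> (xs ! 0))" by (rule P_cong) (simp add: neg tuples_nth)
    then show ?thesis using VNeg by (simp add: vs_alg_def)
  next
    case VAdd then show ?thesis using pl by (simp add: vs_alg_def V_def bin_def)
  next
    case (VScale k)
    then obtain r where r: "r \<in> endos" "k = code r" using fB by (auto simp: vs_alg_def carF)
    have "P 1 (\<lambda>xs. r (xs ! 0))" using endosD(1)[OF r(1)] by (simp add: un_def)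
    then show ?thesis using VScale r dec by (simp add: vs_alg_def V_def)
  qed
  have aB: "is_ualg ?B" unfolding is_ualg_def uB using basic P_closed e by blast
  have fB: "finite (univ ?B)" using uB fin by simp
  interpret B: clone U "is_pol ?B" using clone_is_pol[OF aB fB] uB by simp
  have Bpl: "B.bin pl"
    using is_pol_basic[OF aB fB, of VAdd] by (simp add: vs_alg_simps B.bin_def) (simp add: V_def)
  have Bun: "B.un r" if "r \<in> endos" for r
    using is_pol_basic[OF aB fB, of "VScale (code r)"] that dec by (simp add: vs_alg_simps B.un_def carF) (simp add: V_def)
  have "is_pol ?B n p" if p: "P n p" for n p
  proof -
    let ?q = "\<lambda>k xs. p (replicate k e @ drop k xs)"
    have "is_pol ?B n (?q (n - j))" if "j \<le> n" for j
      using that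
    proof (induction j)
      case 0
      have "is_pol ?B n (\<lambda>xs. p (replicate n e))" by (rule B.P_const) (rule P_closed[OF p zeros])
      then show ?case by (rule B.P_cong) (simp add: tuples_length)
    next
      case (Suc j)
      define k where "k = n - Suc j"
      have k: "k < n" "n - j = Suc k" using Suc.prems by (auto simp: k_def)
      let ?r = "\<lambda>x. df (p ((replicate n e)[k := x])) (p (replicate n e))"
      have "un ?r" by (rule un_bin[OF df P_update[OF p zeros k(1)] un_const[OF P_closed[OF p zeros]]])
      moreover have "?r e = e"
        using df_self[OF P_closed[OF p zeros]] k by (metis list_update_id nth_replicate)
      ultimately have r: "restrict ?r U \<in> endos" by (rule restrict_endos)
      have "is_pol ?B n (\<lambda>xs. pl (restrict ?r U (xs ! k)) (?q (Suc k) xs))"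
        using Suc.IH Suc.prems k by (intro B.bin_app[OF Bpl] B.un_app[OF Bun[OF r]] B.P_proj) auto
      then have "is_pol ?B n (?q k)"
      proof (rule B.P_cong)
        fix xs assume xs: "xs \<in> tuples U n"
        let ?ys = "replicate k e @ drop k xs"
        have len: "length xs = n" using xs by (simp add: tuples_length)
        have ys: "?ys \<in> tuples U n"
          using xs e k by (auto simp: tuples_def dest: in_set_dropD)
        have nth: "?ys ! k = xs ! k" using k len by (simp add: nth_append)
        have "?ys[k := e] = replicate (Suc k) e @ drop (Suc k) xs"
          using k len by (intro nth_equalityI) (auto simp: nth_append nth_list_update less_Suc_eq simp del: replicate_Suc)
        then have "df (p ?ys) (?q (Suc k) xs) = ?r (xs ! k)"
          using difference_unary[OF p k(1) ys] nth by simp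
        moreover have "?q (Suc k) xs \<in> U"
          using P_closed[OF p tuples_update[OF ys e, of k]] \<open>?ys[k := e] = _\<close> by simp
        ultimately show "pl (restrict ?r U (xs ! k)) (?q (Suc k) xs) = ?q k xs"
          using pl_df[OF P_closed[OF p ys], of "?q (Suc k) xs"] tuples_nth[OF xs k(1)] by simp
      qed
      then show ?case by (simp add: k_def)
    qed
    from this[of n] show ?thesis by simp
  qed
  moreover have "P n p" if "is_pol ?B n p" for n p
    using uB that basic by (rule is_pol_imp_P)
  moreover have "finite (carrier F)" using carF finite_endos by simp
  ultimately show ?thesis using F M uB by blast
qed

end

context minimal_clone begin

lemma kind_2_exists:
  assumes twin two_dep
  shows "\<exists>(F :: nat ring) (V :: (nat, 'a) module). field F \<and> finite (carrier F) \<and> Module.module F V \<and>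
     univ (vs_alg F V) = U \<and> (\<forall>n p. is_pol (vs_alg F V) n p \<longleftrightarrow> P n p)"
proof -
  obtain e where e: "e \<in> U" using two_elements by blast
  obtain pl df where "bin pl" "bin df"
    "\<And>x. x \<in> U \<Longrightarrow> pl e x = x" "\<And>x. x \<in> U \<Longrightarrow> pl x e = x"
    "\<And>x. x \<in> U \<Longrightarrow> df x x = e" "\<And>x. x \<in> U \<Longrightarrow> df x e = x"
    using loop_operations[OF assms e] by blast
  then interpret affine_clone U P e pl df
    using assms(1) e by unfold_locales auto
  show ?thesis by (rule vector_space_exists)
qed

lemma kind_of_vs_alg:
  assumes M: "Module.module F V" and U: "univ (vs_alg F V) = U"
    and eq: "\<And>n p. is_pol (vs_alg F V) n p \<longleftrightarrow> P n p"
  shows two_dep twin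
proof -
  interpret Module.module F V by (rule M)
  have UV: "U = carrier V" using U by (simp add: vs_alg_def)
  have aB: "is_ualg (vs_alg F V)"
    by (auto simp: is_ualg_def vs_alg_def tuples_def intro!: M.add.inv_closed M.a_closed smult_closed)
  have fB: "finite (univ (vs_alg F V))" using fin U by simp
  have "is_pol (vs_alg F V) 2 (\<lambda>xs. xs ! 0 \<oplus>\<^bsub>V\<^esub> xs ! 1)"
    using is_pol_basic[OF aB fB, of VAdd] by (simp add: vs_alg_simps)
  then have add: "bin (\<lambda>x y. x \<oplus>\<^bsub>V\<^esub> y)" using eq by (simp add: bin_def)
  obtain a b where ab: "a \<in> U" "b \<in> U" "a \<noteq> b" using two_elements by blast
  have "a \<oplus>\<^bsub>V\<^esub> \<zero>\<^bsub>V\<^esub> \<noteq> b \<oplus>\<^bsub>V\<^esub> \<zero>\<^bsub>V\<^esub>" "\<zero>\<^bsub>V\<^esub> \<oplus>\<^bsub>V\<^esub> a \<noteq> \<zero>\<^bsub>V\<^esub> \<oplus>\<^bsub>V\<^esub> b" "\<zero>\<^bsub>V\<^esub> \<in> U"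
    using ab UV by simp_all
  then show two_dep unfolding two_dep_def using add ab by blast
  show twin unfolding twin_def
  proof (intro allI impI ballI)
    fix f c d assume f: "bin f" and cd: "c \<in> U" "d \<in> U" and inj: "inj_on (\<lambda>x. f x c) U"
    have p: "is_pol (vs_alg F V) 2 (\<lambda>xs. f (xs ! 0) (xs ! 1))" using f eq by (simp add: bin_def)
    have "(\<forall>xs\<in>tuples U 2. p xs \<in> carrier V) \<and> (\<forall>x\<in>U. \<forall>x'\<in>U. \<forall>y\<in>U. \<forall>y'\<in>U.
        p [x, y] \<oplus>\<^bsub>V\<^esub> p [x', y'] = p [x, y'] \<oplus>\<^bsub>V\<^esub> p [x', y])"
      if "is_pol (vs_alg F V) 2 p" for p
      using that
    proof (induction rule: is_pol_induct)
      case (cong p q)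
      have "p [x, y] = q [x, y]" if "x \<in> U" "y \<in> U" for x y
        using cong(2)[of "[x, y]"] that U by (simp add: tuples_def)
      then show ?case using cong U by simp
    next
      case (proj i)
      then have "i = 0 \<or> i = 1" by auto
      then show ?case using UV by (auto simp: tuples_nth M.a_comm)
    next
      case (const a)
      then show ?case using U UV by simp
    next
      case (app g gs)
      have tup: "[x, y] \<in> tuples U 2" if "x \<in> U" "y \<in> U" for x y using that by (simp add: tuples_def)
      show ?case
      proof (cases g)
        case VZero
        then show ?thesis by (simp add: vs_alg_def)
      next
        case VNeg
        then obtain h where gs: "gs = [h]" using app by (auto simp: vs_alg_def length_Suc_conv)
        show ?thesis using app(3)[of h] gs VNeg tup
          by (simp add: vs_alg_def M.minus_add[symmetric])
      next
        case VAdd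
        then have "length gs = Suc (Suc 0)" using app by (auto simp: vs_alg_def)
        then obtain h h' where gs: "gs = [h, h']" by (auto simp: length_Suc_conv)
        have h: "h [x, y] \<in> carrier V" "h' [x, y] \<in> carrier V" if "x \<in> U" "y \<in> U" for x y
          using app(3)[of h] app(3)[of h'] gs tup that by auto
        have "(h [x, y] \<oplus>\<^bsub>V\<^esub> h' [x, y]) \<oplus>\<^bsub>V\<^esub> (h [x', y'] \<oplus>\<^bsub>V\<^esub> h' [x', y']) =
          (h [x, y'] \<oplus>\<^bsub>V\<^esub> h' [x, y']) \<oplus>\<^bsub>V\<^esub> (h [x', y] \<oplus>\<^bsub>V\<^esub> h' [x', y])"
          if "x \<in> U" "x' \<in> U" "y \<in> U" "y' \<in> U" for x x' y y'
        proof -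
          have "(h [x, y] \<oplus>\<^bsub>V\<^esub> h' [x, y]) \<oplus>\<^bsub>V\<^esub> (h [x', y'] \<oplus>\<^bsub>V\<^esub> h' [x', y']) =
            (h [x, y] \<oplus>\<^bsub>V\<^esub> h [x', y']) \<oplus>\<^bsub>V\<^esub> (h' [x, y] \<oplus>\<^bsub>V\<^esub> h' [x', y'])"
            using h that by (simp add: M.a_ac)
          also have "\<dots> = (h [x, y'] \<oplus>\<^bsub>V\<^esub> h [x', y]) \<oplus>\<^bsub>V\<^esub> (h' [x, y'] \<oplus>\<^bsub>V\<^esub> h' [x', y])"
            using app(3)[of h] app(3)[of h'] gs that by simp
          also have "\<dots> = (h [x, y'] \<oplus>\<^bsub>V\<^esub> h' [x, y']) \<oplus>\<^bsub>V\<^esub> (h [x', y] \<oplus>\<^bsub>V\<^esub> h' [x', y])"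
            using h that by (simp add: M.a_ac)
          finally show ?thesis .
        qed
        then show ?thesis using app(3)[of h] app(3)[of h'] gs VAdd by (simp add: vs_alg_def)
      next
        case (VScale k)
        then obtain h where gs: "gs = [h]" using app by (auto simp: vs_alg_def length_Suc_conv)
        have k: "k \<in> carrier F" using app VScale by (auto simp: vs_alg_def)
        show ?thesis using app(3)[of h] gs VScale tup k
          by (simp add: vs_alg_def smult_r_distr[symmetric])
      qed
    qed
    from this[OF p] have
      par: "\<And>x x' y y'. x \<in> U \<Longrightarrow> x' \<in> U \<Longrightarrow> y \<in> U \<Longrightarrow> y' \<in> U \<Longrightarrow>
        f x y \<oplus>\<^bsub>V\<^esub> f x' y' = f x y' \<oplus>\<^bsub>V\<^esub> f x' y"
      by auto
    have cl: "f x y \<in> carrier V" if "x \<in> U" "y \<in> U" for x y using bin_closed[OF f that] UV by simp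
    show "inj_on (\<lambda>x. f x d) U"
    proof (rule inj_onI)
      fix x x' assume *: "x \<in> U" "x' \<in> U" "f x d = f x' d"
      have "f x c \<oplus>\<^bsub>V\<^esub> f x' d = f x d \<oplus>\<^bsub>V\<^esub> f x' c" using par[OF *(1,2) cd] .
      then have "f x c \<oplus>\<^bsub>V\<^esub> f x' d = f x' c \<oplus>\<^bsub>V\<^esub> f x' d"
        using * cd cl M.a_comm[of "f x' d" "f x' c"] by simp
      then have "f x c = f x' c" using * cd cl by simp
      then show "x = x'" using inj_onD[OF inj] * by blast
    qed
  qed
qed

lemma kind_of_unary:
  assumes B: "unary_permutational B" and U: "univ B = U" and eq: "\<And>n p. is_pol B n p \<longleftrightarrow> P n p"
  shows "\<not> two_dep"
proof
  assume two_dep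
  then obtain f a b c a' b' c' where f: "bin f" "a \<in> U" "b \<in> U" "c \<in> U" "f a c \<noteq> f b c"
    "a' \<in> U" "b' \<in> U" "c' \<in> U" "f c' a' \<noteq> f c' b'" unfolding two_dep_def by blast
  have "is_pol B 2 (\<lambda>xs. f (xs ! 0) (xs ! 1))" using f(1) eq by (simp add: bin_def)
  moreover have "\<exists>u i. i < 2 \<and> (\<forall>xs\<in>tuples U 2. p xs = u (xs ! i))" if "is_pol B 2 p" for p
    using that
  proof (induction rule: is_pol_induct)
    case (cong p q)
    then show ?case using U by metis
  next
    case (proj i)
    then show ?case by (intro exI[of _ "\<lambda>x. x"] exI[of _ i]) simp
  next
    case (const a)
    show ?case by (intro exI[of _ "\<lambda>_. a"] exI[of _ 0]) simp
  next
    case (app g gs)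
    then have "length gs = 1" using B by (auto simp: unary_permutational_def)
    then obtain h where h: "gs = [h]" by (auto simp: length_Suc_conv)
    then obtain u i where ui: "i < 2" "\<forall>xs\<in>tuples U 2. h xs = u (xs ! i)" using app(3)[of h] by auto
    then show ?case
      using h by (intro exI[of _ "\<lambda>x. opn B g [u x]"] exI[of _ i]) simp
  qed
  ultimately obtain u i where i: "i < 2" and ui: "\<And>xs. xs \<in> tuples U 2 \<Longrightarrow> f (xs ! 0) (xs ! 1) = u (xs ! i)"
    by blast
  have "f x y = u ([x, y] ! i)" if "x \<in> U" "y \<in> U" for x y
    using ui[of "[x, y]"] that by (simp add: tuples_def)
  moreover have "i = 0 \<or> i = 1" using i by auto
  ultimately show False using f(2-) by auto
qed

end

section \<open>The type of a simple algebra\<close>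

lemma has_kind_iff:
  fixes M :: "('t, 'b) ualg"
  assumes M: "minimal_clone (univ M) (is_pol M)"
  shows "has_kind M i \<longleftrightarrow> i = clone.kind (univ M) (is_pol M)"
proof -
  interpret minimal_clone "univ M" "is_pol M" by (rule M)
  have two: "poly_equiv M (two_alg S b t) \<longleftrightarrow>
    univ M = {b, t} \<and> (\<forall>n p. is_pol (two_alg S b t) n p \<longleftrightarrow> is_pol M n p)" for S b t
    unfolding poly_equiv_iff by (auto simp: two_alg_def)
  have k1: "kind = 1"
    if "is_ualg B" "unary_permutational B" "poly_equiv M B" for B :: "('b \<Rightarrow> 'b, 'b) ualg"
    using that kind_of_unary[of B] unfolding poly_equiv_iff kind_def by auto
  have k2: "kind = 2" if "Module.module F V" "poly_equiv M (vs_alg F V)"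
    for F :: "nat ring" and V :: "(nat, 'b) module"
    using that kind_of_vs_alg[of F V] unfolding poly_equiv_iff kind_def by auto
  have k3: "kind = 3" if "b \<noteq> t" "poly_equiv M (two_alg {Bot, Top, Compl, Meet, Join} b t)" for b t
    using that kind_of_two_alg(1,2)[of b t "{Bot, Top, Compl, Meet, Join}"] not_twin_two_dep
    unfolding two kind_def by auto
  have k4: "kind = 4" if "b \<noteq> t" "poly_equiv M (two_alg {Meet, Join} b t)" for b t
    using that kind_of_two_alg(1,3,4)[of b t "{Meet, Join}"] not_twin_two_dep
    unfolding two kind_def by auto
  have k5: "kind = 5" if "b \<noteq> t" "poly_equiv M (two_alg {Meet} b t)" for b t
    using that kind_of_two_alg(1,3,5)[of b t "{Meet}"] not_twin_two_dep
    unfolding two kind_def by auto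
  have "has_kind M kind"
  proof (cases "two_dep \<and> \<not> twin")
    case True
    then obtain b t where bt: "b \<noteq> t" "{b, t} = univ M"
      "\<forall>n p. is_pol (two_alg (if moving then {Bot, Top, Compl, Meet, Join}
        else if latticed then {Meet, Join} else {Meet}) b t) n p \<longleftrightarrow> is_pol M n p"
      using kind_345_exists by blast
    then have "poly_equiv M (two_alg (if moving then {Bot, Top, Compl, Meet, Join}
        else if latticed then {Meet, Join} else {Meet}) b t)" unfolding two by blast
    then show ?thesis unfolding has_kind_def using bt(1) True by (auto simp: kind_def) blast+
  next
    case False
    then consider "\<not> two_dep" | "two_dep" "twin" by blast
    then show ?thesis
    proof cases
      case 1
      then obtain B :: "('b \<Rightarrow> 'b, 'b) ualg" where "is_ualg B" "unary_permutational B" "poly_equiv M B"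
        using kind_1_exists unfolding poly_equiv_iff by metis
      then show ?thesis using 1 unfolding has_kind_def kind_def by auto
    next
      case 2
      then obtain F :: "nat ring" and V :: "(nat, 'b) module" where
        "field F" "finite (carrier F)" "Module.module F V" "poly_equiv M (vs_alg F V)"
        using kind_2_exists unfolding poly_equiv_iff by metis
      then show ?thesis using 2 unfolding has_kind_def kind_def by auto
    qed
  qed
  moreover have "i = kind" if "has_kind M i"
    using that k1 k2 k3 k4 k5 unfolding has_kind_def by auto
  ultimately show ?thesis by blast
qed

locale clone_hom = C: clone U P + D: clone V Q for U :: "'a set" and P and V :: "'b set" and Q +
  fixes \<phi> :: "'a \<Rightarrow> 'b" and \<psi> :: "'b \<Rightarrow> 'a"
  assumes phi: "x \<in> U \<Longrightarrow> \<phi> x \<in> V" and psi: "y \<in> V \<Longrightarrow> \<psi> y \<in> U"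
    and psi_phi: "x \<in> U \<Longrightarrow> \<psi> (\<phi> x) = x" and phi_psi: "y \<in> V \<Longrightarrow> \<phi> (\<psi> y) = y"
    and transport: "P n p \<Longrightarrow> Q n (\<lambda>ys. \<phi> (p (map \<psi> ys)))"
begin

lemma phi_inj: "x \<in> U \<Longrightarrow> y \<in> U \<Longrightarrow> \<phi> x = \<phi> y \<longleftrightarrow> x = y"
  using psi_phi by metis

lemma psi_inj: "x \<in> V \<Longrightarrow> y \<in> V \<Longrightarrow> \<psi> x = \<psi> y \<longleftrightarrow> x = y"
  using phi_psi by metis

lemma un_transport: assumes "C.un f" shows "D.un (\<lambda>x. \<phi> (f (\<psi> x)))"
  unfolding D.un_def by (rule D.P_cong[OF transport[OF assms[unfolded C.un_def]]]) (simp add: tuples_length)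

lemma bin_transport: assumes "C.bin f" shows "D.bin (\<lambda>x y. \<phi> (f (\<psi> x) (\<psi> y)))"
  unfolding D.bin_def by (rule D.P_cong[OF transport[OF assms[unfolded C.bin_def]]]) (simp add: tuples_length)

lemma inj_transport:
  assumes "\<And>x. x \<in> U \<Longrightarrow> g x \<in> U" shows "inj_on (\<lambda>x. \<phi> (g (\<psi> x))) V \<longleftrightarrow> inj_on g U"
proof
  assume L: "inj_on (\<lambda>x. \<phi> (g (\<psi> x))) V"
  show "inj_on g U"
  proof (rule inj_onI)
    fix x y assume *: "x \<in> U" "y \<in> U" "g x = g y"
    then have "\<phi> x = \<phi> y" using inj_onD[OF L, of "\<phi> x" "\<phi> y"] phi psi_phi by simp
    then show "x = y" using * phi_inj by blast
  qed
next
  assume R: "inj_on g U"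
  show "inj_on (\<lambda>x. \<phi> (g (\<psi> x))) V"
  proof (rule inj_onI)
    fix x y assume *: "x \<in> V" "y \<in> V" "\<phi> (g (\<psi> x)) = \<phi> (g (\<psi> y))"
    then have "g (\<psi> x) = g (\<psi> y)" using phi_inj assms psi by blast
    then have "\<psi> x = \<psi> y" using R * psi by (auto dest: inj_onD)
    then show "x = y" using * psi_inj by blast
  qed
qed

lemma two_dep_transport: assumes "C.two_dep" shows "D.two_dep"
proof -
  obtain f a b c a' b' c' where f: "C.bin f" "a \<in> U" "b \<in> U" "c \<in> U" "f a c \<noteq> f b c"
    "a' \<in> U" "b' \<in> U" "c' \<in> U" "f c' a' \<noteq> f c' b'" using assms unfolding C.two_dep_def by blast
  let ?g = "\<lambda>x y. \<phi> (f (\<psi> x) (\<psi> y))"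
  have "?g (\<phi> a) (\<phi> c) \<noteq> ?g (\<phi> b) (\<phi> c)" "?g (\<phi> c') (\<phi> a') \<noteq> ?g (\<phi> c') (\<phi> b')"
    using f phi_inj psi_phi C.bin_closed[OF f(1)] by auto
  then show ?thesis unfolding D.two_dep_def using bin_transport[OF f(1)] f phi by blast
qed

lemma not_twin_transport: assumes "\<not> C.twin" shows "\<not> D.twin"
proof
  assume D: D.twin
  obtain f c d where f: "C.bin f" "c \<in> U" "d \<in> U" "inj_on (\<lambda>x. f x c) U" "\<not> inj_on (\<lambda>x. f x d) U"
    using assms unfolding C.twin_def by blast
  have *: "inj_on (\<lambda>x. \<phi> (f (\<psi> x) (\<psi> (\<phi> c)))) V \<longleftrightarrow> inj_on (\<lambda>x. f x c) U" if "c \<in> U" for c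
    using inj_transport[of "\<lambda>x. f x c"] C.bin_closed[OF f(1)] that psi_phi by simp
  have "inj_on (\<lambda>x. \<phi> (f (\<psi> x) (\<psi> (\<phi> d)))) V"
    using D bin_transport[OF f(1)] phi[OF f(2)] phi[OF f(3)] *[OF f(2)] f(4) unfolding D.twin_def by blast
  then show False using *[OF f(3)] f(5) by blast
qed

lemma moving_transport: assumes "C.moving" shows "D.moving"
proof -
  obtain f x where f: "C.un f" "inj_on f U" "x \<in> U" "f x \<noteq> x" using assms unfolding C.moving_def by blast
  let ?g = "\<lambda>x. \<phi> (f (\<psi> x))"
  have "inj_on ?g V" using inj_transport[of f] C.un_closed[OF f(1)] f(2) by blast
  moreover have "?g (\<phi> x) \<noteq> \<phi> x" using f psi_phi phi_inj C.un_closed[OF f(1)] by auto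
  ultimately show ?thesis unfolding D.moving_def using un_transport[OF f(1)] phi[OF f(3)] by blast
qed

lemma latticed_transport: assumes "C.latticed" shows "D.latticed"
proof -
  obtain b t where bt: "b \<in> U" "t \<in> U" "b \<noteq> t" "C.bin (C.meet b t)" "C.bin (C.join b t)"
    using assms unfolding C.latticed_def by blast
  have eq: "\<psi> x = t \<longleftrightarrow> x = \<phi> t" "\<psi> x = b \<longleftrightarrow> x = \<phi> b" if "x \<in> V" for x
    using that bt psi_phi phi_psi by metis+
  have "D.bin (D.meet (\<phi> b) (\<phi> t))"
    by (rule D.bin_cong[OF bin_transport[OF bt(4)]]) (use eq in auto)
  moreover have "D.bin (D.join (\<phi> b) (\<phi> t))"
    by (rule D.bin_cong[OF bin_transport[OF bt(5)]]) (use eq in auto)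
  ultimately show ?thesis unfolding D.latticed_def using bt phi phi_inj by blast
qed

end

lemma kind_transport:
  assumes "clone_hom U P V Q \<phi> \<psi>" "clone_hom V Q U P \<psi> \<phi>"
  shows "clone.kind U P = clone.kind V Q"
proof -
  interpret f: clone_hom U P V Q \<phi> \<psi> by (rule assms(1))
  interpret g: clone_hom V Q U P \<psi> \<phi> by (rule assms(2))
  show ?thesis unfolding f.C.kind_def f.D.kind_def
    using f.two_dep_transport g.two_dep_transport f.not_twin_transport g.not_twin_transport
      f.moving_transport g.moving_transport f.latticed_transport g.latticed_transport by auto
qed

lemma funpow_image: assumes "f ` U = U" shows "(f ^^ i) ` U = U"
proof (induction i)
  case (Suc i)
  have "(f ^^ Suc i) ` U = f ` ((f ^^ i) ` U)" by (simp add: image_comp)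
  then show ?case using Suc assms by simp
qed simp

locale simple_alg =
  fixes A :: "('s, 'a) ualg"
  assumes alg: "is_ualg A" and finA: "finite (univ A)" and simp: "simple A"
begin

sublocale clone "univ A" "is_pol A" by (rule clone_is_pol[OF alg finA])

lemma poly_images_iff: "V \<in> poly_images A \<longleftrightarrow> (\<exists>f. un f \<and> V = f ` univ A)"
proof
  assume "V \<in> poly_images A"
  then obtain p where p: "p \<in> poly_ops A 1" "V = (\<lambda>x. p [x]) ` univ A" by (auto simp: poly_images_def)
  have "is_pol A 1 p" using p(1) poly_opsD[OF p(1)] by (simp add: is_pol_def)
  then have "un (\<lambda>x. p [x])" unfolding un_def
    by (rule P_cong) (auto simp: tuples_1[unfolded One_nat_def])
  then show "\<exists>f. un f \<and> V = f ` univ A" using p by blast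
next
  assume "\<exists>f. un f \<and> V = f ` univ A"
  then obtain f where f: "un f" "V = f ` univ A" by blast
  let ?p = "restrict (\<lambda>xs. f (xs ! 0)) (tuples (univ A) 1)"
  have "?p \<in> poly_ops A 1" using f(1) by (simp add: un_def is_pol_def)
  moreover have "V = (\<lambda>x. ?p [x]) ` univ A" using f(2) by (auto simp: tuples_def image_iff)
  ultimately show "V \<in> poly_images A" unfolding poly_images_def by blast
qed

lemma minimal_set_subset: "minimal_set A U \<Longrightarrow> U \<subseteq> univ A"
  unfolding minimal_set_def poly_images_iff using un_closed by blast

lemma minimal_set_exists: "\<exists>U. minimal_set A U"
proof -
  have "univ A \<in> poly_images A" unfolding poly_images_iff using un_id by (intro exI[of _ "\<lambda>x. x"]) simp
  moreover have "card (univ A) \<ge> 2" using simp by (simp add: simple_def)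
  ultimately obtain U where U: "U \<in> poly_images A" "card U \<ge> 2"
    "\<And>V. V \<in> poly_images A \<Longrightarrow> card V \<ge> 2 \<Longrightarrow> card U \<le> card V"
    using ex_has_least_nat[of "\<lambda>U. U \<in> poly_images A \<and> card U \<ge> 2" "univ A" card] by blast
  moreover have "V = U" if "V \<in> poly_images A" "card V \<ge> 2" "V \<subseteq> U" for V
    using U that card_seteq[of U V] card_ge_0_finite[of U] by force
  ultimately show ?thesis unfolding minimal_set_def by blast
qed

text \<open>The pairs not separated by polynomials into \<open>U\<close> form a congruence, which is not full.\<close>

lemma separation:
  assumes U: "minimal_set A U" and ab: "a \<in> univ A" "b \<in> univ A" "a \<noteq> b"
  obtains f where "un f" "\<And>x. x \<in> univ A \<Longrightarrow> f x \<in> U" "f a \<noteq> f b"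
proof -
  define \<theta> where "\<theta> = {(x, y). x \<in> univ A \<and> y \<in> univ A \<and>
    (\<forall>f. un f \<and> (\<forall>z\<in>univ A. f z \<in> U) \<longrightarrow> f x = f y)}"
  have "congruence A \<theta>"
    unfolding congruence_def
  proof (intro conjI ballI impI)
    show "equiv (univ A) \<theta>"
      by (rule equivI) (auto simp: \<theta>_def refl_on_def sym_def trans_def)
  next
    fix g xs ys assume g: "g \<in> symbs A" and xs: "xs \<in> tuples (univ A) (ar A g)"
      and ys: "ys \<in> tuples (univ A) (ar A g)" and th: "\<forall>i<ar A g. (xs ! i, ys ! i) \<in> \<theta>"
    have Pg: "is_pol A (ar A g) (opn A g)" by (rule is_pol_basic[OF alg finA g])
    have "f (opn A g xs) = f (opn A g ys)" if f: "un f" "\<forall>z\<in>univ A. f z \<in> U" for f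
    proof -
      have len: "length xs = ar A g" "length ys = ar A g" using xs ys by (auto simp: tuples_length)
      have "k \<le> ar A g \<Longrightarrow> f (opn A g (take k ys @ drop k xs)) = f (opn A g xs)" for k
      proof (induction k)
        case (Suc k)
        let ?zs = "take k ys @ drop k xs"
        have k: "k < ar A g" using Suc by simp
        have zs: "?zs \<in> tuples (univ A) (ar A g)" by (rule take_drop_tuples[OF xs ys])
        have step: "take (Suc k) ys @ drop (Suc k) xs = ?zs[k := ys ! k]"
          using take_drop_step[of k xs ys] k len by simp
        have nth: "?zs ! k = xs ! k" using k len by (simp add: nth_append)
        have id: "?zs[k := xs ! k] = ?zs" using nth by (metis list_update_id)
        let ?h = "\<lambda>x. f (opn A g (?zs[k := x]))"
        have "un ?h" by (rule un_comp[OF f(1) P_update[OF Pg zs k]])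
        moreover have "\<forall>z\<in>univ A. ?h z \<in> U"
          using f(2) P_closed[OF Pg tuples_update[OF zs]] by blast
        ultimately have "?h (xs ! k) = ?h (ys ! k)" using th k unfolding \<theta>_def by blast
        then show ?case using Suc step id by simp
      qed simp
      from this[of "ar A g"] show ?thesis using len by simp
    qed
    moreover have "opn A g xs \<in> univ A" "opn A g ys \<in> univ A" using P_closed[OF Pg] xs ys by auto
    ultimately show "(opn A g xs, opn A g ys) \<in> \<theta>" unfolding \<theta>_def by blast
  qed
  moreover have "\<theta> \<noteq> univ A \<times> univ A"
  proof
    assume full: "\<theta> = univ A \<times> univ A"
    obtain p where p: "un p" "U = p ` univ A" using U unfolding minimal_set_def poly_images_iff by blast
    have "card U \<ge> 2" using U by (simp add: minimal_set_def)
    then obtain u v where "u \<in> U" "v \<in> U" "u \<noteq> v" by (rule card_ge_2E)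
    then obtain x y where xy: "x \<in> univ A" "y \<in> univ A" "p x \<noteq> p y" using p by blast
    have "(x, y) \<in> \<theta>" using full xy by blast
    then show False using p xy unfolding \<theta>_def by blast
  qed
  ultimately have "\<theta> = Id_on (univ A)" using simp unfolding simple_def by blast
  then have "(a, b) \<notin> \<theta>" using ab by auto
  then show ?thesis using that ab unfolding \<theta>_def by blast
qed

lemma minimal_set_image:
  assumes U: "minimal_set A U" and V: "minimal_set A V" and f: "un f" "\<And>x. x \<in> U \<Longrightarrow> f x \<in> V"
    and ab: "a \<in> U" "b \<in> U" "f a \<noteq> f b"
  shows "f ` U = V"
proof -
  obtain p where p: "un p" "U = p ` univ A" using U unfolding minimal_set_def poly_images_iff by blast
  have "f ` U = (\<lambda>x. f (p x)) ` univ A" using p(2) by auto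
  then have "f ` U \<in> poly_images A" unfolding poly_images_iff using un_comp[OF f(1) p(1)] by blast
  moreover have "f ` U \<subseteq> V" using f by blast
  moreover have "card (f ` U) \<ge> 2"
  proof -
    have "{f a, f b} \<subseteq> f ` U" using ab by blast
    moreover have "finite (f ` U)" using minimal_set_subset[OF U] finA finite_subset by blast
    ultimately have "card {f a, f b} \<le> card (f ` U)" by (intro card_mono)
    then show ?thesis using ab by simp
  qed
  ultimately show ?thesis using V unfolding minimal_set_def by blast
qed

lemma minimal_set_map:
  assumes U: "minimal_set A U" and V: "minimal_set A V"
  obtains f where "un f" "\<And>x. x \<in> univ A \<Longrightarrow> f x \<in> V" "f ` U = V"
proof -
  have "card U \<ge> 2" using U by (simp add: minimal_set_def)
  then obtain a b where ab: "a \<in> U" "b \<in> U" "a \<noteq> b" by (rule card_ge_2E)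
  then have "a \<in> univ A" "b \<in> univ A" using minimal_set_subset[OF U] by auto
  then obtain f where f: "un f" "\<And>x. x \<in> univ A \<Longrightarrow> f x \<in> V" "f a \<noteq> f b"
    using separation[OF V _ _ ab(3)] by metis
  then have "f ` U = V" using minimal_set_image[OF U V f(1) _ ab(1,2) f(3)] minimal_set_subset[OF U] by blast
  then show ?thesis using that f by blast
qed

lemma minimal_set_clone:
  assumes U: "minimal_set A U" shows "minimal_clone U (pol_on A U)"
proof -
  note sub = minimal_set_subset[OF U]
  interpret U: clone U "pol_on A U" by (rule clone_pol_on[OF alg finA sub])
  show ?thesis
  proof
    show fin: "finite U" using sub finA by (rule finite_subset)
    show "card U \<ge> 2" using U by (simp add: minimal_set_def)
    fix f assume f: "U.un f"
    show "inj_on f U \<or> (\<exists>c. \<forall>x\<in>U. f x = c)"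
    proof (rule disjCI)
      assume "\<nexists>c. \<forall>x\<in>U. f x = c"
      then obtain a b where ab: "a \<in> U" "b \<in> U" "f a \<noteq> f b" by metis
      obtain q where q: "is_pol A 1 q" "\<forall>xs\<in>tuples U 1. f (xs ! 0) = q xs"
        using f unfolding U.un_def pol_on_def by blast
      have g: "un (\<lambda>x. q [x])" unfolding un_def by (rule P_cong[OF q(1)]) (auto simp: tuples_1[unfolded One_nat_def])
      have fg: "f x = q [x]" if "x \<in> U" for x using q(2) that by (auto simp: tuples_1[unfolded One_nat_def])
      have "q [x] \<in> U" if "x \<in> U" for x using U.un_closed[OF f that] fg[OF that] by simp
      from minimal_set_image[OF U U g this ab(1,2)] have "(\<lambda>x. q [x]) ` U = U"
        using ab fg by simp
      then have "f ` U = U" using fg by (simp cong: image_cong)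
      then show "inj_on f U" using fin by (simp add: finite_surj_inj)
    qed
  qed
qed

lemma idempotent_retraction:
  assumes U: "minimal_set A U"
  obtains r where "un r" "\<And>x. x \<in> univ A \<Longrightarrow> r x \<in> U" "\<And>x. x \<in> U \<Longrightarrow> r x = x"
proof -
  obtain f where f: "un f" "\<And>x. x \<in> univ A \<Longrightarrow> f x \<in> U" "f ` U = U" using minimal_set_map[OF U U] by blast
  have finU: "finite U" using minimal_set_subset[OF U] finA by (rule finite_subset)
  obtain k where k: "k > 0" "\<And>f x. f \<in> U \<rightarrow> U \<Longrightarrow> x \<in> U \<Longrightarrow> (f ^^ k) ((f ^^ k) x) = (f ^^ k) x"
    using idempotent_power[OF finU] by blast
  have surj: "(f ^^ i) ` U = U" for i
    by (rule funpow_image[OF f(3)])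
  have fU: "f \<in> U \<rightarrow> U" using f(3) by auto
  have "(f ^^ k) x = x" if x: "x \<in> U" for x
  proof -
    obtain y where "y \<in> U" "x = (f ^^ k) y" using surj[of k] x by blast
    then show ?thesis using k(2)[OF fU] by simp
  qed
  moreover have "(f ^^ k) x \<in> U" if "x \<in> univ A" for x
  proof -
    obtain j where j: "k = Suc j" using k by (cases k) auto
    show ?thesis unfolding j using f(2) un_closed[OF un_funpow[OF f(1)] that] by simp
  qed
  ultimately show ?thesis using that un_funpow[OF f(1)] by blast
qed

lemma minimal_sets_hom:
  assumes U: "minimal_set A U" and V: "minimal_set A V"
  shows "\<exists>\<phi> \<psi>. clone_hom U (pol_on A U) V (pol_on A V) \<phi> \<psi> \<and> clone_hom V (pol_on A V) U (pol_on A U) \<psi> \<phi>"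
proof -
  obtain f where f: "un f" "\<And>x. x \<in> univ A \<Longrightarrow> f x \<in> V" "f ` U = V" using minimal_set_map[OF U V] by blast
  obtain g where g: "un g" "\<And>x. x \<in> univ A \<Longrightarrow> g x \<in> U" "g ` V = U" using minimal_set_map[OF V U] by blast
  note subU = minimal_set_subset[OF U] and subV = minimal_set_subset[OF V]
  have finU: "finite U" using subU finA by (rule finite_subset)
  obtain k where k: "k > 0" "\<And>f x. f \<in> U \<rightarrow> U \<Longrightarrow> x \<in> U \<Longrightarrow> (f ^^ k) ((f ^^ k) x) = (f ^^ k) x"
    using idempotent_power[OF finU] by blast
  then obtain j where j: "k = Suc j" by (cases k) auto
  let ?h = "\<lambda>x. g (f x)"
  have hU: "?h ` U = U" using f(3) g(3) by (metis image_image)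
  have surj: "(?h ^^ i) ` U = U" for i
    by (rule funpow_image[OF hU])
  have hF: "?h \<in> U \<rightarrow> U" using hU by auto
  have hk: "(?h ^^ k) x = x" if x: "x \<in> U" for x
  proof -
    obtain y where "y \<in> U" "x = (?h ^^ k) y" using surj[of k] x by blast
    then show ?thesis using k(2)[OF hF] by simp
  qed
  define \<psi> where "\<psi> = (\<lambda>y. (?h ^^ j) (g y))"
  have un\<psi>: "un \<psi>" unfolding \<psi>_def by (rule un_comp[OF un_funpow[OF un_comp[OF g(1) f(1)]] g(1)])
  have \<psi>U: "\<psi> y \<in> U" if "y \<in> univ A" for y unfolding \<psi>_def using surj[of j] g(2)[OF that] by blast
  have \<psi>f: "\<psi> (f x) = x" if "x \<in> U" for x
    using hk[OF that] funpow_swap1[of ?h j x] by (simp add: \<psi>_def j)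
  have f\<psi>: "f (\<psi> y) = y" if y: "y \<in> V" for y
  proof -
    obtain x where "x \<in> U" "y = f x" using f(3) y by blast
    then show ?thesis using \<psi>f by simp
  qed
  have tr: "pol_on A V' n (\<lambda>ys. a (p (map b ys)))"
    if p: "pol_on A U' n p" and a: "un a" "\<And>x. x \<in> univ A \<Longrightarrow> a x \<in> V'" and b: "un b" "\<And>y. y \<in> univ A \<Longrightarrow> b y \<in> U'"
      and sub: "U' \<subseteq> univ A" "V' \<subseteq> univ A" for U' V' n p a b
  proof -
    obtain q where q: "is_pol A n q" "\<forall>xs\<in>tuples U' n. p xs = q xs" using p unfolding pol_on_def by blast
    have "is_pol A n (\<lambda>xs. q (map (\<lambda>q. q xs) (map (\<lambda>i xs. b (xs ! i)) [0..<n])))"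
      by (rule P_comp[OF q(1)]) (auto intro!: un_app[OF b(1)] P_proj)
    from un_app[OF a(1) this] have "is_pol A n (\<lambda>ys. a (q (map b ys)))"
      by (rule P_cong) (auto simp: tuples_def intro!: arg_cong[of _ _ a] arg_cong[of _ _ q] nth_equalityI)
    moreover have "map b ys \<in> tuples U' n" if "ys \<in> tuples V' n" for ys
      using that b(2) sub by (auto intro!: tuples_map)
    moreover have "p xs \<in> univ A" if "xs \<in> tuples U' n" for xs
      using p that sub unfolding pol_on_def by blast
    ultimately show ?thesis unfolding pol_on_def using q(2) a(2) by (metis (no_types, lifting))
  qed
  have "clone_hom U (pol_on A U) V (pol_on A V) f \<psi>"
    unfolding clone_hom_def clone_hom_axioms_def
    using clone_pol_on[OF alg finA subU] clone_pol_on[OF alg finA subV] \<psi>f f\<psi> f(2) \<psi>U subU subV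
      tr[OF _ f(1,2) un\<psi> \<psi>U subU subV] by blast
  moreover have "clone_hom V (pol_on A V) U (pol_on A U) \<psi> f"
    unfolding clone_hom_def clone_hom_axioms_def
    using clone_pol_on[OF alg finA subU] clone_pol_on[OF alg finA subV] \<psi>f f\<psi> f(2) \<psi>U subU subV
      tr[OF _ un\<psi> \<psi>U f(1,2) subV subU] by blast
  ultimately show ?thesis by blast
qed

lemma typ_of_eq:
  assumes U: "minimal_set A U" shows "typ_of A = clone.kind U (pol_on A U)"
proof -
  have kind: "has_kind (induced A V) i \<longleftrightarrow> i = clone.kind V (pol_on A V)" if V: "minimal_set A V" for V i
  proof -
    have "is_pol (induced A V) = pol_on A V"
      using is_pol_induced[OF alg finA minimal_set_subset[OF V]] by blast
    moreover have "univ (induced A V) = V" by (simp add: induced_def)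
    ultimately show ?thesis using has_kind_iff[of "induced A V"] minimal_set_clone[OF V] by simp
  qed
  have "clone.kind V (pol_on A V) = clone.kind U (pol_on A U)" if "minimal_set A V" for V
    using minimal_sets_hom[OF that U] kind_transport by blast
  then have "(\<exists>V. minimal_set A V \<and> has_kind (induced A V) i) \<longleftrightarrow> i = clone.kind U (pol_on A U)" for i
    using kind U by metis
  then show ?thesis unfolding typ_of_def by simp
qed

lemma typ_of_1_iff:
  assumes U: "minimal_set A U" shows "typ_of A = 1 \<longleftrightarrow> \<not> clone.two_dep U (pol_on A U)"
proof -
  interpret U: clone U "pol_on A U" using minimal_set_clone[OF U] by (simp add: minimal_clone_def)
  show ?thesis unfolding typ_of_eq[OF U] U.kind_def by auto
qed

end

section \<open>Counting homomorphisms\<close>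

lemma const_expansion_simps:
  "symbs (const_expansion A) = symbs A <+> univ A" "ar (const_expansion A) (Inl f) = ar A f"
  "ar (const_expansion A) (Inr a) = 0" "univ (const_expansion A) = univ A"
  "opn (const_expansion A) (Inl f) = opn A f" "opn (const_expansion A) (Inr a) = (\<lambda>_. a)"
  by (simp_all add: const_expansion_def)

lemma same_sig_expansion:
  assumes "same_sig X (const_expansion A)"
  shows "symbs X = symbs A <+> univ A" "\<And>f. f \<in> symbs A \<Longrightarrow> Inl f \<in> symbs X \<and> ar X (Inl f) = ar A f"
    "\<And>a. a \<in> univ A \<Longrightarrow> Inr a \<in> symbs X \<and> ar X (Inr a) = 0"
proof -
  show s: "symbs X = symbs A <+> univ A" using assms by (simp add: same_sig_def const_expansion_simps)
  have ar: "ar X f = ar (const_expansion A) f" if "f \<in> symbs X" for f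
    using assms that by (simp add: same_sig_def)
  show "Inl f \<in> symbs X \<and> ar X (Inl f) = ar A f" if "f \<in> symbs A" for f
    using s ar[of "Inl f"] that by (simp add: const_expansion_simps InlI)
  show "Inr a \<in> symbs X \<and> ar X (Inr a) = 0" if "a \<in> univ A" for a
    using s ar[of "Inr a"] that by (simp add: const_expansion_simps InrI)
qed

lemma ualg_opn: "is_ualg X \<Longrightarrow> f \<in> symbs X \<Longrightarrow> xs \<in> tuples (univ X) (ar X f) \<Longrightarrow> opn X f xs \<in> univ X"
  by (simp add: is_ualg_def)

lemma is_ualg_const_expansion: "is_ualg A \<Longrightarrow> is_ualg (const_expansion A)"
  unfolding is_ualg_def by (auto simp: const_expansion_simps)

lemma finite_homs: "finite (univ X) \<Longrightarrow> finite (univ C) \<Longrightarrow> finite (homs X C)"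
  unfolding homs_def by (rule finite_subset[of _ "univ X \<rightarrow>\<^sub>E univ C"]) (auto intro: finite_PiE)

lemma homs_closed: "h \<in> homs X C \<Longrightarrow> x \<in> univ X \<Longrightarrow> h x \<in> univ C"
  unfolding homs_def by auto

lemma homs_opn:
  "h \<in> homs X C \<Longrightarrow> f \<in> symbs X \<Longrightarrow> xs \<in> tuples (univ X) (ar X f) \<Longrightarrow> h (opn X f xs) = opn C f (map h xs)"
  unfolding homs_def by auto

lemma homs_eqI: "h \<in> homs X C \<Longrightarrow> h' \<in> homs X C \<Longrightarrow> (\<And>x. x \<in> univ X \<Longrightarrow> h x = h' x) \<Longrightarrow> h = h'"
  unfolding homs_def by (auto intro: PiE_ext)

lemma poly_power_bound:
  fixes p :: "real poly"
  obtains c :: real where "c \<ge> 0" "\<And>m n :: nat. m \<le> n \<Longrightarrow> poly p (real m) \<le> c * (1 + real n) ^ degree p"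
proof
  let ?c = "\<Sum>i\<le>degree p. \<bar>coeff p i\<bar>"
  show "?c \<ge> 0" by (intro sum_nonneg) simp
  fix m n :: nat assume mn: "m \<le> n"
  have "poly p (real m) = (\<Sum>i\<le>degree p. coeff p i * real m ^ i)" by (rule poly_altdef)
  also have "\<dots> \<le> (\<Sum>i\<le>degree p. \<bar>coeff p i\<bar> * (1 + real n) ^ degree p)"
  proof (rule sum_mono)
    fix i assume i: "i \<in> {..degree p}"
    have "real m ^ i \<le> (1 + real n) ^ i" using mn by (intro power_mono) auto
    also have "\<dots> \<le> (1 + real n) ^ degree p" using i by (intro power_increasing) auto
    finally have "\<bar>coeff p i\<bar> * real m ^ i \<le> \<bar>coeff p i\<bar> * (1 + real n) ^ degree p"
      by (intro mult_left_mono) auto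
    moreover have "coeff p i * real m ^ i \<le> \<bar>coeff p i\<bar> * real m ^ i" by (intro mult_right_mono) auto
    ultimately show "coeff p i * real m ^ i \<le> \<bar>coeff p i\<bar> * (1 + real n) ^ degree p" by linarith
  qed
  also have "\<dots> = ?c * (1 + real n) ^ degree p" by (simp add: sum_distrib_right)
  finally show "poly p (real m) \<le> ?c * (1 + real n) ^ degree p" .
qed

lemma exponential_beats_power:
  fixes c :: real shows "\<exists>n :: nat. 2 ^ n > c * (1 + real n) ^ d"
proof -
  define D where "D = Suc d"
  obtain m :: nat where m: "real m > \<bar>c\<bar> * real D ^ d" using reals_Archimedean2 by blast
  have "c * (1 + real (D * m)) ^ d \<le> \<bar>c\<bar> * (real D * (1 + real m)) ^ d"
  proof (rule mult_mono)
    show "(1 + real (D * m)) ^ d \<le> (real D * (1 + real m)) ^ d"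
      by (rule power_mono) (auto simp: D_def algebra_simps)
  qed auto
  also have "\<dots> = \<bar>c\<bar> * real D ^ d * (1 + real m) ^ d" by (simp add: power_mult_distrib)
  also have "\<dots> < (1 + real m) * (1 + real m) ^ d" using m by (intro mult_strict_right_mono) auto
  also have "\<dots> = (1 + real m) ^ D" by (simp add: D_def)
  also have "\<dots> \<le> (2 ^ m) ^ D"
  proof (rule power_mono)
    have "Suc m \<le> 2 ^ m" by (rule Suc_leI) (rule less_exp)
    then have "real (Suc m) \<le> real (2 ^ m)" by (rule of_nat_mono)
    then show "1 + real m \<le> 2 ^ m" by simp
  qed simp
  also have "\<dots> = 2 ^ (D * m)" by (simp add: power_mult[symmetric] mult.commute)
  finally show ?thesis by blast
qed

lemma K_poly_iff_K_surj:
  assumes A: "is_ualg A" "finite (univ A)"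
  shows "A \<in> K_surj \<longleftrightarrow> const_expansion A \<in> K_poly"
proof
  assume "A \<in> K_surj"
  then obtain p :: "real poly" where p: "\<And>X :: ('a, nat) ualg. is_ualg X \<Longrightarrow> finite (univ X) \<Longrightarrow> same_sig X A \<Longrightarrow>
    real (card (surj_homs X A)) \<le> poly p (real (card (univ X)))" by (auto simp: K_surj_def)
  have "real (card (homs X (const_expansion A))) \<le> poly p (real (card (univ X)))"
    if X: "is_ualg X" "finite (univ X)" "same_sig X (const_expansion A)" for X :: "('a + 'b, nat) ualg"
  proof -
    define Y where "Y = \<lparr>symbs = symbs A, ar = ar A, univ = univ X, opn = (\<lambda>f. opn X (Inl f))\<rparr>"
    note sX = same_sig_expansion(1)[OF X(3)]
    have arl: "ar X (Inl f) = ar A f" if "f \<in> symbs A" for f using same_sig_expansion(2)[OF X(3) that] by simp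
    have arr: "ar X (Inr a) = 0" if "a \<in> univ A" for a using same_sig_expansion(3)[OF X(3) that] by simp
    have "opn X (Inl f) xs \<in> univ X" if "f \<in> symbs A" "xs \<in> tuples (univ X) (ar A f)" for f xs
      using ualg_opn[OF X(1), of "Inl f" xs] same_sig_expansion(2)[OF X(3) that(1)] that(2) by simp
    then have "is_ualg Y" using X(1) by (auto simp: is_ualg_def Y_def)
    moreover have "same_sig Y A" by (simp add: same_sig_def Y_def)
    ultimately have le: "real (card (surj_homs Y A)) \<le> poly p (real (card (univ X)))"
      using p[of Y] X(2) by (simp add: Y_def)
    have "homs X (const_expansion A) \<subseteq> surj_homs Y A"
    proof
      fix h assume h: "h \<in> homs X (const_expansion A)"
      have "h (opn X (Inl f) xs) = opn A f (map h xs)" if "f \<in> symbs A" "xs \<in> tuples (univ X) (ar A f)" for f xs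
        using homs_opn[OF h, of "Inl f" xs] same_sig_expansion(2)[OF X(3) that(1)] that(2)
        by (simp add: const_expansion_simps)
      then have "h \<in> homs Y A"
        using h by (auto simp: homs_def Y_def const_expansion_simps)
      moreover have "univ A \<subseteq> h ` univ X"
      proof
        fix a assume a: "a \<in> univ A"
        have "opn X (Inr a) [] \<in> univ X" using ualg_opn[OF X(1), of "Inr a" "[]"] same_sig_expansion(3)[OF X(3) a] by (simp add: tuples_0)
        moreover have "h (opn X (Inr a) []) = a"
          using homs_opn[OF h, of "Inr a" "[]"] same_sig_expansion(3)[OF X(3) a]
          by (simp add: tuples_0 const_expansion_simps)
        ultimately show "a \<in> h ` univ X" by force
      qed
      ultimately show "h \<in> surj_homs Y A"
        using homs_closed[OF h] by (auto simp: surj_homs_def Y_def const_expansion_simps)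
    qed
    moreover have "finite (surj_homs Y A)"
      using finite_homs[of Y A] X(2) A(2) by (auto simp: surj_homs_def Y_def)
    ultimately have "card (homs X (const_expansion A)) \<le> card (surj_homs Y A)" by (intro card_mono)
    then show ?thesis using le by linarith
  qed
  then show "const_expansion A \<in> K_poly"
    using A is_ualg_const_expansion[OF A(1)] by (auto simp: K_poly_def const_expansion_simps)
next
  assume "const_expansion A \<in> K_poly"
  then obtain p :: "real poly" where p: "\<And>X :: ('a + 'b, nat) ualg. is_ualg X \<Longrightarrow> finite (univ X) \<Longrightarrow>
    same_sig X (const_expansion A) \<Longrightarrow>
    real (card (homs X (const_expansion A))) \<le> poly p (real (card (univ X)))" by (auto simp: K_poly_def)
  have "real (card (surj_homs X A)) \<le> poly (monom 1 (card (univ A)) * p) (real (card (univ X)))"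
    if X: "is_ualg X" "finite (univ X)" "same_sig X A" for X :: "('a, nat) ualg"
  proof -
    define Y where "Y s = \<lparr>symbs = symbs A <+> univ A, ar = ar (const_expansion A), univ = univ X,
      opn = case_sum (opn X) (\<lambda>a _. s a)\<rparr>" for s :: "'b \<Rightarrow> nat"
    have sX: "symbs X = symbs A" "\<And>f. f \<in> symbs A \<Longrightarrow> ar X f = ar A f"
      using X(3) by (auto simp: same_sig_def)
    let ?S = "univ A \<rightarrow>\<^sub>E univ X"
    have bound: "real (card (homs (Y s) (const_expansion A))) \<le> poly p (real (card (univ X)))" if "s \<in> ?S" for s
    proof -
      have "is_ualg (Y s)" using X(1) sX that by (auto simp: is_ualg_def Y_def const_expansion_simps)
      moreover have "same_sig (Y s) (const_expansion A)" by (simp add: same_sig_def Y_def const_expansion_simps)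
      ultimately show ?thesis using p[of "Y s"] X(2) by (simp add: Y_def)
    qed
    have finS: "finite ?S" using A X by (intro finite_PiE) auto
    have finH: "finite (homs (Y s) (const_expansion A))" for s
      using finite_homs[of "Y s" "const_expansion A"] A X by (simp add: Y_def const_expansion_simps)
    have "surj_homs X A \<subseteq> (\<Union>s\<in>?S. homs (Y s) (const_expansion A))"
    proof
      fix h assume "h \<in> surj_homs X A"
      then have h: "h \<in> homs X A" "h ` univ X = univ A" by (auto simp: surj_homs_def)
      define s where "s = restrict (inv_into (univ X) h) (univ A)"
      have s: "s a \<in> univ X" "h (s a) = a" if "a \<in> univ A" for a
        using that h(2) inv_into_into[of a h "univ X"] f_inv_into_f[of a h "univ X"] by (auto simp: s_def)
      have "s \<in> ?S" using s by (auto simp: s_def)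
      moreover have "h \<in> homs (Y s) (const_expansion A)"
        using h(1) s sX by (auto simp: homs_def Y_def const_expansion_simps)
      ultimately show "h \<in> (\<Union>s\<in>?S. homs (Y s) (const_expansion A))" by blast
    qed
    then have "card (surj_homs X A) \<le> card (\<Union>s\<in>?S. homs (Y s) (const_expansion A))"
      using finS finH by (intro card_mono) auto
    also have "\<dots> \<le> (\<Sum>s\<in>?S. card (homs (Y s) (const_expansion A)))" using finS by (rule card_UN_le)
    finally have "real (card (surj_homs X A)) \<le> (\<Sum>s\<in>?S. real (card (homs (Y s) (const_expansion A))))"
      by (metis of_nat_mono of_nat_sum)
    also have "\<dots> \<le> (\<Sum>s\<in>?S. poly p (real (card (univ X))))" by (intro sum_mono bound)
    also have "\<dots> = real (card ?S) * poly p (real (card (univ X)))" by simp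
    also have "card ?S = card (univ X) ^ card (univ A)" using A by (simp add: card_PiE)
    finally show ?thesis by (simp add: poly_monom)
  qed
  then show "A \<in> K_surj" using A unfolding K_surj_def by blast
qed

lemma homs_bound_any_type:
  fixes Y :: "('s, 'y) ualg" and C :: "('s, 'a) ualg"
  assumes p: "\<And>X :: ('s, nat) ualg. is_ualg X \<Longrightarrow> finite (univ X) \<Longrightarrow> same_sig X C \<Longrightarrow>
      real (card (homs X C)) \<le> poly p (real (card (univ X)))"
    and C: "finite (univ C)" and Y: "is_ualg Y" "finite (univ Y)" "same_sig Y C"
  shows "real (card (homs Y C)) \<le> poly p (real (card (univ Y)))"
proof -
  obtain code :: "'y \<Rightarrow> nat" where code: "inj_on code (univ Y)"
    using finite_imp_inj_to_nat_seg[OF Y(2)] by blast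
  define dec where "dec = inv_into (univ Y) code"
  have dec: "dec (code y) = y" if "y \<in> univ Y" for y using code that by (simp add: dec_def)
  define X :: "('s, nat) ualg" where
    "X = \<lparr>symbs = symbs Y, ar = ar Y, univ = code ` univ Y, opn = \<lambda>f xs. code (opn Y f (map dec xs))\<rparr>"
  have tup: "map dec xs \<in> tuples (univ Y) n" if "xs \<in> tuples (univ X) n" for xs n
    using that by (rule tuples_map) (auto simp: X_def dec)
  have cl: "opn Y f ys \<in> univ Y" if "f \<in> symbs Y" "ys \<in> tuples (univ Y) (ar Y f)" for f ys
    using Y(1) that by (simp add: is_ualg_def)
  have "is_ualg X" using Y(1) tup cl by (auto simp: is_ualg_def X_def)
  moreover have "same_sig X C" using Y(3) by (simp add: same_sig_def X_def)
  moreover have finX: "finite (univ X)" using Y(2) by (simp add: X_def)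
  moreover have "card (univ X) = card (univ Y)" using code by (simp add: X_def card_image)
  ultimately have le: "real (card (homs X C)) \<le> poly p (real (card (univ Y)))" using p[of X] by simp
  have "card (homs Y C) \<le> card (homs X C)"
  proof (rule card_inj_on_le)
    show "finite (homs X C)" using finX C by (rule finite_homs)
    let ?T = "\<lambda>h. restrict (\<lambda>x. h (dec x)) (univ X)"
    show "?T ` homs Y C \<subseteq> homs X C"
    proof safe
      fix h assume h: "h \<in> homs Y C"
      have "?T h \<in> univ X \<rightarrow>\<^sub>E univ C" using homs_closed[OF h] dec by (auto simp: X_def)
      moreover have "?T h (opn X f xs) = opn C f (map (?T h) xs)"
        if f: "f \<in> symbs X" and xs: "xs \<in> tuples (univ X) (ar X f)" for f xs
      proof -
        have f': "f \<in> symbs Y" and xs': "map dec xs \<in> tuples (univ Y) (ar Y f)"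
          using f tup[OF xs] by (auto simp: X_def)
        have "?T h (opn X f xs) = h (opn Y f (map dec xs))"
          using dec cl[OF f' xs'] by (simp add: X_def)
        also have "\<dots> = opn C f (map h (map dec xs))" by (rule homs_opn[OF h f' xs'])
        also have "map h (map dec xs) = map (?T h) xs" using xs by (auto simp: tuples_def)
        finally show ?thesis .
      qed
      ultimately show "?T h \<in> homs X C" unfolding homs_def by blast
    qed
    show "inj_on ?T (homs Y C)"
    proof (rule inj_onI)
      fix h h' assume *: "h \<in> homs Y C" "h' \<in> homs Y C" "?T h = ?T h'"
      show "h = h'"
      proof (rule homs_eqI[OF *(1,2)])
        fix y assume "y \<in> univ Y"
        then show "h y = h' y" using fun_cong[OF *(3), of "code y"] dec by (simp add: X_def)
      qed
    qed
  qed
  then show ?thesis using le by linarith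
qed

context simple_alg begin

abbreviation "A' \<equiv> const_expansion A"

text \<open>The constants of \<open>A'\<close> make every polynomial of \<open>A\<close> act on \<open>X\<close>.\<close>

lemma lift_pol:
  assumes X: "is_ualg X" "same_sig X A'" and p: "is_pol A n p"
  shows "\<exists>q. \<forall>xs\<in>tuples (univ X) n. q xs \<in> univ X \<and> (\<forall>h\<in>homs X A'. h (q xs) = p (map h xs))"
  using p
proof (induction rule: is_pol_induct)
  case (cong p q)
  have "map h xs \<in> tuples (univ A) n" if "xs \<in> tuples (univ X) n" "h \<in> homs X A'" for h xs
    using that(1) by (rule tuples_map) (use homs_closed[OF that(2)] in \<open>simp add: const_expansion_simps\<close>)
  then show ?case using cong by metis
next
  case (proj i)
  then show ?case by (intro exI[of _ "\<lambda>xs. xs ! i"]) (auto simp: tuples_length tuples_nth)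
next
  case (const a)
  have s: "Inr a \<in> symbs X" "ar X (Inr a) = 0"
    using same_sig_expansion(3)[OF X(2) const] by auto
  have "opn X (Inr a) [] \<in> univ X" using X(1) s by (auto simp: is_ualg_def tuples_0)
  moreover have "h (opn X (Inr a) []) = a" if "h \<in> homs X A'" for h
    using homs_opn[OF that s(1), of "[]"] s by (simp add: tuples_0 const_expansion_simps)
  ultimately show ?case by (intro exI[of _ "\<lambda>_. opn X (Inr a) []"]) blast
next
  case (app f gs)
  have s: "Inl f \<in> symbs X" "ar X (Inl f) = ar A f"
    using same_sig_expansion(2)[OF X(2) app(1)] by auto
  obtain q where q: "\<And>g. g \<in> set gs \<Longrightarrow> \<forall>xs\<in>tuples (univ X) n. q g xs \<in> univ X \<and>
    (\<forall>h\<in>homs X A'. h (q g xs) = g (map h xs))" using app(3) by metis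
  show ?case
  proof (intro exI[of _ "\<lambda>xs. opn X (Inl f) (map (\<lambda>g. q g xs) gs)"] ballI conjI)
    fix xs assume xs: "xs \<in> tuples (univ X) n"
    have t: "map (\<lambda>g. q g xs) gs \<in> tuples (univ X) (ar X (Inl f))"
      using q xs app(2) s by (auto simp: tuples_def)
    show "opn X (Inl f) (map (\<lambda>g. q g xs) gs) \<in> univ X" using X(1) s(1) t by (auto simp: is_ualg_def)
    fix h assume h: "h \<in> homs X A'"
    have "h (opn X (Inl f) (map (\<lambda>g. q g xs) gs)) = opn A f (map h (map (\<lambda>g. q g xs) gs))"
      using homs_opn[OF h s(1) t] by (simp add: const_expansion_simps)
    also have "map h (map (\<lambda>g. q g xs) gs) = map (\<lambda>g. g (map h xs)) gs" using q xs h by auto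
    finally show "h (opn X (Inl f) (map (\<lambda>g. q g xs) gs)) = opn A f (map (\<lambda>g. g (map h xs)) gs)" .
  qed
qed

lemma lift_un:
  assumes X: "is_ualg X" "same_sig X A'" and f: "un f"
  obtains q where "\<And>x. x \<in> univ X \<Longrightarrow> q x \<in> univ X"
    "\<And>x h. x \<in> univ X \<Longrightarrow> h \<in> homs X A' \<Longrightarrow> h (q x) = f (h x)"
proof -
  obtain q where q: "\<forall>xs\<in>tuples (univ X) 1. q xs \<in> univ X \<and> (\<forall>h\<in>homs X A'. h (q xs) = f (map h xs ! 0))"
    using lift_pol[OF X f[unfolded un_def]] by blast
  have "q [x] \<in> univ X \<and> (\<forall>h\<in>homs X A'. h (q [x]) = f (h x))" if "x \<in> univ X" for x
    using bspec[OF q, of "[x]"] that by (simp add: tuples_def)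
  then show ?thesis using that[of "\<lambda>x. q [x]"] by blast
qed

lemma lift_bin_on:
  assumes X: "is_ualg X" "same_sig X A'" and U: "U \<subseteq> univ A" and f: "clone.bin (pol_on A U) f"
  obtains q where "\<And>x y. x \<in> univ X \<Longrightarrow> y \<in> univ X \<Longrightarrow> q x y \<in> univ X"
    "\<And>x y h. x \<in> univ X \<Longrightarrow> y \<in> univ X \<Longrightarrow> h \<in> homs X A' \<Longrightarrow> h x \<in> U \<Longrightarrow> h y \<in> U \<Longrightarrow> h (q x y) = f (h x) (h y)"
proof -
  interpret U: clone U "pol_on A U" by (rule clone_pol_on[OF alg finA U])
  obtain p where p: "is_pol A 2 p" "\<forall>xs\<in>tuples U 2. f (xs ! 0) (xs ! 1) = p xs"
    using f unfolding U.bin_def pol_on_def by blast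
  obtain q where q: "\<forall>xs\<in>tuples (univ X) 2. q xs \<in> univ X \<and> (\<forall>h\<in>homs X A'. h (q xs) = p (map h xs))"
    using lift_pol[OF X p(1)] by blast
  have "p [x, y] = f x y" if "x \<in> U" "y \<in> U" for x y
    using bspec[OF p(2), of "[x, y]"] that by (simp add: tuples_def)
  moreover have "q [x, y] \<in> univ X \<and> (\<forall>h\<in>homs X A'. h (q [x, y]) = p [h x, h y])" if "x \<in> univ X" "y \<in> univ X" for x y
    using bspec[OF q, of "[x, y]"] that by (simp add: tuples_def)
  ultimately show ?thesis using that[of "\<lambda>x y. q [x, y]"] by metis
qed

context
  fixes X :: "('s + 'a, 'x) ualg" and U :: "'a set"
  assumes X: "is_ualg X" "finite (univ X)" "same_sig X A'" and U: "minimal_set A U"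
begin

lemma retract:
  obtains Z where "Z \<subseteq> univ X" "\<And>h z. h \<in> homs X A' \<Longrightarrow> z \<in> Z \<Longrightarrow> h z \<in> U"
    "\<And>h h'. h \<in> homs X A' \<Longrightarrow> h' \<in> homs X A' \<Longrightarrow> (\<And>z. z \<in> Z \<Longrightarrow> h z = h' z) \<Longrightarrow> h = h'"
proof -
  obtain r where r: "un r" "\<And>x. x \<in> univ A \<Longrightarrow> r x \<in> U" "\<And>x. x \<in> U \<Longrightarrow> r x = x"
    using idempotent_retraction[OF U] by blast
  obtain R where R: "\<And>x. x \<in> univ X \<Longrightarrow> R x \<in> univ X"
    "\<And>x h. x \<in> univ X \<Longrightarrow> h \<in> homs X A' \<Longrightarrow> h (R x) = r (h x)" using lift_un[OF X(1,3) r(1)] by blast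
  have hA: "h x \<in> univ A" if "h \<in> homs X A'" "x \<in> univ X" for h x
    using homs_closed[OF that] by (simp add: const_expansion_simps)
  have "h = h'" if h: "h \<in> homs X A'" "h' \<in> homs X A'" and eq: "\<And>z. z \<in> R ` univ X \<Longrightarrow> h z = h' z" for h h'
  proof (rule homs_eqI[OF h], rule ccontr)
    fix x assume x: "x \<in> univ X" and ne: "h x \<noteq> h' x"
    obtain f where f: "un f" "\<And>x. x \<in> univ A \<Longrightarrow> f x \<in> U" "f (h x) \<noteq> f (h' x)"
      using separation[OF U hA[OF h(1) x] hA[OF h(2) x] ne] by blast
    obtain F where F: "\<And>x. x \<in> univ X \<Longrightarrow> F x \<in> univ X"
      "\<And>x h. x \<in> univ X \<Longrightarrow> h \<in> homs X A' \<Longrightarrow> h (F x) = f (h x)" using lift_un[OF X(1,3) f(1)] by blast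
    have "k (R (F x)) = f (k x)" if k: "k \<in> homs X A'" for k
      using R(2)[OF F(1)[OF x] k] F(2)[OF x k] r(3)[OF f(2)[OF hA[OF k x]]] by simp
    then have "f (h x) = f (h' x)" using eq[of "R (F x)"] F(1)[OF x] h by auto
    then show False using f by simp
  qed
  moreover have "R ` univ X \<subseteq> univ X" using R(1) by blast
  moreover have "h z \<in> U" if h: "h \<in> homs X A'" and "z \<in> R ` univ X" for h z
    using that(2) R(2)[OF _ h] r(2) hA[OF h] by auto
  ultimately show ?thesis using that by blast
qed

lemma card_homs_meet:
  assumes bt: "U = {b, t}" "b \<noteq> t" and mt: "clone.bin (pol_on A U) (\<lambda>x y. if x = t \<and> y = t then t else b)"
  shows "card (homs X A') \<le> card (univ X)"
proof -
  obtain Z where Z: "Z \<subseteq> univ X" "\<And>h z. h \<in> homs X A' \<Longrightarrow> z \<in> Z \<Longrightarrow> h z \<in> U"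
    "\<And>h h'. h \<in> homs X A' \<Longrightarrow> h' \<in> homs X A' \<Longrightarrow> (\<And>z. z \<in> Z \<Longrightarrow> h z = h' z) \<Longrightarrow> h = h'"
    using retract by blast
  note sub = minimal_set_subset[OF U]
  obtain M where M: "\<And>x y. x \<in> univ X \<Longrightarrow> y \<in> univ X \<Longrightarrow> M x y \<in> univ X"
    "\<And>x y h. x \<in> univ X \<Longrightarrow> y \<in> univ X \<Longrightarrow> h \<in> homs X A' \<Longrightarrow> h x \<in> U \<Longrightarrow> h y \<in> U \<Longrightarrow>
       h (M x y) = (if h x = t \<and> h y = t then t else b)" using lift_bin_on[OF X(1,3) sub mt] by blast
  obtain x0 where x0: "x0 \<in> univ X" using X(1) by (auto simp: is_ualg_def)
  have "t \<in> univ A" using sub bt by auto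
  from lift_un[OF X(1,3) un_const[OF this]] obtain T where
    T: "\<And>x. x \<in> univ X \<Longrightarrow> T x \<in> univ X" "\<And>x h. x \<in> univ X \<Longrightarrow> h \<in> homs X A' \<Longrightarrow> h (T x) = t" by blast
  define c where "c = T x0"
  have c: "c \<in> univ X" "\<And>h. h \<in> homs X A' \<Longrightarrow> h c = t" using T x0 by (auto simp: c_def)
  have fold: "foldr M l c \<in> univ X \<and> (\<forall>h\<in>homs X A'. h (foldr M l c) = (if \<forall>z\<in>set l. h z = t then t else b))"
    if "set l \<subseteq> Z" for l using that
  proof (induction l)
    case (Cons z l)
    then have z: "z \<in> Z" "z \<in> univ X" and IH: "foldr M l c \<in> univ X"
      "\<And>h. h \<in> homs X A' \<Longrightarrow> h (foldr M l c) = (if \<forall>z\<in>set l. h z = t then t else b)" using Z by auto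
    have "h (M z (foldr M l c)) = (if \<forall>z\<in>set (z # l). h z = t then t else b)" if h: "h \<in> homs X A'" for h
      using M(2)[OF z(2) IH(1) h Z(2)[OF h z(1)]] IH(2)[OF h] bt by auto
    then show ?case using M(1)[OF z(2) IH(1)] by simp
  qed (use c in auto)
  have "finite Z" using Z(1) X(2) by (rule finite_subset)
  define l where "l h = (SOME l. set l = {z \<in> Z. h z = t})" for h :: "'x \<Rightarrow> 'a"
  have l: "set (l h) = {z \<in> Z. h z = t}" for h
  proof -
    have "finite {z \<in> Z. h z = t}" using \<open>finite Z\<close> by simp
    then show ?thesis unfolding l_def using someI_ex[OF finite_list] by metis
  qed
  show ?thesis
  proof (rule card_inj_on_le[OF _ _ X(2)])
    show "(\<lambda>h. foldr M (l h) c) ` homs X A' \<subseteq> univ X" using fold l by auto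
    show "inj_on (\<lambda>h. foldr M (l h) c) (homs X A')"
    proof (rule inj_onI)
      fix h h' assume h: "h \<in> homs X A'" "h' \<in> homs X A'" and eq: "foldr M (l h) c = foldr M (l h') c"
      have val: "k (foldr M (l g) c) = (if \<forall>z\<in>Z. g z = t \<longrightarrow> k z = t then t else b)"
        if k: "k \<in> homs X A'" for k g
      proof -
        have "set (l g) \<subseteq> Z" using l by blast
        from bspec[OF conjunct2[OF fold[OF this]] k] show ?thesis unfolding l by auto
      qed
      have "h' (foldr M (l h') c) = t" "h (foldr M (l h) c) = t"
        using val[OF h(2), of h'] val[OF h(1), of h] by auto
      then have "h' (foldr M (l h) c) = t" "h (foldr M (l h') c) = t" using eq by simp_all
      then have *: "\<forall>z\<in>Z. h z = t \<longrightarrow> h' z = t" "\<forall>z\<in>Z. h' z = t \<longrightarrow> h z = t"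
        using val[OF h(2), of h] val[OF h(1), of h'] bt(2) by (metis, metis)
      have "h z = h' z" if "z \<in> Z" for z
      proof -
        have "h z = b \<or> h z = t" "h' z = b \<or> h' z = t"
          using Z(2)[OF h(1) that] Z(2)[OF h(2) that] bt(1) by auto
        then show ?thesis using * that by metis
      qed
      then show "h = h'" using Z(3) h by blast
    qed
  qed
qed

text \<open>The sums of the subsets of a minimal set of elements determining homomorphisms are pairwise
  distinct, hence such a set has logarithmic size.\<close>

lemma card_homs_latin:
  assumes f: "clone.bin (pol_on A U) f" and inj1: "\<And>c. c \<in> U \<Longrightarrow> inj_on (\<lambda>x. f x c) U"
    and inj2: "\<And>c. c \<in> U \<Longrightarrow> inj_on (\<lambda>y. f c y) U"
  shows "card (homs X A') \<le> card (univ X) ^ card U"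
proof -
  obtain Z where Z: "Z \<subseteq> univ X" "\<And>h z. h \<in> homs X A' \<Longrightarrow> z \<in> Z \<Longrightarrow> h z \<in> U"
    "\<And>h h'. h \<in> homs X A' \<Longrightarrow> h' \<in> homs X A' \<Longrightarrow> (\<And>z. z \<in> Z \<Longrightarrow> h z = h' z) \<Longrightarrow> h = h'"
    using retract by blast
  note sub = minimal_set_subset[OF U]
  interpret U: clone U "pol_on A U" by (rule clone_pol_on[OF alg finA sub])
  have finU: "finite U" using sub finA by (rule finite_subset)
  have finZ: "finite Z" using Z(1) X(2) by (rule finite_subset)
  obtain M where M: "\<And>x y. x \<in> univ X \<Longrightarrow> y \<in> univ X \<Longrightarrow> M x y \<in> univ X"
    "\<And>x y h. x \<in> univ X \<Longrightarrow> y \<in> univ X \<Longrightarrow> h \<in> homs X A' \<Longrightarrow> h x \<in> U \<Longrightarrow> h y \<in> U \<Longrightarrow> h (M x y) = f (h x) (h y)"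
    using lift_bin_on[OF X(1,3) sub f] by blast
  obtain x0 where x0: "x0 \<in> univ X" using X(1) by (auto simp: is_ualg_def)
  have "card U \<ge> 2" using U by (simp add: minimal_set_def)
  then obtain u where u: "u \<in> U" using card_ge_2E by blast
  then have "u \<in> univ A" using sub by auto
  from lift_un[OF X(1,3) un_const[OF this]] obtain T where
    T: "\<And>x. x \<in> univ X \<Longrightarrow> T x \<in> univ X" "\<And>x h. x \<in> univ X \<Longrightarrow> h \<in> homs X A' \<Longrightarrow> h (T x) = u" by blast
  define c where "c = T x0"
  have c: "c \<in> univ X" "\<And>h. h \<in> homs X A' \<Longrightarrow> h c = u" using T x0 by (auto simp: c_def)
  have fold: "foldr M l c \<in> univ X \<and> (\<forall>h\<in>homs X A'. h (foldr M l c) \<in> U)" if "set l \<subseteq> Z" for l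
    using that
  proof (induction l)
    case (Cons z l)
    then have z: "z \<in> Z" "z \<in> univ X" and IH: "foldr M l c \<in> univ X"
      "\<And>h. h \<in> homs X A' \<Longrightarrow> h (foldr M l c) \<in> U" using Z by auto
    have "h (M z (foldr M l c)) \<in> U" if h: "h \<in> homs X A'" for h
      using M(2)[OF z(2) IH(1) h Z(2)[OF h z(1)]] IH(2)[OF h] Z(2)[OF h z(1)] U.bin_closed[OF f] by auto
    then show ?case using M(1)[OF z(2) IH(1)] by simp
  qed (use c u in auto)
  have foldM: "h (foldr M (z # l) c) = f (h z) (h (foldr M l c))" if "z \<in> Z" "set l \<subseteq> Z" "h \<in> homs X A'" for h z l
    using M(2)[of z "foldr M l c" h] fold[OF that(2)] that Z by auto
  have same: "h (foldr M l c) = h' (foldr M l c)"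
    if "set l \<subseteq> Z" "h \<in> homs X A'" "h' \<in> homs X A'" "\<And>z. z \<in> set l \<Longrightarrow> h z = h' z" for l h h'
    using that(1,4)
  proof (induction l)
    case Nil then show ?case using c(2)[OF that(2)] c(2)[OF that(3)] by simp
  next
    case (Cons z l)
    then show ?case using foldM[of z l h] foldM[of z l h'] that(2,3) by simp
  qed
  have diff: "h (foldr M l c) \<noteq> h' (foldr M l c)"
    if "set l \<subseteq> Z" "h \<in> homs X A'" "h' \<in> homs X A'" "distinct l" "g \<in> set l" "h g \<noteq> h' g"
      "\<And>z. z \<in> set l \<Longrightarrow> z \<noteq> g \<Longrightarrow> h z = h' z" for l h h' g
    using that(1,4,5,7)
  proof (induction l)
    case (Cons z l)
    note hh = that(2,3)
    have lZ: "set l \<subseteq> Z" "z \<in> Z" using Cons.prems by auto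
    have inU: "h (foldr M l c) \<in> U" "h' (foldr M l c) \<in> U" "h z \<in> U" "h' z \<in> U"
      using fold[OF lZ(1)] hh Z(2) lZ by auto
    note eqs = foldM[OF lZ(2,1) hh(1)] foldM[OF lZ(2,1) hh(2)]
    show ?case
    proof (cases "z = g")
      case True
      then have eq: "h (foldr M l c) = h' (foldr M l c)"
      proof (intro same[OF lZ(1) hh])
        fix y assume "y \<in> set l"
        then show "h y = h' y" using Cons.prems(4)[of y] Cons.prems(2) True by fastforce
      qed
      have "h z \<noteq> h' z" using that(6) True by simp
      then show ?thesis unfolding eqs eq using inj_onD[OF inj1[OF inU(2)] _ inU(3,4)] by blast
    next
      case False
      then have "h (foldr M l c) \<noteq> h' (foldr M l c)"
        using Cons.prems by (intro Cons.IH) auto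
      moreover have "h z = h' z" using Cons.prems False by auto
      moreover have "f (h' z) (h (foldr M l c)) = f (h' z) (h' (foldr M l c)) \<Longrightarrow> h (foldr M l c) = h' (foldr M l c)"
        using inj_onD[OF inj2[OF inU(4)] _ inU(1,2)] .
      ultimately show ?thesis unfolding eqs by metis
    qed
  qed simp
  define det where "det G \<longleftrightarrow> G \<subseteq> Z \<and>
    (\<forall>h\<in>homs X A'. \<forall>h'\<in>homs X A'. (\<forall>g\<in>G. h g = h' g) \<longrightarrow> h = h')" for G
  have "det Z" unfolding det_def using Z(3) by blast
  then obtain G where G: "det G" "\<And>G'. det G' \<Longrightarrow> card G \<le> card G'"
    using ex_has_least_nat[of det Z card] by blast
  have GZ: "G \<subseteq> Z" and finG: "finite G" using G(1) finZ finite_subset by (auto simp: det_def)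
  have sep: "\<exists>h\<in>homs X A'. \<exists>h'\<in>homs X A'. (\<forall>z\<in>G. z \<noteq> g \<longrightarrow> h z = h' z) \<and> h g \<noteq> h' g" if g: "g \<in> G" for g
  proof -
    have "card (G - {g}) < card G" using finG g by (rule card_Diff1_less)
    then have "\<not> det (G - {g})" using G(2) by (meson not_le)
    then obtain h h' where h: "h \<in> homs X A'" "h' \<in> homs X A'" "\<forall>z\<in>G - {g}. h z = h' z" "h \<noteq> h'"
      using GZ unfolding det_def by blast
    moreover have "h g \<noteq> h' g" using h G(1) unfolding det_def by blast
    ultimately show ?thesis by blast
  qed
  define l where "l S = (SOME l. set l = S \<and> distinct l)" for S :: "'x set"
  have l: "set (l S) = S" "distinct (l S)" if "S \<subseteq> G" for S
  proof -
    have "finite S" using that finG by (rule finite_subset)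
    from someI_ex[OF finite_distinct_list[OF this]] show "set (l S) = S" "distinct (l S)"
      unfolding l_def by auto
  qed
  have key: "foldr M (l S) c \<noteq> foldr M (l S') c" if S: "S \<subseteq> G" "S' \<subseteq> G" "g \<in> S" "g \<notin> S'" for S S' g
  proof
    assume eq: "foldr M (l S) c = foldr M (l S') c"
    have "g \<in> G" using S by blast
    then obtain h h' where h: "h \<in> homs X A'" "h' \<in> homs X A'" "\<forall>z\<in>G. z \<noteq> g \<longrightarrow> h z = h' z" "h g \<noteq> h' g"
      using sep by blast
    have "h (foldr M (l S) c) \<noteq> h' (foldr M (l S) c)"
      by (rule diff[where g = g]) (use l S GZ h in auto)
    moreover have "h (foldr M (l S') c) = h' (foldr M (l S') c)"
      by (rule same) (use l S GZ h in auto)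
    ultimately show False using eq by simp
  qed
  have "card (Pow G) \<le> card (univ X)"
  proof (rule card_inj_on_le[OF _ _ X(2)])
    show "(\<lambda>S. foldr M (l S) c) ` Pow G \<subseteq> univ X" using fold l GZ by fastforce
    show "inj_on (\<lambda>S. foldr M (l S) c) (Pow G)"
    proof (rule inj_onI, rule ccontr)
      fix S S' assume *: "S \<in> Pow G" "S' \<in> Pow G" "foldr M (l S) c = foldr M (l S') c" "S \<noteq> S'"
      then obtain g where "g \<in> S \<and> g \<notin> S' \<or> g \<in> S' \<and> g \<notin> S" by blast
      then show False using key[of S S' g] key[of S' S g] * by auto
    qed
  qed
  then have pow: "2 ^ card G \<le> card (univ X)" using finG by (simp add: card_Pow)
  have "card (homs X A') \<le> card (G \<rightarrow>\<^sub>E U)"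
  proof (rule card_inj_on_le)
    show "finite (G \<rightarrow>\<^sub>E U)" using finG finU by (intro finite_PiE) auto
    show "(\<lambda>h. restrict h G) ` homs X A' \<subseteq> G \<rightarrow>\<^sub>E U" using Z(2) GZ by auto
    show "inj_on (\<lambda>h. restrict h G) (homs X A')"
    proof (rule inj_onI)
      fix h h' assume *: "h \<in> homs X A'" "h' \<in> homs X A'" "restrict h G = restrict h' G"
      then have "\<forall>g\<in>G. h g = h' g" by (metis restrict_apply')
      then show "h = h'" using G(1) * unfolding det_def by blast
    qed
  qed
  also have "\<dots> = card U ^ card G" using finG by (simp add: card_PiE)
  also have "\<dots> \<le> (2 ^ card U) ^ card G" by (rule power_mono) (auto intro: less_imp_le less_exp)
  also have "\<dots> = (2 ^ card G) ^ card U" by (simp add: power_mult[symmetric] mult.commute)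
  also have "\<dots> \<le> card (univ X) ^ card U" using pow by (rule power_mono) simp
  finally show ?thesis .
qed

end

lemma K_poly_of_two_dep:
  assumes U: "minimal_set A U" and dep: "clone.two_dep U (pol_on A U)"
  shows "A' \<in> K_poly"
proof -
  interpret U: minimal_clone U "pol_on A U" by (rule minimal_set_clone[OF U])
  have "\<exists>k. \<forall>X :: ('s + 'a, nat) ualg. is_ualg X \<and> finite (univ X) \<and> same_sig X A' \<longrightarrow>
    card (homs X A') \<le> card (univ X) ^ k"
  proof (cases U.twin)
    case True
    obtain f where "U.bin f" "\<And>c. c \<in> U \<Longrightarrow> inj_on (\<lambda>x. f x c) U" "\<And>c. c \<in> U \<Longrightarrow> inj_on (\<lambda>y. f c y) U"
      using U.twin_latin_square[OF True dep] by blast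
    then show ?thesis using card_homs_latin[OF _ _ _ U] by (intro exI[of _ "card U"]) blast
  next
    case False
    obtain b t where bt: "U = {b, t}" "b \<noteq> t" "U.bin (U.meet b t)" using U.not_twin_meet[OF False] by blast
    have "card (homs X A') \<le> card (univ X) ^ 1"
      if "is_ualg X" "finite (univ X)" "same_sig X A'" for X :: "('s + 'a, nat) ualg"
      using card_homs_meet[OF that U bt] by simp
    then show ?thesis by blast
  qed
  then obtain k where k: "\<And>X :: ('s + 'a, nat) ualg. is_ualg X \<Longrightarrow> finite (univ X) \<Longrightarrow> same_sig X A' \<Longrightarrow>
    card (homs X A') \<le> card (univ X) ^ k" by blast
  have "real (card (homs X A')) \<le> poly (monom 1 k) (real (card (univ X)))"
    if "is_ualg X" "finite (univ X)" "same_sig X A'" for X :: "('s + 'a, nat) ualg"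
  proof -
    have "real (card (homs X A')) \<le> real (card (univ X) ^ k)" using k[OF that] by (simp only: of_nat_le_iff)
    then show ?thesis by (simp add: poly_monom)
  qed
  then show ?thesis
    using is_ualg_const_expansion[OF alg] finA unfolding K_poly_def by (auto simp: const_expansion_simps)
qed

lemma not_K_poly_of_unary:
  assumes U: "minimal_set A U" and nd: "\<not> clone.two_dep U (pol_on A U)"
  shows "A' \<notin> K_poly"
proof
  interpret U: minimal_clone U "pol_on A U" by (rule minimal_set_clone[OF U])
  assume "A' \<in> K_poly"
  then obtain p :: "real poly" where p: "\<And>X :: ('s + 'a, nat) ualg. is_ualg X \<Longrightarrow> finite (univ X) \<Longrightarrow>
    same_sig X A' \<Longrightarrow> real (card (homs X A')) \<le> poly p (real (card (univ X)))" by (auto simp: K_poly_def)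
  note sub = minimal_set_subset[OF U]
  define F where "F = {f \<in> univ A \<rightarrow>\<^sub>E U. un f}"
  have finF: "finite F" unfolding F_def
    by (rule finite_subset[of _ "univ A \<rightarrow>\<^sub>E U"]) (use finA U.fin in \<open>auto intro: finite_PiE\<close>)
  define K where "K = card F"
  define N where "N n = card U + n * card U ^ card U" for n
  have main: "2 ^ n \<le> poly p (real m)" "m \<le> N n ^ K"
    if "m = card {restrict q (tuples U n) | q. is_pol A n q}" for n m
  proof -
    define T where "T = tuples U n"
    define XU where "XU = {restrict q T | q. is_pol A n q}"
    have finT: "finite T" unfolding T_def using U.fin by (rule finite_tuples)
    have TA: "xs \<in> tuples (univ A) n" if "xs \<in> T" for xs using that tuples_mono[OF sub] by (simp add: T_def)
    have XUc: "XU \<subseteq> T \<rightarrow>\<^sub>E univ A" using P_closed TA by (fastforce simp: XU_def)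
    have finXU: "finite XU"
      by (rule finite_subset[OF XUc]) (use finT finA in \<open>auto intro: finite_PiE\<close>)
    define Y :: "('s + 'a, 'a list \<Rightarrow> 'a) ualg" where
      "Y = \<lparr>symbs = symbs A', ar = ar A', univ = XU,
         opn = case_sum (\<lambda>f gs. restrict (\<lambda>xs. opn A f (map (\<lambda>g. g xs) gs)) T) (\<lambda>a gs. restrict (\<lambda>xs. a) T)\<rparr>"
    have Yl: "restrict (\<lambda>xs. opn A f (map (\<lambda>g. g xs) gs)) T \<in> XU" if f: "f \<in> symbs A" and gs: "gs \<in> tuples XU (ar A f)" for f gs
    proof -
      have "\<forall>g\<in>set gs. \<exists>q. is_pol A n q \<and> g = restrict q T" using gs by (auto simp: tuples_def XU_def)
      then obtain q where q: "\<And>g. g \<in> set gs \<Longrightarrow> is_pol A n (q g) \<and> g = restrict (q g) T" by metis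
      have "is_pol A n (\<lambda>xs. opn A f (map (\<lambda>g. g xs) (map q gs)))"
        by (rule is_pol_app[OF finA f]) (use gs q in \<open>auto simp: tuples_length\<close>)
      moreover have "restrict (\<lambda>xs. opn A f (map (\<lambda>g. g xs) gs)) T = restrict (\<lambda>xs. opn A f (map (\<lambda>g. g xs) (map q gs))) T"
      proof (rule restrict_ext)
        fix xs assume "xs \<in> T"
        then have "map (\<lambda>g. g xs) gs = map (\<lambda>g. g xs) (map q gs)" using q by (auto simp: map_eq_conv) (metis restrict_apply')
        then show "opn A f (map (\<lambda>g. g xs) gs) = opn A f (map (\<lambda>g. g xs) (map q gs))" by (rule arg_cong)
      qed
      ultimately show ?thesis unfolding XU_def by blast
    qed
    have Yr: "restrict (\<lambda>xs. a) T \<in> XU" if "a \<in> univ A" for a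
      using P_const[OF that, of n] unfolding XU_def by blast
    obtain u where u: "u \<in> U" using U.two_elements by blast
    have Y: "is_ualg Y" unfolding is_ualg_def
      using Yl Yr u sub by (auto simp: Y_def const_expansion_simps)
    have "same_sig Y A'" by (simp add: same_sig_def Y_def)
    then have le: "real (card (homs Y A')) \<le> poly p (real (card XU))"
      using homs_bound_any_type[OF p _ Y] finXU finA by (simp add: Y_def const_expansion_simps)
    have "card T \<le> card (homs Y A')"
    proof (rule card_inj_on_le)
      show "finite (homs Y A')" by (rule finite_homs) (simp_all add: Y_def finXU finA const_expansion_simps)
      let ?ev = "\<lambda>xs. restrict (\<lambda>g. g xs) XU"
      show "?ev ` T \<subseteq> homs Y A'"
      proof safe
        fix xs assume xs: "xs \<in> T"
        have "?ev xs (opn Y f gs) = opn A' f (map (?ev xs) gs)"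
          if f: "f \<in> symbs Y" and gs: "gs \<in> tuples (univ Y) (ar Y f)" for f gs
        proof -
          have m: "map (?ev xs) gs = map (\<lambda>g. g xs) gs" using gs by (auto simp: tuples_def Y_def)
          show ?thesis unfolding m
          proof (cases f)
            case (Inl f')
            then show "?ev xs (opn Y f gs) = opn A' f (map (\<lambda>g. g xs) gs)" using f gs Yl[of f' gs] xs by (auto simp: Y_def const_expansion_simps)
          next
            case (Inr a)
            then show "?ev xs (opn Y f gs) = opn A' f (map (\<lambda>g. g xs) gs)" using f Yr[of a] xs by (auto simp: Y_def const_expansion_simps)
          qed
        qed
        moreover have "?ev xs \<in> univ Y \<rightarrow>\<^sub>E univ A'"
          using XUc xs by (auto simp: Y_def const_expansion_simps)
        ultimately show "?ev xs \<in> homs Y A'" unfolding homs_def by blast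
      qed
      show "inj_on ?ev T"
      proof (rule inj_onI)
        fix xs ys assume *: "xs \<in> T" "ys \<in> T" "?ev xs = ?ev ys"
        have "xs ! i = ys ! i" if i: "i < n" for i
        proof -
          have "restrict (\<lambda>xs. xs ! i) T \<in> XU" using P_proj[OF i] unfolding XU_def by blast
          then have "restrict (\<lambda>xs. xs ! i) T xs = restrict (\<lambda>xs. xs ! i) T ys"
            using *(3) by (metis (mono_tags, lifting) restrict_apply')
          then show ?thesis using *(1,2) by simp
        qed
        then show "xs = ys" using * by (intro nth_equalityI) (auto simp: T_def tuples_length)
      qed
    qed
    moreover have "card T = card U ^ n" unfolding T_def using U.fin by (rule card_tuples)
    moreover have "2 ^ n \<le> card U ^ n" using U.card2 by (intro power_mono) auto
    ultimately have "2 ^ n \<le> card (homs Y A')" by linarith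
    then have "real (2 ^ n) \<le> real (card (homs Y A'))" by (rule of_nat_mono)
    also have "\<dots> \<le> poly p (real m)" using le that by (simp add: XU_def T_def)
    finally show "2 ^ n \<le> poly p (real m)" by simp
    define E where "E = (\<lambda>c. restrict (\<lambda>xs. c) T) ` U \<union>
      (\<lambda>(i, u). restrict (\<lambda>xs. u (xs ! i)) T) ` ({..<n} \<times> (U \<rightarrow>\<^sub>E U))"
    have finE: "finite E" unfolding E_def using U.fin by (auto intro!: finite_PiE)
    have "card E \<le> card ((\<lambda>c. restrict (\<lambda>xs. c) T) ` U) +
      card ((\<lambda>(i, u). restrict (\<lambda>xs. u (xs ! i)) T) ` ({..<n} \<times> (U \<rightarrow>\<^sub>E U)))" unfolding E_def by (rule card_Un_le)
    also have "\<dots> \<le> card U + card ({..<n} \<times> (U \<rightarrow>\<^sub>E U))"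
      using U.fin by (intro add_mono card_image_le) (auto intro!: finite_PiE)
    also have "\<dots> = N n" using U.fin by (simp add: N_def card_cartesian_product card_PiE)
    finally have cE: "card E \<le> N n" .
    have "card XU \<le> card (F \<rightarrow>\<^sub>E E)"
    proof (rule card_inj_on_le)
      show "finite (F \<rightarrow>\<^sub>E E)" using finF finE by (intro finite_PiE) auto
      let ?\<Phi> = "\<lambda>g. \<lambda>f\<in>F. restrict (\<lambda>xs. f (g xs)) T"
      have inE: "restrict (\<lambda>xs. f (g xs)) T \<in> E" if g: "g \<in> XU" and f: "f \<in> F" for f g
      proof -
        obtain q where q: "is_pol A n q" "g = restrict q T" using g by (auto simp: XU_def)
        have f': "un f" "\<And>x. x \<in> univ A \<Longrightarrow> f x \<in> U" using f by (auto simp: F_def)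
        have "is_pol A n (\<lambda>xs. f (q xs))" by (rule un_app[OF f'(1) q(1)])
        then have "pol_on A U n (\<lambda>xs. f (q xs))"
          unfolding pol_on_def using f'(2) P_closed[OF q(1)] tuples_mono[OF sub] by blast
        from U.essentially_unary[OF nd this] have "restrict (\<lambda>xs. f (q xs)) T \<in> E"
        proof (elim disjE bexE exE conjE)
          fix c assume c: "c \<in> U" "\<forall>xs\<in>tuples U n. f (q xs) = c"
          then have "restrict (\<lambda>xs. f (q xs)) T = restrict (\<lambda>xs. c) T"
            by (intro restrict_ext) (simp add: T_def)
          then show ?thesis using c by (auto simp: E_def)
        next
          fix i u assume i: "i < n" "U.un u" "inj_on u U" "\<forall>xs\<in>tuples U n. f (q xs) = u (xs ! i)"
          have "restrict (\<lambda>xs. f (q xs)) T = restrict (\<lambda>xs. restrict u U (xs ! i)) T"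
            by (intro restrict_ext) (use i in \<open>simp add: T_def tuples_nth\<close>)
          moreover have "restrict u U \<in> U \<rightarrow>\<^sub>E U" using U.un_closed[OF i(2)] by auto
          ultimately show ?thesis using i(1) unfolding E_def
            by (intro UnI2 image_eqI[of _ _ "(i, restrict u U)"]) auto
        qed
        moreover have "restrict (\<lambda>xs. f (g xs)) T = restrict (\<lambda>xs. f (q xs)) T"
          by (intro restrict_ext) (simp add: q)
        ultimately show ?thesis by simp
      qed
      then show "?\<Phi> ` XU \<subseteq> F \<rightarrow>\<^sub>E E" by auto
      show "inj_on ?\<Phi> XU"
      proof (rule inj_onI)
        fix g g' assume g: "g \<in> XU" "g' \<in> XU" and eq: "?\<Phi> g = ?\<Phi> g'"
        show "g = g'"
        proof (rule PiE_ext)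
          show "g \<in> T \<rightarrow>\<^sub>E univ A" "g' \<in> T \<rightarrow>\<^sub>E univ A" using g XUc by auto
          fix xs assume xs: "xs \<in> T"
          show "g xs = g' xs"
          proof (rule ccontr)
            assume ne: "g xs \<noteq> g' xs"
            have gA: "g xs \<in> univ A" "g' xs \<in> univ A" using g XUc xs by auto
            obtain f where f: "un f" "\<And>x. x \<in> univ A \<Longrightarrow> f x \<in> U" "f (g xs) \<noteq> f (g' xs)"
              using separation[OF U gA ne] by blast
            have "restrict f (univ A) \<in> F" using f un_cong[OF f(1)] by (auto simp: F_def)
            then show False using fun_cong[OF fun_cong[OF eq], of "restrict f (univ A)" xs] xs gA f(3) by simp
          qed
        qed
      qed
    qed
    also have "\<dots> = card E ^ K" using finF by (simp add: card_PiE K_def)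
    also have "\<dots> \<le> N n ^ K" using cE by (rule power_mono) simp
    finally show "m \<le> N n ^ K" using that by (simp add: XU_def T_def)
  qed
  obtain c where c: "c \<ge> 0" "\<And>m n :: nat. m \<le> n \<Longrightarrow> poly p (real m) \<le> c * (1 + real n) ^ degree p"
    using poly_power_bound[of p] by blast
  define B where "B = 1 + real (card U) + real (card U ^ card U)"
  have bound: "2 ^ n \<le> (c * (2 * B ^ K) ^ degree p) * (1 + real n) ^ (K * degree p)" for n
  proof -
    define m where "m = card {restrict q (tuples U n) | q. is_pol A n q}"
    have B1: "B \<ge> 1" by (simp add: B_def)
    have "real (N n) \<le> B * (1 + real n)"
      by (simp add: N_def B_def algebra_simps)
    then have NK: "real (N n) ^ K \<le> (B * (1 + real n)) ^ K" by (rule power_mono) simp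
    have "1 * 1 \<le> B * (1 + real n)" using B1 by (intro mult_mono) auto
    then have "1 \<le> (B * (1 + real n)) ^ K" by (intro one_le_power) simp
    with NK have le: "1 + real (N n ^ K) \<le> 2 * B ^ K * (1 + real n) ^ K" by (simp add: power_mult_distrib)
    have "2 ^ n \<le> poly p (real m)" using main(1)[OF m_def] .
    also have "\<dots> \<le> c * (1 + real (N n ^ K)) ^ degree p" using c(2)[OF main(2)[OF m_def]] .
    also have "\<dots> \<le> c * (2 * B ^ K * (1 + real n) ^ K) ^ degree p"
      using le c(1) by (intro mult_left_mono power_mono) auto
    also have "\<dots> = (c * (2 * B ^ K) ^ degree p) * (1 + real n) ^ (K * degree p)"
      by (simp add: power_mult_distrib power_mult)
    finally show ?thesis .
  qed
  obtain n :: nat where "2 ^ n > (c * (2 * B ^ K) ^ degree p) * (1 + real n) ^ (K * degree p)"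
    using exponential_beats_power by blast
  then show False using bound[of n] by linarith
qed

theorem K_poly_iff_typ: "A' \<in> K_poly \<longleftrightarrow> typ_of A \<noteq> 1"
proof -
  obtain U where U: "minimal_set A U" using minimal_set_exists by blast
  show ?thesis using typ_of_1_iff[OF U] K_poly_of_two_dep[OF U] not_K_poly_of_unary[OF U] by blast
qed

end

section \<open>Verification of random access machine programs\<close>

definition wp :: "('s, nat) ualg \<Rightarrow> 's com \<Rightarrow> (nat \<Rightarrow> config \<Rightarrow> bool) \<Rightarrow> config \<Rightarrow> bool" where
  "wp X c Q s \<longleftrightarrow> (\<exists>t s'. exec X c s t s' \<and> Q t s')"

lemma reg_set_reg [simp]: "reg (set_reg i v s) = (reg s)(i := v)"
  and arr_set_reg [simp]: "arr (set_reg i v s) = arr s"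
  and out_set_reg [simp]: "out (set_reg i v s) = out s"
  by (simp_all add: set_reg_def)

lemma set_reg_set_reg [simp]: "set_reg i v (set_reg i w s) = set_reg i v s"
  by (simp add: set_reg_def)

lemma wp_Const [simp]: "wp X (Const i v) Q s \<longleftrightarrow> Q 1 (set_reg i v s)"
  unfolding wp_def by (auto simp: exec.simps[of X "Const i v"])

lemma wp_Add [simp]: "wp X (Add i j k) Q s \<longleftrightarrow> Q 1 (set_reg i (reg s j + reg s k) s)"
  unfolding wp_def by (auto simp: exec.simps[of X "Add i j k"])

lemma wp_Sub [simp]: "wp X (Sub i j k) Q s \<longleftrightarrow> Q 1 (set_reg i (reg s j - reg s k) s)"
  unfolding wp_def by (auto simp: exec.simps[of X "Sub i j k"])

lemma wp_Load [simp]: "wp X (Load i a j) Q s \<longleftrightarrow> Q 1 (set_reg i (arr s a (reg s j)) s)"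
  unfolding wp_def by (auto simp: exec.simps[of X "Load i a j"])

lemma wp_Store [simp]: "wp X (Store a i j) Q s \<longleftrightarrow> Q 1 (s\<lparr>arr := (arr s)(a := (arr s a)(reg s i := reg s j))\<rparr>)"
  unfolding wp_def by (auto simp: exec.simps[of X "Store a i j"])

lemma wp_Apply [simp]: "wp X (Apply i f js) Q s \<longleftrightarrow> Q 1 (set_reg i (lookup X f (map (reg s) js)) s)"
  unfolding wp_def by (auto simp: exec.simps[of X "Apply i f js"])

lemma wp_Emit [simp]: "wp X (Emit i) Q s \<longleftrightarrow> Q 1 (s\<lparr>out := out s @ [reg s i]\<rparr>)"
  unfolding wp_def by (auto simp: exec.simps[of X "Emit i"])

lemma wp_Seq [simp]: "wp X (Seq c d) Q s \<longleftrightarrow> wp X c (\<lambda>t s'. wp X d (\<lambda>t'. Q (t + t')) s') s"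
  unfolding wp_def by (simp add: exec.simps[of X "Seq c d"]) blast

lemma wp_Cond [simp]: "wp X (Cond i c d) Q s \<longleftrightarrow>
     (if reg s i \<noteq> 0 then wp X c (\<lambda>t. Q (t + 1)) s else wp X d (\<lambda>t. Q (t + 1)) s)"
  unfolding wp_def by (auto simp: exec.simps[of X "Cond i c d"])

lemma wp_mono: "wp X c Q s \<Longrightarrow> (\<And>t s'. Q t s' \<Longrightarrow> R t s') \<Longrightarrow> wp X c R s"
  unfolding wp_def by blast

lemma wp_seqI:
  "wp X c Q s \<Longrightarrow> (\<And>t s'. Q t s' \<Longrightarrow> wp X d (\<lambda>t'. R (t + t')) s') \<Longrightarrow> wp X (Seq c d) R s"
  unfolding wp_Seq by (rule wp_mono)

lemma wp_while:
  assumes step: "\<And>s. I s \<Longrightarrow> reg s i \<noteq> 0 \<Longrightarrow> wp X c (\<lambda>t s'. t \<le> T \<and> I s' \<and> \<mu> s' < \<mu> s) s" and I: "I s"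
  shows "wp X (While i c) (\<lambda>t s'. t \<le> (T + 1) * \<mu> s + 1 \<and> I s' \<and> reg s' i = 0) s"
  using I
proof (induction "\<mu> s" arbitrary: s rule: less_induct)
  case less
  show ?case
  proof (cases "reg s i = 0")
    case True
    then show ?thesis using less.prems exec.WhileF[of s i X c] unfolding wp_def by fastforce
  next
    case False
    then obtain t s' where 1: "exec X c s t s'" "t \<le> T" "I s'" "\<mu> s' < \<mu> s"
      using step[OF less.prems] unfolding wp_def by blast
    then obtain t' s'' where 2: "exec X (While i c) s' t' s''" "t' \<le> (T + 1) * \<mu> s' + 1" "I s''" "reg s'' i = 0"
      using less.hyps[of s'] unfolding wp_def by blast
    have "exec X (While i c) s (t + t' + 1) s''" using False 1(1) 2(1) by (rule exec.WhileT)
    moreover have "t + t' + 1 \<le> (T + 1) * \<mu> s + 1"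
    proof -
      have "(T + 1) * Suc (\<mu> s') \<le> (T + 1) * \<mu> s" using 1(4) by (intro mult_le_mono2) simp
      then show ?thesis using 1(2) 2(2) by simp
    qed
    ultimately show ?thesis using 2 unfolding wp_def by blast
  qed
qed

text \<open>Registers: size of the input, the constants one and zero, the variables of the main loops,
  scratch registers; the even (odd) registers from 20 on range over preimages of prescribed elements
  (arguments of operations).\<close>

abbreviation (input) "rN \<equiv> (0 :: nat)"
abbreviation (input) "rOne \<equiv> (1 :: nat)"
abbreviation (input) "rZero \<equiv> (2 :: nat)"
abbreviation (input) "rK \<equiv> (3 :: nat)"
abbreviation (input) "rHead \<equiv> (4 :: nat)"
abbreviation (input) "rTail \<equiv> (5 :: nat)"
abbreviation (input) "rEnd \<equiv> (6 :: nat)"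
abbreviation (input) "rLev \<equiv> (7 :: nat)"
abbreviation (input) "rRow \<equiv> (8 :: nat)"
abbreviation (input) "rA \<equiv> (9 :: nat)"
abbreviation (input) "rGood \<equiv> (10 :: nat)"
abbreviation (input) "rT \<equiv> (11 :: nat)"
abbreviation (input) "rD \<equiv> (12 :: nat)"
abbreviation (input) "rD' \<equiv> (13 :: nat)"
abbreviation (input) "rVal \<equiv> (14 :: nat)"
abbreviation (input) "rY \<equiv> (15 :: nat)"
abbreviation (input) "rFlag \<equiv> (16 :: nat)"
abbreviation (input) "rCh \<equiv> (17 :: nat)"
abbreviation (input) "rIdx \<equiv> (18 :: nat)"
abbreviation (input) "rX \<equiv> (19 :: nat)"
abbreviation (input) "rPin j \<equiv> 20 + 2 * (j :: nat)"
abbreviation (input) "rArg j \<equiv> 21 + 2 * (j :: nat)"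

definition env :: "nat \<Rightarrow> config \<Rightarrow> bool" where
  "env n s \<longleftrightarrow> reg s rN = n \<and> reg s rOne = 1 \<and> reg s rZero = 0"

definition countdown :: "nat \<Rightarrow> 's com \<Rightarrow> 's com" where
  "countdown a c = Seq (Add a rN rZero) (While a (Seq (Sub a a rOne) c))"

lemma wp_countdown:
  assumes env: "\<And>k s. I k s \<Longrightarrow> env n s" and s: "env n s" and init: "I n (set_reg a n s)"
    and step: "\<And>k s. k < n \<Longrightarrow> I (Suc k) s \<Longrightarrow> reg s a = Suc k \<Longrightarrow>
      wp X c (\<lambda>t s'. t \<le> T \<and> I k s' \<and> reg s' a = k) (set_reg a k s)"
  shows "wp X (countdown a c) (\<lambda>t s'. t \<le> (T + 2) * n + 2 \<and> I 0 s') s"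
proof -
  let ?I = "\<lambda>s. reg s a \<le> n \<and> I (reg s a) s"
  let ?s = "set_reg a n s"
  have "wp X (While a (Seq (Sub a a rOne) c))
    (\<lambda>t s'. t \<le> (T + 1 + 1) * reg ?s a + 1 \<and> ?I s' \<and> reg s' a = 0) ?s"
  proof (rule wp_while[where \<mu> = "\<lambda>s. reg s a" and I = ?I])
    show "?I ?s" using init by simp
    fix s assume s: "?I s" "reg s a \<noteq> 0"
    then obtain k where k: "reg s a = Suc k" by (cases "reg s a") auto
    then have one: "reg s rOne = 1" using env[of _ s] s by (auto simp: env_def)
    have "wp X c (\<lambda>t s'. t \<le> T \<and> I k s' \<and> reg s' a = k) (set_reg a k s)"
      by (rule step) (use s k in auto)
    then have "wp X c (\<lambda>t s'. 1 + t \<le> T + 1 \<and> ?I s' \<and> reg s' a < reg s a) (set_reg a k s)"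
      by (rule wp_mono) (use s k in auto)
    then show "wp X (Seq (Sub a a rOne) c) (\<lambda>t s'. t \<le> T + 1 \<and> ?I s' \<and> reg s' a < reg s a) s"
      using k one by simp
  qed
  then have "wp X (While a (Seq (Sub a a rOne) c)) (\<lambda>t s'. 1 + t \<le> (T + 2) * n + 2 \<and> I 0 s') ?s"
    by (rule wp_mono) auto
  then show ?thesis unfolding countdown_def using s by (simp add: env_def)
qed

fun nest :: "nat list \<Rightarrow> 's com \<Rightarrow> 's com" where
  "nest [] c = c"
| "nest (a # as) c = countdown a (nest as c)"

fun nest_time :: "nat \<Rightarrow> nat \<Rightarrow> nat \<Rightarrow> nat" where
  "nest_time n T 0 = T"
| "nest_time n T (Suc r) = (nest_time n T r + 2) * n + 2"

text \<open>\<open>J D s\<close>: the tuples in \<open>D\<close> have been processed.\<close>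

lemma wp_nest_aux:
  assumes env: "\<And>D s. J D s \<Longrightarrow> env n s"
    and stable: "\<And>D s a v. J D s \<Longrightarrow> a \<in> set (ps @ as) \<Longrightarrow> J D (set_reg a v s)"
    and body: "\<And>D s xs. J D s \<Longrightarrow> xs \<in> tuples {0..<n} (length (ps @ as)) \<Longrightarrow> map (reg s) (ps @ as) = xs \<Longrightarrow>
      wp X c (\<lambda>t s'. t \<le> T \<and> J (insert xs D) s' \<and> (\<forall>a\<in>set (ps @ as). reg s' a = reg s a)) s"
    and dist: "distinct (ps @ as)" and J: "J D s" and ys: "ys \<in> tuples {0..<n} (length ps)" "map (reg s) ps = ys"
  shows "wp X (nest as c) (\<lambda>t s'. t \<le> nest_time n T (length as) \<and>
    J (D \<union> (\<lambda>zs. ys @ zs) ` tuples {0..<n} (length as)) s' \<and> (\<forall>a\<in>set ps. reg s' a = reg s a)) s"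
  using assms
proof (induction as arbitrary: ps ys D s)
  case Nil
  have "wp X c (\<lambda>t s'. t \<le> T \<and> J (insert ys D) s' \<and> (\<forall>a\<in>set (ps @ []). reg s' a = reg s a)) s"
    by (rule Nil(3)) (use Nil in simp_all)
  then show ?case by (simp add: tuples_0)
next
  case (Cons a as)
  let ?D = "\<lambda>k. D \<union> {ys @ x # zs | x zs. k \<le> x \<and> x < n \<and> zs \<in> tuples {0..<n} (length as)}"
  let ?I = "\<lambda>k s'. J (?D k) s' \<and> (\<forall>b\<in>set ps. reg s' b = reg s b)"
  have a: "a \<notin> set ps" using Cons.prems(4) by auto
  have "wp X (countdown a (nest as c)) (\<lambda>t s'. t \<le> (nest_time n T (length as) + 2) * n + 2 \<and> ?I 0 s') s"
  proof (rule wp_countdown[where I = ?I])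
    show "env n s'" if "?I k s'" for k s' using Cons.prems(1) that by blast
    show "env n s" using Cons.prems(1,5) by blast
    have "?D n = D" by auto
    then show "?I n (set_reg a n s)" using Cons.prems(2)[OF Cons.prems(5)] a by auto
    fix k s' assume k: "k < n" and I: "?I (Suc k) s'" "reg s' a = Suc k"
    let ?s = "set_reg a k s'"
    have "wp X (nest as c) (\<lambda>t s''. t \<le> nest_time n T (length as) \<and>
      J (?D (Suc k) \<union> (\<lambda>zs. (ys @ [k]) @ zs) ` tuples {0..<n} (length as)) s'' \<and>
      (\<forall>b\<in>set (ps @ [a]). reg s'' b = reg ?s b)) ?s"
    proof (rule Cons.IH)
      show "J D s \<Longrightarrow> env n s" for D s by (rule Cons.prems(1))
      show "J D s \<Longrightarrow> b \<in> set ((ps @ [a]) @ as) \<Longrightarrow> J D (set_reg b v s)" for D s b v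
        by (rule Cons.prems(2)) auto
      show "wp X c (\<lambda>t s'. t \<le> T \<and> J (insert xs D) s' \<and> (\<forall>b\<in>set ((ps @ [a]) @ as). reg s' b = reg s b)) s"
        if "J D s" "xs \<in> tuples {0..<n} (length ((ps @ [a]) @ as))" "map (reg s) ((ps @ [a]) @ as) = xs" for D s xs
        using Cons.prems(3)[of D s xs] that by simp
      show "distinct ((ps @ [a]) @ as)" using Cons.prems(4) by simp
      show "J (?D (Suc k)) ?s" using Cons.prems(2) I by auto
      show "ys @ [k] \<in> tuples {0..<n} (length (ps @ [a]))" using Cons.prems(6) k by (auto simp: tuples_def)
      show "map (reg ?s) (ps @ [a]) = ys @ [k]" using Cons.prems(7) I a by auto
    qed
    then show "wp X (nest as c) (\<lambda>t s''. t \<le> nest_time n T (length as) \<and> ?I k s'' \<and> reg s'' a = k) ?s"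
    proof (rule wp_mono)
      fix t s'' assume *: "t \<le> nest_time n T (length as) \<and>
        J (?D (Suc k) \<union> (\<lambda>zs. (ys @ [k]) @ zs) ` tuples {0..<n} (length as)) s'' \<and>
        (\<forall>b\<in>set (ps @ [a]). reg s'' b = reg ?s b)"
      have "?D (Suc k) \<union> (\<lambda>zs. (ys @ [k]) @ zs) ` tuples {0..<n} (length as) = ?D k"
      proof (intro Set.equalityI subsetI)
        fix x assume "x \<in> ?D (Suc k) \<union> (\<lambda>zs. (ys @ [k]) @ zs) ` tuples {0..<n} (length as)"
        then show "x \<in> ?D k" using k by force
      next
        fix x assume "x \<in> ?D k"
        then show "x \<in> ?D (Suc k) \<union> (\<lambda>zs. (ys @ [k]) @ zs) ` tuples {0..<n} (length as)"
          by (auto simp: image_iff le_less Suc_le_eq)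
      qed
      then show "t \<le> nest_time n T (length as) \<and> ?I k s'' \<and> reg s'' a = k"
        using * I a by auto
    qed
  qed
  moreover have "?D 0 = D \<union> (\<lambda>zs. ys @ zs) ` tuples {0..<n} (length (a # as))"
  proof -
    have "tuples {0..<n} (Suc r) = {x # zs | x zs. x < n \<and> zs \<in> tuples {0..<n} r}" for r
      by (auto simp: tuples_def length_Suc_conv)
    then show ?thesis by auto
  qed
  ultimately show ?case by simp
qed

lemma wp_nest:
  assumes "\<And>D s. J D s \<Longrightarrow> env n s"
    and "\<And>D s a v. J D s \<Longrightarrow> a \<in> set as \<Longrightarrow> J D (set_reg a v s)"
    and "\<And>D s xs. J D s \<Longrightarrow> xs \<in> tuples {0..<n} (length as) \<Longrightarrow> map (reg s) as = xs \<Longrightarrow>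
      wp X c (\<lambda>t s'. t \<le> T \<and> J (insert xs D) s' \<and> (\<forall>a\<in>set as. reg s' a = reg s a)) s"
    and "distinct as" and "J D s"
  shows "wp X (nest as c) (\<lambda>t s'. t \<le> nest_time n T (length as) \<and> J (D \<union> tuples {0..<n} (length as)) s') s"
  using wp_nest_aux[of J n "[]" as X c T D s "[]"] assms by (simp add: tuples_0)

definition same :: "nat set \<Rightarrow> config \<Rightarrow> config \<Rightarrow> bool" where
  "same S s s' \<longleftrightarrow> (\<forall>r. r \<notin> S \<longrightarrow> reg s' r = reg s r) \<and> arr s' 1 = arr s 1 \<and> out s' = out s"

lemma same_refl: "same S s s" by (simp add: same_def)

lemma same_trans: "same S s s' \<Longrightarrow> same S s' s'' \<Longrightarrow> same S s s''"
  by (simp add: same_def)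

lemma same_mono: "same S s s' \<Longrightarrow> S \<subseteq> S' \<Longrightarrow> same S' s s'"
  by (auto simp: same_def)

lemma same_reg: "same S s s' \<Longrightarrow> r \<notin> S \<Longrightarrow> reg s' r = reg s r"
  by (simp add: same_def)

lemma same_set_reg: "same S s s' \<Longrightarrow> r \<in> S \<Longrightarrow> same S s (set_reg r v s')"
  by (auto simp: same_def)

definition skip :: "'s com" where "skip = Const rT 0"

text \<open>Array 0 holds a partial map, with 0 for undefined; \<open>act y w\<close> records that the element in
  register \<open>y\<close> has value \<open>w\<close>, or clears the flag if this is contradictory.\<close>

definition act :: "nat \<Rightarrow> nat \<Rightarrow> 's com" where
  "act y w = Seq (Const rVal w) (Seq (Load rT 0 y) (Cond rT
     (Seq (Sub rD rT rVal) (Seq (Sub rD' rVal rT) (Seq (Add rD rD rD') (Cond rD (Const rFlag 0) skip))))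
     (Seq (Store 0 y rVal) (Const rCh 1))))"

definition acted :: "nat \<Rightarrow> nat \<Rightarrow> config \<Rightarrow> config \<Rightarrow> bool" where
  "acted x w s s' \<longleftrightarrow> same {rT, rD, rD', rVal, rFlag, rCh} s s' \<and>
     arr s' 0 = (if arr s 0 x = 0 then (arr s 0)(x := w) else arr s 0) \<and>
     reg s' rCh = (if arr s 0 x = 0 then 1 else reg s rCh) \<and>
     reg s' rFlag = (if arr s 0 x \<noteq> 0 \<and> arr s 0 x \<noteq> w then 0 else reg s rFlag)"

lemma wp_act:
  assumes "y \<notin> {rT, rD, rD', rVal, rFlag, rCh}"
  shows "wp X (act y w) (\<lambda>t s'. t \<le> 8 \<and> acted (reg s y) w s s') s"
  using assms by (auto simp: act_def acted_def same_def skip_def)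

fun sel :: "'s com list \<Rightarrow> 's com" where
  "sel [] = skip"
| "sel (c # cs) = Seq (Sub rT rT rOne) (Cond rT (sel cs) c)"

lemma wp_sel:
  assumes "reg s rOne = 1" "v < length cs" "reg s rT = Suc v"
    "wp X (cs ! v) (\<lambda>t s'. t \<le> T \<and> Q s') (set_reg rT 0 s)"
  shows "wp X (sel cs) (\<lambda>t s'. t \<le> 2 * length cs + T \<and> Q s') s"
  using assms
proof (induction cs arbitrary: v s)
  case (Cons c cs)
  show ?case
  proof (cases v)
    case 0
    have "wp X c (\<lambda>t s'. Suc (Suc t) \<le> 2 * length (c # cs) + T \<and> Q s') (set_reg rT 0 s)"
      using Cons.prems(4) unfolding 0 by (simp del: One_nat_def) (erule wp_mono, simp)
    then show ?thesis using Cons.prems 0 by (simp add: numeral_2_eq_2)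
  next
    case (Suc u)
    have eq: "set_reg rT 0 (set_reg rT v s) = set_reg rT 0 s" by (simp add: set_reg_def)
    have "wp X (sel cs) (\<lambda>t s'. t \<le> 2 * length cs + T \<and> Q s') (set_reg rT v s)"
      by (rule Cons.IH[of _ u]) (use Cons.prems Suc eq in auto)
    then have "wp X (sel cs) (\<lambda>t s'. Suc (Suc t) \<le> 2 * length (c # cs) + T \<and> Q s') (set_reg rT v s)"
      by (rule wp_mono) simp
    then show ?thesis using Cons.prems Suc by simp
  qed
qed simp

text \<open>\<open>look m tab k acc\<close> evaluates the remaining \<open>k\<close> arguments of an operation with value table \<open>tab\<close>
  under the partial map by case distinction and records the result.\<close>

fun look :: "nat \<Rightarrow> (nat list \<Rightarrow> nat) \<Rightarrow> nat \<Rightarrow> nat list \<Rightarrow> 's com" where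
  "look m tab 0 acc = act rY (tab acc)"
| "look m tab (Suc k) acc = Seq (Load rT 0 (rArg (length acc)))
     (Cond rT (sel (map (\<lambda>v. look m tab k (acc @ [Suc v])) [0..<m])) skip)"

definition looked :: "bool \<Rightarrow> nat \<Rightarrow> nat \<Rightarrow> config \<Rightarrow> config \<Rightarrow> bool" where
  "looked b x w s s' \<longleftrightarrow> (if b then acted x w s s' else same {rT} s s' \<and> arr s' 0 = arr s 0)"

lemma looked_set_reg: "looked b x w (set_reg rT v s) s' \<Longrightarrow> looked b x w s s'"
  by (auto simp: looked_def acted_def same_def split: if_splits)

lemma wp_look:
  assumes "reg s rOne = 1" "length xs = k" "\<And>j. j < k \<Longrightarrow> reg s (rArg (length acc + j)) = xs ! j"
    "\<And>x. x \<in> set xs \<Longrightarrow> arr s 0 x \<le> m"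
  shows "wp X (look m tab k acc) (\<lambda>t s'. t \<le> k * (2 * m + 4) + 8 \<and>
    looked (\<forall>x\<in>set xs. arr s 0 x \<noteq> 0) (reg s rY) (tab (acc @ map (arr s 0) xs)) s s') s"
  using assms
proof (induction k arbitrary: acc xs s)
  case 0
  have "wp X (act rY (tab acc)) (\<lambda>t s'. t \<le> 8 \<and> acted (reg s rY) (tab acc) s s') s"
    by (rule wp_act) simp
  then show ?case using 0 by (simp add: looked_def)
next
  case (Suc k)
  obtain x ys where xs: "xs = x # ys" "length ys = k" using Suc.prems(2) by (cases xs) auto
  have x: "reg s (rArg (length acc)) = x" using Suc.prems(3)[of 0] xs by simp
  let ?v = "arr s 0 x"
  let ?s = "set_reg rT ?v s"
  let ?Q = "\<lambda>s'. looked (\<forall>x\<in>set xs. arr s 0 x \<noteq> 0) (reg s rY) (tab (acc @ map (arr s 0) xs)) s s'"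
  show ?case
  proof (cases "?v = 0")
    case True
    then have "?Q (set_reg rT 0 (set_reg rT 0 s))" using xs by (simp add: looked_def same_def)
    then show ?thesis using x True by (simp add: skip_def)
  next
    case False
    then obtain v where v: "?v = Suc v" by (cases ?v) auto
    then have vm: "v < m" using Suc.prems(4)[of x] xs by simp
    let ?r = "set_reg rT 0 ?s"
    have "wp X (look m tab k (acc @ [Suc v])) (\<lambda>t s'. t \<le> k * (2 * m + 4) + 8 \<and>
      looked (\<forall>x\<in>set ys. arr ?r 0 x \<noteq> 0) (reg ?r rY) (tab ((acc @ [Suc v]) @ map (arr ?r 0) ys)) ?r s') ?r"
    proof (rule Suc.IH)
      show "reg ?r rOne = 1" using Suc.prems(1) by simp
      show "length ys = k" by (rule xs)
      show "reg ?r (rArg (length (acc @ [Suc v]) + j)) = ys ! j" if "j < k" for j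
        using Suc.prems(3)[of "Suc j"] that xs by simp
      show "arr ?r 0 z \<le> m" if "z \<in> set ys" for z using Suc.prems(4) that xs by simp
    qed
    then have "wp X (look m tab k (acc @ [Suc v])) (\<lambda>t s'. t \<le> k * (2 * m + 4) + 8 \<and> ?Q s') ?r"
    proof (rule wp_mono)
      fix t s' assume *: "t \<le> k * (2 * m + 4) + 8 \<and>
        looked (\<forall>x\<in>set ys. arr ?r 0 x \<noteq> 0) (reg ?r rY) (tab ((acc @ [Suc v]) @ map (arr ?r 0) ys)) ?r s'"
      have "looked (\<forall>x\<in>set xs. arr s 0 x \<noteq> 0) (reg s rY) (tab (acc @ map (arr s 0) xs)) ?r s'"
        using * v xs by simp
      then show "t \<le> k * (2 * m + 4) + 8 \<and> ?Q s'" using * looked_set_reg by blast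
    qed
    then have "wp X (map (\<lambda>v. look m tab k (acc @ [Suc v])) [0..<m] ! v)
      (\<lambda>t s'. t \<le> k * (2 * m + 4) + 8 \<and> ?Q s') ?r" using vm by simp
    note wp_sel[where s = ?s, OF _ _ _ this]
    then have "wp X (sel (map (\<lambda>v. look m tab k (acc @ [Suc v])) [0..<m]))
      (\<lambda>t s'. t \<le> 2 * m + (k * (2 * m + 4) + 8) \<and> ?Q s') ?s"
      using Suc.prems(1) vm v unfolding length_map length_upt minus_nat.diff_0 by (simp del: set_reg_set_reg)
    then have "wp X (sel (map (\<lambda>v. look m tab k (acc @ [Suc v])) [0..<m]))
      (\<lambda>t s'. Suc (Suc t) \<le> Suc k * (2 * m + 4) + 8 \<and> ?Q s') ?s" by (rule wp_mono) auto
    then show ?thesis using x v by simp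
  qed
qed

section \<open>Enumerating homomorphisms level by level\<close>

definition tab :: "('s, 'a) ualg \<Rightarrow> ('a \<Rightarrow> nat) \<Rightarrow> 's \<Rightarrow> nat list \<Rightarrow> nat" where
  "tab C enc f vs = enc (opn C f (map (inv_into (univ C) enc) vs))"

definition step_prog :: "('s, 'a) ualg \<Rightarrow> ('a \<Rightarrow> nat) \<Rightarrow> nat \<Rightarrow> 's \<Rightarrow> 's com" where
  "step_prog C enc m f = nest (map (\<lambda>j. rArg j) [0..<ar C f])
     (Seq (Apply rY f (map (\<lambda>j. rArg j) [0..<ar C f])) (look m (tab C enc f) (ar C f) []))"

primrec pass_prog :: "('s, 'a) ualg \<Rightarrow> ('a \<Rightarrow> nat) \<Rightarrow> nat \<Rightarrow> 's list \<Rightarrow> 's com" where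
  "pass_prog C enc m [] = skip"
| "pass_prog C enc m (f # fs) = Seq (step_prog C enc m f) (pass_prog C enc m fs)"

definition close_prog :: "('s, 'a) ualg \<Rightarrow> ('a \<Rightarrow> nat) \<Rightarrow> nat \<Rightarrow> 's list \<Rightarrow> 's com" where
  "close_prog C enc m fs = Seq (Const rCh 1) (While rCh (Seq (Const rCh 0) (pass_prog C enc m fs)))"

primrec pins_prog :: "('a \<Rightarrow> nat) \<Rightarrow> nat \<Rightarrow> 'a list \<Rightarrow> 's com" where
  "pins_prog enc j [] = skip"
| "pins_prog enc j (a # as) = Seq (act (rPin j) (enc a)) (pins_prog enc (Suc j) as)"

definition copy_prog :: "'s com" where
  "copy_prog = countdown rX (Seq (Add rIdx rHead rX) (Seq (Load rT 1 rIdx) (Store 0 rX rT)))"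

definition test_prog :: "('s, 'a) ualg \<Rightarrow> ('a \<Rightarrow> nat) \<Rightarrow> nat \<Rightarrow> 's list \<Rightarrow> 'a list \<Rightarrow> 's com" where
  "test_prog C enc m fs pl = Seq copy_prog (Seq (Store 0 rK rA) (Seq (Const rFlag 1) (Seq (Const rCh 0)
     (Seq (pins_prog enc 0 pl) (close_prog C enc m fs)))))"

definition append_prog :: "'s com" where
  "append_prog = Seq (countdown rX (Seq (Add rIdx rHead rX) (Seq (Load rT 1 rIdx)
     (Seq (Add rIdx rTail rX) (Store 1 rIdx rT)))))
     (Seq (Add rIdx rTail rK) (Seq (Store 1 rIdx rA) (Add rTail rTail rN)))"

definition cand_prog :: "('s, 'a) ualg \<Rightarrow> ('a \<Rightarrow> nat) \<Rightarrow> nat \<Rightarrow> 's list \<Rightarrow> 'a list \<Rightarrow> nat \<Rightarrow> 's com" where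
  "cand_prog C enc m fs pl a = Seq (Const rA a) (Seq (Const rGood 0)
     (Seq (nest (map (\<lambda>j. rPin j) [0..<length pl]) (Seq (test_prog C enc m fs pl) (Cond rFlag (Const rGood 1) skip)))
       (Cond rGood append_prog skip)))"

primrec cands_prog :: "('s, 'a) ualg \<Rightarrow> ('a \<Rightarrow> nat) \<Rightarrow> nat \<Rightarrow> 's list \<Rightarrow> 'a list \<Rightarrow> nat list \<Rightarrow> 's com" where
  "cands_prog C enc m fs pl [] = skip"
| "cands_prog C enc m fs pl (a # as) = Seq (cand_prog C enc m fs pl a) (cands_prog C enc m fs pl as)"

definition level_prog :: "('s, 'a) ualg \<Rightarrow> ('a \<Rightarrow> nat) \<Rightarrow> nat \<Rightarrow> 's list \<Rightarrow> 'a list \<Rightarrow> 's com" where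
  "level_prog C enc m fs pl = Seq (Add rEnd rTail rZero) (Seq (Sub rRow rEnd rHead)
     (While rRow (Seq (cands_prog C enc m fs pl [1..<Suc m]) (Seq (Add rHead rHead rN) (Sub rRow rEnd rHead)))))"

definition levels_prog :: "('s, 'a) ualg \<Rightarrow> ('a \<Rightarrow> nat) \<Rightarrow> nat \<Rightarrow> 's list \<Rightarrow> 'a list \<Rightarrow> 's com" where
  "levels_prog C enc m fs pl = Seq (Const rK 0) (Seq (Sub rLev rN rK)
     (While rLev (Seq (level_prog C enc m fs pl) (Seq (Add rK rK rOne) (Sub rLev rN rK)))))"

definition emit_prog :: "'s com" where
  "emit_prog = Seq (Sub rRow rTail rHead) (While rRow (Seq (Load rT 1 rHead) (Seq (Emit rT)
     (Seq (Add rHead rHead rOne) (Sub rRow rTail rHead)))))"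

definition enum_prog :: "('s, 'a) ualg \<Rightarrow> ('a \<Rightarrow> nat) \<Rightarrow> nat \<Rightarrow> 's list \<Rightarrow> 'a list \<Rightarrow> 's com" where
  "enum_prog C enc m fs pl = Seq (Const rOne 1) (Seq (Const rZero 0) (Seq (Const rHead 0) (Seq (Add rTail rN rZero)
     (Seq (levels_prog C enc m fs pl) emit_prog))))"

definition step_time :: "('s, 'a) ualg \<Rightarrow> nat \<Rightarrow> 's \<Rightarrow> nat \<Rightarrow> nat" where
  "step_time C m f n = nest_time n (ar C f * (2 * m + 4) + 9) (ar C f)"

definition pass_time :: "('s, 'a) ualg \<Rightarrow> nat \<Rightarrow> 's list \<Rightarrow> nat \<Rightarrow> nat" where
  "pass_time C m fs n = sum_list (map (\<lambda>f. step_time C m f n) fs) + 1"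

definition close_time :: "('s, 'a) ualg \<Rightarrow> nat \<Rightarrow> 's list \<Rightarrow> nat \<Rightarrow> nat" where
  "close_time C m fs n = (pass_time C m fs n + 2) * (n + 2) + 2"

definition test_time :: "('s, 'a) ualg \<Rightarrow> nat \<Rightarrow> 's list \<Rightarrow> 'a list \<Rightarrow> nat \<Rightarrow> nat" where
  "test_time C m fs pl n = 5 * n + 8 * length pl + 6 + close_time C m fs n"

definition cand_time :: "('s, 'a) ualg \<Rightarrow> nat \<Rightarrow> 's list \<Rightarrow> 'a list \<Rightarrow> nat \<Rightarrow> nat" where
  "cand_time C m fs pl n = nest_time n (test_time C m fs pl n + 2) (length pl) + 6 * n + 8"

definition cands_time :: "('s, 'a) ualg \<Rightarrow> nat \<Rightarrow> 's list \<Rightarrow> 'a list \<Rightarrow> nat \<Rightarrow> nat" where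
  "cands_time C m fs pl n = m * cand_time C m fs pl n + 1"

definition level_time :: "('s, 'a) ualg \<Rightarrow> nat \<Rightarrow> 's list \<Rightarrow> 'a list \<Rightarrow> nat \<Rightarrow> nat \<Rightarrow> nat" where
  "level_time C m fs pl B n = (cands_time C m fs pl n + 3) * (n * B) + 3"

definition enum_time :: "('s, 'a) ualg \<Rightarrow> nat \<Rightarrow> 's list \<Rightarrow> 'a list \<Rightarrow> nat \<Rightarrow> nat \<Rightarrow> nat" where
  "enum_time C m fs pl B n = (level_time C m fs pl B n + 3) * n + 5 * (n * B) + 9"

definition scratch :: "nat set" where
  "scratch = {11..19} \<union> range (\<lambda>j. rArg j)"

lemma scratch_iff: "r \<in> scratch \<longleftrightarrow> 11 \<le> r \<and> r \<le> 19 \<or> 21 \<le> r \<and> odd r"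
proof -
  have "r \<in> range (\<lambda>j. rArg j) \<longleftrightarrow> 21 \<le> r \<and> odd r"
  proof
    assume r: "21 \<le> r \<and> odd r"
    then have "r = rArg ((r - 21) div 2)" by presburger
    then show "r \<in> range (\<lambda>j. rArg j)" by (rule range_eqI)
  qed auto
  then show ?thesis by (auto simp: scratch_def)
qed

lemma same_scratch_reg: "same scratch s s' \<Longrightarrow> r \<le> 10 \<Longrightarrow> reg s' r = reg s r"
  by (simp add: same_def scratch_iff)

lemma same_scratch_pin: "same scratch s s' \<Longrightarrow> reg s' (rPin j) = reg s (rPin j)"
  by (simp add: same_def scratch_iff)

locale enumeration =
  fixes C :: "('s, 'a) ualg" and enc :: "'a \<Rightarrow> nat" and m :: nat and fs :: "'s list" and pl :: "'a list"
    and X :: "('s, nat) ualg" and n :: nat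
  assumes C: "is_ualg C" and enc: "bij_betw enc (univ C) {1..m}" and fs: "set fs = symbs C"
    and pl: "set pl \<subseteq> univ C" and X: "is_ualg X" "same_sig X C" "univ X = {0..<n}"
begin

abbreviation "dec \<equiv> inv_into (univ C) enc"

lemma enc_range: "a \<in> univ C \<Longrightarrow> enc a \<in> {1..m}"
  using enc by (auto simp: bij_betw_def)

lemma dec_enc [simp]: "a \<in> univ C \<Longrightarrow> dec (enc a) = a"
  using enc by (auto simp: bij_betw_def)

lemma dec_in: "v \<in> {1..m} \<Longrightarrow> dec v \<in> univ C"
  using enc by (metis bij_betw_def inv_into_into)

lemma enc_dec: "v \<in> {1..m} \<Longrightarrow> enc (dec v) = v"
  using enc by (metis bij_betw_def f_inv_into_f)

lemma sig: "symbs X = symbs C" "f \<in> symbs C \<Longrightarrow> ar X f = ar C f"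
  using X(2) by (auto simp: same_sig_def)

lemma opn_X: "f \<in> symbs C \<Longrightarrow> xs \<in> tuples {0..<n} (ar C f) \<Longrightarrow> opn X f xs < n"
  using X sig by (auto simp: is_ualg_def)

lemma tab_range:
  assumes "f \<in> symbs C" "length vs = ar C f" "set vs \<subseteq> {1..m}" shows "tab C enc f vs \<in> {1..m}"
  unfolding tab_def
proof (rule enc_range)
  have "map dec vs \<in> tuples (univ C) (ar C f)" using assms dec_in by (auto simp: tuples_def)
  then show "opn C f (map dec vs) \<in> univ C" using C assms by (simp add: is_ualg_def)
qed

definition phom :: "nat set \<Rightarrow> (nat \<Rightarrow> 'a) \<Rightarrow> bool" where
  "phom S h \<longleftrightarrow> S \<subseteq> {0..<n} \<and> (\<forall>x\<in>S. h x \<in> univ C) \<and> (\<forall>f\<in>symbs C. \<forall>xs\<in>tuples S (ar C f).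
     opn X f xs \<in> S \<and> h (opn X f xs) = opn C f (map h xs))"

definition fits :: "nat set \<Rightarrow> (nat \<Rightarrow> 'a) \<Rightarrow> (nat \<times> nat) set \<Rightarrow> bool" where
  "fits S h E \<longleftrightarrow> (\<forall>(x, w)\<in>E. x \<in> S \<and> enc (h x) = w)"

definition graph :: "(nat \<Rightarrow> nat) \<Rightarrow> (nat \<times> nat) set" where
  "graph W = {(x, W x) | x. x < n \<and> W x \<noteq> 0}"

definition consistent :: "(nat \<Rightarrow> nat) \<Rightarrow> 's \<Rightarrow> nat list \<Rightarrow> bool" where
  "consistent W f xs \<longleftrightarrow> ((\<forall>x\<in>set xs. W x \<noteq> 0) \<longrightarrow> W (opn X f xs) = tab C enc f (map W xs))"

definition undefd :: "(nat \<Rightarrow> nat) \<Rightarrow> nat" where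
  "undefd W = card {x. x < n \<and> W x = 0}"

definition ainv :: "(nat \<times> nat) set \<Rightarrow> (nat \<times> nat) set \<Rightarrow> ('s \<times> nat list) set \<Rightarrow> nat \<Rightarrow> (nat \<Rightarrow> nat) \<Rightarrow> nat \<Rightarrow> nat \<Rightarrow> bool" where
  "ainv E E' D d W fl ch \<longleftrightarrow> (\<forall>x<n. W x \<le> m) \<and> (\<forall>(x, w)\<in>E'. w \<noteq> 0) \<and>
     (\<forall>S h. phom S h \<longrightarrow> fits S h E \<longrightarrow> fl \<noteq> 0 \<and> fits S h (graph W)) \<and>
     (fl \<noteq> 0 \<longrightarrow> (\<forall>(x, w)\<in>E'. W x = w)) \<and> undefd W \<le> d \<and> (ch \<noteq> 0 \<longrightarrow> undefd W < d) \<and>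
     (ch = 0 \<and> fl \<noteq> 0 \<longrightarrow> (\<forall>(f, xs)\<in>D. consistent W f xs))"

lemma undefd_le: "undefd W \<le> n"
  unfolding undefd_def using card_mono[of "{..<n}" "{x. x < n \<and> W x = 0}"] by auto

lemma undefd_update: "x < n \<Longrightarrow> W x = 0 \<Longrightarrow> w \<noteq> 0 \<Longrightarrow> undefd (W(x := w)) < undefd W"
  unfolding undefd_def by (rule psubset_card_mono) auto

lemma ainv_record:
  assumes I: "ainv E E' D d W fl ch" and x: "x < n" and w: "w \<in> {1..m}"
    and forced: "\<forall>S h. phom S h \<and> fits S h E \<and> fits S h (graph W) \<longrightarrow> x \<in> S \<and> enc (h x) = w"
  defines "W' \<equiv> (if W x = 0 then W(x := w) else W)"
    and "ch' \<equiv> (if W x = 0 then 1 else ch)"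
    and "fl' \<equiv> (if W x \<noteq> 0 \<and> W x \<noteq> w then 0 else fl)"
  shows "ainv E E' D d W' fl' ch'" "fl' \<noteq> 0 \<Longrightarrow> W' x = w" "ch' = 0 \<Longrightarrow> W' = W"
proof -
  show "fl' \<noteq> 0 \<Longrightarrow> W' x = w" "ch' = 0 \<Longrightarrow> W' = W" by (auto simp: W'_def fl'_def ch'_def split: if_splits)
  have sound: "fl' \<noteq> 0 \<and> fits S h (graph W')" if S: "phom S h" "fits S h E" for S h
  proof -
    have *: "fl \<noteq> 0" "fits S h (graph W)" using I S unfolding ainv_def by blast+
    have f: "x \<in> S" "enc (h x) = w" using forced S *(2) by blast+
    show ?thesis
    proof (cases "W x = 0")
      case True
      then show ?thesis using * f by (auto simp: W'_def fl'_def fits_def graph_def split: if_splits)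
    next
      case False
      then have "W x = w" using * f x by (auto simp: fits_def graph_def)
      then show ?thesis using * False by (simp add: W'_def fl'_def)
    qed
  qed
  show "ainv E E' D d W' fl' ch'"
  proof (cases "W x = 0")
    case True
    have "undefd W' < undefd W" using undefd_update[of x W w] x True w by (simp add: W'_def)
    moreover have "undefd W \<le> d" using I unfolding ainv_def by blast
    ultimately have d: "undefd W' < d" by linarith
    have a1: "\<forall>y<n. W' y \<le> m" using I w unfolding ainv_def W'_def by auto
    have a2: "\<forall>(y, v)\<in>E'. v \<noteq> 0" using I unfolding ainv_def by blast
    have a3: "\<forall>S h. phom S h \<longrightarrow> fits S h E \<longrightarrow> fl' \<noteq> 0 \<and> fits S h (graph W')" using sound by blast
    have a4: "fl' \<noteq> 0 \<longrightarrow> (\<forall>(y, v)\<in>E'. W' y = v)"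
    proof (intro impI ballI)
      fix p assume fl': "fl' \<noteq> 0" and p: "p \<in> E'"
      obtain y v where yv: "p = (y, v)" by (cases p)
      have "fl \<noteq> 0" using fl' True by (simp add: fl'_def)
      then have "\<forall>(y, v)\<in>E'. W y = v" using I unfolding ainv_def by simp
      then have "W y = v" "v \<noteq> 0" using a2 p yv by auto
      then show "case p of (y, v) \<Rightarrow> W' y = v" using True yv by (auto simp: W'_def)
    qed
    have a5: "undefd W' \<le> d" "ch' \<noteq> 0 \<longrightarrow> undefd W' < d" using d by simp_all
    have a7: "ch' = 0 \<and> fl' \<noteq> 0 \<longrightarrow> (\<forall>(f, xs)\<in>D. consistent W' f xs)" using True by (simp add: ch'_def)
    show ?thesis unfolding ainv_def
      by (rule conjI[OF a1 conjI[OF a2 conjI[OF a3 conjI[OF a4 conjI[OF a5(1) conjI[OF a5(2) a7]]]]]])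
  next
    case False
    then show ?thesis using I sound
      unfolding ainv_def by (auto simp: W'_def fl'_def ch'_def split: if_splits)
  qed
qed

lemma ainv_insert_args:
  "ainv E E' (insert (f, xs) D) d W fl ch \<longleftrightarrow> ainv E E' D d W fl ch \<and> (ch = 0 \<and> fl \<noteq> 0 \<longrightarrow> consistent W f xs)"
  unfolding ainv_def by auto

lemma ainv_insert_pin:
  "ainv E (insert (x, w) E') D d W fl ch \<longleftrightarrow> ainv E E' D d W fl ch \<and> w \<noteq> 0 \<and> (fl \<noteq> 0 \<longrightarrow> W x = w)"
  unfolding ainv_def by auto

lemma ainv_pin:
  assumes I: "ainv E E' {} d (arr s 0) (reg s rFlag) (reg s rCh)" and E: "(x, w) \<in> E" and x: "x < n" and w: "w \<in> {1..m}"
    and act: "acted x w s s'"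
  shows "ainv E (insert (x, w) E') {} d (arr s' 0) (reg s' rFlag) (reg s' rCh)"
proof -
  have "\<forall>S h. phom S h \<and> fits S h E \<and> fits S h (graph (arr s 0)) \<longrightarrow> x \<in> S \<and> enc (h x) = w"
    using E by (auto simp: fits_def)
  note r = ainv_record[OF I x w this]
  have e: "arr s' 0 = (if arr s 0 x = 0 then (arr s 0)(x := w) else arr s 0)"
    "reg s' rCh = (if arr s 0 x = 0 then 1 else reg s rCh)"
    "reg s' rFlag = (if arr s 0 x \<noteq> 0 \<and> arr s 0 x \<noteq> w then 0 else reg s rFlag)"
    using act unfolding acted_def by blast+
  note r' = r[folded e]
  show ?thesis unfolding ainv_insert_pin using r'(1,2) w by simp
qed

lemma ainv_step:
  assumes I: "ainv E E' D d (arr s 0) (reg s rFlag) (reg s rCh)"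
    and f: "f \<in> symbs C" and xs: "xs \<in> tuples {0..<n} (ar C f)"
    and look: "looked (\<forall>x\<in>set xs. arr s 0 x \<noteq> 0) (opn X f xs) (tab C enc f (map (arr s 0) xs)) s s'"
  shows "ainv E E' (insert (f, xs) D) d (arr s' 0) (reg s' rFlag) (reg s' rCh)"
proof (cases "\<forall>x\<in>set xs. arr s 0 x \<noteq> 0")
  case False
  then have "same {rT} s s'" "arr s' 0 = arr s 0" using look unfolding looked_def by metis+
  moreover have "consistent (arr s 0) f xs" using False by (auto simp: consistent_def)
  ultimately show ?thesis using I by (auto simp: ainv_def same_reg)
next
  case True
  let ?W = "arr s 0" and ?y = "opn X f xs" and ?w = "tab C enc f (map (arr s 0) xs)"
  have len: "length xs = ar C f" and xn: "\<And>x. x \<in> set xs \<Longrightarrow> x < n" using xs by (auto simp: tuples_def)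
  have Wm: "?W x \<in> {1..m}" if "x \<in> set xs" for x
    using I True xn[OF that] that by (auto simp: ainv_def Suc_le_eq)
  have y: "?y < n" using opn_X[OF f xs] .
  have w: "?w \<in> {1..m}" by (rule tab_range[OF f]) (use len Wm in auto)
  have "?y \<in> S \<and> enc (h ?y) = ?w" if S: "phom S h" "fits S h E" "fits S h (graph ?W)" for S h
  proof -
    have xS: "x \<in> S" "enc (h x) = ?W x" if "x \<in> set xs" for x
      using S(3) xn[OF that] True that by (auto simp: fits_def graph_def)
    then have "xs \<in> tuples S (ar C f)" using len by (auto simp: tuples_def)
    then have "?y \<in> S" "h ?y = opn C f (map h xs)" using S(1) f by (auto simp: phom_def)
    moreover have "map dec (map ?W xs) = map h xs"
    proof -
      have "dec (?W x) = h x" if "x \<in> set xs" for x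
        using xS[OF that] S(1) by (metis dec_enc phom_def)
      then show ?thesis by simp
    qed
    ultimately show ?thesis unfolding tab_def by metis
  qed
  then have "\<forall>S h. phom S h \<and> fits S h E \<and> fits S h (graph ?W) \<longrightarrow> ?y \<in> S \<and> enc (h ?y) = ?w" by blast
  note r = ainv_record[OF I y w this]
  have act: "acted ?y ?w s s'" using look True unfolding looked_def by simp
  have e: "arr s' 0 = (if arr s 0 ?y = 0 then (arr s 0)(?y := ?w) else arr s 0)"
    "reg s' rCh = (if arr s 0 ?y = 0 then 1 else reg s rCh)"
    "reg s' rFlag = (if arr s 0 ?y \<noteq> 0 \<and> arr s 0 ?y \<noteq> ?w then 0 else reg s rFlag)"
    using act unfolding acted_def by blast+
  note r' = r[folded e]
  have "consistent (arr s' 0) f xs" if "reg s' rCh = 0" "reg s' rFlag \<noteq> 0"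
    using r'(2)[OF that(2)] r'(3)[OF that(1)] unfolding consistent_def by simp
  then show ?thesis unfolding ainv_insert_args using r'(1) by blast
qed

definition AI where
  "AI E E' D d s \<longleftrightarrow> ainv E E' D d (arr s 0) (reg s rFlag) (reg s rCh)"

lemma env_same: "env n s \<Longrightarrow> same scratch s s' \<Longrightarrow> env n s'"
  by (simp add: env_def same_scratch_reg)

lemma wp_step:
  assumes env: "env n s" and I: "AI E E' D d s" and f: "f \<in> symbs C"
  shows "wp X (step_prog C enc m f) (\<lambda>t s'. t \<le> step_time C m f n \<and> same scratch s s' \<and>
    AI E E' (D \<union> {f} \<times> tuples {0..<n} (ar C f)) d s') s"
proof -
  let ?as = "map (\<lambda>j. rArg j) [0..<ar C f]"
  let ?J = "\<lambda>T s'. env n s' \<and> same scratch s s' \<and> AI E E' (D \<union> {f} \<times> T) d s'"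
  have len: "length ?as = ar C f" by simp
  have "wp X (nest ?as (Seq (Apply rY f ?as) (look m (tab C enc f) (ar C f) [])))
    (\<lambda>t s'. t \<le> nest_time n (ar C f * (2 * m + 4) + 9) (length ?as) \<and> ?J ({} \<union> tuples {0..<n} (length ?as)) s') s"
  proof (rule wp_nest[where J = ?J])
    show "env n s'" if "?J T s'" for T s' using that by blast
    show "?J T (set_reg a v s')" if "?J T s'" "a \<in> set ?as" for T s' a v
      using that by (auto simp: env_def AI_def scratch_iff intro!: same_set_reg)
    show "distinct ?as" by (simp add: distinct_map inj_on_def)
    show "?J {} s" using env I by (simp add: same_refl)
    fix T s' xs assume J: "?J T s'" and xs: "xs \<in> tuples {0..<n} (length ?as)" "map (reg s') ?as = xs"
    have xs': "xs \<in> tuples {0..<n} (ar C f)" using xs by simp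
    have lk: "lookup X f (map (reg s') ?as) = opn X f xs"
      unfolding lookup_def xs(2) using f sig xs' X by simp
    let ?s = "set_reg rY (opn X f xs) s'"
    have "wp X (look m (tab C enc f) (ar C f) []) (\<lambda>t s''. t \<le> ar C f * (2 * m + 4) + 8 \<and>
      looked (\<forall>x\<in>set xs. arr ?s 0 x \<noteq> 0) (reg ?s rY) (tab C enc f ([] @ map (arr ?s 0) xs)) ?s s'') ?s"
    proof (rule wp_look)
      show "reg ?s rOne = 1" using J by (simp add: env_def)
      show "length xs = ar C f" using xs' by (simp add: tuples_length)
      show "reg ?s (rArg (length [] + j)) = xs ! j" if "j < ar C f" for j
        using that xs(2) by (auto simp: nth_map)
      show "arr ?s 0 x \<le> m" if "x \<in> set xs" for x
        using J xs' that by (auto simp: AI_def ainv_def tuples_def)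
    qed
    then have "wp X (look m (tab C enc f) (ar C f) []) (\<lambda>t s''. 1 + t \<le> ar C f * (2 * m + 4) + 9 \<and>
      ?J (insert xs T) s'' \<and> (\<forall>a\<in>set ?as. reg s'' a = reg s' a)) ?s"
    proof (rule wp_mono)
      fix t s'' assume *: "t \<le> ar C f * (2 * m + 4) + 8 \<and>
        looked (\<forall>x\<in>set xs. arr ?s 0 x \<noteq> 0) (reg ?s rY) (tab C enc f ([] @ map (arr ?s 0) xs)) ?s s''"
      have "AI E E' (D \<union> {f} \<times> T) d ?s" using J by (simp add: AI_def)
      then have "AI E E' (insert (f, xs) (D \<union> {f} \<times> T)) d s''"
        using ainv_step[OF _ f xs', of E E' _ d ?s s''] * by (simp add: AI_def)
      moreover have "insert (f, xs) (D \<union> {f} \<times> T) = D \<union> {f} \<times> insert xs T" by auto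
      moreover have same: "same {rT, rD, rD', rVal, rFlag, rCh} ?s s''"
        using * by (auto simp: looked_def acted_def same_def split: if_splits)
      have "same scratch ?s s''" by (rule same_mono[OF same]) (auto simp: scratch_iff)
      moreover have "same scratch s ?s" using J by (auto simp: scratch_iff intro: same_set_reg)
      ultimately have "?J (insert xs T) s''" using env_same[OF env] same_trans by metis
      moreover have "\<forall>a\<in>set ?as. reg s'' a = reg s' a" using same by (auto simp: same_def)
      ultimately show "1 + t \<le> ar C f * (2 * m + 4) + 9 \<and> ?J (insert xs T) s'' \<and> (\<forall>a\<in>set ?as. reg s'' a = reg s' a)"
        using * by simp
    qed
    then show "wp X (Seq (Apply rY f ?as) (look m (tab C enc f) (ar C f) []))
      (\<lambda>t s''. t \<le> ar C f * (2 * m + 4) + 9 \<and> ?J (insert xs T) s'' \<and> (\<forall>a\<in>set ?as. reg s'' a = reg s' a)) s'"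
      unfolding wp_Seq wp_Apply lk .
  qed
  then show ?thesis unfolding step_prog_def step_time_def len by (rule wp_mono) simp
qed

lemma wp_pass:
  assumes "env n s" "AI E E' D d s" "set gs \<subseteq> symbs C"
  shows "wp X (pass_prog C enc m gs) (\<lambda>t s'. t \<le> pass_time C m gs n \<and> same scratch s s' \<and>
    AI E E' (D \<union> {(f, xs). f \<in> set gs \<and> xs \<in> tuples {0..<n} (ar C f)}) d s') s"
  using assms
proof (induction gs arbitrary: s D)
  case Nil
  then show ?case by (auto simp: skip_def pass_time_def AI_def scratch_iff intro!: same_set_reg same_refl)
next
  case (Cons f gs)
  let ?D = "D \<union> {f} \<times> tuples {0..<n} (ar C f)"
  have eq: "?D \<union> {(f, xs). f \<in> set gs \<and> xs \<in> tuples {0..<n} (ar C f)} =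
    D \<union> {(g, xs). g \<in> set (f # gs) \<and> xs \<in> tuples {0..<n} (ar C g)}" by auto
  have "wp X (step_prog C enc m f) (\<lambda>t s'. t \<le> step_time C m f n \<and> same scratch s s' \<and> AI E E' ?D d s') s"
    by (rule wp_step) (use Cons.prems in auto)
  then show ?case unfolding pass_prog.simps
  proof (rule wp_seqI)
    fix t s' assume *: "t \<le> step_time C m f n \<and> same scratch s s' \<and> AI E E' ?D d s'"
    have "wp X (pass_prog C enc m gs) (\<lambda>t s''. t \<le> pass_time C m gs n \<and> same scratch s' s'' \<and>
      AI E E' (?D \<union> {(f, xs). f \<in> set gs \<and> xs \<in> tuples {0..<n} (ar C f)}) d s'') s'"
      by (rule Cons.IH) (use * Cons.prems env_same in auto)
    then show "wp X (pass_prog C enc m gs) (\<lambda>t'' s''. t + t'' \<le> pass_time C m (f # gs) n \<and> same scratch s s'' \<and>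
      AI E E' (D \<union> {(g, xs). g \<in> set (f # gs) \<and> xs \<in> tuples {0..<n} (ar C g)}) d s'') s'"
      unfolding eq by (rule wp_mono) (use * same_trans in \<open>auto simp: pass_time_def\<close>)
  qed
qed

definition all_args :: "('s \<times> nat list) set" where
  "all_args = {(f, xs). f \<in> symbs C \<and> xs \<in> tuples {0..<n} (ar C f)}"

lemma closed_solvable:
  assumes I: "ainv E E all_args d W fl 0"
    and E: "\<And>x w. (x, w) \<in> E \<Longrightarrow> x < n"
  shows "fl \<noteq> 0 \<longleftrightarrow> (\<exists>S h. phom S h \<and> fits S h E)"
proof
  assume fl: "fl \<noteq> 0"
  let ?S = "{x. x < n \<and> W x \<noteq> 0}" and ?h = "\<lambda>x. dec (W x)"
  have Wm: "W x \<in> {1..m}" if "x \<in> ?S" for x using I that by (auto simp: ainv_def Suc_le_eq)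
  have "phom ?S ?h"
    unfolding phom_def
  proof (intro conjI ballI)
    show "?S \<subseteq> {0..<n}" by auto
    show "?h x \<in> univ C" if "x \<in> ?S" for x using dec_in[OF Wm[OF that]] .
    fix f xs assume f: "f \<in> symbs C" and xs: "xs \<in> tuples ?S (ar C f)"
    have xs': "xs \<in> tuples {0..<n} (ar C f)" using xs by (auto simp: tuples_def)
    then have "(f, xs) \<in> all_args" using f by (simp add: all_args_def)
    then have "consistent W f xs" using I fl by (auto simp: ainv_def)
    then have eq: "W (opn X f xs) = tab C enc f (map W xs)" using xs by (auto simp: consistent_def tuples_def)
    have "set (map W xs) \<subseteq> {1..m}" using Wm xs by (fastforce simp: tuples_def)
    then have t: "tab C enc f (map W xs) \<in> {1..m}" using tab_range[OF f] xs by (simp add: tuples_length)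
    then show "opn X f xs \<in> ?S" using opn_X[OF f xs'] eq by simp
    have "map ?h xs \<in> tuples (univ C) (ar C f)" using xs by (rule tuples_map) (rule dec_in[OF Wm])
    then have "opn C f (map ?h xs) \<in> univ C" using C f by (simp add: is_ualg_def)
    then show "?h (opn X f xs) = opn C f (map ?h xs)" unfolding eq by (simp add: tab_def comp_def)
  qed
  moreover have "fits ?S ?h E"
    unfolding fits_def
  proof clarify
    fix x w assume xw: "(x, w) \<in> E"
    then have "W x = w" "w \<noteq> 0" using I fl by (auto simp: ainv_def)
    then show "x \<in> ?S \<and> enc (?h x) = w" using E[OF xw] enc_dec[OF Wm, of x] by auto
  qed
  ultimately show "\<exists>S h. phom S h \<and> fits S h E" by blast
next
  assume "\<exists>S h. phom S h \<and> fits S h E"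
  then show "fl \<noteq> 0" using I unfolding ainv_def by blast
qed

lemma wp_close:
  assumes env: "env n s" and I: "AI E E {} d s" and E: "\<And>x w. (x, w) \<in> E \<Longrightarrow> x < n"
  shows "wp X (close_prog C enc m fs) (\<lambda>t s'. t \<le> close_time C m fs n \<and> same scratch s s' \<and>
    (reg s' rFlag \<noteq> 0 \<longleftrightarrow> (\<exists>S h. phom S h \<and> fits S h E))) s"
proof -
  let ?I = "\<lambda>s'. same scratch s s' \<and> AI E E all_args (n + 1) s'"
  let ?\<mu> = "\<lambda>s'. undefd (arr s' 0) + (if reg s' rCh \<noteq> 0 then 1 else 0)"
  let ?s = "set_reg rCh 1 s"
  have "wp X (While rCh (Seq (Const rCh 0) (pass_prog C enc m fs)))
    (\<lambda>t s'. t \<le> (pass_time C m fs n + 1 + 1) * ?\<mu> ?s + 1 \<and> ?I s' \<and> reg s' rCh = 0) ?s"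
  proof (rule wp_while[where I = ?I and \<mu> = ?\<mu>])
    show "?I ?s" using I undefd_le[of "arr s 0"]
      by (auto simp: AI_def ainv_def scratch_iff intro!: same_set_reg same_refl)
    fix s' assume s': "?I s'" "reg s' rCh \<noteq> 0"
    let ?r = "set_reg rCh 0 s'"
    have "AI E E {} (undefd (arr s' 0)) ?r" using s' by (auto simp: AI_def ainv_def)
    moreover have "same scratch s ?r" using s' by (auto simp: scratch_iff intro: same_set_reg)
    ultimately have "wp X (pass_prog C enc m fs) (\<lambda>t s''. t \<le> pass_time C m fs n \<and> same scratch ?r s'' \<and>
      AI E E ({} \<union> {(f, xs). f \<in> set fs \<and> xs \<in> tuples {0..<n} (ar C f)}) (undefd (arr s' 0)) s'') ?r"
      using env_same[OF env] fs by (intro wp_pass) auto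
    then have "wp X (pass_prog C enc m fs) (\<lambda>t s''. 1 + t \<le> pass_time C m fs n + 1 \<and> ?I s'' \<and> ?\<mu> s'' < ?\<mu> s') ?r"
    proof (rule wp_mono)
      fix t s'' assume *: "t \<le> pass_time C m fs n \<and> same scratch ?r s'' \<and>
        AI E E ({} \<union> {(f, xs). f \<in> set fs \<and> xs \<in> tuples {0..<n} (ar C f)}) (undefd (arr s' 0)) s''"
      then have A: "AI E E all_args (undefd (arr s' 0)) s''" using fs by (simp add: all_args_def)
      then have "AI E E all_args (n + 1) s''"
        using undefd_le[of "arr s' 0"] undefd_le[of "arr s'' 0"] by (auto simp: AI_def ainv_def)
      moreover have "?\<mu> s'' < ?\<mu> s'" using A s'(2) by (auto simp: AI_def ainv_def)
      ultimately show "1 + t \<le> pass_time C m fs n + 1 \<and> ?I s'' \<and> ?\<mu> s'' < ?\<mu> s'"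
        using * \<open>same scratch s ?r\<close> same_trans by (metis add.commute add_le_cancel_right)
    qed
    then show "wp X (Seq (Const rCh 0) (pass_prog C enc m fs))
      (\<lambda>t s''. t \<le> pass_time C m fs n + 1 \<and> ?I s'' \<and> ?\<mu> s'' < ?\<mu> s') s'"
      unfolding wp_Seq wp_Const .
  qed
  then have "wp X (While rCh (Seq (Const rCh 0) (pass_prog C enc m fs)))
    (\<lambda>t s'. 1 + t \<le> close_time C m fs n \<and> same scratch s s' \<and>
      (reg s' rFlag \<noteq> 0 \<longleftrightarrow> (\<exists>S h. phom S h \<and> fits S h E))) ?s"
  proof (rule wp_mono)
    fix t s' assume *: "t \<le> (pass_time C m fs n + 1 + 1) * ?\<mu> ?s + 1 \<and> ?I s' \<and> reg s' rCh = 0"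
    have "(pass_time C m fs n + 1 + 1) * ?\<mu> ?s \<le> (pass_time C m fs n + 2) * (n + 2)"
      using undefd_le[of "arr s 0"] by (intro mult_le_mono) auto
    then have "1 + t \<le> close_time C m fs n" using * unfolding close_time_def by linarith
    moreover have "reg s' rFlag \<noteq> 0 \<longleftrightarrow> (\<exists>S h. phom S h \<and> fits S h E)"
    proof (rule closed_solvable[OF _ E])
      show "ainv E E all_args (n + 1) (arr s' 0) (reg s' rFlag) 0" using * unfolding AI_def by metis
    qed
    ultimately show "1 + t \<le> close_time C m fs n \<and> same scratch s s' \<and>
      (reg s' rFlag \<noteq> 0 \<longleftrightarrow> (\<exists>S h. phom S h \<and> fits S h E))" using * by blast
  qed
  then show ?thesis unfolding close_prog_def wp_Seq wp_Const .
qed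

lemma wp_pins:
  assumes "env n s" "AI E E' {} d s"
    and "\<And>i. i < length as \<Longrightarrow> reg s (rPin (j + i)) < n \<and> (reg s (rPin (j + i)), enc (as ! i)) \<in> E \<and> as ! i \<in> univ C"
  shows "wp X (pins_prog enc j as) (\<lambda>t s'. t \<le> 8 * length as + 1 \<and> same scratch s s' \<and>
    AI E (E' \<union> {(reg s (rPin (j + i)), enc (as ! i)) | i. i < length as}) {} d s') s"
  using assms
proof (induction as arbitrary: j s E')
  case Nil
  then show ?case by (auto simp: skip_def AI_def scratch_iff intro!: same_set_reg same_refl)
next
  case (Cons a as)
  let ?x = "reg s (rPin j)"
  have x: "?x < n" "(?x, enc a) \<in> E" "a \<in> univ C" using Cons.prems(3)[of 0] by auto
  have "wp X (act (rPin j) (enc a)) (\<lambda>t s'. t \<le> 8 \<and> acted ?x (enc a) s s') s"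
    by (rule wp_act) auto
  then show ?case unfolding pins_prog.simps
  proof (rule wp_seqI)
    fix t :: nat and s' assume *: "t \<le> 8 \<and> acted ?x (enc a) s s'"
    have A: "AI E (insert (?x, enc a) E') {} d s'"
      using ainv_pin[OF _ x(2,1) enc_range[OF x(3)]] Cons.prems(2) * unfolding AI_def by blast
    have same: "same scratch s s'"
      using * by (auto simp: acted_def scratch_iff elim!: same_mono)
    have pin: "reg s' (rPin i) = reg s (rPin i)" for i
      by (rule same_scratch_pin[OF same])
    have "wp X (pins_prog enc (Suc j) as) (\<lambda>t s''. t \<le> 8 * length as + 1 \<and> same scratch s' s'' \<and>
      AI E (insert (?x, enc a) E' \<union> {(reg s' (rPin (Suc j + i)), enc (as ! i)) | i. i < length as}) {} d s'') s'"
    proof (rule Cons.IH)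
      show "env n s'" using env_same Cons.prems same by blast
      show "AI E (insert (?x, enc a) E') {} d s'" by (rule A)
      show "reg s' (rPin (Suc j + i)) < n \<and> (reg s' (rPin (Suc j + i)), enc (as ! i)) \<in> E \<and> as ! i \<in> univ C"
        if "i < length as" for i
        using Cons.prems(3)[of "Suc i"] that pin[of "Suc j + i"] by simp
    qed
    moreover have "insert (?x, enc a) E' \<union> {(reg s' (rPin (Suc j + i)), enc (as ! i)) | i. i < length as} =
      E' \<union> {(reg s (rPin (j + i)), enc ((a # as) ! i)) | i. i < length (a # as)}" (is "?L = ?R")
    proof -
      have "{(reg s (rPin (j + i)), enc ((a # as) ! i)) | i. i < length (a # as)} =
        insert (?x, enc a) {(reg s (rPin (Suc j + i)), enc (as ! i)) | i. i < length as}"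
      proof (intro Set.equalityI subsetI)
        fix z assume "z \<in> {(reg s (rPin (j + i)), enc ((a # as) ! i)) | i. i < length (a # as)}"
        then obtain i where i: "i < length (a # as)" "z = (reg s (rPin (j + i)), enc ((a # as) ! i))" by blast
        then show "z \<in> insert (?x, enc a) {(reg s (rPin (Suc j + i)), enc (as ! i)) | i. i < length as}"
          by (cases i) auto
      next
        fix z assume "z \<in> insert (?x, enc a) {(reg s (rPin (Suc j + i)), enc (as ! i)) | i. i < length as}"
        then consider "z = (?x, enc a)" | i where "i < length as" "z = (reg s (rPin (Suc j + i)), enc (as ! i))" by blast
        then show "z \<in> {(reg s (rPin (j + i)), enc ((a # as) ! i)) | i. i < length (a # as)}"
        proof cases
          case 1 then show ?thesis by (intro CollectI exI[of _ 0]) simp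
        next
          case 2 then show ?thesis by (intro CollectI exI[of _ "Suc i"]) simp
        qed
      qed
      then show ?thesis unfolding pin by simp
    qed
    ultimately have "wp X (pins_prog enc (Suc j) as) (\<lambda>t s''. t \<le> 8 * length as + 1 \<and> same scratch s' s'' \<and>
      AI E ?R {} d s'') s'" by simp
    then show "wp X (pins_prog enc (Suc j) as) (\<lambda>t' s''. t + t' \<le> 8 * length (a # as) + 1 \<and> same scratch s s'' \<and>
      AI E ?R {} d s'') s'"
      by (rule wp_mono) (use * same same_trans in auto)
  qed
qed

definition row :: "config \<Rightarrow> nat \<Rightarrow> nat" where
  "row s x = (if x = reg s rK then reg s rA else arr s 1 (reg s rHead + x))"

definition pinned :: "nat list \<Rightarrow> (nat \<times> nat) set" where
  "pinned c = {(c ! i, enc (pl ! i)) | i. i < length pl}"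

definition good :: "(nat \<Rightarrow> nat) \<Rightarrow> bool" where
  "good W \<longleftrightarrow> (\<exists>c\<in>tuples {0..<n} (length pl). \<exists>S h. phom S h \<and> fits S h (graph W \<union> pinned c))"

lemma graph_cong: "(\<And>x. x < n \<Longrightarrow> W x = W' x) \<Longrightarrow> graph W = graph W'"
  by (auto simp: graph_def)

lemma good_cong: "(\<And>x. x < n \<Longrightarrow> W x = W' x) \<Longrightarrow> good W = good W'"
  unfolding good_def using graph_cong[of W W'] by simp

lemma wp_copy:
  assumes env: "env n s"
  shows "wp X copy_prog (\<lambda>t s'. t \<le> 5 * n + 2 \<and> same scratch s s' \<and>
    (\<forall>x<n. arr s' 0 x = arr s 1 (reg s rHead + x))) s"
proof -
  let ?I = "\<lambda>k s'. same scratch s s' \<and> (\<forall>x<n. k \<le> x \<longrightarrow> arr s' 0 x = arr s 1 (reg s rHead + x))"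
  have "wp X copy_prog (\<lambda>t s'. t \<le> (3 + 2) * n + 2 \<and> ?I 0 s') s"
    unfolding copy_prog_def
  proof (rule wp_countdown[where I = ?I])
    show "env n s'" if "?I k s'" for k s' using env_same env that by blast
    show "env n s" by (rule env)
    show "?I n (set_reg rX n s)" by (auto simp: scratch_iff intro!: same_set_reg same_refl)
    fix k s' assume k: "k < n" "?I (Suc k) s'" "reg s' rX = Suc k"
    have "reg s' rHead = reg s rHead" "arr s' 1 = arr s 1"
      using k(2) same_scratch_reg[of s s' rHead] by (simp_all add: same_def)
    then show "wp X (Seq (Add rIdx rHead rX) (Seq (Load rT 1 rIdx) (Store 0 rX rT)))
      (\<lambda>t s'. t \<le> 3 \<and> ?I k s' \<and> reg s' rX = k) (set_reg rX k s')"
      using k by (auto simp: same_def scratch_iff Suc_le_eq)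
  qed
  then show ?thesis by (rule wp_mono) auto
qed

lemma wp_test:
  assumes env: "env n s" and K: "reg s rK < n" and A: "reg s rA \<in> {1..m}"
    and row: "\<And>x. x < n \<Longrightarrow> arr s 1 (reg s rHead + x) \<le> m"
    and c: "c \<in> tuples {0..<n} (length pl)" "map (reg s) (map (\<lambda>j. rPin j) [0..<length pl]) = c"
  shows "wp X (test_prog C enc m fs pl) (\<lambda>t s'. t \<le> test_time C m fs pl n \<and> same scratch s s' \<and>
    (reg s' rFlag \<noteq> 0 \<longleftrightarrow> (\<exists>S h. phom S h \<and> fits S h (graph (row s) \<union> pinned c)))) s"
proof -
  let ?E = "graph (row s) \<union> pinned c"
  have ci: "c ! i = reg s (rPin i)" "c ! i < n" if "i < length pl" for i
    using c that tuples_nth[OF c(1) that] by auto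
  show ?thesis unfolding test_prog_def
  proof (rule wp_seqI[OF wp_copy[OF env]])
    fix t1 s1 assume 1: "t1 \<le> 5 * n + 2 \<and> same scratch s s1 \<and> (\<forall>x<n. arr s1 0 x = arr s 1 (reg s rHead + x))"
    let ?s2 = "set_reg rCh 0 (set_reg rFlag 1 (s1\<lparr>arr := (arr s1)(0 := (arr s1 0)(reg s1 rK := reg s1 rA))\<rparr>))"
    have regs: "reg s1 rK = reg s rK" "reg s1 rA = reg s rA" using 1 same_scratch_reg by auto
    have same2: "same scratch s ?s2" using 1 by (auto simp: same_def scratch_iff)
    have W: "arr ?s2 0 x = row s x" if "x < n" for x using 1 that regs by (simp add: row_def)
    have g: "graph (arr ?s2 0) = graph (row s)" by (rule graph_cong[OF W])
    have "\<And>x w. (x, w) \<in> graph (row s) \<Longrightarrow> arr ?s2 0 x = w" using W by (auto simp: graph_def)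
    moreover have "\<forall>x<n. arr ?s2 0 x \<le> m" using W row A by (auto simp: row_def)
    moreover have "\<forall>S h. phom S h \<longrightarrow> fits S h ?E \<longrightarrow> fits S h (graph (arr ?s2 0))"
      unfolding g by (auto simp: fits_def)
    ultimately have AI2: "AI ?E (graph (row s)) {} n ?s2"
      unfolding AI_def ainv_def using undefd_le[of "arr ?s2 0"] by (auto simp: graph_def)
    have pin: "reg ?s2 (rPin i) = reg s (rPin i)" for i
      by (rule same_scratch_pin[OF same2])
    have "wp X (pins_prog enc 0 pl) (\<lambda>t s'. t \<le> 8 * length pl + 1 \<and> same scratch ?s2 s' \<and>
      AI ?E (graph (row s) \<union> {(reg ?s2 (rPin (0 + i)), enc (pl ! i)) | i. i < length pl}) {} n s') ?s2"
    proof (rule wp_pins[OF env_same[OF env same2] AI2])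
      fix i assume i: "i < length pl"
      have "(c ! i, enc (pl ! i)) \<in> pinned c" using i by (auto simp: pinned_def)
      then show "reg ?s2 (rPin (0 + i)) < n \<and> (reg ?s2 (rPin (0 + i)), enc (pl ! i)) \<in> ?E \<and> pl ! i \<in> univ C"
        using i ci[OF i] pin[of i] pl nth_mem[OF i] by auto
    qed
    moreover have "{(reg ?s2 (rPin (0 + i)), enc (pl ! i)) | i. i < length pl} = pinned c"
      unfolding pinned_def pin add_0 by (rule Collect_cong) (metis ci(1))
    ultimately have p: "wp X (pins_prog enc 0 pl) (\<lambda>t s'. t \<le> 8 * length pl + 1 \<and> same scratch ?s2 s' \<and> AI ?E ?E {} n s') ?s2"
      by simp
    have "wp X (Seq (pins_prog enc 0 pl) (close_prog C enc m fs)) (\<lambda>t s'. t \<le> 8 * length pl + 1 + close_time C m fs n \<and>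
      same scratch s s' \<and> (reg s' rFlag \<noteq> 0 \<longleftrightarrow> (\<exists>S h. phom S h \<and> fits S h ?E))) ?s2"
    proof (rule wp_seqI[OF p])
      fix t s3 assume 3: "t \<le> 8 * length pl + 1 \<and> same scratch ?s2 s3 \<and> AI ?E ?E {} n s3"
      have same3: "same scratch s s3" using 3 same2 same_trans by blast
      have "wp X (close_prog C enc m fs) (\<lambda>t s'. t \<le> close_time C m fs n \<and> same scratch s3 s' \<and>
        (reg s' rFlag \<noteq> 0 \<longleftrightarrow> (\<exists>S h. phom S h \<and> fits S h ?E))) s3"
      proof (rule wp_close)
        show "env n s3" using env_same[OF env same3] .
        show "AI ?E ?E {} n s3" using 3 by blast
        show "x < n" if "(x, w) \<in> ?E" for x w using that ci(2) by (auto simp: graph_def pinned_def)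
      qed
      then show "wp X (close_prog C enc m fs) (\<lambda>t' s'. t + t' \<le> 8 * length pl + 1 + close_time C m fs n \<and>
        same scratch s s' \<and> (reg s' rFlag \<noteq> 0 \<longleftrightarrow> (\<exists>S h. phom S h \<and> fits S h ?E))) s3"
        by (rule wp_mono) (use 3 same_trans[OF same3] in auto)
    qed
    then have "wp X (Seq (pins_prog enc 0 pl) (close_prog C enc m fs)) (\<lambda>t s'. t1 + (1 + (1 + (1 + t))) \<le> test_time C m fs pl n \<and>
      same scratch s s' \<and> (reg s' rFlag \<noteq> 0 \<longleftrightarrow> (\<exists>S h. phom S h \<and> fits S h ?E))) ?s2"
      by (rule wp_mono) (use 1 in \<open>simp add: test_time_def\<close>)
    then show "wp X (Seq (Store 0 rK rA) (Seq (Const rFlag 1) (Seq (Const rCh 0)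
      (Seq (pins_prog enc 0 pl) (close_prog C enc m fs))))) (\<lambda>t' s'. t1 + t' \<le> test_time C m fs pl n \<and> same scratch s s' \<and>
      (reg s' rFlag \<noteq> 0 \<longleftrightarrow> (\<exists>S h. phom S h \<and> fits S h ?E))) s1"
      unfolding wp_Seq[of _ "Store 0 rK rA"] wp_Seq[of _ "Const rFlag 1"] wp_Seq[of _ "Const rCh 0"] wp_Store wp_Const .
  qed
qed

end

context enumeration begin

definition holds :: "nat list list \<Rightarrow> config \<Rightarrow> bool" where
  "holds L s \<longleftrightarrow> reg s rTail = reg s rHead + n * length L \<and> (\<forall>w\<in>set L. length w = n \<and> set w \<subseteq> {0..m}) \<and>
     (\<forall>i<length L. \<forall>x<n. arr s 1 (reg s rHead + i * n + x) = L ! i ! x)"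

definition keep :: "nat set \<Rightarrow> config \<Rightarrow> config \<Rightarrow> bool" where
  "keep R s s' \<longleftrightarrow> (\<forall>r\<in>R. reg s' r = reg s r) \<and> out s' = out s"

lemma keep_trans: "keep R s s' \<Longrightarrow> keep R s' s'' \<Longrightarrow> keep R s s''"
  by (simp add: keep_def)

lemma wp_append:
  assumes env: "env n s" and H: "holds (w # R) s" and K: "reg s rK < n" and A: "reg s rA \<le> m"
  shows "wp X append_prog (\<lambda>t s'. t \<le> 6 * n + 5 \<and> keep ({..10} - {rTail}) s s' \<and>
    holds ((w # R) @ [w[reg s rK := reg s rA]]) s') s"
proof -
  define hd tl where "hd = reg s rHead" and "tl = reg s rTail"
  have tl: "tl = hd + n * Suc (length R)" using H by (simp add: holds_def hd_def tl_def)
  have w: "length w = n" "set w \<subseteq> {0..m}" using H by (auto simp: holds_def)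
  have whd: "arr s 1 (hd + x) = w ! x" if "x < n" for x
    using H that unfolding holds_def hd_def by force
  let ?I = "\<lambda>k (s' :: config). (\<forall>r. r \<notin> {rT, rIdx, rX} \<longrightarrow> reg s' r = reg s r) \<and> out s' = out s \<and>
    (\<forall>i. arr s' 1 i = (if tl + k \<le> i \<and> i < tl + n then w ! (i - tl) else arr s 1 i))"
  have "wp X (countdown rX (Seq (Add rIdx rHead rX) (Seq (Load rT 1 rIdx) (Seq (Add rIdx rTail rX) (Store 1 rIdx rT)))))
    (\<lambda>t s'. t \<le> (4 + 2) * n + 2 \<and> ?I 0 s') s"
  proof (rule wp_countdown[where I = ?I])
    show "env n s'" if "?I k s'" for k s' using env that by (auto simp: env_def)
    show "env n s" by (rule env)
    show "?I n (set_reg rX n s)" by auto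
    fix k s' assume k: "k < n" and I: "?I (Suc k) s'" and X: "reg s' rX = Suc k"
    have regs: "reg s' rHead = hd" "reg s' rTail = tl" using I by (simp_all add: hd_def tl_def)
    have "hd + k < tl" using tl k by (simp add: trans_less_add1)
    then have val: "arr s' 1 (hd + k) = w ! k" using I whd[OF k] by simp
    have arr: "((arr s' 1)(tl + k := w ! k)) i =
      (if tl + k \<le> i \<and> i < tl + n then w ! (i - tl) else arr s 1 i)" for i
    proof (cases "i = tl + k")
      case True then show ?thesis using k by simp
    next
      case False
      then have "tl + Suc k \<le> i \<longleftrightarrow> tl + k \<le> i" by auto
      then show ?thesis using I False by simp
    qed
    show "wp X (Seq (Add rIdx rHead rX) (Seq (Load rT 1 rIdx) (Seq (Add rIdx rTail rX) (Store 1 rIdx rT))))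
      (\<lambda>t s'. t \<le> 4 \<and> ?I k s' \<and> reg s' rX = k) (set_reg rX k s')"
      using I regs val arr k by simp
  qed
  then show ?thesis unfolding append_prog_def
  proof (rule wp_seqI)
    fix t s' assume *: "t \<le> (4 + 2) * n + 2 \<and> ?I 0 s'"
    then have regs: "reg s' rHead = hd" "reg s' rTail = tl" "reg s' rK = reg s rK" "reg s' rA = reg s rA" "reg s' rN = n"
      using env by (simp_all add: hd_def tl_def env_def)
    define k a where "k = reg s rK" and "a = reg s rA"
    let ?r = "set_reg rTail (tl + n) ((set_reg rIdx (tl + k) s')\<lparr>arr := (arr s')(1 := (arr s' 1)(tl + k := a))\<rparr>)"
    have arr: "arr ?r 1 i = (if tl \<le> i \<and> i < tl + n then w[k := a] ! (i - tl) else arr s 1 i)" for i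
    proof (cases "i = tl + k")
      case True then show ?thesis using K w by (simp add: k_def)
    next
      case False
      then have "tl \<le> i \<Longrightarrow> k \<noteq> i - tl" by auto
      then show ?thesis using * False by simp
    qed
    have "holds ((w # R) @ [w[k := a]]) ?r"
      unfolding holds_def
    proof (intro conjI ballI allI impI)
      show "reg ?r rTail = reg ?r rHead + n * length ((w # R) @ [w[k := a]])" using tl regs by simp
      fix v assume "v \<in> set ((w # R) @ [w[k := a]])"
      then show "length v = n" "set v \<subseteq> {0..m}"
        using H A w set_update_subset_insert[of w k a] by (auto simp: holds_def a_def)
    next
      fix i x assume i: "i < length ((w # R) @ [w[k := a]])" and x: "x < n"
      show "arr ?r 1 (reg ?r rHead + i * n + x) = ((w # R) @ [w[k := a]]) ! i ! x"
      proof (cases "i = Suc (length R)")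
        case True
        then have "hd + i * n + x = tl + x" using tl by (simp add: mult.commute)
        then show ?thesis using True x regs arr[of "tl + x"] by (simp add: nth_append)
      next
        case False
        then have i': "i < Suc (length R)" using i by simp
        have "i * n + x < Suc i * n" using x by simp
        also have "\<dots> \<le> Suc (length R) * n" using i' by (intro mult_le_mono1) simp
        finally have "hd + i * n + x < tl" using tl by (simp add: mult.commute)
        moreover have "arr s 1 (hd + i * n + x) = (w # R) ! i ! x"
          using H i' x unfolding holds_def hd_def by simp
        moreover have "((w # R) @ [w[k := a]]) ! i = (w # R) ! i" using i' nth_append_left[of i "w # R"] by simp
        ultimately show ?thesis using regs arr[of "hd + i * n + x"] by simp
      qed
    qed
    moreover have "keep ({..10} - {rTail}) s ?r" using * by (simp add: keep_def)
    ultimately show "wp X (Seq (Add rIdx rTail rK) (Seq (Store 1 rIdx rA) (Add rTail rTail rN)))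
      (\<lambda>t' s'. t + t' \<le> 6 * n + 5 \<and> keep ({..10} - {rTail}) s s' \<and> holds ((w # R) @ [w[reg s rK := reg s rA]]) s') s'"
      using * regs by (simp add: k_def a_def)
  qed
qed

abbreviation "main_regs \<equiv> {..8} - {rTail}"

lemma wp_cand:
  assumes env: "env n s" and H: "holds (w # R) s" and K: "reg s rK < n" and a: "a \<in> {1..m}"
  shows "wp X (cand_prog C enc m fs pl a) (\<lambda>t s'. t \<le> cand_time C m fs pl n \<and> keep main_regs s s' \<and>
    holds ((w # R) @ (if good ((!) (w[reg s rK := a])) then [w[reg s rK := a]] else [])) s') s"
proof -
  let ?s = "set_reg rGood 0 (set_reg rA a s)"
  let ?ps = "map (\<lambda>j. rPin j) [0..<length pl]"
  let ?S = "scratch \<union> {rGood} \<union> range (\<lambda>j. rPin j)"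
  let ?sol = "\<lambda>c. \<exists>S h. phom S h \<and> fits S h (graph (row ?s) \<union> pinned c)"
  let ?J = "\<lambda>T s'. env n s' \<and> same ?S ?s s' \<and> (reg s' rGood \<noteq> 0 \<longleftrightarrow> (\<exists>c\<in>T. ?sol c))"
  have small: "r \<notin> ?S" if "r \<le> 9" for r using that by (auto simp: scratch_iff)
  have w: "length w = n" "set w \<subseteq> {0..m}" using H by (auto simp: holds_def)
  have whd: "arr s 1 (reg s rHead + x) = w ! x" if "x < n" for x
    using H that unfolding holds_def by force
  have len: "length ?ps = length pl" by simp
  have "wp X (nest ?ps (Seq (test_prog C enc m fs pl) (Cond rFlag (Const rGood 1) skip)))
    (\<lambda>t s'. t \<le> nest_time n (test_time C m fs pl n + 2) (length ?ps) \<and> ?J ({} \<union> tuples {0..<n} (length ?ps)) s') ?s"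
  proof (rule wp_nest[where J = ?J])
    show "env n s'" if "?J T s'" for T s' using that by blast
    show "?J T (set_reg b v s')" if "?J T s'" "b \<in> set ?ps" for T s' b v
      using that by (auto simp: env_def intro!: same_set_reg)
    show "distinct ?ps" by (simp add: distinct_map inj_on_def)
    show "?J {} ?s" using env by (simp add: same_refl env_def)
    fix T s' c assume J: "?J T s'" and c: "c \<in> tuples {0..<n} (length ?ps)" "map (reg s') ?ps = c"
    have sm: "reg s' r = reg ?s r" if "r \<le> 9" for r using J small[OF that] by (auto simp: same_def)
    have regs: "reg s' rK = reg s rK" "reg s' rA = a" "reg s' rHead = reg s rHead" using sm by simp_all
    have arr1: "arr s' 1 = arr s 1" using J by (simp add: same_def)
    have row: "row s' = row ?s" using regs arr1 by (auto simp: row_def)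
    have "wp X (test_prog C enc m fs pl) (\<lambda>t s''. t \<le> test_time C m fs pl n \<and> same scratch s' s'' \<and>
      (reg s'' rFlag \<noteq> 0 \<longleftrightarrow> (\<exists>S h. phom S h \<and> fits S h (graph (row s') \<union> pinned c)))) s'"
    proof (rule wp_test)
      show "env n s'" using J by blast
      show "reg s' rK < n" "reg s' rA \<in> {1..m}" using regs K a by simp_all
      show "arr s' 1 (reg s' rHead + x) \<le> m" if "x < n" for x
      proof -
        have "w ! x \<in> set w" using w(1) that by simp
        then have "w ! x \<le> m" using w(2) by auto
        then show ?thesis using regs arr1 whd[OF that] by simp
      qed
      show "c \<in> tuples {0..<n} (length pl)" "map (reg s') ?ps = c" using c by simp_all
    qed
    then show "wp X (Seq (test_prog C enc m fs pl) (Cond rFlag (Const rGood 1) skip))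
      (\<lambda>t s''. t \<le> test_time C m fs pl n + 2 \<and> ?J (insert c T) s'' \<and> (\<forall>b\<in>set ?ps. reg s'' b = reg s' b)) s'"
    proof (rule wp_seqI)
      fix t s'' assume *: "t \<le> test_time C m fs pl n \<and> same scratch s' s'' \<and>
        (reg s'' rFlag \<noteq> 0 \<longleftrightarrow> (\<exists>S h. phom S h \<and> fits S h (graph (row s') \<union> pinned c)))"
      have same2: "same ?S ?s s''" using J * same_trans same_mono[of scratch s' s'' ?S] by blast
      have env2: "env n s''" using J * env_same by blast
      have g: "reg s'' rGood = reg s' rGood" using * same_scratch_reg by auto
      have pins: "\<forall>b\<in>set ?ps. reg s'' b = reg s' b" using * same_scratch_pin by auto
      have f: "reg s'' rFlag \<noteq> 0 \<longleftrightarrow> ?sol c" using * row by simp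
      show "wp X (Cond rFlag (Const rGood 1) skip) (\<lambda>t' s''. t + t' \<le> test_time C m fs pl n + 2 \<and>
        ?J (insert c T) s'' \<and> (\<forall>b\<in>set ?ps. reg s'' b = reg s' b)) s''"
      proof (cases "reg s'' rFlag = 0")
        case True
        have "?J (insert c T) (set_reg rT 0 s'')"
          using J True f g env2 same2 by (auto simp: env_def scratch_iff intro!: same_set_reg)
        moreover have "\<forall>b\<in>set ?ps. reg (set_reg rT 0 s'') b = reg s' b" using pins by auto
        ultimately show ?thesis using True * by (simp add: skip_def)
      next
        case False
        have "?J (insert c T) (set_reg rGood 1 s'')"
          using False f env2 same2 by (auto simp: env_def intro!: same_set_reg)
        moreover have "\<forall>b\<in>set ?ps. reg (set_reg rGood 1 s'') b = reg s' b" using pins by auto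
        ultimately show ?thesis using False * by simp
      qed
    qed
  qed
  then have N: "wp X (nest ?ps (Seq (test_prog C enc m fs pl) (Cond rFlag (Const rGood 1) skip)))
    (\<lambda>t s'. t \<le> nest_time n (test_time C m fs pl n + 2) (length pl) \<and> ?J (tuples {0..<n} (length pl)) s') ?s"
    unfolding len by simp
  have rowg: "good (row ?s) = good ((!) (w[reg s rK := a]))"
    by (rule good_cong) (use whd w in \<open>auto simp: row_def nth_list_update\<close>)
  have "wp X (Seq (nest ?ps (Seq (test_prog C enc m fs pl) (Cond rFlag (Const rGood 1) skip))) (Cond rGood append_prog skip))
    (\<lambda>t s'. 1 + (1 + t) \<le> cand_time C m fs pl n \<and> keep main_regs s s' \<and>
      holds ((w # R) @ (if good ((!) (w[reg s rK := a])) then [w[reg s rK := a]] else [])) s') ?s"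
    using N
  proof (rule wp_seqI)
    fix t s' assume *: "t \<le> nest_time n (test_time C m fs pl n + 2) (length pl) \<and> ?J (tuples {0..<n} (length pl)) s'"
    have sm: "reg s' r = reg ?s r" if "r \<le> 9" for r using * small[OF that] by (auto simp: same_def)
    have regs: "reg s' rK = reg s rK" "reg s' rA = a" "reg s' rHead = reg s rHead" "reg s' rTail = reg s rTail"
      using sm by simp_all
    have arr1: "arr s' 1 = arr s 1" using * by (simp add: same_def)
    have H': "holds (w # R) s'" using H regs arr1 unfolding holds_def by simp
    have keep1: "keep main_regs s s'" unfolding keep_def using sm * by (simp add: same_def)
    have gd: "reg s' rGood \<noteq> 0 \<longleftrightarrow> good ((!) (w[reg s rK := a]))"
      using * rowg unfolding good_def by simp
    show "wp X (Cond rGood append_prog skip) (\<lambda>t' s'. 1 + (1 + (t + t')) \<le> cand_time C m fs pl n \<and> keep main_regs s s' \<and>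
      holds ((w # R) @ (if good ((!) (w[reg s rK := a])) then [w[reg s rK := a]] else [])) s') s'"
    proof (cases "reg s' rGood = 0")
      case True
      have "keep main_regs s (set_reg rT 0 s')" using keep1 by (simp add: keep_def)
      moreover have "holds (w # R) (set_reg rT 0 s')" using H' by (simp add: holds_def)
      ultimately show ?thesis using True gd * by (simp add: skip_def cand_time_def)
    next
      case False
      have "wp X append_prog (\<lambda>t s''. t \<le> 6 * n + 5 \<and> keep ({..10} - {rTail}) s' s'' \<and>
        holds ((w # R) @ [w[reg s' rK := reg s' rA]]) s'') s'"
        by (rule wp_append[OF _ H']) (use * regs K a in auto)
      then have "wp X append_prog (\<lambda>t' s''. 1 + (1 + (t + (t' + 1))) \<le> cand_time C m fs pl n \<and> keep main_regs s s'' \<and>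
        holds ((w # R) @ [w[reg s rK := a]]) s'') s'"
      proof (rule wp_mono)
        fix t' s'' assume **: "t' \<le> 6 * n + 5 \<and> keep ({..10} - {rTail}) s' s'' \<and>
          holds ((w # R) @ [w[reg s' rK := reg s' rA]]) s''"
        then have "keep main_regs s' s''" by (auto simp: keep_def)
        then show "1 + (1 + (t + (t' + 1))) \<le> cand_time C m fs pl n \<and> keep main_regs s s'' \<and>
          holds ((w # R) @ [w[reg s rK := a]]) s''"
          using * ** regs keep_trans[OF keep1] by (simp add: cand_time_def)
      qed
      then show ?thesis using False gd by simp
    qed
  qed
  then show ?thesis unfolding cand_prog_def wp_Seq wp_Const .
qed

definition ext_row :: "nat \<Rightarrow> nat list \<Rightarrow> nat list \<Rightarrow> nat list list" where
  "ext_row k as w = map (\<lambda>a. w[k := a]) (filter (\<lambda>a. good ((!) (w[k := a]))) as)"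

lemma env_keep: "env n s \<Longrightarrow> keep main_regs s s' \<Longrightarrow> env n s'"
  by (simp add: env_def keep_def)

lemma wp_cands:
  assumes "env n s" "holds (w # R) s" "reg s rK < n" "set as \<subseteq> {1..m}"
  shows "wp X (cands_prog C enc m fs pl as) (\<lambda>t s'. t \<le> length as * cand_time C m fs pl n + 1 \<and> keep main_regs s s' \<and>
    holds ((w # R) @ ext_row (reg s rK) as w) s') s"
  using assms
proof (induction as arbitrary: s R)
  case Nil
  then show ?case by (simp add: skip_def keep_def ext_row_def holds_def)
next
  case (Cons a as)
  let ?e = "if good ((!) (w[reg s rK := a])) then [w[reg s rK := a]] else []"
  have "wp X (cand_prog C enc m fs pl a) (\<lambda>t s'. t \<le> cand_time C m fs pl n \<and> keep main_regs s s' \<and> holds ((w # R) @ ?e) s') s"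
    by (rule wp_cand) (use Cons.prems in auto)
  then show ?case unfolding cands_prog.simps
  proof (rule wp_seqI)
    fix t s' assume *: "t \<le> cand_time C m fs pl n \<and> keep main_regs s s' \<and> holds ((w # R) @ ?e) s'"
    have k: "reg s' rK = reg s rK" using * by (simp add: keep_def)
    have "wp X (cands_prog C enc m fs pl as) (\<lambda>t s''. t \<le> length as * cand_time C m fs pl n + 1 \<and> keep main_regs s' s'' \<and>
      holds ((w # R @ ?e) @ ext_row (reg s' rK) as w) s'') s'"
      by (rule Cons.IH) (use * k Cons.prems env_keep in auto)
    moreover have "(w # R @ ?e) @ ext_row (reg s' rK) as w = (w # R) @ ext_row (reg s rK) (a # as) w"
      unfolding k by (simp add: ext_row_def)
    ultimately show "wp X (cands_prog C enc m fs pl as) (\<lambda>t' s''. t + t' \<le> length (a # as) * cand_time C m fs pl n + 1 \<and>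
      keep main_regs s s'' \<and> holds ((w # R) @ ext_row (reg s rK) (a # as) w) s'') s'"
      using * keep_trans by (auto elim!: wp_mono)
  qed
qed

definition next_level :: "nat \<Rightarrow> nat list list \<Rightarrow> nat list list" where
  "next_level k L = concat (map (ext_row k [1..<Suc m]) L)"

abbreviation "level_regs \<equiv> {rN, rOne, rZero, rK, rLev}"

lemma n_pos: "n > 0"
  using X by (auto simp: is_ualg_def)

lemma holds_tl: "holds (w # R) s \<Longrightarrow> reg s' rHead = reg s rHead + n \<Longrightarrow> reg s' rTail = reg s rTail \<Longrightarrow> arr s' 1 = arr s 1 \<Longrightarrow> holds R s'"
proof -
  assume H: "holds (w # R) s" and r: "reg s' rHead = reg s rHead + n" "reg s' rTail = reg s rTail" "arr s' 1 = arr s 1"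
  have "arr s' 1 (reg s' rHead + i * n + x) = R ! i ! x" if "i < length R" "x < n" for i x
  proof -
    have "arr s 1 (reg s rHead + Suc i * n + x) = (w # R) ! Suc i ! x"
      using H that unfolding holds_def by (metis Suc_less_eq length_Cons)
    then show ?thesis using r by (simp add: add_ac)
  qed
  then show ?thesis using H r by (simp add: holds_def)
qed

lemma wp_level:
  assumes env: "env n s" and H: "holds L s" and K: "reg s rK < n" and B: "length L \<le> B"
  shows "wp X (level_prog C enc m fs pl) (\<lambda>t s'. t \<le> level_time C m fs pl B n \<and> keep level_regs s s' \<and>
    holds (next_level (reg s rK) L) s') s"
proof -
  let ?k = "reg s rK"
  let ?I = "\<lambda>s'. keep level_regs s s' \<and> (\<exists>L1 L2. L = L1 @ L2 \<and> holds (L2 @ next_level ?k L1) s' \<and>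
    reg s' rEnd = reg s' rHead + n * length L2 \<and> reg s' rRow = n * length L2)"
  let ?\<mu> = "\<lambda>s' :: config. reg s' rRow"
  let ?s = "set_reg rRow (n * length L) (set_reg rEnd (reg s rTail) s)"
  let ?T = "cands_time C m fs pl n + 2"
  have tl: "reg s rTail = reg s rHead + n * length L" using H by (simp add: holds_def)
  have len: "length [1..<Suc m] = m" by (simp del: upt_Suc)
  have "wp X (While rRow (Seq (cands_prog C enc m fs pl [1..<Suc m]) (Seq (Add rHead rHead rN) (Sub rRow rEnd rHead))))
    (\<lambda>t s'. t \<le> (?T + 1) * ?\<mu> ?s + 1 \<and> ?I s' \<and> reg s' rRow = 0) ?s"
  proof (rule wp_while[where I = ?I and \<mu> = ?\<mu>])
    have "holds (L @ next_level ?k []) ?s" using H by (simp add: next_level_def holds_def)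
    moreover have "keep level_regs s ?s" by (simp add: keep_def)
    ultimately show "?I ?s" using tl by (intro conjI exI[of _ "[]"] exI[of _ L]) simp_all
    fix s' assume I: "?I s'" "reg s' rRow \<noteq> 0"
    then obtain L1 L2 where L: "L = L1 @ L2" "holds (L2 @ next_level ?k L1) s'"
      "reg s' rEnd = reg s' rHead + n * length L2" "reg s' rRow = n * length L2" by blast
    then obtain w L3 where L2: "L2 = w # L3" using I(2) by (cases L2) auto
    have k: "reg s' rK = ?k" using I by (simp add: keep_def)
    have env': "env n s'" using I env by (simp add: keep_def env_def)
    have "wp X (cands_prog C enc m fs pl [1..<Suc m]) (\<lambda>t s''. t \<le> length [1..<Suc m] * cand_time C m fs pl n + 1 \<and> keep main_regs s' s'' \<and>
      holds ((w # (L3 @ next_level ?k L1)) @ ext_row (reg s' rK) [1..<Suc m] w) s'') s'"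
      by (rule wp_cands[OF env']) (use L L2 K k in auto)
    then show "wp X (Seq (cands_prog C enc m fs pl [1..<Suc m]) (Seq (Add rHead rHead rN) (Sub rRow rEnd rHead)))
      (\<lambda>t s''. t \<le> ?T \<and> ?I s'' \<and> ?\<mu> s'' < ?\<mu> s') s'"
    proof (rule wp_seqI)
      fix t s'' assume *: "t \<le> length [1..<Suc m] * cand_time C m fs pl n + 1 \<and> keep main_regs s' s'' \<and>
        holds ((w # (L3 @ next_level ?k L1)) @ ext_row (reg s' rK) [1..<Suc m] w) s''"
      have regs: "reg s'' rN = n" "reg s'' rEnd = reg s' rHead + n * length L2" "reg s'' rHead = reg s' rHead"
        using * env' L by (simp_all add: keep_def env_def)
      let ?r = "set_reg rRow (n * length L3) (set_reg rHead (reg s' rHead + n) s'')"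
      have nl: "L3 @ next_level ?k (L1 @ [w]) = (L3 @ next_level ?k L1) @ ext_row (reg s' rK) [1..<Suc m] w"
        unfolding k by (simp add: next_level_def)
      have "holds (w # (L3 @ next_level ?k L1) @ ext_row (reg s' rK) [1..<Suc m] w) s''" using * by simp
      then have "holds (L3 @ next_level ?k (L1 @ [w])) ?r"
        unfolding nl by (rule holds_tl) (use regs in simp_all)
      moreover have "keep level_regs s ?r" using * I by (simp add: keep_def)
      moreover have "L = (L1 @ [w]) @ L3" using L L2 by simp
      moreover have "reg ?r rEnd = reg ?r rHead + n * length L3" using regs L2 by simp
      moreover have "reg ?r rRow = n * length L3" by simp
      ultimately have "?I ?r" by blast
      moreover have "?\<mu> ?r < ?\<mu> s'" using L L2 n_pos by simp
      moreover have "t + 2 \<le> ?T" using conjunct1[OF *] unfolding len cands_time_def by linarith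
      ultimately show "wp X (Seq (Add rHead rHead rN) (Sub rRow rEnd rHead))
        (\<lambda>t' s''. t + t' \<le> ?T \<and> ?I s'' \<and> ?\<mu> s'' < ?\<mu> s') s''"
        using regs L2 by simp
    qed
  qed
  then have "wp X (While rRow (Seq (cands_prog C enc m fs pl [1..<Suc m]) (Seq (Add rHead rHead rN) (Sub rRow rEnd rHead))))
    (\<lambda>t s'. 1 + (1 + t) \<le> level_time C m fs pl B n \<and> keep level_regs s s' \<and> holds (next_level ?k L) s') ?s"
  proof (rule wp_mono)
    fix t s' assume *: "t \<le> (?T + 1) * ?\<mu> ?s + 1 \<and> ?I s' \<and> reg s' rRow = 0"
    then obtain L1 L2 where L: "L = L1 @ L2" "holds (L2 @ next_level ?k L1) s'" "reg s' rRow = n * length L2" by blast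
    then have "L2 = []" using * n_pos by auto
    moreover have "(?T + 1) * ?\<mu> ?s \<le> (cands_time C m fs pl n + 3) * (n * B)" using B by (intro mult_le_mono) simp_all
    ultimately show "1 + (1 + t) \<le> level_time C m fs pl B n \<and> keep level_regs s s' \<and> holds (next_level ?k L) s'"
      using * L by (simp add: level_time_def)
  qed
  then show ?thesis unfolding level_prog_def using env tl by (simp add: env_def)
qed

primrec levels :: "nat \<Rightarrow> nat list list" where
  "levels 0 = [replicate n 0]"
| "levels (Suc k) = next_level k (levels k)"

lemma wp_levels:
  assumes env: "env n s" and H: "holds (levels 0) s" and B: "\<And>k. k \<le> n \<Longrightarrow> length (levels k) \<le> B"
  shows "wp X (levels_prog C enc m fs pl) (\<lambda>t s'. t \<le> (level_time C m fs pl B n + 3) * n + 3 \<and>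
    env n s' \<and> out s' = out s \<and> holds (levels n) s') s"
proof -
  let ?I = "\<lambda>s'. env n s' \<and> out s' = out s \<and> (\<exists>k\<le>n. reg s' rK = k \<and> reg s' rLev = n - k \<and> holds (levels k) s')"
  let ?\<mu> = "\<lambda>s' :: config. reg s' rLev"
  let ?s = "set_reg rLev n (set_reg rK 0 s)"
  let ?T = "level_time C m fs pl B n + 2"
  have "wp X (While rLev (Seq (level_prog C enc m fs pl) (Seq (Add rK rK rOne) (Sub rLev rN rK))))
    (\<lambda>t s'. t \<le> (?T + 1) * ?\<mu> ?s + 1 \<and> ?I s' \<and> reg s' rLev = 0) ?s"
  proof (rule wp_while[where I = ?I and \<mu> = ?\<mu>])
    show "?I ?s" using env H by (simp add: env_def holds_def)
    fix s' assume I: "?I s'" "reg s' rLev \<noteq> 0"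
    then obtain k where k: "k < n" "reg s' rK = k" "reg s' rLev = n - k" "holds (levels k) s'" by auto
    have "wp X (level_prog C enc m fs pl) (\<lambda>t s''. t \<le> level_time C m fs pl B n \<and> keep level_regs s' s'' \<and>
      holds (next_level (reg s' rK) (levels k)) s'') s'"
      by (rule wp_level) (use I k B in auto)
    then show "wp X (Seq (level_prog C enc m fs pl) (Seq (Add rK rK rOne) (Sub rLev rN rK)))
      (\<lambda>t s''. t \<le> ?T \<and> ?I s'' \<and> ?\<mu> s'' < ?\<mu> s') s'"
    proof (rule wp_seqI)
      fix t s'' assume *: "t \<le> level_time C m fs pl B n \<and> keep level_regs s' s'' \<and>
        holds (next_level (reg s' rK) (levels k)) s''"
      let ?r = "set_reg rLev (n - Suc k) (set_reg rK (Suc k) s'')"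
      have regs: "reg s'' rK = k" "reg s'' rOne = 1" "reg s'' rN = n" using * k I by (auto simp: keep_def env_def)
      have "holds (levels (Suc k)) ?r" using * k by (simp add: holds_def)
      moreover have "env n ?r" "out ?r = out s" using * I by (auto simp: keep_def env_def)
      ultimately have "?I ?r" using k(1) by (intro conjI exI[of _ "Suc k"]) simp_all
      moreover have "?\<mu> ?r < ?\<mu> s'" using k by simp
      ultimately show "wp X (Seq (Add rK rK rOne) (Sub rLev rN rK))
        (\<lambda>t' s''. t + t' \<le> ?T \<and> ?I s'' \<and> ?\<mu> s'' < ?\<mu> s') s''"
        using regs * by simp
    qed
  qed
  then have "wp X (While rLev (Seq (level_prog C enc m fs pl) (Seq (Add rK rK rOne) (Sub rLev rN rK))))
    (\<lambda>t s'. 1 + (1 + t) \<le> (level_time C m fs pl B n + 3) * n + 3 \<and> env n s' \<and> out s' = out s \<and> holds (levels n) s') ?s"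
    by (rule wp_mono) (auto simp: algebra_simps)
  then show ?thesis unfolding levels_prog_def using env by (simp add: env_def)
qed

lemma wp_emit:
  assumes one: "reg s rOne = 1" and le: "reg s rHead \<le> reg s rTail"
  shows "wp X emit_prog (\<lambda>t s'. t \<le> 5 * (reg s rTail - reg s rHead) + 2 \<and>
    out s' = out s @ map (arr s 1) [reg s rHead..<reg s rTail]) s"
proof -
  let ?I = "\<lambda>s' :: config. reg s' rOne = 1 \<and> reg s' rTail = reg s rTail \<and> arr s' 1 = arr s 1 \<and> reg s' rHead \<le> reg s rTail \<and>
    reg s' rRow = reg s rTail - reg s' rHead \<and>
    out s' @ map (arr s 1) [reg s' rHead..<reg s rTail] = out s @ map (arr s 1) [reg s rHead..<reg s rTail]"
  let ?\<mu> = "\<lambda>s' :: config. reg s' rRow"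
  let ?s = "set_reg rRow (reg s rTail - reg s rHead) s"
  have "wp X (While rRow (Seq (Load rT 1 rHead) (Seq (Emit rT) (Seq (Add rHead rHead rOne) (Sub rRow rTail rHead)))))
    (\<lambda>t s'. t \<le> (4 + 1) * ?\<mu> ?s + 1 \<and> ?I s' \<and> reg s' rRow = 0) ?s"
  proof (rule wp_while[where I = ?I and \<mu> = ?\<mu>])
    show "?I ?s" using one le by simp
    fix s' assume I: "?I s'" "reg s' rRow \<noteq> 0"
    then have "reg s' rHead < reg s rTail" by simp
    then have "[reg s' rHead..<reg s rTail] = reg s' rHead # [Suc (reg s' rHead)..<reg s rTail]" by (rule upt_conv_Cons)
    then show "wp X (Seq (Load rT 1 rHead) (Seq (Emit rT) (Seq (Add rHead rHead rOne) (Sub rRow rTail rHead))))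
      (\<lambda>t s''. t \<le> 4 \<and> ?I s'' \<and> ?\<mu> s'' < ?\<mu> s') s'"
      using I by simp
  qed
  then have "wp X (While rRow (Seq (Load rT 1 rHead) (Seq (Emit rT) (Seq (Add rHead rHead rOne) (Sub rRow rTail rHead)))))
    (\<lambda>t s'. 1 + t \<le> 5 * (reg s rTail - reg s rHead) + 2 \<and>
      out s' = out s @ map (arr s 1) [reg s rHead..<reg s rTail]) ?s"
    by (rule wp_mono) auto
  then show ?thesis unfolding emit_prog_def wp_Seq wp_Sub .
qed

lemma holds_concat: "holds L s \<Longrightarrow> map (arr s 1) [reg s rHead..<reg s rTail] = concat L"
proof (induction L arbitrary: s)
  case Nil then show ?case by (simp add: holds_def)
next
  case (Cons w L)
  let ?r = "set_reg rHead (reg s rHead + n) s"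
  have "holds L ?r" by (rule holds_tl[OF Cons.prems]) simp_all
  then have IH: "map (arr s 1) [reg s rHead + n..<reg s rTail] = concat L" using Cons.IH[of ?r] by simp
  have "arr s 1 (reg s rHead + x) = w ! x" if "x < n" for x
    using Cons.prems that unfolding holds_def by force
  then have "map (arr s 1) [reg s rHead..<reg s rHead + n] = w"
    using Cons.prems by (intro nth_equalityI) (auto simp: holds_def)
  moreover have "reg s rHead + n \<le> reg s rTail" using Cons.prems by (simp add: holds_def)
  then have "[reg s rHead..<reg s rTail] = [reg s rHead..<reg s rHead + n] @ [reg s rHead + n..<reg s rTail]"
    using upt_add_eq_append[of "reg s rHead" "reg s rHead + n" "reg s rTail - (reg s rHead + n)"] by simp
  ultimately show ?case using IH by simp
qed

lemma wp_enum:
  assumes B: "\<And>k. k \<le> n \<Longrightarrow> length (levels k) \<le> B"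
  shows "wp X (enum_prog C enc m fs pl) (\<lambda>t s'. t \<le> enum_time C m fs pl B n \<and> out s' = concat (levels n)) (init n)"
proof -
  let ?s = "set_reg rTail n (set_reg rHead 0 (set_reg rZero 0 (set_reg rOne 1 (init n))))"
  have env: "env n ?s" by (simp add: env_def init_def)
  have "holds (levels 0) ?s" by (auto simp: holds_def init_def)
  then have "wp X (levels_prog C enc m fs pl) (\<lambda>t s'. t \<le> (level_time C m fs pl B n + 3) * n + 3 \<and>
    env n s' \<and> out s' = out ?s \<and> holds (levels n) s') ?s" using B by (rule wp_levels[OF env])
  then have "wp X (Seq (levels_prog C enc m fs pl) emit_prog)
    (\<lambda>t s'. 1 + (1 + (1 + (1 + t))) \<le> enum_time C m fs pl B n \<and> out s' = concat (levels n)) ?s"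
  proof (rule wp_seqI)
    fix t s' assume *: "t \<le> (level_time C m fs pl B n + 3) * n + 3 \<and> env n s' \<and> out s' = out ?s \<and> holds (levels n) s'"
    then have tl: "reg s' rTail = reg s' rHead + n * length (levels n)" by (simp add: holds_def)
    have "wp X emit_prog (\<lambda>t s''. t \<le> 5 * (reg s' rTail - reg s' rHead) + 2 \<and>
      out s'' = out s' @ map (arr s' 1) [reg s' rHead..<reg s' rTail]) s'"
      by (rule wp_emit) (use * tl in \<open>simp_all add: env_def\<close>)
    then show "wp X emit_prog (\<lambda>t' s'. 1 + (1 + (1 + (1 + (t + t')))) \<le> enum_time C m fs pl B n \<and> out s' = concat (levels n)) s'"
    proof (rule wp_mono)
      fix t' s'' assume **: "t' \<le> 5 * (reg s' rTail - reg s' rHead) + 2 \<and>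
        out s'' = out s' @ map (arr s' 1) [reg s' rHead..<reg s' rTail]"
      have "n * length (levels n) \<le> n * B" using B[of n] by simp
      moreover have "t' \<le> 5 * (n * length (levels n)) + 2" using ** tl by simp
      ultimately have "t' \<le> 5 * (n * B) + 2" by linarith
      then show "1 + (1 + (1 + (1 + (t + t')))) \<le> enum_time C m fs pl B n \<and> out s'' = concat (levels n)"
        using * ** holds_concat by (simp add: enum_time_def init_def)
    qed
  qed
  then show ?thesis unfolding enum_prog_def by (simp add: init_def)
qed

end

lemma distinct_concat_map:
  assumes "distinct L" "\<And>w. w \<in> set L \<Longrightarrow> distinct (f w)"
    "\<And>v w. v \<in> set L \<Longrightarrow> w \<in> set L \<Longrightarrow> v \<noteq> w \<Longrightarrow> set (f v) \<inter> set (f w) = {}"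
  shows "distinct (concat (map f L))"
  using assms
proof (induction L)
  case (Cons v L)
  have "distinct (concat (map f L))" using Cons.prems by (intro Cons.IH) auto
  moreover have "set (f v) \<inter> set (f w) = {}" if "w \<in> set L" for w
    by (rule Cons.prems(3)) (use Cons.prems(1) that in auto)
  ultimately have "distinct (concat (map f L))" "set (f v) \<inter> set (concat (map f L)) = {}"
    by (simp, force)
  moreover have "distinct (f v)" by (rule Cons.prems(2)) simp
  ultimately show ?case by simp
qed simp

context enumeration begin

definition rows :: "nat \<Rightarrow> nat list set" where
  "rows k = {w. length w = n \<and> (\<forall>i<k. w ! i \<in> {1..m}) \<and> (\<forall>i. k \<le> i \<and> i < n \<longrightarrow> w ! i = 0) \<and>
     (k = 0 \<or> good ((!) w))}"

lemma fitsD: "fits S h E \<Longrightarrow> (x, a) \<in> E \<Longrightarrow> x \<in> S \<and> enc (h x) = a"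
  by (auto simp: fits_def)

lemma good_mono: "good W \<Longrightarrow> graph W' \<subseteq> graph W \<Longrightarrow> good W'"
  unfolding good_def fits_def by (meson Un_iff subsetD)

lemma next_rows:
  assumes k: "k < n" and L: "distinct L" "set L = rows k"
  shows "distinct (next_level k L)" "set (next_level k L) = rows (Suc k)"
proof -
  have len: "length w = n" "w ! k = 0" if "w \<in> rows k" for w using that k by (auto simp: rows_def)
  show "distinct (next_level k L)"
    unfolding next_level_def
  proof (rule distinct_concat_map[OF L(1)])
    fix w assume "w \<in> set L"
    then have "length w = n" using L len by blast
    then have "inj_on (\<lambda>a. w[k := a]) A" for A using k by (metis inj_onI nth_list_update_eq)
    then show "distinct (ext_row k [1..<Suc m] w)" unfolding ext_row_def by (simp add: distinct_map del: upt_Suc)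
  next
    fix v w assume vw: "v \<in> set L" "w \<in> set L" "v \<noteq> w"
    then have "v \<in> rows k" "w \<in> rows k" using L by auto
    then have z: "length v = n" "length w = n" "v ! k = 0" "w ! k = 0" using len by auto
    have "v[k := a] \<noteq> w[k := b]" for a b
    proof
      assume eq: "v[k := a] = w[k := b]"
      have "v ! i = w ! i" if "i < n" for i
        using arg_cong[OF eq, of "\<lambda>u. u ! i"] that z by (cases "i = k") auto
      then have "v = w" using z by (intro nth_equalityI) auto
      then show False using vw by blast
    qed
    then show "set (ext_row k [1..<Suc m] v) \<inter> set (ext_row k [1..<Suc m] w) = {}"
      unfolding ext_row_def by auto
  qed
  have "set (next_level k L) = {w[k := a] | w a. w \<in> rows k \<and> a \<in> {1..m} \<and> good ((!) (w[k := a]))}"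
    unfolding next_level_def ext_row_def using L(2) by (simp del: upt_Suc add: atLeastLessThanSuc_atLeastAtMost) blast
  also have "\<dots> = rows (Suc k)"
  proof (intro Set.equalityI subsetI)
    fix v assume "v \<in> {w[k := a] | w a. w \<in> rows k \<and> a \<in> {1..m} \<and> good ((!) (w[k := a]))}"
    then obtain w a where "v = w[k := a]" "w \<in> rows k" "a \<in> {1..m}" "good ((!) (w[k := a]))" by blast
    then show "v \<in> rows (Suc k)" using k by (auto simp: rows_def nth_list_update less_Suc_eq)
  next
    fix v assume v: "v \<in> rows (Suc k)"
    let ?w = "v[k := 0]"
    have vl: "length v = n" using v by (simp add: rows_def)
    have g: "good ((!) v)" using v by (simp add: rows_def)
    have "graph ((!) ?w) \<subseteq> graph ((!) v)"
      using vl k by (auto simp: graph_def nth_list_update split: if_splits)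
    then have "good ((!) ?w)" by (rule good_mono[OF g])
    then have "?w \<in> rows k" using v k by (auto simp: rows_def nth_list_update)
    moreover have "?w[k := v ! k] = v" by simp
    moreover have "v ! k \<in> {1..m}" using v by (simp add: rows_def)
    ultimately show "v \<in> {w[k := a] | w a. w \<in> rows k \<and> a \<in> {1..m} \<and> good ((!) (w[k := a]))}"
      using g by (intro CollectI exI[of _ ?w] exI[of _ "v ! k"]) simp
  qed
  finally show "set (next_level k L) = rows (Suc k)" .
qed

lemma levels_rows: "k \<le> n \<Longrightarrow> distinct (levels k) \<and> set (levels k) = rows k"
proof (induction k)
  case 0
  have "rows 0 = {replicate n 0}"
    by (auto simp: rows_def intro: nth_equalityI)
  then show ?case by simp
next
  case (Suc k)
  then show ?case using next_rows[of k "levels k"] by simp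
qed

definition pinned_homs :: "nat set \<Rightarrow> (nat \<Rightarrow> 'a) set" where
  "pinned_homs S = {h \<in> homs \<lparr>symbs = symbs X, ar = ar X, univ = S, opn = opn X\<rparr> C. set pl \<subseteq> h ` S}"

lemma card_rows:
  assumes b: "\<And>S. S \<subseteq> {0..<n} \<Longrightarrow> is_ualg \<lparr>symbs = symbs X, ar = ar X, univ = S, opn = opn X\<rparr> \<Longrightarrow>
      card (pinned_homs S) \<le> b"
    and finC: "finite (univ C)" and k: "k \<le> n"
  shows "card (rows k) \<le> 1 + n ^ length pl * b"
proof (cases "k = 0")
  case True
  have "set (levels 0) = rows 0" using levels_rows[of 0] by blast
  then have "rows k = {replicate n 0}" using True by simp
  then show ?thesis by simp
next
  case False
  define T where "T = tuples {0..<n} (length pl)"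
  define R where "R c = {w. length w = n \<and> (\<forall>i<k. w ! i \<in> {1..m}) \<and> (\<forall>i. k \<le> i \<and> i < n \<longrightarrow> w ! i = 0) \<and>
    (\<exists>S h. phom S h \<and> fits S h (graph ((!) w) \<union> pinned c))}" for c
  have R: "finite (R c) \<and> card (R c) \<le> b" if c: "c \<in> T" for c
  proof -
    define S where "S = \<Inter>{S. S \<subseteq> {0..<n} \<and> {0..<k} \<union> set c \<subseteq> S \<and>
      (\<forall>f\<in>symbs C. \<forall>xs\<in>tuples S (ar C f). opn X f xs \<in> S)}"
    have cn: "set c \<subseteq> {0..<n}" "length c = length pl" using c by (auto simp: T_def tuples_def)
    have "{0..<n} \<in> {S. S \<subseteq> {0..<n} \<and> {0..<k} \<union> set c \<subseteq> S \<and>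
      (\<forall>f\<in>symbs C. \<forall>xs\<in>tuples S (ar C f). opn X f xs \<in> S)}" 
    proof (intro CollectI conjI ballI)
      fix f xs assume "f \<in> symbs C" "xs \<in> tuples {0..<n} (ar C f)"
      then show "opn X f xs \<in> {0..<n}" using opn_X by simp
    qed (use k cn in auto)
    then have Sn: "S \<subseteq> {0..<n}" unfolding S_def by blast
    have Sk: "{0..<k} \<union> set c \<subseteq> S" unfolding S_def by blast
    have Scl: "opn X f xs \<in> S" if "f \<in> symbs C" "xs \<in> tuples S (ar C f)" for f xs
      unfolding S_def
    proof (rule InterI)
      fix S' assume S': "S' \<in> {S. S \<subseteq> {0..<n} \<and> {0..<k} \<union> set c \<subseteq> S \<and>
        (\<forall>f\<in>symbs C. \<forall>xs\<in>tuples S (ar C f). opn X f xs \<in> S)}"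
      then have "S \<subseteq> S'" unfolding S_def by blast
      then have "xs \<in> tuples S' (ar C f)" using that(2) by (rule tuples_mono)
      then show "opn X f xs \<in> S'" using S' that(1) by blast
    qed
    let ?Y = "\<lparr>symbs = symbs X, ar = ar X, univ = S, opn = opn X\<rparr>"
    have "is_ualg ?Y" using Sk False Scl sig by (auto simp: is_ualg_def)
    then have le: "card (pinned_homs S) \<le> b" using b Sn by blast
    have finS: "finite S" using Sn by (rule finite_subset) simp
    have finH: "finite (pinned_homs S)"
      unfolding pinned_homs_def using finite_homs[of ?Y C] finS finC by simp
    let ?g = "\<lambda>h. map (\<lambda>i. if i < k then enc (h i) else 0) [0..<n]"
    have sub: "R c \<subseteq> ?g ` pinned_homs S"
    proof
      fix w assume "w \<in> R c"
      then obtain S' h where w: "length w = n" "\<And>i. i < k \<Longrightarrow> w ! i \<in> {1..m}" "\<And>i. k \<le> i \<Longrightarrow> i < n \<Longrightarrow> w ! i = 0"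
        and h: "phom S' h" "fits S' h (graph ((!) w) \<union> pinned c)" unfolding R_def by blast
      have wk: "i \<in> S' \<and> enc (h i) = w ! i" if "i < k" for i
      proof -
        have "(i, w ! i) \<in> graph ((!) w)" using w(2)[OF that] that k by (auto simp: graph_def)
        then show ?thesis using fitsD[OF h(2)] by blast
      qed
      have ci: "c ! i \<in> S' \<and> enc (h (c ! i)) = enc (pl ! i)" if "i < length pl" for i
      proof -
        have "(c ! i, enc (pl ! i)) \<in> pinned c" using that by (auto simp: pinned_def)
        then show ?thesis using fitsD[OF h(2)] by blast
      qed
      have "set c \<subseteq> S'" using ci cn by (auto simp: in_set_conv_nth)
      then have SS': "S \<subseteq> S'" unfolding S_def using h(1) wk by (intro Inter_lower) (auto simp: phom_def)
      let ?h = "restrict h S"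
      have "?h \<in> homs ?Y C"
        unfolding homs_def
      proof (intro CollectI conjI ballI)
        show "?h \<in> univ ?Y \<rightarrow>\<^sub>E univ C" using SS' h(1) by (auto simp: phom_def)
        fix f xs assume f: "f \<in> symbs ?Y" and xs: "xs \<in> tuples (univ ?Y) (ar ?Y f)"
        have f': "f \<in> symbs C" using f sig by simp
        then have xs': "xs \<in> tuples S (ar C f)" using xs sig by simp
        have "h (opn X f xs) = opn C f (map h xs)"
          using h(1) f' tuples_mono[OF SS' xs'] by (simp add: phom_def)
        moreover have "map h xs = map ?h xs" using xs' by (auto simp: tuples_def)
        ultimately show "?h (opn ?Y f xs) = opn C f (map ?h xs)" using Scl[OF f' xs'] by simp
      qed
      moreover have "set pl \<subseteq> ?h ` S"
      proof
        fix a assume "a \<in> set pl"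
        then obtain i where i: "i < length pl" "a = pl ! i" by (auto simp: in_set_conv_nth)
        have cS: "c ! i \<in> S" using Sk cn i by auto
        have "h (c ! i) \<in> univ C" "a \<in> univ C" using h(1) ci[OF i(1)] pl i by (auto simp: phom_def)
        then have "h (c ! i) = a" using ci[OF i(1)] i(2) dec_enc by metis
        then show "a \<in> ?h ` S" using cS by (metis imageI restrict_apply')
      qed
      ultimately have "?h \<in> pinned_homs S" by (simp add: pinned_homs_def)
      moreover have "w = ?g ?h"
      proof (rule nth_equalityI)
        fix i assume "i < length w"
        then show "w ! i = ?g ?h ! i" using w wk[of i] Sk by (cases "i < k") auto
      qed (use w in simp)
      ultimately show "w \<in> ?g ` pinned_homs S" by blast
    qed
    have "finite (R c)" using finH sub finite_surj by blast
    moreover have "card (R c) \<le> card (pinned_homs S)" using finH sub by (rule surj_card_le)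
    ultimately show ?thesis using le by linarith
  qed
  have "rows k \<subseteq> (\<Union>c\<in>T. R c)" using False by (auto simp: rows_def good_def R_def T_def)
  moreover have finT: "finite T" unfolding T_def by (rule finite_tuples) simp
  ultimately have "card (rows k) \<le> card (\<Union>c\<in>T. R c)" using R by (intro card_mono) auto
  also have "\<dots> \<le> (\<Sum>c\<in>T. card (R c))" using finT by (rule card_UN_le)
  also have "\<dots> \<le> (\<Sum>c\<in>T. b)" using R by (intro sum_mono) blast
  also have "\<dots> = n ^ length pl * b" by (simp add: T_def card_tuples)
  finally show ?thesis by simp
qed

definition row_map :: "nat list \<Rightarrow> nat \<Rightarrow> 'a" where
  "row_map w = restrict (\<lambda>x. dec (w ! x)) {0..<n}"

lemma enumerated:
  "distinct (map row_map (levels n))" "set (map row_map (levels n)) = {h \<in> homs X C. set pl \<subseteq> h ` univ X}"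
  "concat (levels n) = concat (map (\<lambda>h. map (\<lambda>x. enc (h x)) [0..<n]) (map row_map (levels n)))"
proof -
  have L: "distinct (levels n)" "set (levels n) = rows n" using levels_rows[of n] by auto
  have w: "length w = n" "\<And>i. i < n \<Longrightarrow> w ! i \<in> {1..m}" "good ((!) w)" if "w \<in> rows n" for w
    using that n_pos by (auto simp: rows_def)
  have enc_row: "map (\<lambda>x. enc (row_map w x)) [0..<n] = w" if "w \<in> rows n" for w
    using w[OF that] enc_dec by (intro nth_equalityI) (auto simp: row_map_def)
  show "distinct (map row_map (levels n))"
    unfolding distinct_map
  proof (intro conjI inj_onI)
    fix v w assume "v \<in> set (levels n)" "w \<in> set (levels n)" "row_map v = row_map w"
    then show "v = w" using enc_row L(2) by metis
  qed (rule L(1))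
  have "map (\<lambda>h. map (\<lambda>x. enc (h x)) [0..<n]) (map row_map (levels n)) = levels n"
    unfolding map_map comp_def by (rule map_idI) (use L enc_row in auto)
  then show "concat (levels n) = concat (map (\<lambda>h. map (\<lambda>x. enc (h x)) [0..<n]) (map row_map (levels n)))"
    by simp
  have "row_map ` rows n = {h \<in> homs X C. set pl \<subseteq> h ` univ X}"
  proof (intro Set.equalityI subsetI)
    fix h assume "h \<in> row_map ` rows n"
    then obtain v where v: "v \<in> rows n" "h = row_map v" by blast
    note v' = w[OF v(1)]
    obtain c S g where c: "c \<in> tuples {0..<n} (length pl)" and g: "phom S g" "fits S g (graph ((!) v) \<union> pinned c)"
      using v'(3) unfolding good_def by blast
    have xS: "x \<in> S \<and> enc (g x) = v ! x" if "x < n" for x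
    proof -
      have "(x, v ! x) \<in> graph ((!) v)" using v'(2)[OF that] that by (auto simp: graph_def)
      then show ?thesis using fitsD[OF g(2)] by blast
    qed
    then have S: "S = {0..<n}" using g(1) by (auto simp: phom_def)
    have gh: "g x = h x" if "x < n" for x
    proof -
      have "g x \<in> univ C" using g(1) S that by (simp add: phom_def)
      then have "g x = dec (v ! x)" using xS[OF that] dec_enc by metis
      then show ?thesis using v(2) that by (simp add: row_map_def)
    qed
    have "h \<in> homs X C"
      unfolding homs_def
    proof (intro CollectI conjI ballI)
      show "h \<in> univ X \<rightarrow>\<^sub>E univ C" using v v'(2) dec_in X(3) by (auto simp: row_map_def)
      fix f xs assume f: "f \<in> symbs X" and xs: "xs \<in> tuples (univ X) (ar X f)"
      have f': "f \<in> symbs C" using f sig by simp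
      have xs': "xs \<in> tuples {0..<n} (ar C f)" using xs sig f' X(3) by simp
      have "g (opn X f xs) = opn C f (map g xs)" using g(1) f' xs' S by (simp add: phom_def)
      moreover have "map g xs = map h xs" using xs' gh by (auto simp: tuples_def)
      ultimately show "h (opn X f xs) = opn C f (map h xs)" using gh opn_X[OF f' xs'] by simp
    qed
    moreover have "set pl \<subseteq> h ` univ X"
    proof
      fix a assume "a \<in> set pl"
      then obtain i where i: "i < length pl" "a = pl ! i" by (auto simp: in_set_conv_nth)
      have "(c ! i, enc (pl ! i)) \<in> pinned c" using i by (auto simp: pinned_def)
      then have "enc (g (c ! i)) = enc (pl ! i)" "c ! i < n" using fitsD[OF g(2)] S by auto
      moreover have "g (c ! i) \<in> univ C" using g(1) S \<open>c ! i < n\<close> by (simp add: phom_def)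
      moreover have "a \<in> univ C" using pl i by auto
      ultimately have "h (c ! i) = a" using gh i dec_enc by metis
      then show "a \<in> h ` univ X" using \<open>c ! i < n\<close> X(3) by force
    qed
    ultimately show "h \<in> {h \<in> homs X C. set pl \<subseteq> h ` univ X}" by blast
  next
    fix h assume "h \<in> {h \<in> homs X C. set pl \<subseteq> h ` univ X}"
    then have h: "h \<in> homs X C" "set pl \<subseteq> h ` univ X" by auto
    let ?w = "map (\<lambda>x. enc (h x)) [0..<n]"
    have hC: "h x \<in> univ C" if "x < n" for x using homs_closed[OF h(1)] X(3) that by simp
    have ph: "phom {0..<n} h"
      unfolding phom_def
    proof (intro conjI ballI)
      fix f xs assume f: "f \<in> symbs C" and xs: "xs \<in> tuples {0..<n} (ar C f)"
      show "opn X f xs \<in> {0..<n}" using opn_X[OF f xs] by simp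
      show "h (opn X f xs) = opn C f (map h xs)"
        using homs_opn[OF h(1), of f xs] f xs sig X(3) by simp
    qed (use hC in auto)
    define c where "c = map (inv_into {0..<n} h) pl"
    have ci: "c ! i < n \<and> h (c ! i) = pl ! i" if "i < length pl" for i
    proof -
      have "pl ! i \<in> h ` {0..<n}" using h(2) X(3) that by auto
      then have "inv_into {0..<n} h (pl ! i) \<in> {0..<n}" "h (inv_into {0..<n} h (pl ! i)) = pl ! i"
        by (rule inv_into_into, rule f_inv_into_f)
      then show ?thesis using that by (simp add: c_def)
    qed
    have "c \<in> tuples {0..<n} (length pl)"
      using ci by (auto simp: tuples_def in_set_conv_nth c_def)
    moreover have "fits {0..<n} h (graph ((!) ?w) \<union> pinned c)"
      using ci by (auto simp: fits_def graph_def pinned_def)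
    ultimately have "good ((!) ?w)" unfolding good_def using ph by blast
    moreover have "?w ! i \<in> {1..m}" if "i < n" for i
      using enc_range[OF hC[OF that]] that by simp
    ultimately have "?w \<in> rows n" by (simp add: rows_def)
    moreover have "h = row_map ?w"
    proof
      fix x show "h x = row_map ?w x"
      proof (cases "x < n")
        case True
        then show ?thesis using dec_enc[OF hC[OF True]] by (simp add: row_map_def)
      next
        case False
        have "h \<in> extensional {0..<n}" using h(1) X(3) by (simp add: homs_def PiE_def)
        then show ?thesis using False by (simp add: row_map_def extensional_def)
      qed
    qed
    ultimately show "h \<in> row_map ` rows n" by blast
  qed
  then show "set (map row_map (levels n)) = {h \<in> homs X C. set pl \<subseteq> h ` univ X}" using L by simp
qed

end

definition poly_bounded :: "(nat \<Rightarrow> nat) \<Rightarrow> bool" where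
  "poly_bounded f \<longleftrightarrow> (\<exists>q :: real poly. \<forall>n. real (f n) \<le> poly q (real n))"

lemma poly_bounded_const: "poly_bounded (\<lambda>n. c)"
  unfolding poly_bounded_def by (intro exI[of _ "[:real c:]"]) simp

lemma poly_bounded_id: "poly_bounded (\<lambda>n. n)"
  unfolding poly_bounded_def by (intro exI[of _ "[:0, 1:]"]) simp

lemma poly_bounded_add:
  assumes "poly_bounded f" "poly_bounded g" shows "poly_bounded (\<lambda>n. f n + g n)"
proof -
  obtain p q :: "real poly" where "\<And>n. real (f n) \<le> poly p (real n)" "\<And>n. real (g n) \<le> poly q (real n)"
    using assms unfolding poly_bounded_def by blast
  then show ?thesis unfolding poly_bounded_def by (intro exI[of _ "p + q"]) (simp add: add_mono)
qed

lemma poly_bounded_mult: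
  assumes "poly_bounded f" "poly_bounded g" shows "poly_bounded (\<lambda>n. f n * g n)"
proof -
  obtain p q :: "real poly" where p: "\<And>n. real (f n) \<le> poly p (real n)" "\<And>n. real (g n) \<le> poly q (real n)"
    using assms unfolding poly_bounded_def by blast
  have "real (f n * g n) \<le> poly (p * q) (real n)" for n
    using mult_mono[OF p(1)[of n] p(2)[of n]] order_trans[OF of_nat_0_le_iff p(1)[of n]] by simp
  then show ?thesis unfolding poly_bounded_def by blast
qed

lemma poly_bounded_power: "poly_bounded f \<Longrightarrow> poly_bounded (\<lambda>n. f n ^ k)"
  by (induction k) (auto intro: poly_bounded_const[of 1, simplified] poly_bounded_mult)

lemma poly_bounded_sum_list:
  "(\<And>x. x \<in> set xs \<Longrightarrow> poly_bounded (f x)) \<Longrightarrow> poly_bounded (\<lambda>n. sum_list (map (\<lambda>x. f x n) xs))"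
  by (induction xs) (auto intro: poly_bounded_const[of 0] poly_bounded_add)

lemma poly_bounded_nest_time:
  assumes "poly_bounded T" shows "poly_bounded (\<lambda>n. nest_time n (T n) r)"
proof (induction r)
  case 0
  then show ?case using assms by simp
next
  case (Suc r)
  then show ?case unfolding nest_time.simps
    by (intro poly_bounded_add poly_bounded_mult poly_bounded_const poly_bounded_id)
qed

lemma poly_bounded_enum_time:
  assumes B: "poly_bounded B" shows "poly_bounded (\<lambda>n. enum_time C m fs pl (B n) n)"
proof -
  note arith = poly_bounded_add poly_bounded_mult poly_bounded_const poly_bounded_id
  have step: "poly_bounded (\<lambda>n. step_time C m f n)" for f
    unfolding step_time_def by (rule poly_bounded_nest_time[OF poly_bounded_const])
  have pass: "poly_bounded (\<lambda>n. pass_time C m fs n)"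
    unfolding pass_time_def by (rule poly_bounded_add[OF poly_bounded_sum_list[OF step] poly_bounded_const])
  have "poly_bounded (\<lambda>n. close_time C m fs n)"
    unfolding close_time_def by (intro arith pass)
  then have test: "poly_bounded (\<lambda>n. test_time C m fs pl n)"
    unfolding test_time_def by (intro arith)
  have "poly_bounded (\<lambda>n. nest_time n (test_time C m fs pl n + 2) (length pl))"
    by (rule poly_bounded_nest_time[OF poly_bounded_add[OF test poly_bounded_const]])
  then have cand: "poly_bounded (\<lambda>n. cand_time C m fs pl n)"
    unfolding cand_time_def by (intro arith)
  have cands: "poly_bounded (\<lambda>n. cands_time C m fs pl n)"
    unfolding cands_time_def by (intro arith cand)
  have "poly_bounded (\<lambda>n. level_time C m fs pl (B n) n)"
    unfolding level_time_def by (intro arith cands B)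
  then show ?thesis unfolding enum_time_def by (intro arith B)
qed

theorem poly_time_enumerable_pinned:
  fixes C :: "('s, 'a) ualg" and p :: "real poly"
  assumes C: "is_ualg C" "finite (univ C)" "finite (symbs C)" and pl: "set pl \<subseteq> univ C"
    and p: "\<And>X :: ('s, nat) ualg. is_ualg X \<Longrightarrow> finite (univ X) \<Longrightarrow> same_sig X C \<Longrightarrow>
      real (card {h \<in> homs X C. set pl \<subseteq> h ` univ X}) \<le> poly p (real (card (univ X)))"
  shows "poly_time_enumerable (\<lambda>X. {h \<in> homs X C. set pl \<subseteq> h ` univ X}) C"
proof -
  define m where "m = card (univ C)"
  obtain enc where enc: "bij_betw enc (univ C) {1..m}"
    using finite_same_card_bij[OF C(2), of "{1..m}"] unfolding m_def by auto
  obtain fs where fs: "set fs = symbs C" using C(3) finite_list by blast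
  obtain c :: real where c: "c \<ge> 0" "\<And>k n :: nat. k \<le> n \<Longrightarrow> poly p (real k) \<le> c * (1 + real n) ^ degree p"
    using poly_power_bound[of p] by blast
  define b where "b n = nat \<lceil>c\<rceil> * (1 + n) ^ degree p" for n :: nat
  define B where "B n = 1 + n ^ length pl * b n" for n
  have "poly_bounded B" unfolding B_def b_def
    by (intro poly_bounded_add poly_bounded_mult poly_bounded_power poly_bounded_const poly_bounded_id)
  from poly_bounded_enum_time[OF this, of C m fs pl] obtain q :: "real poly" where
    q: "\<And>n. real (enum_time C m fs pl (B n) n) \<le> poly q (real n)" unfolding poly_bounded_def by blast
  show ?thesis
    unfolding poly_time_enumerable_def
  proof (rule exI[of _ "enum_prog C enc m fs pl"], rule exI[of _ enc], rule exI[of _ q], intro conjI allI impI)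
    show "inj_on enc (univ C)" using enc by (rule bij_betw_imp_inj_on)
  next
    fix X :: "('s, nat) ualg" and n assume X: "is_ualg X \<and> same_sig X C \<and> univ X = {0..<n}"
    interpret enumeration C enc m fs pl X n
      by unfold_locales (use C enc fs pl X in auto)
    have "length (levels k) \<le> B n" if k: "k \<le> n" for k
    proof -
      have "card (pinned_homs S) \<le> b n"
        if S: "S \<subseteq> {0..<n}" "is_ualg \<lparr>symbs = symbs X, ar = ar X, univ = S, opn = opn X\<rparr>" for S
      proof -
        have finS: "finite S" using S(1) by (rule finite_subset) simp
        have cS: "card S \<le> n" using card_mono[OF _ S(1)] by simp
        let ?Y = "\<lparr>symbs = symbs X, ar = ar X, univ = S, opn = opn X\<rparr>"
        have "same_sig ?Y C" using X by (simp add: same_sig_def)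
        then have "real (card (pinned_homs S)) \<le> poly p (real (card S))"
          using p[OF S(2)] finS by (simp add: pinned_homs_def)
        also have "\<dots> \<le> c * (1 + real n) ^ degree p" by (rule c(2)[OF cS])
        also have "\<dots> \<le> real (nat \<lceil>c\<rceil>) * (1 + real n) ^ degree p"
          by (intro mult_right_mono) (use c(1) in \<open>auto simp: real_nat_ceiling_ge\<close>)
        also have "\<dots> = real (b n)" by (simp add: b_def)
        finally show ?thesis by simp
      qed
      then have "card (rows k) \<le> B n" unfolding B_def using assms(2) k by (intro card_rows) auto
      then show ?thesis using levels_rows[OF k] distinct_card by metis
    qed
    from wp_enum[OF this] obtain t s where
      "exec X (enum_prog C enc m fs pl) (init n) t s" "t \<le> enum_time C m fs pl (B n) n" "out s = concat (levels n)"
      unfolding wp_def by blast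
    moreover from this(2) have "real t \<le> poly q (real n)" using q[of n] by linarith
    ultimately show "\<exists>time s hs. exec X (enum_prog C enc m fs pl) (init n) time s \<and> real time \<le> poly q (real n) \<and>
      distinct hs \<and> set hs = {h \<in> homs X C. set pl \<subseteq> h ` univ X} \<and>
      out s = concat (map (\<lambda>h. map (\<lambda>x. enc (h x)) [0..<n]) hs)"
      using enumerated by (intro exI[of _ t] exI[of _ s] exI[of _ "map row_map (levels n)"]) simp
  qed
qed

lemma K_poly_eff_iff:
  assumes "finite (symbs C)" shows "C \<in> K_poly_eff \<longleftrightarrow> C \<in> K_poly"
proof
  assume C: "C \<in> K_poly"
  then obtain p :: "real poly" where "is_ualg C" "finite (univ C)"
    "\<And>X :: ('a, nat) ualg. is_ualg X \<Longrightarrow> finite (univ X) \<Longrightarrow> same_sig X C \<Longrightarrow>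
      real (card (homs X C)) \<le> poly p (real (card (univ X)))" by (auto simp: K_poly_def)
  then have "poly_time_enumerable (\<lambda>X. {h \<in> homs X C. set [] \<subseteq> h ` univ X}) C"
    using assms by (intro poly_time_enumerable_pinned[where p = p]) auto
  then show "C \<in> K_poly_eff" using C by (simp add: K_poly_eff_def)
qed (simp add: K_poly_eff_def)

lemma K_surj_eff_iff:
  assumes "finite (symbs C)" shows "C \<in> K_surj_eff \<longleftrightarrow> C \<in> K_surj"
proof
  assume C: "C \<in> K_surj"
  then obtain p :: "real poly" where *: "is_ualg C" "finite (univ C)"
    "\<And>X :: ('a, nat) ualg. is_ualg X \<Longrightarrow> finite (univ X) \<Longrightarrow> same_sig X C \<Longrightarrow>
      real (card (surj_homs X C)) \<le> poly p (real (card (univ X)))" by (auto simp: K_surj_def)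
  obtain pl where pl: "set pl = univ C" using *(2) finite_list by blast
  have eq: "{h \<in> homs X C. set pl \<subseteq> h ` univ X} = surj_homs X C" for X :: "('a, nat) ualg"
    using homs_closed[of _ X C] by (fastforce simp: pl surj_homs_def)
  have "poly_time_enumerable (\<lambda>X. {h \<in> homs X C. set pl \<subseteq> h ` univ X}) C"
    using assms * pl eq by (intro poly_time_enumerable_pinned[where p = p]) auto
  then show "C \<in> K_surj_eff" using C by (simp add: K_surj_eff_def eq)
qed (simp add: K_surj_eff_def)

theorem theorem28:
  fixes A :: "('s, 'a) ualg"
  assumes "is_ualg A" and "finite (univ A)" and "simple A"
  shows "(A \<in> K_surj \<longleftrightarrow> typ_of A \<noteq> 1) \<and>
    (A \<in> K_surj \<longleftrightarrow> const_expansion A \<in> K_poly) \<and>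
    (finite (symbs A) \<longrightarrow>
      (A \<in> K_surj_eff \<longleftrightarrow> A \<in> K_surj) \<and>
      (A \<in> K_surj_eff \<longleftrightarrow> const_expansion A \<in> K_poly_eff))"
proof -
  interpret simple_alg A using assms by unfold_locales
  have "finite (symbs (const_expansion A))" if "finite (symbs A)"
    using that assms(2) by (simp add: const_expansion_simps)
  then show ?thesis
    using K_poly_iff_K_surj[OF assms(1,2)] K_poly_iff_typ K_surj_eff_iff[of A] K_poly_eff_iff[of "const_expansion A"]
    by blast
qed

end
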